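(* Let $\mathbb K$ be a field, $s,d\in\mathbb N$, and let $\mathcal R$ be a nc Fornasini--Marchesini realization centred at $\underline Y\in(\mathbb K^{s\times s})^d$, described by $(L;D,C,\underline{\mathbf A},\underline{\mathbf B})$, which is both controllable and observable. The following are equivalent: (1) There exists a nc rational function $\mathfrak R$ of $x_1,\ldots,x_d$ over $\mathbb K$ that is regular at $\underline Y$ such that $dom_{sm}(\mathfrak R)=\Omega_{sm}(\mathcal R)$ and $\mathfrak R(\underline X)=\mathcal R(\underline X)$ for every $\underline X\in dom_{sm}(\mathfrak R)$ and $m\in\mathbb N$. (2) The coefficients of $\mathcal R$ satisfy the linearized lost-abbey conditions. (3) There exists a nc rational function $\mathfrak R$ of $x_1,\ldots,x_d$ over $\mathbb K$ that is regular at $\underline Y$ such that $dom_n(\mathfrak R)=\{\underline X\in(\mathbb K^{n\times n})^d:I_s\otimes\underline X\in\Omega_{sn}(\mathcal R)\}$ and $I_s\otimes\mathfrak R(\underline X)=\mathcal R(I_s\otimes\underline X)$ for every $\underline X\in dom_n(\mathfrak R)$ and $n\in\mathbb N$.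
   Context: Rational functions. Nc rational expressions in $x_1,\ldots,x_d$ over $\mathbb K$ are obtained from nc polynomials by successive additions, multiplications and inversions; $dom_n(R)$ is the set of $d$-tuples of $n\times n$ matrices over $\mathbb K$ at which all inverses in $R$ exist, $dom(R)=\coprod_n dom_n(R)$. $R_1,R_2$ are equivalent if they agree on $dom(R_1)\cap dom(R_2)$. A nc rational function $\mathfrak R$ is an equivalence class of expressions with nonempty domain; $dom(\mathfrak R)=\bigcup_{R\in\mathfrak R}dom(R)$, $dom_n(\mathfrak R)$ is its part of $n\times n$ matrices, $\mathfrak R(\underline X)=R(\underline X)$ for any $R\in\mathfrak R$ with $\underline X\in dom(R)$; $\mathfrak R$ is regular at $\underline X$ if $\underline X\in dom(\mathfrak R)$. Realizations. A nc Fornasini--Marchesini realization $\mathcal R$ centred at $\underline Y=(Y_1,\ldots,Y_d)\in(\mathbb K^{s\times s})^d$, described by $(L;D,C,\underline{\mathbf A},\underline{\mathbf B})$, consists of $L\in\mathbb N$, linear maps $\mathbf A_k:\mathbb K^{s\times s}\to\mathbb K^{L\times L}$, $\mathbf B_k:\mathbb K^{s\times s}\to\mathbb K^{L\times s}$ ($1\le k\le d$), and matrices $C\in\mathbb K^{s\times L}$, $D\in\mathbb K^{s\times s}$. A linear map $\mathbf T$ on $\mathbb K^{s\times s}$ is extended to $X=[X_{ij}]\in\mathbb K^{sm\times sm}$ with $s\times s$ blocks by $(X)\mathbf T=[\mathbf T(X_{ij})]$. For $\underline X\in(\mathbb K^{sm\times sm})^d$ put $\Lambda_{\underline{\mathbf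 A},\underline Y}(\underline X)=I_{Lm}-\sum_k(X_k-I_m\otimes Y_k)\mathbf A_k$, $\Omega_{sm}(\mathcal R)=\{\underline X\in(\mathbb K^{sm\times sm})^d:\det\Lambda_{\underline{\mathbf A},\underline Y}(\underline X)\ne0\}$ and, on this set, $\mathcal R(\underline X)=I_m\otimes D+(I_m\otimes C)\Lambda_{\underline{\mathbf A},\underline Y}(\underline X)^{-1}\sum_k(X_k-I_m\otimes Y_k)\mathbf B_k$. Here $\otimes$ is the Kronecker product $P\otimes Q=[p_{ij}Q]$ and $I_s\otimes\underline X=(I_s\otimes X_k)_k$. Controllable: the sum of the column spaces of all matrices $\mathbf A_{i_1}(X_1)\cdots\mathbf A_{i_\ell}(X_\ell)\mathbf B_k(X_{\ell+1})$ ($\ell\ge0$, $1\le i_1,\ldots,i_\ell,k\le d$, $X_j\in\mathbb K^{s\times s}$) is $\mathbb K^L$. Observable: the intersection of the kernels of all $C\mathbf A_{i_1}(X_1)\cdots\mathbf A_{i_\ell}(X_\ell)$ ($\ell\ge0$, same ranges) is $\{0\}$. Linearized lost-abbey conditions: with $[S,Y]=SY-YS$, for all $S,Z_1,Z_2\in\mathbb K^{s\times s}$ and $1\le i_1,i_2\le d$: $SD-DS=C\sum_k\mathbf B_k([S,Y_k])$; $SC\mathbf B_{i_1}(Z_1)-C\mathbf B_{i_1}(SZ_1)=C\big(\sum_k\mathbf A_k([S,Y_k])\big)\mathbf B_{i_1}(Z_1)$; $SC\mathbf A_{i_1}(Z_1)-C\mathbf A_{i_1}(SZ_1)=C\big(\sum_k\mathbf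 A_k([S,Y_k])\big)\mathbf A_{i_1}(Z_1)$; $\mathbf B_{i_1}(Z_1S)-\mathbf B_{i_1}(Z_1)S=\mathbf A_{i_1}(Z_1)\sum_k\mathbf B_k([S,Y_k])$; $\mathbf A_{i_1}(Z_1S)\mathbf B_{i_2}(Z_2)-\mathbf A_{i_1}(Z_1)\mathbf B_{i_2}(SZ_2)=\mathbf A_{i_1}(Z_1)\big(\sum_k\mathbf A_k([S,Y_k])\big)\mathbf B_{i_2}(Z_2)$; $\mathbf A_{i_1}(Z_1S)\mathbf A_{i_2}(Z_2)-\mathbf A_{i_1}(Z_1)\mathbf A_{i_2}(SZ_2)=\mathbf A_{i_1}(Z_1)\big(\sum_k\mathbf A_k([S,Y_k])\big)\mathbf A_{i_2}(Z_2)$ (sums over $k=1,\ldots,d$). *)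

theory Defs
  imports
    "Jordan_Normal_Form.Determinant"
    "Jordan_Normal_Form.Gauss_Jordan_Elimination"
    "Jordan_Normal_Form.Matrix_Kernel"
begin

text \<open>
  Matrices are those of \<open>Jordan_Normal_Form\<close>, whose dimensions are terms, so sizes such as
  \<open>s * m\<close> can be quantified over. All indices are \<open>0\<close>-based: the variables
  \<open>x\<^sub>1, \<dots>, x\<^sub>d\<close> are numbered \<open>0, \<dots>, d - 1\<close>.
\<close>

definition mat_tuples :: "nat \<Rightarrow> nat \<Rightarrow> 'a mat list set" where
  "mat_tuples d n = {X. length X = d \<and> set X \<subseteq> carrier_mat n n}"

text \<open>
  The summands have to be \<open>nr\<close> by \<open>nc\<close> matrices; the dimensions are given explicitly since
  the zero matrix depends on them.
\<close>
definition msum :: "nat \<Rightarrow> nat \<Rightarrow> nat \<Rightarrow> (nat \<Rightarrow> 'a::comm_monoid_add mat) \<Rightarrow> 'a mat" where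
  "msum nr nc d M = mat nr nc (\<lambda>ij. \<Sum>k<d. M k $$ ij)"

text \<open>The block matrix \<open>[p\<^sub>i\<^sub>j Q]\<close>.\<close>
definition kron :: "'a::times mat \<Rightarrow> 'a mat \<Rightarrow> 'a mat" where
  "kron P Q = mat (dim_row P * dim_row Q) (dim_col P * dim_col Q)
     (\<lambda>(i, j). P $$ (i div dim_row Q, j div dim_col Q) * Q $$ (i mod dim_row Q, j mod dim_col Q))"


section \<open>Nc rational expressions and functions\<close>

text \<open>
  Nc polynomials are themselves the expressions built from constants and variables by addition
  and multiplication, so they need no separate constructor.
\<close>
datatype 'a nc_expr =
    Const 'a
  | Var nat
  | Add "'a nc_expr" "'a nc_expr"
  | Mul "'a nc_expr" "'a nc_expr"
  | Inv "'a nc_expr"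

fun nc_vars :: "'a nc_expr \<Rightarrow> nat set" where
  "nc_vars (Const c) = {}"
| "nc_vars (Var k) = {k}"
| "nc_vars (Add R S) = nc_vars R \<union> nc_vars S"
| "nc_vars (Mul R S) = nc_vars R \<union> nc_vars S"
| "nc_vars (Inv R) = nc_vars R"

text \<open>
  Evaluation at a tuple of \<open>n\<close> by \<open>n\<close> matrices; the result is \<open>None\<close> iff one of the inverses
  occurring in the expression does not exist.
\<close>
fun nc_eval :: "nat \<Rightarrow> 'a::field mat list \<Rightarrow> 'a nc_expr \<Rightarrow> 'a mat option" where
  "nc_eval n X (Const c) = Some (c \<cdot>\<^sub>m 1\<^sub>m n)"
| "nc_eval n X (Var k) = Some (X ! k)"
| "nc_eval n X (Add R S) =
     Option.bind (nc_eval n X R) (\<lambda>M. map_option (\<lambda>N. M + N) (nc_eval n X S))"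
| "nc_eval n X (Mul R S) =
     Option.bind (nc_eval n X R) (\<lambda>M. map_option (\<lambda>N. M * N) (nc_eval n X S))"
| "nc_eval n X (Inv R) = Option.bind (nc_eval n X R) mat_inverse"

definition nc_dom :: "nat \<Rightarrow> nat \<Rightarrow> 'a::field nc_expr \<Rightarrow> 'a mat list set" where
  "nc_dom d n R = {X \<in> mat_tuples d n. nc_eval n X R \<noteq> None}"

text \<open>
  Matrix sizes range over \<open>n \<ge> 1\<close>: every expression is defined on the empty matrices, so
  admitting \<open>n = 0\<close> would make the nonemptiness of the domain vacuous.
\<close>
definition nc_rat_exprs :: "nat \<Rightarrow> 'a::field nc_expr set" where
  "nc_rat_exprs d = {R. nc_vars R \<subseteq> {..<d} \<and> (\<exists>n\<ge>1. nc_dom d n R \<noteq> {})}"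

definition nc_equiv :: "nat \<Rightarrow> ('a::field nc_expr \<times> 'a nc_expr) set" where
  "nc_equiv d = {(R, S). R \<in> nc_rat_exprs d \<and> S \<in> nc_rat_exprs d \<and>
     (\<forall>n\<ge>1. \<forall>X \<in> nc_dom d n R \<inter> nc_dom d n S. nc_eval n X R = nc_eval n X S)}"

definition nc_rat_funs :: "nat \<Rightarrow> 'a::field nc_expr set set" where
  "nc_rat_funs d = nc_rat_exprs d // nc_equiv d"

definition rat_dom :: "nat \<Rightarrow> nat \<Rightarrow> 'a::field nc_expr set \<Rightarrow> 'a mat list set" where
  "rat_dom d n F = (\<Union>R\<in>F. nc_dom d n R)"

definition rat_eval :: "nat \<Rightarrow> nat \<Rightarrow> 'a::field nc_expr set \<Rightarrow> 'a mat list \<Rightarrow> 'a mat" where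
  "rat_eval d n F X = the (nc_eval n X (SOME R. R \<in> F \<and> X \<in> nc_dom d n R))"


section \<open>Nc Fornasini--Marchesini realizations\<close>

record 'a fm_data =
  fmL :: nat
  fmD :: "'a mat"
  fmC :: "'a mat"
  fmA :: "nat \<Rightarrow> 'a mat \<Rightarrow> 'a mat"
  fmB :: "nat \<Rightarrow> 'a mat \<Rightarrow> 'a mat"

definition mat_linear :: "nat \<Rightarrow> nat \<Rightarrow> nat \<Rightarrow> ('a::field mat \<Rightarrow> 'a mat) \<Rightarrow> bool" where
  "mat_linear s nr nc T \<longleftrightarrow>
     (\<forall>X\<in>carrier_mat s s. T X \<in> carrier_mat nr nc) \<and>
     (\<forall>X\<in>carrier_mat s s. \<forall>Y\<in>carrier_mat s s. T (X + Y) = T X + T Y) \<and>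
     (\<forall>c. \<forall>X\<in>carrier_mat s s. T (c \<cdot>\<^sub>m X) = c \<cdot>\<^sub>m T X)"

definition fm_realization :: "nat \<Rightarrow> nat \<Rightarrow> 'a::field mat list \<Rightarrow> 'a fm_data \<Rightarrow> bool" where
  "fm_realization s d Y r \<longleftrightarrow>
     Y \<in> mat_tuples d s \<and>
     fmD r \<in> carrier_mat s s \<and>
     fmC r \<in> carrier_mat s (fmL r) \<and>
     (\<forall>k<d. mat_linear s (fmL r) (fmL r) (fmA r k)) \<and>
     (\<forall>k<d. mat_linear s (fmL r) s (fmB r k))"

text \<open>
  The extension of \<open>T\<close>, from \<open>s\<close> by \<open>s\<close> matrices to \<open>nr\<close> by \<open>nc\<close> matrices, to an \<open>s * m\<close> by
  \<open>s * m\<close> matrix: \<open>T\<close> is applied to each of the \<open>m * m\<close> blocks.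
\<close>
definition mat_block :: "nat \<Rightarrow> 'a mat \<Rightarrow> nat \<Rightarrow> nat \<Rightarrow> 'a mat" where
  "mat_block s X i j = mat s s (\<lambda>(a, b). X $$ (i * s + a, j * s + b))"

definition block_ext ::
  "nat \<Rightarrow> nat \<Rightarrow> nat \<Rightarrow> nat \<Rightarrow> ('a mat \<Rightarrow> 'a mat) \<Rightarrow> 'a mat \<Rightarrow> 'a mat" where
  "block_ext s nr nc m T X = mat (nr * m) (nc * m)
     (\<lambda>(i, j). T (mat_block s X (i div nr) (j div nc)) $$ (i mod nr, j mod nc))"

definition fm_Lambda ::
  "nat \<Rightarrow> nat \<Rightarrow> 'a::field mat list \<Rightarrow> 'a fm_data \<Rightarrow> nat \<Rightarrow> 'a mat list \<Rightarrow> 'a mat" where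
  "fm_Lambda s d Y r m X = 1\<^sub>m (fmL r * m) -
     msum (fmL r * m) (fmL r * m) d
       (\<lambda>k. block_ext s (fmL r) (fmL r) m (fmA r k) (X ! k - kron (1\<^sub>m m) (Y ! k)))"

definition fm_Omega ::
  "nat \<Rightarrow> nat \<Rightarrow> 'a::field mat list \<Rightarrow> 'a fm_data \<Rightarrow> nat \<Rightarrow> 'a mat list set" where
  "fm_Omega s d Y r m = {X \<in> mat_tuples d (s * m). det (fm_Lambda s d Y r m X) \<noteq> 0}"

definition fm_eval ::
  "nat \<Rightarrow> nat \<Rightarrow> 'a::field mat list \<Rightarrow> 'a fm_data \<Rightarrow> nat \<Rightarrow> 'a mat list \<Rightarrow> 'a mat" where
  "fm_eval s d Y r m X = kron (1\<^sub>m m) (fmD r) +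
     kron (1\<^sub>m m) (fmC r) * the (mat_inverse (fm_Lambda s d Y r m X)) *
     msum (fmL r * m) (s * m) d
       (\<lambda>k. block_ext s (fmL r) s m (fmB r k) (X ! k - kron (1\<^sub>m m) (Y ! k)))"

text \<open>
  A list \<open>[(i\<^sub>1, X\<^sub>1), \<dots>, (i\<^sub>l, X\<^sub>l)]\<close> encodes the indices and arguments of the product
  \<open>A\<^bsub>i\<^sub>1\<^esub>(X\<^sub>1) \<cdots> A\<^bsub>i\<^sub>l\<^esub>(X\<^sub>l)\<close>.
\<close>
definition fm_words :: "nat \<Rightarrow> nat \<Rightarrow> (nat \<times> 'a mat) list set" where
  "fm_words s d = lists ({..<d} \<times> carrier_mat s s)"

definition fm_prod :: "'a::field fm_data \<Rightarrow> (nat \<times> 'a mat) list \<Rightarrow> 'a mat" where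
  "fm_prod r w = foldr (\<lambda>(i, X) M. fmA r i X * M) w (1\<^sub>m (fmL r))"

definition controllable :: "nat \<Rightarrow> nat \<Rightarrow> 'a::field fm_data \<Rightarrow> bool" where
  "controllable s d r \<longleftrightarrow>
     LinearCombinations.module.span class_ring (module_vec TYPE('a) (fmL r))
       (\<Union>w\<in>fm_words s d. \<Union>k<d. \<Union>Z\<in>carrier_mat s s.
          vec_space.col_space (fmL r) (fm_prod r w * fmB r k Z))
     = carrier_vec (fmL r)"

definition observable :: "nat \<Rightarrow> nat \<Rightarrow> 'a::field fm_data \<Rightarrow> bool" where
  "observable s d r \<longleftrightarrow>
     (\<Inter>w\<in>fm_words s d. mat_kernel (fmC r * fm_prod r w)) = {0\<^sub>v (fmL r)}"

definition commutator :: "'a::ring mat \<Rightarrow> 'a mat \<Rightarrow> 'a mat" where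
  "commutator S Y = S * Y - Y * S"

definition linearized_lost_abbey ::
  "nat \<Rightarrow> nat \<Rightarrow> 'a::field mat list \<Rightarrow> 'a fm_data \<Rightarrow> bool" where
  "linearized_lost_abbey s d Y r \<longleftrightarrow>
     (let L = fmL r; D = fmD r; C = fmC r; A = fmA r; B = fmB r;
          AS = (\<lambda>S. msum L L d (\<lambda>k. A k (commutator S (Y ! k))));
          BS = (\<lambda>S. msum L s d (\<lambda>k. B k (commutator S (Y ! k))))
      in \<forall>S\<in>carrier_mat s s. \<forall>Z1\<in>carrier_mat s s. \<forall>Z2\<in>carrier_mat s s. \<forall>i1<d. \<forall>i2<d.
        S * D - D * S = C * BS S \<and>
        S * C * B i1 Z1 - C * B i1 (S * Z1) = C * AS S * B i1 Z1 \<and>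
        S * C * A i1 Z1 - C * A i1 (S * Z1) = C * AS S * A i1 Z1 \<and>
        B i1 (Z1 * S) - B i1 Z1 * S = A i1 Z1 * BS S \<and>
        A i1 (Z1 * S) * B i2 Z2 - A i1 Z1 * B i2 (S * Z2) = A i1 Z1 * AS S * B i2 Z2 \<and>
        A i1 (Z1 * S) * A i2 Z2 - A i1 Z1 * A i2 (S * Z2) = A i1 Z1 * AS S * A i2 Z2)"

end

theory Submission
  imports Defs "Jordan_Normal_Form.Char_Poly"
begin

text \<open>
  (3) implies (1) because \<open>I\<^sub>s \<otimes> X\<close> and \<open>X\<close> have the same infinite ampliation. (1) implies (2): rational
  functions respect intertwinings \<open>X' T = T X\<close>; applied to block triangular points this gives the
  conditions multiplied on both sides by factors that controllability and observability cancel.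

  (2) implies (3): the conditions make \<open>\<R>\<close> respect intertwinings, so that \<open>\<R>(X \<otimes> I\<^sub>s)\<close> is a matrix
  \<open>\<phi> \<otimes> I\<^sub>s\<close>. At a point where \<open>\<Lambda>\<close> is invertible, \<open>\<Lambda>\<^sup>-\<^sup>1\<close> is a polynomial in \<open>\<Lambda>\<close>, so a preconditioned
  Gaussian elimination is an expression for \<open>\<phi>\<close> defined there. Its domain never exceeds the
  invertibility set of \<open>\<Lambda>\<close>, and all these expressions are equivalent. Conversely, let \<open>S\<close> be equivalent to
  them and defined at \<open>P\<close>. On a line through \<open>P\<close> the inverse of \<open>\<Lambda>\<close> is a fraction \<open>N / h\<close> of polynomials in
  the parameter. If it had a pole at \<open>P\<close>, then evaluating \<open>S\<close> at block triangular points containing the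
  line would show that \<open>C \<Lambda>\<^sub>U\<^sup>-\<^sup>1 A(Z) N(0) x = 0\<close> for all controllable vectors \<open>x\<close>, whence \<open>N(0) = 0\<close>, and the
  fraction could be reduced.
\<close>

text \<open>Two levels of matrices are nested in one ring: the outer index is the position of a
  block, the inner one the position inside it. Points, coefficients and pencils of all sizes are
  elements of this ring; sizes survive only in the predicate \<open>Fin nr nc\<close>. Three
  obstacles shape the argument. The field may be finite, so polynomial identities cannot be tested
  at its elements; quotients K[t]/(g), acting as matrices, take their place. Invertibility of a
  pencil does not make the pivots of an elimination invertible, so one expression need not cover all
  regular points; a separate one is made for each point, and these have to be linked to each other
  although their domains differ. Finally, the domain of a function is a union over all
  representatives, including expressions built without regard to the realization. That none of them
  is defined outside the regular set is the hardest part, and the only one on the way to (3) that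
  needs controllability and observability.\<close>

text \<open>Row-finite infinite matrices. Ampliations \<open>I \<otimes> M\<close> of matrices of all sizes live in this single ring,
  so that points of different sizes are compared by equations.\<close>
typedef (overloaded) 'r rfmat = "{f :: nat \<Rightarrow> nat \<Rightarrow> 'r::zero. \<forall>i. finite {j. f i j \<noteq> 0}}"
  morphisms ent Rfmat
  by (rule exI[of _ "\<lambda>_ _. 0"]) simp

setup_lifting type_definition_rfmat

lemma finite_ent: "finite {j. ent P i j \<noteq> 0}"
  using ent[of P] by blast

lemma rfmat_eqI: "(\<And>i j. ent P i j = ent Q i j) \<Longrightarrow> P = Q"
  by (metis ent_inject ext)

lemma ent_Rfmat: "(\<And>i. finite {j. f i j \<noteq> 0}) \<Longrightarrow> ent (Rfmat f) = f"
  by (simp add: Rfmat_inverse)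

instantiation rfmat :: (ring_1) ring_1
begin

lift_definition zero_rfmat :: "'a rfmat" is "\<lambda>_ _. 0" by simp

lift_definition one_rfmat :: "'a rfmat" is "\<lambda>i j. if i = j then 1 else 0"
  by simp

lift_definition plus_rfmat :: "'a rfmat \<Rightarrow> 'a rfmat \<Rightarrow> 'a rfmat" is "\<lambda>f g i j. f i j + g i j"
proof -
  fix f g :: "nat \<Rightarrow> nat \<Rightarrow> 'a"
  assume "\<And>i. finite {j. f i j \<noteq> 0}" "\<And>i. finite {j. g i j \<noteq> 0}"
  then have "finite ({j. f i j \<noteq> 0} \<union> {j. g i j \<noteq> 0})" for i by blast
  then have "finite {j. f i j + g i j \<noteq> 0}" for i
    by (rule rev_finite_subset[where B = "{j. f i j \<noteq> 0} \<union> {j. g i j \<noteq> 0}"]) auto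
  then show "\<And>i. finite {j. f i j + g i j \<noteq> 0}" by blast
qed

lift_definition uminus_rfmat :: "'a rfmat \<Rightarrow> 'a rfmat" is "\<lambda>f i j. - f i j" by simp

lift_definition minus_rfmat :: "'a rfmat \<Rightarrow> 'a rfmat \<Rightarrow> 'a rfmat" is "\<lambda>f g i j. f i j - g i j"
proof -
  fix f g :: "nat \<Rightarrow> nat \<Rightarrow> 'a"
  assume "\<And>i. finite {j. f i j \<noteq> 0}" "\<And>i. finite {j. g i j \<noteq> 0}"
  then have "finite ({j. f i j \<noteq> 0} \<union> {j. g i j \<noteq> 0})" for i by blast
  then have "finite {j. f i j - g i j \<noteq> 0}" for i
    by (rule rev_finite_subset[where B = "{j. f i j \<noteq> 0} \<union> {j. g i j \<noteq> 0}"]) auto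
  then show "\<And>i. finite {j. f i j - g i j \<noteq> 0}" by blast
qed

lift_definition times_rfmat :: "'a rfmat \<Rightarrow> 'a rfmat \<Rightarrow> 'a rfmat"
  is "\<lambda>f g i j. \<Sum>l | f i l \<noteq> 0. f i l * g l j"
proof -
  fix f g :: "nat \<Rightarrow> nat \<Rightarrow> 'a"
  assume fg: "\<And>i. finite {j. f i j \<noteq> 0}" "\<And>i. finite {j. g i j \<noteq> 0}"
  fix i
  from fg have "finite (\<Union>l\<in>{l. f i l \<noteq> 0}. {j. g l j \<noteq> 0})" by blast
  moreover have "{j. (\<Sum>l | f i l \<noteq> 0. f i l * g l j) \<noteq> 0} \<subseteq> (\<Union>l\<in>{l. f i l \<noteq> 0}. {j. g l j \<noteq> 0})"
  proof
    fix j assume "j \<in> {j. (\<Sum>l | f i l \<noteq> 0. f i l * g l j) \<noteq> 0}"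
    then obtain l where "l \<in> {l. f i l \<noteq> 0}" "f i l * g l j \<noteq> 0"
      by (auto elim!: sum.not_neutral_contains_not_neutral)
    then show "j \<in> (\<Union>l\<in>{l. f i l \<noteq> 0}. {j. g l j \<noteq> 0})" by auto
  qed
  ultimately show "finite {j. (\<Sum>l | f i l \<noteq> 0. f i l * g l j) \<noteq> 0}"
    by (rule rev_finite_subset)
qed

lemma ent_times_supp:
  assumes "finite S" "\<And>l. ent P i l \<noteq> 0 \<Longrightarrow> l \<in> S"
  shows "ent (P * Q) i j = (\<Sum>l\<in>S. ent P i l * ent Q l j)"
  unfolding times_rfmat.rep_eq
  by (rule sum.mono_neutral_left) (use assms in auto)

instance
proof
  fix a b c :: "'a rfmat"
  show "a + b + c = a + (b + c)" by transfer (simp add: add.assoc)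
  show "a + b = b + a" by transfer (simp add: add.commute)
  show "0 + a = a" by transfer simp
  show "- a + a = 0" by transfer simp
  show "a - b = a + - b" by transfer simp
  show "0 \<noteq> (1 :: 'a rfmat)"
    by transfer (metis zero_neq_one)
  show "1 * a = a"
  proof (rule rfmat_eqI)
    fix i j
    show "ent (1 * a) i j = ent a i j"
      by (subst ent_times_supp[of "{i}"]) (auto simp: one_rfmat.rep_eq split: if_splits)
  qed
  show "a * 1 = a"
  proof (rule rfmat_eqI)
    fix i j
    show "ent (a * 1) i j = ent a i j"
      unfolding times_rfmat.rep_eq one_rfmat.rep_eq
      using finite_ent[of a i] by (simp add: if_distrib cong: if_cong)
  qed
  show "(a + b) * c = a * c + b * c"
  proof (rule rfmat_eqI)
    fix i j
    let ?S = "{l. ent a i l \<noteq> 0} \<union> {l. ent b i l \<noteq> 0}"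
    have f: "finite ?S" using finite_ent by blast
    have 1: "ent ((a + b) * c) i j = (\<Sum>l\<in>?S. ent (a + b) i l * ent c l j)"
      by (rule ent_times_supp[OF f]) (auto simp: plus_rfmat.rep_eq)
    have 2: "ent (a * c) i j = (\<Sum>l\<in>?S. ent a i l * ent c l j)"
      by (rule ent_times_supp[OF f]) auto
    have 3: "ent (b * c) i j = (\<Sum>l\<in>?S. ent b i l * ent c l j)"
      by (rule ent_times_supp[OF f]) auto
    show "ent ((a + b) * c) i j = ent (a * c + b * c) i j"
      unfolding 1 plus_rfmat.rep_eq[of "a * c"] 2 3
      by (simp add: plus_rfmat.rep_eq distrib_right sum.distrib)
  qed
  show "a * (b + c) = a * b + a * c"
    by (rule rfmat_eqI)
      (simp add: times_rfmat.rep_eq plus_rfmat.rep_eq distrib_left sum.distrib)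
  show "a * b * c = a * (b * c)"
  proof (rule rfmat_eqI)
    fix i j
    let ?S = "{l. ent a i l \<noteq> 0}" let ?T = "\<Union>l\<in>?S. {j. ent b l j \<noteq> 0}"
    have fS: "finite ?S" and fT: "finite ?T" using finite_ent by blast+
    have ab: "ent (a * b) i k = (\<Sum>l\<in>?S. ent a i l * ent b l k)" for k
      by (rule ent_times_supp[OF fS]) auto
    have "ent (a * b * c) i j = (\<Sum>k\<in>?T. ent (a * b) i k * ent c k j)"
    proof (rule ent_times_supp[OF fT])
      fix k assume "ent (a * b) i k \<noteq> 0"
      then obtain l where "l \<in> ?S" "ent a i l * ent b l k \<noteq> 0"
        unfolding ab by (rule sum.not_neutral_contains_not_neutral)
      then show "k \<in> ?T" by auto
    qed
    also have "\<dots> = (\<Sum>k\<in>?T. \<Sum>l\<in>?S. ent a i l * (ent b l k * ent c k j))"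
      unfolding ab by (simp add: sum_distrib_right mult.assoc)
    also have "\<dots> = (\<Sum>l\<in>?S. \<Sum>k\<in>?T. ent a i l * (ent b l k * ent c k j))"
      by (rule sum.swap)
    also have "\<dots> = (\<Sum>l\<in>?S. ent a i l * ent (b * c) l j)"
    proof (rule sum.cong)
      fix l assume l: "l \<in> ?S"
      have "ent (b * c) l j = (\<Sum>k\<in>?T. ent b l k * ent c k j)"
        by (rule ent_times_supp[OF fT]) (use l in auto)
      then show "(\<Sum>k\<in>?T. ent a i l * (ent b l k * ent c k j)) = ent a i l * ent (b * c) l j"
        by (simp add: sum_distrib_left)
    qed simp
    also have "\<dots> = ent (a * (b * c)) i j"
      by (rule ent_times_supp[OF fS, symmetric]) auto
    finally show "ent (a * b * c) i j = ent (a * (b * c)) i j" .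
  qed
qed

end

lemma ent_0 [simp]: "ent 0 i j = 0" by (simp add: zero_rfmat.rep_eq)
lemma ent_1: "ent 1 i j = (if i = j then 1 else 0)" by (simp add: one_rfmat.rep_eq)
lemma ent_add [simp]: "ent (P + Q) i j = ent P i j + ent Q i j" by (simp add: plus_rfmat.rep_eq)
lemma ent_diff [simp]: "ent (P - Q) i j = ent P i j - ent Q i j" by (simp add: minus_rfmat.rep_eq)
lemma ent_minus [simp]: "ent (- P) i j = - ent P i j" by (simp add: uminus_rfmat.rep_eq)
lemma ent_sum [simp]: "ent (sum f S) i j = (\<Sum>x\<in>S. ent (f x) i j)"
  by (induction S rule: infinite_finite_induct) auto

text \<open>The summation set may depend on the column: it has to contain the nonzero products only,
  not the support of row \<open>i\<close>. Right multiplication by a sparse matrix calls for this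
  form.\<close>

lemma ent_sum_supp:
  assumes "\<And>l. l \<notin> S \<Longrightarrow> ent P i l * ent Q l j = 0" "finite S"
  shows "ent (P * Q) i j = (\<Sum>l\<in>S. ent P i l * ent Q l j)"
proof -
  let ?T = "S \<union> {l. ent P i l \<noteq> 0}"
  have "ent (P * Q) i j = (\<Sum>l\<in>?T. ent P i l * ent Q l j)"
    by (rule ent_times_supp) (use assms finite_ent in auto)
  also have "\<dots> = (\<Sum>l\<in>S. ent P i l * ent Q l j)"
    by (rule sum.mono_neutral_right) (use assms finite_ent in auto)
  finally show ?thesis .
qed

subsection \<open>Diagonal constants and entrywise maps\<close>

lift_definition dg :: "'r::ring_1 \<Rightarrow> 'r rfmat" is "\<lambda>c i j. if i = j then c else 0"
  by simp

lemma ent_dg: "ent (dg c) i j = (if i = j then c else 0)" by (simp add: dg.rep_eq)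

lemma ent_dg_mult [simp]: "ent (dg c * P) i j = c * ent P i j"
  by (subst ent_times_supp[of "{i}"]) (auto simp: ent_dg split: if_splits)

lemma ent_mult_dg [simp]: "ent (P * dg c) i j = ent P i j * c"
  by (subst ent_sum_supp[of "{j}"]) (auto simp: ent_dg split: if_splits)

lemma dg_hom [simp]:
  "dg 0 = 0" "dg 1 = 1" "dg (a + b) = dg a + dg b" "dg (a - b) = dg a - dg b" "dg (- a) = - dg a"
  by (rule rfmat_eqI, simp add: ent_dg ent_1)+

lemma dg_mult [simp]: "dg (a * b) = dg a * dg b"
  by (rule rfmat_eqI) (simp add: ent_dg)

lemma dg_eq_iff [simp]: "dg a = dg b \<longleftrightarrow> a = b"
  by (metis ent_dg)

lemma dg_central: "(\<And>x. c * x = x * c) \<Longrightarrow> dg c * P = P * dg c"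
  by (rule rfmat_eqI) simp

text \<open>The zero test keeps the rows finite for every \<open>h\<close>, so the operation is
  total; for \<open>h 0 = 0\<close> it disappears by \<open>ent_rmap\<close>.\<close>

lift_definition rmap :: "('r::zero \<Rightarrow> 'q::zero) \<Rightarrow> 'r rfmat \<Rightarrow> 'q rfmat"
  is "\<lambda>h f i j. if f i j = 0 then 0 else h (f i j)"
proof -
  fix h :: "'r \<Rightarrow> 'q" and f :: "nat \<Rightarrow> nat \<Rightarrow> 'r"
  assume "\<And>i. finite {j. f i j \<noteq> 0}"
  then have "finite {j. (if f i j = 0 then 0 else h (f i j)) \<noteq> 0}" for i
    by (metis (mono_tags, lifting) Collect_mono rev_finite_subset)
  then show "\<And>i. finite {j. (if f i j = 0 then 0 else h (f i j)) \<noteq> 0}" by blast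
qed

lemma ent_rmap: "h 0 = 0 \<Longrightarrow> ent (rmap h P) i j = h (ent P i j)"
  by (simp add: rmap.rep_eq)

locale rhom =
  fixes h :: "'r::ring_1 \<Rightarrow> 'q::ring_1"
  assumes add: "h (x + y) = h x + h y" and mult: "h (x * y) = h x * h y" and one: "h 1 = 1"
begin

lemma zero [simp]: "h 0 = 0" using add[of 0 0] by simp
lemma minus: "h (- x) = - h x" using add[of x "- x"] by (simp add: eq_neg_iff_add_eq_0 add.commute)
lemma diff: "h (x - y) = h x - h y" using add[of x "- y"] by (simp add: minus)
lemma sum: "h (sum f S) = (\<Sum>x\<in>S. h (f x))"
  by (induction S rule: infinite_finite_induct) (auto simp: add)

lemma rmap_rhom: "rhom (rmap h)"
proof
  fix P Q :: "'r rfmat"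
  show "rmap h (P + Q) = rmap h P + rmap h Q" by (rule rfmat_eqI) (simp add: ent_rmap add)
  show "rmap h 1 = 1" by (rule rfmat_eqI) (simp add: ent_rmap ent_1 one)
  show "rmap h (P * Q) = rmap h P * rmap h Q"
  proof (rule rfmat_eqI)
    fix i j
    have 1: "ent (P * Q) i j = (\<Sum>l\<in>{l. ent P i l \<noteq> 0}. ent P i l * ent Q l j)"
      by (rule ent_times_supp) (auto simp: finite_ent)
    have "ent (rmap h P * rmap h Q) i j = (\<Sum>l\<in>{l. ent P i l \<noteq> 0}. ent (rmap h P) i l * ent (rmap h Q) l j)"
      by (rule ent_times_supp) (auto simp: finite_ent ent_rmap)
    then show "ent (rmap h (P * Q)) i j = ent (rmap h P * rmap h Q) i j"
      by (simp add: ent_rmap 1 sum mult)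
  qed
qed

lemma rmap_dg: "rmap h (dg c) = dg (h c)"
  by (rule rfmat_eqI) (simp add: ent_rmap ent_dg)

end

subsection \<open>Two by two block matrices\<close>

text \<open>The index sets of the two blocks are interleaved as the even and the odd numbers.\<close>
lift_definition blk :: "'r::ring_1 rfmat \<Rightarrow> 'r rfmat \<Rightarrow> 'r rfmat \<Rightarrow> 'r rfmat \<Rightarrow> 'r rfmat"
  is "\<lambda>a b c e i j. if even i then (if even j then a else b) (i div 2) (j div 2)
        else (if even j then c else e) (i div 2) (j div 2)"
proof -
  fix a b c e :: "nat \<Rightarrow> nat \<Rightarrow> 'r"
  let ?f = "\<lambda>i j. if even i then (if even j then a else b) (i div 2) (j div 2)
        else (if even j then c else e) (i div 2) (j div 2)"
  assume h: "\<And>i. finite {j. a i j \<noteq> 0}" "\<And>i. finite {j. b i j \<noteq> 0}"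
    "\<And>i. finite {j. c i j \<noteq> 0}" "\<And>i. finite {j. e i j \<noteq> 0}"
  fix i
  let ?S = "{j. a (i div 2) j \<noteq> 0} \<union> {j. b (i div 2) j \<noteq> 0} \<union> {j. c (i div 2) j \<noteq> 0} \<union> {j. e (i div 2) j \<noteq> 0}"
  have "finite ((\<lambda>j. 2 * j) ` ?S \<union> (\<lambda>j. 2 * j + 1) ` ?S)" using h by simp
  moreover have "{j. ?f i j \<noteq> 0} \<subseteq> (\<lambda>j. 2 * j) ` ?S \<union> (\<lambda>j. 2 * j + 1) ` ?S"
  proof
    fix j assume j: "j \<in> {j. ?f i j \<noteq> 0}"
    then have "j div 2 \<in> ?S" by (auto split: if_splits)
    moreover have "j = 2 * (j div 2) \<or> j = 2 * (j div 2) + 1" by presburger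
    ultimately show "j \<in> (\<lambda>j. 2 * j) ` ?S \<union> (\<lambda>j. 2 * j + 1) ` ?S" by blast
  qed
  ultimately show "finite {j. ?f i j \<noteq> 0}" by (rule rev_finite_subset)
qed

lemma ent_blk: "ent (blk a b c e) i j = ent (if even i then (if even j then a else b)
        else (if even j then c else e)) (i div 2) (j div 2)"
  by (simp add: blk.rep_eq)

lemma blk_add [simp]: "blk a b c e + blk a' b' c' e' = blk (a + a') (b + b') (c + c') (e + e')"
  by (rule rfmat_eqI) (simp add: ent_blk)
lemma blk_diff [simp]: "blk a b c e - blk a' b' c' e' = blk (a - a') (b - b') (c - c') (e - e')"
  by (rule rfmat_eqI) (simp add: ent_blk)
lemma blk_sum: "(\<Sum>x\<in>S. blk (a x) (b x) (c x) (e x)) = blk (sum a S) (sum b S) (sum c S) (sum e S)"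
  by (rule rfmat_eqI) (simp add: ent_blk)

lemma nat_double_neq: "2 * (a::nat) \<noteq> Suc (2 * b)" "Suc (2 * a) \<noteq> 2 * b"
  by presburger+

lemma dg_blk: "dg x = blk (dg x) 0 0 (dg x)"
  by (rule rfmat_eqI) (auto simp: ent_blk ent_dg elim!: evenE oddE)

lemma zero_blk: "0 = blk 0 0 0 0"
  by (rule rfmat_eqI) (simp add: ent_blk)

lemma one_blk: "1 = blk 1 0 0 1"
  using dg_blk[of 1] by simp

lemma blk_eq_iff [simp]:
  "blk a b c e = blk a' b' c' e' \<longleftrightarrow> a = a' \<and> b = b' \<and> c = c' \<and> e = e'"
proof
  assume h: "blk a b c e = blk a' b' c' e'"
  have "ent (blk a b c e) i j = ent (blk a' b' c' e') i j" for i j using h by simp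
  note k = this[unfolded ent_blk]
  have "ent a i j = ent a' i j" "ent b i j = ent b' i j" "ent c i j = ent c' i j" "ent e i j = ent e' i j" for i j
    using k[of "2 * i" "2 * j"] k[of "2 * i" "2 * j + 1"] k[of "2 * i + 1" "2 * j"] k[of "2 * i + 1" "2 * j + 1"]
    by simp_all
  then show "a = a' \<and> b = b' \<and> c = c' \<and> e = e'" by (meson rfmat_eqI)
qed simp

lemma blk_eq_0_1 [simp]:
  "blk a b c e = 0 \<longleftrightarrow> a = 0 \<and> b = 0 \<and> c = 0 \<and> e = 0"
  "blk a b c e = 1 \<longleftrightarrow> a = 1 \<and> b = 0 \<and> c = 0 \<and> e = 1"
  by (subst zero_blk, simp, subst one_blk, simp)

lemma blk_mult [simp]: "blk a b c e * blk a' b' c' e' =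
  blk (a * a' + b * c') (a * b' + b * e') (c * a' + e * c') (c * b' + e * e')"
proof (rule rfmat_eqI)
  fix i j :: nat
  let ?p = "if even i then a else c" and ?q = "if even i then b else e"
  let ?x = "if even j then a' else b'" and ?y = "if even j then c' else e'"
  let ?S = "{l. ent ?p (i div 2) l \<noteq> 0} \<union> {l. ent ?q (i div 2) l \<noteq> 0}"
  have fS: "finite ?S" using finite_ent by blast
  let ?F = "\<lambda>l. ent (blk a b c e) i l * ent (blk a' b' c' e') l j"
  have "ent (blk a b c e * blk a' b' c' e') i j = sum ?F ((\<lambda>l. 2 * l) ` ?S \<union> (\<lambda>l. 2 * l + 1) ` ?S)"
  proof (rule ent_times_supp)
    fix l assume l: "ent (blk a b c e) i l \<noteq> 0"
    then have "l div 2 \<in> ?S" by (auto simp: ent_blk split: if_splits)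
    moreover have "l = 2 * (l div 2) \<or> l = 2 * (l div 2) + 1" by presburger
    ultimately show "l \<in> (\<lambda>l. 2 * l) ` ?S \<union> (\<lambda>l. 2 * l + 1) ` ?S" by blast
  qed (use fS in simp)
  also have "\<dots> = sum ?F ((\<lambda>l. 2 * l) ` ?S) + sum ?F ((\<lambda>l. 2 * l + 1) ` ?S)"
    by (rule sum.union_disjoint) (use fS in \<open>auto simp: nat_double_neq\<close>)
  also have "sum ?F ((\<lambda>l. 2 * l) ` ?S) = (\<Sum>l\<in>?S. ent ?p (i div 2) l * ent ?x l (j div 2))"
    by (subst sum.reindex) (auto simp: inj_on_def ent_blk)
  also have "\<dots> = ent (?p * ?x) (i div 2) (j div 2)"
    by (rule ent_times_supp[OF fS, symmetric]) auto
  also have "sum ?F ((\<lambda>l. 2 * l + 1) ` ?S) = (\<Sum>l\<in>?S. ent ?q (i div 2) l * ent ?y l (j div 2))"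
    by (subst sum.reindex) (auto simp: inj_on_def ent_blk)
  also have "\<dots> = ent (?q * ?y) (i div 2) (j div 2)"
    by (rule ent_times_supp[OF fS, symmetric]) auto
  finally show "ent (blk a b c e * blk a' b' c' e') i j = ent (blk (a * a' + b * c') (a * b' + b * e') (c * a' + e * c') (c * b' + e * e')) i j"
    by (simp add: ent_blk)
qed

lemma rmap_blk: "h 0 = 0 \<Longrightarrow> rmap h (blk a b c e) = blk (rmap h a) (rmap h b) (rmap h c) (rmap h e)"
  by (rule rfmat_eqI) (simp add: ent_rmap ent_blk)

subsection \<open>Evaluation of expressions in rings\<close>

text \<open>A relation instead of a partial function, since an inverse in a general ring is
  characterized, not computed; \<open>ev_unique\<close> makes it single-valued. Constants enter
  through \<open>\<kappa>\<close>, so the same expression can be evaluated in rings with one or two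
  levels of matrices.\<close>

fun ev :: "('a \<Rightarrow> 'r::ring_1) \<Rightarrow> (nat \<Rightarrow> 'r) \<Rightarrow> 'a nc_expr \<Rightarrow> 'r \<Rightarrow> bool" where
  "ev \<kappa> X (Const c) V = (V = \<kappa> c)"
| "ev \<kappa> X (Var k) V = (V = X k)"
| "ev \<kappa> X (Add R S) V = (\<exists>M N. ev \<kappa> X R M \<and> ev \<kappa> X S N \<and> V = M + N)"
| "ev \<kappa> X (Mul R S) V = (\<exists>M N. ev \<kappa> X R M \<and> ev \<kappa> X S N \<and> V = M * N)"
| "ev \<kappa> X (Inv R) V = (\<exists>M. ev \<kappa> X R M \<and> M * V = 1 \<and> V * M = 1)"

lemma ev_cong:
  "(\<And>k. k \<in> nc_vars R \<Longrightarrow> X k = X' k) \<Longrightarrow> ev \<kappa> X R V = ev \<kappa> X' R V"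
proof (induction R arbitrary: V)
  case (Add R S)
  then have "ev \<kappa> X R = ev \<kappa> X' R" "ev \<kappa> X S = ev \<kappa> X' S" by (simp_all add: fun_eq_iff)
  then show ?case by simp
next
  case (Mul R S)
  then have "ev \<kappa> X R = ev \<kappa> X' R" "ev \<kappa> X S = ev \<kappa> X' S" by (simp_all add: fun_eq_iff)
  then show ?case by simp
next
  case (Inv R)
  then have "ev \<kappa> X R = ev \<kappa> X' R" by (simp_all add: fun_eq_iff)
  then show ?case by simp
qed simp_all

text \<open>Only inversion needs an argument: \<open>M' * T = T * M\<close> is multiplied by the two
  inverses from outside. \<open>T\<close> itself is never inverted, so it may be a column or a
  corner of a block matrix. The choice \<open>T = 1\<close> yields uniqueness of values.\<close>

lemma ev_intertwine:
  assumes "\<And>c. \<kappa> c * T = T * \<kappa> c" "\<And>k. k \<in> nc_vars R \<Longrightarrow> X' k * T = T * X k"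
    and "ev \<kappa> X' R V'" "ev \<kappa> X R V"
  shows "V' * T = T * V"
  using assms(2-)
proof (induction R arbitrary: V V')
  case (Add R S)
  then obtain M N M' N' where *: "ev \<kappa> X R M" "ev \<kappa> X S N" "ev \<kappa> X' R M'" "ev \<kappa> X' S N'"
    "V = M + N" "V' = M' + N'" by auto
  with Add.IH[of M' M] Add.IH(2)[of N' N] Add.prems(1) show ?case
    by (simp add: distrib_left distrib_right)
next
  case (Mul R S)
  then obtain M N M' N' where *: "ev \<kappa> X R M" "ev \<kappa> X S N" "ev \<kappa> X' R M'" "ev \<kappa> X' S N'"
    "V = M * N" "V' = M' * N'" by auto
  with Mul.IH(1)[of M' M] Mul.IH(2)[of N' N] Mul.prems(1)
  have "M' * T = T * M" "N' * T = T * N" by simp_all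
  then show ?case using * by (metis mult.assoc)
next
  case (Inv R)
  then obtain M M' where *: "ev \<kappa> X R M" "M * V = 1" "V * M = 1"
    "ev \<kappa> X' R M'" "M' * V' = 1" "V' * M' = 1" by auto
  with Inv.IH[of M' M] Inv.prems(1) have "M' * T = T * M" by simp
  then have "V' * T = V' * (M' * T) * V" using * by (metis mult.assoc mult.right_neutral)
  also have "\<dots> = T * V" using * by (metis mult.assoc mult.left_neutral)
  finally show ?case .
qed (use assms(1) in simp_all)

lemma ev_unique: "ev \<kappa> X R V \<Longrightarrow> ev \<kappa> X R W \<Longrightarrow> V = W"
  using ev_intertwine[of \<kappa> 1 R X X V W] by simp

text \<open>A block triangular matrix with invertible diagonal is invertible with an explicit
  corner, so an expression defined at both diagonal points is defined at the triangular point,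
  whatever the corner \<open>Z\<close>. The assumption on \<open>\<kappa>\<close> says that
  constants act as block scalars; for \<open>dg\<close> it is \<open>dg_blk\<close>.\<close>

lemma ev_tri:
  assumes \<kappa>: "\<And>c. \<kappa> c = blk (\<kappa> c) 0 0 (\<kappa> c)"
  shows "ev \<kappa> U R u \<Longrightarrow> ev \<kappa> V R v \<Longrightarrow> \<exists>z. ev \<kappa> (\<lambda>k. blk (U k) (Z k) 0 (V k)) R (blk u z 0 v)"
proof (induction R arbitrary: u v)
  case (Const c)
  then show ?case using \<kappa>[of c] by (metis ev.simps(1))
next
  case (Add R S)
  then obtain u1 u2 v1 v2 where *: "ev \<kappa> U R u1" "ev \<kappa> U S u2" "ev \<kappa> V R v1" "ev \<kappa> V S v2"
    "u = u1 + u2" "v = v1 + v2" by auto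
  with Add.IH obtain z1 z2 where "ev \<kappa> (\<lambda>k. blk (U k) (Z k) 0 (V k)) R (blk u1 z1 0 v1)"
    "ev \<kappa> (\<lambda>k. blk (U k) (Z k) 0 (V k)) S (blk u2 z2 0 v2)" by blast
  moreover have "blk u (z1 + z2) 0 v = blk u1 z1 0 v1 + blk u2 z2 0 v2" using * by simp
  ultimately have "ev \<kappa> (\<lambda>k. blk (U k) (Z k) 0 (V k)) (Add R S) (blk u (z1 + z2) 0 v)"
    unfolding ev.simps by blast
  then show ?case by blast
next
  case (Mul R S)
  then obtain u1 u2 v1 v2 where *: "ev \<kappa> U R u1" "ev \<kappa> U S u2" "ev \<kappa> V R v1" "ev \<kappa> V S v2"
    "u = u1 * u2" "v = v1 * v2" by auto
  with Mul.IH obtain z1 z2 where "ev \<kappa> (\<lambda>k. blk (U k) (Z k) 0 (V k)) R (blk u1 z1 0 v1)"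
    "ev \<kappa> (\<lambda>k. blk (U k) (Z k) 0 (V k)) S (blk u2 z2 0 v2)" by blast
  moreover have "blk u (u1 * z2 + z1 * v2) 0 v = blk u1 z1 0 v1 * blk u2 z2 0 v2" using * by simp
  ultimately have "ev \<kappa> (\<lambda>k. blk (U k) (Z k) 0 (V k)) (Mul R S) (blk u (u1 * z2 + z1 * v2) 0 v)"
    unfolding ev.simps by blast
  then show ?case by blast
next
  case (Inv R)
  then obtain u1 v1 where *: "ev \<kappa> U R u1" "ev \<kappa> V R v1"
    "u1 * u = 1" "u * u1 = 1" "v1 * v = 1" "v * v1 = 1" by auto
  with Inv.IH obtain z1 where z1: "ev \<kappa> (\<lambda>k. blk (U k) (Z k) 0 (V k)) R (blk u1 z1 0 v1)" by blast
  have "u1 * (u * z1 * v) = z1 * v" "u * z1 * v * v1 = u * z1"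
    using * by (metis mult.assoc mult.left_neutral, metis mult.assoc mult.right_neutral)
  then have "blk u1 z1 0 v1 * blk u (- (u * z1 * v)) 0 v = 1" "blk u (- (u * z1 * v)) 0 v * blk u1 z1 0 v1 = 1"
    using * by (simp_all add: mult.assoc)
  with z1 have "ev \<kappa> (\<lambda>k. blk (U k) (Z k) 0 (V k)) (Inv R) (blk u (- (u * z1 * v)) 0 v)"
    unfolding ev.simps by blast
  then show ?case by blast
qed auto

text \<open>Fractions \<open>M / \<eta> q\<close> representing the value of an expression over a ring of polynomials. The
  denominator of a subexpression divides that of the expression.\<close>
fun pev :: "('a \<Rightarrow> 'p::ring_1) \<Rightarrow> ('b::comm_ring_1 \<Rightarrow> 'p) \<Rightarrow> (nat \<Rightarrow> 'p) \<Rightarrow> 'a nc_expr \<Rightarrow> 'p \<Rightarrow> 'b \<Rightarrow> bool"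
where
  "pev \<kappa> \<eta> X (Const c) M q = (M = \<kappa> c \<and> q = 1)"
| "pev \<kappa> \<eta> X (Var k) M q = (M = X k \<and> q = 1)"
| "pev \<kappa> \<eta> X (Add R S) M q = (\<exists>M1 q1 M2 q2. pev \<kappa> \<eta> X R M1 q1 \<and> pev \<kappa> \<eta> X S M2 q2 \<and>
     M = M1 * \<eta> q2 + M2 * \<eta> q1 \<and> q = q1 * q2)"
| "pev \<kappa> \<eta> X (Mul R S) M q = (\<exists>M1 q1 M2 q2. pev \<kappa> \<eta> X R M1 q1 \<and> pev \<kappa> \<eta> X S M2 q2 \<and>
     M = M1 * M2 \<and> q = q1 * q2)"
| "pev \<kappa> \<eta> X (Inv R) M q = (\<exists>M1 q1 N p. pev \<kappa> \<eta> X R M1 q1 \<and> M1 * N = \<eta> p \<and> N * M1 = \<eta> p \<and>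
     M = \<eta> q1 * \<eta> q1 * N \<and> q = q1 * p)"

definition unit :: "'r::ring_1 \<Rightarrow> bool" where "unit x \<longleftrightarrow> (\<exists>y. x * y = 1 \<and> y * x = 1)"

lemma unit_leftI:
  assumes "unit (x * y)" "x * y = y * x" shows "unit x"
proof -
  obtain z where z: "x * y * z = 1" "z * (x * y) = 1" using assms(1) unfolding unit_def by blast
  have "x * (y * z) = 1" using z by (simp add: mult.assoc)
  moreover have "z * y * x = 1" using z assms(2) by (simp add: mult.assoc)
  ultimately show ?thesis unfolding unit_def by (metis mult.assoc mult.left_neutral mult.right_neutral)
qed

lemma unit_multI: "unit x \<Longrightarrow> unit y \<Longrightarrow> unit (x * y)"
  unfolding unit_def by (metis mult.assoc mult.left_neutral)

lemma unit_one [simp]: "unit 1" unfolding unit_def by (metis mult.left_neutral)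

lemma unit_cancel_right: "unit y \<Longrightarrow> x * y = z * y \<Longrightarrow> x = z"
  unfolding unit_def by (metis mult.assoc mult.right_neutral)

lemma unit_cancel_left: "unit y \<Longrightarrow> y * x = y * z \<Longrightarrow> x = z"
  unfolding unit_def by (metis mult.assoc mult.left_neutral)

text \<open>Denominators are central, and those of subexpressions are factors of the final one. So
  the single unit \<open>h (\<eta> q)\<close> makes all of them units, and every inverse in the
  expression exists after the specialization \<open>h\<close>.\<close>

lemma (in rhom) pev_hom:
  assumes \<kappa>: "\<And>c. \<kappa>' c = h (\<kappa> c)" and \<eta>: "rhom \<eta>" and c: "\<And>q x. \<eta> q * x = x * \<eta> q"
  shows "pev \<kappa> \<eta> X R M q \<Longrightarrow> unit (h (\<eta> q)) \<Longrightarrow> \<exists>V. ev \<kappa>' (\<lambda>k. h (X k)) R V \<and> V * h (\<eta> q) = h M"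
proof (induction R arbitrary: M q)
  case (Const c)
  then show ?case using \<kappa> by (simp add: rhom.one[OF \<eta>] one)
next
  case (Var k)
  then show ?case by (simp add: rhom.one[OF \<eta>] one)
next
  case (Add R S)
  then obtain M1 q1 M2 q2 where *: "pev \<kappa> \<eta> X R M1 q1" "pev \<kappa> \<eta> X S M2 q2"
     "M = M1 * \<eta> q2 + M2 * \<eta> q1" "q = q1 * q2" by auto
  have u: "unit (h (\<eta> q1))" "unit (h (\<eta> q2))"
    using Add.prems(2) * unit_leftI c by (metis mult rhom.mult[OF \<eta>])+
  from Add.IH(1)[OF *(1) u(1)] Add.IH(2)[OF *(2) u(2)] obtain V1 V2 where
    V: "ev \<kappa>' (\<lambda>k. h (X k)) R V1" "V1 * h (\<eta> q1) = h M1" "ev \<kappa>' (\<lambda>k. h (X k)) S V2" "V2 * h (\<eta> q2) = h M2"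
    by blast
  have "(V1 + V2) * h (\<eta> q) = h M"
    using * V(2,4) c[of q1 "\<eta> q2"]
    by (simp add: rhom.mult[OF \<eta>] mult add distrib_right flip: mult.assoc)
      (metis mult mult.assoc)
  then show ?case using V by auto
next
  case (Mul R S)
  then obtain M1 q1 M2 q2 where *: "pev \<kappa> \<eta> X R M1 q1" "pev \<kappa> \<eta> X S M2 q2"
     "M = M1 * M2" "q = q1 * q2" by auto
  have u: "unit (h (\<eta> q1))" "unit (h (\<eta> q2))"
    using Mul.prems(2) * unit_leftI c by (metis mult rhom.mult[OF \<eta>])+
  from Mul.IH(1)[OF *(1) u(1)] Mul.IH(2)[OF *(2) u(2)] obtain V1 V2 where
    V: "ev \<kappa>' (\<lambda>k. h (X k)) R V1" "V1 * h (\<eta> q1) = h M1" "ev \<kappa>' (\<lambda>k. h (X k)) S V2" "V2 * h (\<eta> q2) = h M2"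
    by blast
  have "h (\<eta> q1) * h M2 = h M2 * h (\<eta> q1)" using c[of q1 M2] by (metis mult)
  then have "V2 * h (\<eta> q2) * h (\<eta> q1) = h (\<eta> q1) * (V2 * h (\<eta> q2))" using V by simp
  moreover have "h (\<eta> q1) * h (\<eta> q2) = h (\<eta> q2) * h (\<eta> q1)" using c by (metis mult)
  ultimately have "V1 * V2 * (h (\<eta> q1) * h (\<eta> q2)) = V1 * h (\<eta> q1) * (V2 * h (\<eta> q2))"
    by (metis mult.assoc)
  then have "V1 * V2 * h (\<eta> q) = h M"
    using * V(2,4) by (simp add: rhom.mult[OF \<eta>] mult)
  then show ?case using V by auto
next
  case (Inv R)
  \<comment> \<open>The inverse of \<open>M1 / q1\<close> is \<open>q1 * N / p\<close>. Extending
    this fraction by \<open>q1\<close>, whence the square in the numerator, keeps \<open>q1\<close>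
    a divisor of the denominator.\<close>
  then obtain M1 q1 N p where *: "pev \<kappa> \<eta> X R M1 q1" "M1 * N = \<eta> p" "N * M1 = \<eta> p"
     "M = \<eta> q1 * \<eta> q1 * N" "q = q1 * p" by auto
  have u: "unit (h (\<eta> q1))" "unit (h (\<eta> p))"
    using Inv.prems(2) * unit_leftI c by (metis mult rhom.mult[OF \<eta>])+
  from Inv.IH[OF *(1) u(1)] obtain V where
    V: "ev \<kappa>' (\<lambda>k. h (X k)) R V" "V * h (\<eta> q1) = h M1" by blast
  obtain i where i: "h (\<eta> p) * i = 1" "i * h (\<eta> p) = 1" using u(2) unfolding unit_def by blast
  let ?W = "h (\<eta> q1) * h N * i"
  have "V * ?W = h (M1 * N) * i" using V(2) by (metis mult mult.assoc)
  then have 1: "V * ?W = 1" using * i by simp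
  have ci: "i * h x = h x * i" for x
    using c[of p x] i by (metis mult mult.assoc mult.left_neutral mult.right_neutral)
  \<comment> \<open>\<open>V\<close> is known only through \<open>V * h (\<eta> q1) = h M1\<close>,
    so \<open>?W * V = 1\<close> is reached by cancelling the unit
    \<open>h (\<eta> q1)\<close>.\<close>
  have "h (\<eta> q1) * (?W * V) = ?W * (V * h (\<eta> q1))" 
  proof -
    have "?W * (V * h (\<eta> q1)) = h (\<eta> q1) * i * (h (N * M1))" 
      using V(2) ci by (metis mult mult.assoc)
    also have "\<dots> = h (\<eta> q1)" using * i by (metis mult.assoc mult.right_neutral)
    finally have a: "?W * (V * h (\<eta> q1)) = h (\<eta> q1)" .
    then have "?W * V * h (\<eta> q1) = 1 * h (\<eta> q1)" by (simp add: mult.assoc)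
    then have "?W * V = 1" by (rule unit_cancel_right[OF u(1)])
    with a show ?thesis by simp
  qed
  moreover have "?W * (V * h (\<eta> q1)) = h (\<eta> q1)"
  proof -
    have "?W * (V * h (\<eta> q1)) = h (\<eta> q1) * i * (h (N * M1))" 
      using V(2) ci by (metis mult mult.assoc)
    also have "\<dots> = h (\<eta> q1)" using * i by (metis mult.assoc mult.right_neutral)
    finally show ?thesis .
  qed
  ultimately have 2: "?W * V = 1" using unit_cancel_left[OF u(1), of "?W * V" 1] by simp
  have "?W * h (\<eta> q) = h M"
  proof -
    have "?W * h (\<eta> q) = h (\<eta> q1) * h N * (i * h (\<eta> p)) * h (\<eta> q1)"
      using c[of p "\<eta> q1"] *(5) rhom.mult[OF \<eta>] by (metis mult mult.assoc)
    also have "\<dots> = h (\<eta> q1) * (h N * h (\<eta> q1))" using i by (simp add: mult.assoc)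
    also have "\<dots> = h M" using *(4) c[of q1 N] by (metis mult mult.assoc)
    finally show ?thesis .
  qed
  then show ?case using V(1) 1 2 by auto
qed

subsection \<open>Matrices as periodic elements\<close>

text \<open>\<open>amp nr nc M\<close> is \<open>I \<otimes> M\<close> with infinitely many copies of \<open>M\<close>, and \<open>0\<close> if \<open>nr\<close> or \<open>nc\<close> is \<open>0\<close>.\<close>
lift_definition amp :: "nat \<Rightarrow> nat \<Rightarrow> 'b::comm_ring_1 mat \<Rightarrow> 'b rfmat"
  is "\<lambda>nr nc M i j. if 0 < nr \<and> 0 < nc \<and> i div nr = j div nc then M $$ (i mod nr, j mod nc) else 0"
proof -
  fix nr nc i :: nat and M :: "'b mat"
  have "{j. (if 0 < nr \<and> 0 < nc \<and> i div nr = j div nc then M $$ (i mod nr, j mod nc) else 0) \<noteq> 0}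
    \<subseteq> {j. 0 < nc \<and> j < (i div nr) * nc + nc}"
    by (auto split: if_splits) (metis div_mult_mod_eq mod_less_divisor nat_add_left_cancel_less)
  then show "finite {j. (if 0 < nr \<and> 0 < nc \<and> i div nr = j div nc then M $$ (i mod nr, j mod nc) else 0) \<noteq> 0}"
    by (rule finite_subset) simp
qed

lemma ent_amp: "ent (amp nr nc M) i j =
    (if 0 < nr \<and> 0 < nc \<and> i div nr = j div nc then M $$ (i mod nr, j mod nc) else 0)"
  by (simp add: amp.rep_eq)

lemma amp_dim0 [simp]: "amp 0 nc M = 0" "amp nr 0 M = 0"
  by (rule rfmat_eqI, simp add: ent_amp)+

lemma amp_add: "X \<in> carrier_mat nr nc \<Longrightarrow> Y \<in> carrier_mat nr nc \<Longrightarrow> amp nr nc (X + Y) = amp nr nc X + amp nr nc Y"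
  by (rule rfmat_eqI) (auto simp: ent_amp)

lemma amp_diff: "X \<in> carrier_mat nr nc \<Longrightarrow> Y \<in> carrier_mat nr nc \<Longrightarrow> amp nr nc (X - Y) = amp nr nc X - amp nr nc Y"
  by (rule rfmat_eqI) (auto simp: ent_amp)

lemma amp_smult: "X \<in> carrier_mat nr nc \<Longrightarrow> amp nr nc (c \<cdot>\<^sub>m X) = dg c * amp nr nc X"
  by (rule rfmat_eqI) (auto simp: ent_amp)

lemma amp_zero [simp]: "amp nr nc (0\<^sub>m nr nc) = 0"
  by (rule rfmat_eqI) (auto simp: ent_amp)

lemma amp_one: "0 < n \<Longrightarrow> amp n n (1\<^sub>m n) = 1"
  by (rule rfmat_eqI) (auto simp: ent_amp ent_1, metis div_mult_mod_eq)

lemma amp_inj: "X \<in> carrier_mat nr nc \<Longrightarrow> Y \<in> carrier_mat nr nc \<Longrightarrow> amp nr nc X = amp nr nc Y \<Longrightarrow> X = Y"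
proof (rule eq_matI)
  fix i j assume h: "X \<in> carrier_mat nr nc" "Y \<in> carrier_mat nr nc" "amp nr nc X = amp nr nc Y"
    "i < dim_row Y" "j < dim_col Y"
  then have "ent (amp nr nc X) i j = ent (amp nr nc Y) i j" by simp
  then show "X $$ (i, j) = Y $$ (i, j)" using h(1,2,4,5) by (simp add: ent_amp split: if_splits)
qed auto

lemma ent_mult_window:
  assumes "\<And>l. l div k \<noteq> I \<Longrightarrow> ent P i l * ent Q l j = 0" "0 < k"
  shows "ent (P * Q) i j = (\<Sum>t<k. ent P i (I * k + t) * ent Q (I * k + t) j)"
proof -
  have "ent (P * Q) i j = (\<Sum>l\<in>(\<lambda>t. I * k + t) ` {..<k}. ent P i l * ent Q l j)"
  proof (rule ent_sum_supp)
    fix l assume l: "l \<notin> (\<lambda>t. I * k + t) ` {..<k}"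
    have "l div k \<noteq> I"
    proof
      assume "l div k = I"
      then have "l = I * k + l mod k" by (metis div_mult_mod_eq)
      then show False using l \<open>0 < k\<close> by (metis imageI lessThan_iff mod_less_divisor)
    qed
    then show "ent P i l * ent Q l j = 0" by (rule assms)
  qed simp
  then show ?thesis by (simp add: sum.reindex inj_on_def)
qed

lemma amp_mult:
  assumes "X \<in> carrier_mat nr nk" "Y \<in> carrier_mat nk nc"
  shows "amp nr nc (X * Y) = amp nr nk X * amp nk nc Y"
proof (cases "nr = 0 \<or> nc = 0 \<or> nk = 0")
  case True
  have "amp nr nc (X * Y) = 0" if "nk = 0"
    by (rule rfmat_eqI) (use that assms in \<open>auto simp: ent_amp scalar_prod_def\<close>)
  then show ?thesis using True by auto
next
  case False
  show ?thesis
  proof (rule rfmat_eqI)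
    fix i j
    have "ent (amp nr nk X * amp nk nc Y) i j =
      (\<Sum>t<nk. ent (amp nr nk X) i (i div nr * nk + t) * ent (amp nk nc Y) (i div nr * nk + t) j)"
      by (rule ent_mult_window) (use False in \<open>auto simp: ent_amp\<close>)
    also have "\<dots> = ent (amp nr nc (X * Y)) i j"
      using False assms by (simp add: ent_amp scalar_prod_def atLeast0LessThan)
    finally show "ent (amp nr nc (X * Y)) i j = ent (amp nr nk X * amp nk nc Y) i j" by simp
  qed
qed

definition bl :: "nat \<Rightarrow> nat \<Rightarrow> 'b mat \<Rightarrow> nat \<Rightarrow> nat \<Rightarrow> 'b mat" where
  "bl nr nc X I J = mat nr nc (\<lambda>(a, b). X $$ (I * nr + a, J * nc + b))"

lemma bl_carrier [simp]: "bl nr nc X I J \<in> carrier_mat nr nc" by (simp add: bl_def)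

text \<open>Likewise for a matrix of \<open>m * m\<close> blocks, keeping the index of the block apart from that of the entry
  inside it.\<close>
lift_definition amp2 :: "nat \<Rightarrow> nat \<Rightarrow> nat \<Rightarrow> 'b::comm_ring_1 mat \<Rightarrow> 'b rfmat rfmat"
  is "\<lambda>nr nc m X I J. if 0 < m \<and> I div m = J div m then amp nr nc (bl nr nc X (I mod m) (J mod m)) else 0"
proof -
  fix nr nc m I :: nat and X :: "'b mat"
  have "{J. (if 0 < m \<and> I div m = J div m then amp nr nc (bl nr nc X (I mod m) (J mod m)) else 0) \<noteq> 0}
    \<subseteq> {J. 0 < m \<and> J < (I div m) * m + m}"
    by (auto split: if_splits) (metis div_mult_mod_eq mod_less_divisor nat_add_left_cancel_less)
  then show "finite {J. (if 0 < m \<and> I div m = J div m then amp nr nc (bl nr nc X (I mod m) (J mod m)) else 0) \<noteq> 0}"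
    by (rule finite_subset) simp
qed

lemma ent_amp2: "ent (amp2 nr nc m X) I J =
    (if 0 < m \<and> I div m = J div m then amp nr nc (bl nr nc X (I mod m) (J mod m)) else 0)"
  by (simp add: amp2.rep_eq)

lemma block_index_less: "(I::nat) < m \<Longrightarrow> a < n \<Longrightarrow> I * n + a < n * m"
proof -
  assume "I < m" "a < n"
  then have "I * n + a < (I + 1) * n" by simp
  also have "\<dots> \<le> m * n" using \<open>I < m\<close> by (intro mult_right_mono) auto
  finally show ?thesis by (simp add: mult.commute)
qed

lemma bl_add: "X \<in> carrier_mat (nr * m) (nc * m) \<Longrightarrow> Y \<in> carrier_mat (nr * m) (nc * m) \<Longrightarrow> I < m \<Longrightarrow> J < m \<Longrightarrow>
    bl nr nc (X + Y) I J = bl nr nc X I J + bl nr nc Y I J"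
  by (rule eq_matI) (auto simp: bl_def block_index_less)

lemma bl_diff: "X \<in> carrier_mat (nr * m) (nc * m) \<Longrightarrow> Y \<in> carrier_mat (nr * m) (nc * m) \<Longrightarrow> I < m \<Longrightarrow> J < m \<Longrightarrow>
    bl nr nc (X - Y) I J = bl nr nc X I J - bl nr nc Y I J"
  by (rule eq_matI) (auto simp: bl_def block_index_less)

lemma bl_smult: "X \<in> carrier_mat (nr * m) (nc * m) \<Longrightarrow> I < m \<Longrightarrow> J < m \<Longrightarrow>
    bl nr nc (c \<cdot>\<^sub>m X) I J = c \<cdot>\<^sub>m bl nr nc X I J"
  by (rule eq_matI) (auto simp: bl_def block_index_less)

lemma amp2_add: "X \<in> carrier_mat (nr * m) (nc * m) \<Longrightarrow> Y \<in> carrier_mat (nr * m) (nc * m) \<Longrightarrow>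
    amp2 nr nc m (X + Y) = amp2 nr nc m X + amp2 nr nc m Y"
  by (rule rfmat_eqI) (auto simp: ent_amp2 bl_add amp_add)

lemma amp2_diff: "X \<in> carrier_mat (nr * m) (nc * m) \<Longrightarrow> Y \<in> carrier_mat (nr * m) (nc * m) \<Longrightarrow>
    amp2 nr nc m (X - Y) = amp2 nr nc m X - amp2 nr nc m Y"
  by (rule rfmat_eqI) (auto simp: ent_amp2 bl_diff amp_diff)

lemma amp2_smult: "X \<in> carrier_mat (nr * m) (nc * m) \<Longrightarrow>
    amp2 nr nc m (c \<cdot>\<^sub>m X) = dg (dg c) * amp2 nr nc m X"
  by (rule rfmat_eqI) (auto simp: ent_amp2 bl_smult amp_smult)

lemma amp2_zero [simp]: "amp2 nr nc m (0\<^sub>m (nr * m) (nc * m)) = (0 :: 'a::comm_ring_1 rfmat rfmat)"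
proof (rule rfmat_eqI)
  fix I J
  have "bl nr nc (0\<^sub>m (nr * m) (nc * m) :: 'a mat) (I mod m) (J mod m) = 0\<^sub>m nr nc" if "0 < m"
    by (rule eq_matI) (use that in \<open>auto simp: bl_def block_index_less\<close>)
  then show "ent (amp2 nr nc m (0\<^sub>m (nr * m) (nc * m))) I J = ent (0 :: 'a rfmat rfmat) I J"
    by (cases "0 < m") (simp_all add: ent_amp2)
qed

lemma div_mod_eqI: "0 < (m::nat) \<Longrightarrow> I div m = J div m \<Longrightarrow> I mod m = J mod m \<Longrightarrow> I = J"
  by (metis div_mult_mod_eq)

lemma amp2_one: 
  assumes "0 < n" "0 < m" shows "amp2 n n m (1\<^sub>m (n * m)) = (1 :: 'a::comm_ring_1 rfmat rfmat)"
proof (rule rfmat_eqI)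
  fix I J
  have "bl n n (1\<^sub>m (n * m) :: 'a mat) (I mod m) (J mod m) = (if I mod m = J mod m then 1\<^sub>m n else 0\<^sub>m n n :: 'a mat)"
  proof (rule eq_matI)
    fix a b assume "a < dim_row (if I mod m = J mod m then 1\<^sub>m n else 0\<^sub>m n n :: 'a mat)"
      "b < dim_col (if I mod m = J mod m then 1\<^sub>m n else 0\<^sub>m n n :: 'a mat)"
    then have ab: "a < n" "b < n" by (auto split: if_splits)
    have "(I mod m) * n + a = (J mod m) * n + b \<longleftrightarrow> I mod m = J mod m \<and> a = b"
    proof
      assume h: "(I mod m) * n + a = (J mod m) * n + b"
      then have "((I mod m) * n + a) div n = ((J mod m) * n + b) div n" by simp
      then have "I mod m = J mod m" using ab by simp
      then show "I mod m = J mod m \<and> a = b" using h by simp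
    qed auto
    moreover have "(I mod m) * n + a < n * m" "(J mod m) * n + b < n * m"
      using ab assms by (auto intro: block_index_less)
    ultimately show "bl n n (1\<^sub>m (n * m) :: 'a mat) (I mod m) (J mod m) $$ (a, b) = (if I mod m = J mod m then 1\<^sub>m n else 0\<^sub>m n n) $$ (a, b)"
      using ab by (simp add: bl_def)
  qed (auto simp: bl_def)
  then show "ent (amp2 n n m (1\<^sub>m (n * m))) I J = ent (1 :: 'a rfmat rfmat) I J"
    using assms div_mod_eqI[of m I J] by (cases "I = J") (auto simp: ent_amp2 ent_1 amp_one)
qed

lemma amp2_mult:
  assumes X: "X \<in> carrier_mat (nr * m) (nk * m)" and Y: "Y \<in> carrier_mat (nk * m) (nc * m)"
  shows "amp2 nr nc m (X * Y) = amp2 nr nk m X * amp2 nk nc m Y"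
proof (cases "m = 0")
  case True
  then show ?thesis by (intro rfmat_eqI) (simp add: ent_amp2 times_rfmat.rep_eq)
next
  case False
  then have m: "0 < m" by simp
  show ?thesis
  proof (rule rfmat_eqI)
    fix I J
    let ?x = "\<lambda>t. bl nr nk X (I mod m) t" and ?y = "\<lambda>t. bl nk nc Y t (J mod m)"
    have "ent (amp2 nr nk m X * amp2 nk nc m Y) I J =
      (\<Sum>t<m. ent (amp2 nr nk m X) I (I div m * m + t) * ent (amp2 nk nc m Y) (I div m * m + t) J)"
      by (rule ent_mult_window) (use m in \<open>auto simp: ent_amp2\<close>)
    also have "\<dots> = (if I div m = J div m then (\<Sum>t<m. amp nr nc (?x t * ?y t)) else 0)"
      using m by (simp add: ent_amp2 amp_mult[of _ nr nk _ nc])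
    also have "\<dots> = ent (amp2 nr nc m (X * Y)) I J"
    proof (cases "I div m = J div m")
      case True
      have "(\<Sum>t<m. amp nr nc (?x t * ?y t)) = amp nr nc (bl nr nc (X * Y) (I mod m) (J mod m))"
      proof (rule rfmat_eqI)
        fix i j
        show "ent (\<Sum>t<m. amp nr nc (?x t * ?y t)) i j = ent (amp nr nc (bl nr nc (X * Y) (I mod m) (J mod m))) i j"
        proof (cases "0 < nr \<and> 0 < nc \<and> i div nr = j div nc")
          case t: True
          let ?p = "I mod m * nr + i mod nr" and ?q = "J mod m * nc + j mod nc"
          have pq: "?p < nr * m" "?q < nc * m" using t m by (auto intro: block_index_less)
          have "ent (\<Sum>t<m. amp nr nc (?x t * ?y t)) i j = (\<Sum>t<m. (?x t * ?y t) $$ (i mod nr, j mod nc))"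
            using t by (simp add: ent_amp)
          also have "\<dots> = (\<Sum>t<m. \<Sum>c<nk. X $$ (?p, t * nk + c) * Y $$ (t * nk + c, ?q))"
            using t by (simp add: scalar_prod_def bl_def atLeast0LessThan)
          also have "\<dots> = (\<Sum>t<m. \<Sum>l\<in>{t * nk..<t * nk + nk}. X $$ (?p, l) * Y $$ (l, ?q))"
            by (rule sum.cong[OF refl])
               (rule sum.reindex_bij_witness[where i = "\<lambda>l. l - t * nk" and j = "\<lambda>c. t * nk + c" for t], auto)
          also have "\<dots> = (\<Sum>l<m * nk. X $$ (?p, l) * Y $$ (l, ?q))" by (rule sum.nat_group)
          also have "\<dots> = (X * Y) $$ (?p, ?q)"
            using X Y pq by (simp add: scalar_prod_def atLeast0LessThan mult.commute)
          also have "\<dots> = ent (amp nr nc (bl nr nc (X * Y) (I mod m) (J mod m))) i j"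
            using t by (simp add: ent_amp bl_def)
          finally show ?thesis .
        next
          case False
          then show ?thesis by (auto simp: ent_amp)
        qed
      qed
      then show ?thesis using True m by (simp add: ent_amp2)
    qed (simp add: ent_amp2)
    finally show "ent (amp2 nr nc m (X * Y)) I J = ent (amp2 nr nk m X * amp2 nk nc m Y) I J" by simp
  qed
qed

lemma amp2_inj:
  assumes "0 < m" "X \<in> carrier_mat (nr * m) (nc * m)" "Y \<in> carrier_mat (nr * m) (nc * m)"
    and e: "amp2 nr nc m X = amp2 nr nc m Y"
  shows "X = Y"
proof (rule eq_matI)
  fix i j assume "i < dim_row Y" "j < dim_col Y"
  then have ij: "i < nr * m" "j < nc * m" using assms by auto
  then have n: "0 < nr" "0 < nc" by (auto intro: gr0I)
  have I: "i div nr < m" "j div nc < m" using ij by (simp_all add: less_mult_imp_div_less mult.commute)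
  have "ent (amp2 nr nc m X) (i div nr) (j div nc) = ent (amp2 nr nc m Y) (i div nr) (j div nc)" using e by simp
  then have "amp nr nc (bl nr nc X (i div nr) (j div nc)) = amp nr nc (bl nr nc Y (i div nr) (j div nc))"
    using I assms(1) by (simp add: ent_amp2)
  then have "bl nr nc X (i div nr) (j div nc) = bl nr nc Y (i div nr) (j div nc)"
    using amp_inj bl_carrier by blast
  then have "bl nr nc X (i div nr) (j div nc) $$ (i mod nr, j mod nc) = bl nr nc Y (i div nr) (j div nc) $$ (i mod nr, j mod nc)" by simp
  then show "X $$ (i, j) = Y $$ (i, j)" using n by (simp add: bl_def)
qed (use assms in auto)

definition Amp :: "nat \<Rightarrow> nat \<Rightarrow> 'b::comm_ring_1 rfmat set" where
  "Amp nr nc = amp nr nc ` carrier_mat nr nc"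

lemma amp_in_Amp: "X \<in> carrier_mat nr nc \<Longrightarrow> amp nr nc X \<in> Amp nr nc"
  by (simp add: Amp_def)

lemma Amp_closed:
  "0 \<in> Amp nr nc" "x \<in> Amp nr nc \<Longrightarrow> y \<in> Amp nr nc \<Longrightarrow> x + y \<in> Amp nr nc"
  "x \<in> Amp nr nc \<Longrightarrow> y \<in> Amp nr nc \<Longrightarrow> x - y \<in> Amp nr nc"
  "x \<in> Amp nr nk \<Longrightarrow> y \<in> Amp nk nc \<Longrightarrow> x * y \<in> Amp nr nc"
proof -
  show "0 \<in> Amp nr nc" unfolding Amp_def by (metis amp_zero imageI zero_carrier_mat)
  show "x \<in> Amp nr nc \<Longrightarrow> y \<in> Amp nr nc \<Longrightarrow> x + y \<in> Amp nr nc"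
    unfolding Amp_def by (auto simp flip: amp_add)
  show "x \<in> Amp nr nc \<Longrightarrow> y \<in> Amp nr nc \<Longrightarrow> x - y \<in> Amp nr nc"
    unfolding Amp_def by (auto simp flip: amp_diff intro!: imageI minus_carrier_mat)
  show "x \<in> Amp nr nk \<Longrightarrow> y \<in> Amp nk nc \<Longrightarrow> x * y \<in> Amp nr nc"
    unfolding Amp_def by (auto simp flip: amp_mult)
qed

lemma Amp_sum: "(\<And>x. x \<in> S \<Longrightarrow> f x \<in> Amp nr nc) \<Longrightarrow> sum f S \<in> Amp nr nc"
  by (induction S rule: infinite_finite_induct) (auto intro: Amp_closed)

definition per :: "nat \<Rightarrow> nat \<Rightarrow> nat \<Rightarrow> 'b::comm_ring_1 rfmat rfmat \<Rightarrow> bool" where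
  "per nr nc m P \<longleftrightarrow> 0 < m \<and> (\<forall>I J. ent P I J \<in> Amp nr nc) \<and>
     (\<forall>I J. ent P I J = (if I div m = J div m then ent P (I mod m) (J mod m) else 0))"

text \<open>Ampliations of block matrices with any number of blocks per side. Two periods have a
  common multiple, so by \<open>per_mono\<close> the elements of all these sizes together are closed
  under the ring operations.\<close>

definition Fin :: "nat \<Rightarrow> nat \<Rightarrow> 'b::comm_ring_1 rfmat rfmat \<Rightarrow> bool" where
  "Fin nr nc P \<longleftrightarrow> (\<exists>m. per nr nc m P)"

lemma per_pos: "per nr nc m P \<Longrightarrow> 0 < m"
  and per_Amp: "per nr nc m P \<Longrightarrow> ent P I J \<in> Amp nr nc"
  unfolding per_def by blast+

lemma per_ent: "per nr nc m P \<Longrightarrow> ent P I J = (if I div m = J div m then ent P (I mod m) (J mod m) else 0)"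
  unfolding per_def by (elim conjE allE) assumption

lemma per_amp2: "0 < m \<Longrightarrow> per nr nc m (amp2 nr nc m X)"
  unfolding per_def by (auto simp: ent_amp2 intro: amp_in_Amp Amp_closed)

lemma per_imp_amp2:
  assumes "per nr nc m P"
  obtains X where "X \<in> carrier_mat (nr * m) (nc * m)" "P = amp2 nr nc m X"
proof -
  let ?X = "mat (nr * m) (nc * m) (\<lambda>(i, j). ent (ent P (i div nr) (j div nc)) (i mod nr) (j mod nc))"
  have m: "0 < m" using assms by (rule per_pos)
  have "P = amp2 nr nc m ?X"
  proof (rule rfmat_eqI)
    fix I J
    let ?I = "I mod m" and ?J = "J mod m"
    obtain M where M: "M \<in> carrier_mat nr nc" "ent P ?I ?J = amp nr nc M"
      using per_Amp[OF assms, of ?I ?J] unfolding Amp_def by blast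
    have "bl nr nc ?X ?I ?J = M"
    proof (rule eq_matI)
      fix a b assume "a < dim_row M" "b < dim_col M"
      then have ab: "a < nr" "b < nc" using M by auto
      then have "?I * nr + a < nr * m" "?J * nc + b < nc * m" using m by (auto intro: block_index_less)
      then show "bl nr nc ?X ?I ?J $$ (a, b) = M $$ (a, b)"
        using ab M(2) by (simp add: bl_def ent_amp)
    qed (use M in \<open>auto simp: bl_def\<close>)
    then show "ent P I J = ent (amp2 nr nc m ?X) I J"
      using m M(2) by (simp add: ent_amp2 per_ent[OF assms, of I J])
  qed
  then show ?thesis by (rule that[rotated]) simp
qed

lemma per_iff_amp2: "per nr nc m P \<longleftrightarrow> 0 < m \<and> (\<exists>X\<in>carrier_mat (nr * m) (nc * m). P = amp2 nr nc m X)"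
proof
  assume "per nr nc m P"
  then show "0 < m \<and> (\<exists>X\<in>carrier_mat (nr * m) (nc * m). P = amp2 nr nc m X)"
    by (auto intro: per_pos elim: per_imp_amp2)
qed (auto intro: per_amp2)

lemma per_mono:
  assumes "per nr nc m P" "0 < k" shows "per nr nc (m * k) P"
  unfolding per_def
proof (intro conjI allI)
  show "0 < m * k" "\<And>I J. ent P I J \<in> Amp nr nc" using assms by (auto intro: per_pos per_Amp)
  fix I J
  have e: "ent P I J = (if I div m = J div m then ent P (I mod m) (J mod m) else 0)" for I J
    using assms(1) by (rule per_ent)
  have 1: "(I mod (m * k)) div m = (I div m) mod k" "(I mod (m * k)) mod m = I mod m"
    "I div (m * k) = (I div m) div k" for I
    using assms(2) per_pos[OF assms(1)] by (simp_all add: mod_mult2_eq div_mult2_eq)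
  have "I div m = J div m" if "(I div m) mod k = (J div m) mod k" "(I div m) div k = (J div m) div k"
    using that by (metis div_mult_mod_eq)
  then show "ent P I J = (if I div (m * k) = J div (m * k) then ent P (I mod (m * k)) (J mod (m * k)) else 0)"
    unfolding e[of I J] e[of "I mod (m * k)"] 1 by auto
qed

lemma per_add: "per nr nc m P \<Longrightarrow> per nr nc m Q \<Longrightarrow> per nr nc m (P + Q)"
  unfolding per_iff_amp2 by (metis amp2_add add_carrier_mat)

lemma per_diff: "per nr nc m P \<Longrightarrow> per nr nc m Q \<Longrightarrow> per nr nc m (P - Q)"
  unfolding per_iff_amp2 by (metis amp2_diff minus_carrier_mat)

lemma per_mult: "per nr nk m P \<Longrightarrow> per nk nc m Q \<Longrightarrow> per nr nc m (P * Q)"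
  unfolding per_iff_amp2 by (metis amp2_mult mult_carrier_mat)

lemma per_scal: "per nr nc m P \<Longrightarrow> per nr nc m (dg (dg c) * P)"
  unfolding per_iff_amp2 by (metis amp2_smult smult_carrier_mat)

lemma per_zero: "0 < m \<Longrightarrow> per nr nc m 0"
  using per_amp2[of m nr nc "0\<^sub>m (nr * m) (nc * m)"] by simp

lemma per_one: "0 < m \<Longrightarrow> 0 < n \<Longrightarrow> per n n m 1"
  using per_amp2[of m n n "1\<^sub>m (n * m)"] by (simp add: amp2_one)

lemma per_dg: "x \<in> Amp nr nc \<Longrightarrow> per nr nc 1 (dg x)"
  by (simp add: per_def ent_dg Amp_closed)

text \<open>Since the index sets of the two blocks are interleaved, a window of \<open>2 * m\<close>
  indices consists of one window of \<open>m\<close> indices from each. This is why a block matrix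
  of periodic elements is periodic again.\<close>

lemma per_blk:
  assumes "per nr nc m a" "per nr nc m b" "per nr nc m c" "per nr nc m e"
  shows "per nr nc (2 * m) (blk a b c e)"
  unfolding per_def
proof (intro conjI allI)
  show "0 < 2 * m" using per_pos[OF assms(1)] by simp
  show "ent (blk a b c e) I J \<in> Amp nr nc" for I J using assms by (simp add: per_Amp ent_blk)
  fix I J :: nat
  let ?p = "if even I then if even J then a else b else if even J then c else e"
  have p: "per nr nc m ?p" using assms by simp
  have 1: "even (I mod (2 * m)) = even I" "(I mod (2 * m)) div 2 = (I div 2) mod m"
    "I div (2 * m) = (I div 2) div m" for I
    by (simp_all add: mod_mult2_eq div_mult2_eq)
  have e: "ent ?p (I div 2) (J div 2) = (if (I div 2) div m = (J div 2) div m then ent ?p (I div 2 mod m) (J div 2 mod m) else 0)"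
    using p by (rule per_ent)
  show "ent (blk a b c e) I J = (if I div (2 * m) = J div (2 * m)
     then ent (blk a b c e) (I mod (2 * m)) (J mod (2 * m)) else 0)"
    unfolding ent_blk 1 by (rule e)
qed

lemma Fin_common:
  assumes "Fin nr nc P" "Fin nr' nc' Q"
  obtains m where "per nr nc m P" "per nr' nc' m Q"
proof -
  obtain m m' where *: "per nr nc m P" "per nr' nc' m' Q" using assms unfolding Fin_def by blast
  then have "0 < m" "0 < m'" by (auto intro: per_pos)
  then have "per nr nc (m * m') P" "per nr' nc' (m * m') Q"
    using per_mono[OF *(1), of m'] per_mono[OF *(2), of m] by (auto simp: mult.commute)
  then show ?thesis using that by blast
qed

lemma Fin_family:
  assumes "\<And>k. k < (d::nat) \<Longrightarrow> Fin nr nc (P k)"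
  obtains m where "0 < m" "\<And>k. k < d \<Longrightarrow> per nr nc m (P k)"
proof -
  have "\<exists>m>0. \<forall>k<d. per nr nc m (P k)" using assms
  proof (induction d)
    case (Suc d)
    then obtain m where m: "0 < m" "\<forall>k<d. per nr nc m (P k)" by auto
    obtain m' where m': "per nr nc m' (P d)" using Suc.prems unfolding Fin_def by blast
    then have "0 < m'" by (rule per_pos)
    have "per nr nc (m * m') (P k)" if "k < Suc d" for k
    proof (cases "k < d")
      case True
      then show ?thesis using m per_mono \<open>0 < m'\<close> by blast
    next
      case False
      then show ?thesis using that m' per_mono[OF m', of m] m(1) by (simp add: less_Suc_eq mult.commute)
    qed
    then show ?case using m \<open>0 < m'\<close> by (intro exI[of _ "m * m'"]) auto
  qed auto
  then show ?thesis using that by blast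
qed

lemma Fin_add: "Fin nr nc P \<Longrightarrow> Fin nr nc Q \<Longrightarrow> Fin nr nc (P + Q)"
  by (metis Fin_common Fin_def per_add)
lemma Fin_diff: "Fin nr nc P \<Longrightarrow> Fin nr nc Q \<Longrightarrow> Fin nr nc (P - Q)"
  by (metis Fin_common Fin_def per_diff)
lemma Fin_mult: "Fin nr nk P \<Longrightarrow> Fin nk nc Q \<Longrightarrow> Fin nr nc (P * Q)"
  by (metis Fin_common Fin_def per_mult)
lemma Fin_scal: "Fin nr nc P \<Longrightarrow> Fin nr nc (dg (dg c) * P)"
  by (metis Fin_def per_scal)
lemma Fin_zero: "Fin nr nc 0" unfolding Fin_def by (rule exI[of _ 1]) (rule per_zero, simp)
lemma Fin_one: "0 < n \<Longrightarrow> Fin n n 1" by (metis Fin_def per_one zero_less_one)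
lemma Fin_dg: "x \<in> Amp nr nc \<Longrightarrow> Fin nr nc (dg x)" by (metis Fin_def per_dg)
lemma Fin_uminus: "Fin nr nc P \<Longrightarrow> Fin nr nc (- P)" using Fin_diff[OF Fin_zero, of nr nc P] by simp
lemma Fin_sum: "(\<And>x. x \<in> S \<Longrightarrow> Fin nr nc (f x)) \<Longrightarrow> Fin nr nc (sum f S)"
  by (induction S rule: infinite_finite_induct) (auto intro: Fin_add Fin_zero)
lemma Fin_blk:
  assumes "Fin nr nc a" "Fin nr nc b" "Fin nr nc c" "Fin nr nc e"
  shows "Fin nr nc (blk a b c e)"
proof -
  obtain m where "0 < m" and m: "\<And>k. k < 4 \<Longrightarrow> per nr nc m ([a, b, c, e] ! k)"
    by (rule Fin_family[of 4 nr nc "\<lambda>k. [a, b, c, e] ! k"]) (use assms in \<open>auto simp: less_Suc_eq numeral_eq_Suc\<close>)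
  from m[of 0] m[of 1] m[of 2] m[of 3] have "per nr nc (2 * m) (blk a b c e)" by (intro per_blk) auto
  then show ?thesis unfolding Fin_def by blast
qed

lemma Fin_ent: "Fin nr nc P \<Longrightarrow> ent P I J \<in> Amp nr nc" by (auto simp: Fin_def intro: per_Amp)

subsection \<open>Inverses of periodic elements\<close>

lemma dg2_central: "dg (dg c) * P = P * dg (dg (c :: 'b::comm_ring_1))"
  by (intro dg_central mult.commute)

text \<open>A kernel vector is repeated in every column, so that singularity is witnessed by a
  square matrix, whose ampliation lies in the same ring.\<close>

lemma mat_kernel_square:
  fixes X :: "'a::field mat"
  assumes X: "X \<in> carrier_mat N N" and "det X = 0"
  obtains V where "V \<in> carrier_mat N N" "X * V = 0\<^sub>m N N" "V \<noteq> 0\<^sub>m N N"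
proof -
  obtain v where v: "v \<in> carrier_vec N" "v \<noteq> 0\<^sub>v N" "X *\<^sub>v v = 0\<^sub>v N"
    using det_0_iff_vec_prod_zero_field[OF X] assms(2) by blast
  let ?V = "mat N N (\<lambda>(i, j). v $ i)"
  have "X * ?V = 0\<^sub>m N N"
  proof (rule eq_matI)
    fix i j assume ij: "i < dim_row (0\<^sub>m N N :: 'a mat)" "j < dim_col (0\<^sub>m N N :: 'a mat)"
    have "col ?V j = v" using ij v by (intro eq_vecI) auto
    then have "(X * ?V) $$ (i, j) = (X *\<^sub>v v) $ i" using ij X by simp
    then show "(X * ?V) $$ (i, j) = 0\<^sub>m N N $$ (i, j)" using v ij by simp
  qed (use X in auto)
  moreover have "?V \<noteq> 0\<^sub>m N N"
  proof
    assume h: "?V = 0\<^sub>m N N"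
    have "v $ i = 0" if "i < N" for i
      using arg_cong[OF h, of "\<lambda>M. M $$ (i, i)"] that by simp
    then have "v = 0\<^sub>v N" using v(1) by (intro eq_vecI) auto
    then show False using v by simp
  qed
  ultimately show ?thesis using that by (metis mat_carrier)
qed

lemma det_nonzero_inverse:
  fixes X :: "'a::field mat"
  assumes X: "X \<in> carrier_mat N N" and "det X \<noteq> 0"
  obtains W where "W \<in> carrier_mat N N" "X * W = 1\<^sub>m N" "W * X = 1\<^sub>m N" "mat_inverse X = Some W"
proof -
  have "X \<in> Units (ring_mat TYPE('a) N ())" using det_non_zero_imp_unit[OF assms] .
  then have "mat_inverse X \<noteq> None" using mat_inverse(1)[OF X, of "()"] by blast
  then obtain W where "mat_inverse X = Some W" by blast
  then show ?thesis using mat_inverse(2)[OF X] that by blast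
qed

lemma mat_inverse_None_det:
  fixes X :: "'a::field mat"
  assumes X: "X \<in> carrier_mat N N" "mat_inverse X = None" shows "det X = 0"
  by (metis assms det_nonzero_inverse option.distinct(1))

lemma amp2_det_nonzero:
  fixes X :: "'a::field mat"
  assumes X: "X \<in> carrier_mat (n * m) (n * m)" and m: "0 < m"
    and inj: "\<And>v. Fin n n v \<Longrightarrow> amp2 n n m X * v = 0 \<Longrightarrow> v = 0"
  shows "det X \<noteq> 0"
proof
  assume "det X = 0"
  then obtain V where V: "V \<in> carrier_mat (n * m) (n * m)" "X * V = 0\<^sub>m (n * m) (n * m)" "V \<noteq> 0\<^sub>m (n * m) (n * m)"
    using mat_kernel_square[OF X] by blast
  have "amp2 n n m X * amp2 n n m V = 0" using amp2_mult[OF X V(1)] V(2) by simp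
  then have "amp2 n n m V = amp2 n n m (0\<^sub>m (n * m) (n * m))"
    using inj[of "amp2 n n m V"] per_amp2[OF m] unfolding Fin_def by auto
  then show False using amp2_inj[OF m V(1), of "0\<^sub>m (n * m) (n * m)"] V(3) by simp
qed

lemma left_inverse_det_nonzero:
  fixes X :: "'a::field mat"
  assumes "X \<in> carrier_mat (n * m) (n * m)" "0 < m" and W: "W * amp2 n n m X = 1"
  shows "det X \<noteq> 0"
proof (rule amp2_det_nonzero)
  fix v assume "amp2 n n m X * v = 0"
  then have "W * amp2 n n m X * v = 0" by (simp add: mult.assoc)
  then show "v = 0" using W by simp
qed (use assms in auto)

lemma det_nonzero_unit:
  fixes X :: "'a::field mat"
  assumes "X \<in> carrier_mat (n * m) (n * m)" "0 < m" "0 < n" "det X \<noteq> 0"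
  obtains W where "W \<in> carrier_mat (n * m) (n * m)" "mat_inverse X = Some W"
    "amp2 n n m X * amp2 n n m W = 1" "amp2 n n m W * amp2 n n m X = 1"
proof -
  obtain W where W: "W \<in> carrier_mat (n * m) (n * m)" "X * W = 1\<^sub>m (n * m)" "W * X = 1\<^sub>m (n * m)" "mat_inverse X = Some W"
    using det_nonzero_inverse[OF assms(1,4)] by blast
  then have "amp2 n n m X * amp2 n n m W = 1" "amp2 n n m W * amp2 n n m X = 1"
    unfolding amp2_mult[OF assms(1) W(1), symmetric] amp2_mult[OF W(1) assms(1), symmetric] W(2,3)
      amp2_one[OF assms(3,2)] by simp_all
  then show ?thesis using that W by blast
qed

lemma Fin_inj_imp_unit:
  fixes P :: "'a::field rfmat rfmat"
  assumes P: "Fin n n P" "0 < n" and inj: "\<And>v. Fin n n v \<Longrightarrow> P * v = 0 \<Longrightarrow> v = 0"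
  obtains W where "Fin n n W" "P * W = 1" "W * P = 1"
proof -
  obtain m X where m: "0 < m" and X: "X \<in> carrier_mat (n * m) (n * m)" "P = amp2 n n m X"
    using P unfolding Fin_def per_iff_amp2 by blast
  have "det X \<noteq> 0" using amp2_det_nonzero[OF X(1) m] inj X(2) by blast
  then obtain W where "W \<in> carrier_mat (n * m) (n * m)"
    "amp2 n n m X * amp2 n n m W = 1" "amp2 n n m W * amp2 n n m X = 1"
    using det_nonzero_unit[OF X(1) m P(2)] by blast
  moreover have "Fin n n (amp2 n n m W)" using per_amp2[OF m] unfolding Fin_def by blast
  ultimately show ?thesis using that X(2) by blast
qed

text \<open>\<open>W\<close> is any row-finite matrix, and in that ring one-sided inverses need not
  be two-sided. It makes \<open>P\<close> injective, hence a matrix of finite size invertible; the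
  periodic inverse found there must equal \<open>W\<close>.\<close>

lemma Fin_left_inverse:
  fixes P :: "'a::field rfmat rfmat"
  assumes P: "Fin n n P" "0 < n" and W: "W * P = 1"
  shows "Fin n n W" "P * W = 1"
proof -
  have "v = 0" if "P * v = 0" for v
  proof -
    have "W * P * v = 0" using that by (simp add: mult.assoc)
    then show ?thesis using W by simp
  qed
  then obtain W' where W': "Fin n n W'" "P * W' = 1" using Fin_inj_imp_unit[OF P] by metis
  have "W = W * (P * W')" using W' by simp
  also have "\<dots> = W'" using W by (simp flip: mult.assoc)
  finally have "W = W'" .
  then show "Fin n n W" "P * W = 1" using W' by auto
qed

lemma Fin_adjugate:
  fixes P :: "'b::comm_ring_1 rfmat rfmat"
  assumes "Fin n n P" "0 < n"
  obtains m X N where "0 < m" "X \<in> carrier_mat (n * m) (n * m)" "P = amp2 n n m X"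
    "Fin n n N" "P * N = dg (dg (det X))" "N * P = dg (dg (det X))"
proof -
  obtain m X where m: "0 < m" and X: "X \<in> carrier_mat (n * m) (n * m)" "P = amp2 n n m X"
    using assms unfolding Fin_def per_iff_amp2 by blast
  let ?N = "amp2 n n m (adj_mat X)"
  note a = adj_mat[OF X(1)]
  have "P * ?N = dg (dg (det X))" "?N * P = dg (dg (det X))"
    unfolding X(2) amp2_mult[OF X(1) a(1), symmetric] amp2_mult[OF a(1) X(1), symmetric] a(2,3)
    by (simp_all add: amp2_smult amp2_one m assms(2))
  then show ?thesis using that[OF m X] per_amp2[OF m] unfolding Fin_def by blast
qed

text \<open>Cayley-Hamilton through the adjugate of \<open>t - X\<close>: its coefficients in
  \<open>t\<close> satisfy a recursion that telescopes to \<open>\<chi>(P) = 0\<close>. The constant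
  coefficient of \<open>\<chi>\<close> is the determinant of \<open>X\<close> up to sign, so
  multiplication by \<open>W\<close> and a division express \<open>W\<close> by powers of
  \<open>P\<close>.\<close>

lemma cayley_hamilton_inverse:
  fixes P W :: "'a::field rfmat rfmat"
  assumes P: "Fin n n P" "0 < n" and W: "W * P = 1"
  obtains K c where "W = (\<Sum>k<K. dg (dg (c k)) * P ^ k)"
proof -
  obtain m X where m: "0 < m" and X: "X \<in> carrier_mat (n * m) (n * m)" "P = amp2 n n m X"
    using P unfolding Fin_def per_iff_amp2 by blast
  let ?N = "n * m"
  let ?T = "mat ?N ?N (\<lambda>(i, j). (if i = j then [:0, 1:] else 0) - [:X $$ (i, j):])"
  have T: "?T \<in> carrier_mat ?N ?N" by simp
  define \<chi> where "\<chi> = det ?T"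
  define B where "B = adj_mat ?T"
  note a = adj_mat[OF T, folded B_def \<chi>_def]
  have "det X \<noteq> 0" using left_inverse_det_nonzero[OF X(1) m] W X(2) by simp
  have "poly \<chi> 0 = det (map_mat (\<lambda>p. poly p 0) ?T)" unfolding \<chi>_def by (rule comm_ring_hom.hom_det[OF poly_hom.comm_ring_hom_axioms, symmetric])
  also have "map_mat (\<lambda>p. poly p 0) ?T = (-1) \<cdot>\<^sub>m X" using X(1) by (intro eq_matI) auto
  also have "det \<dots> = (-1) ^ ?N * det X" using X(1) by simp
  finally have \<chi>0: "coeff \<chi> 0 \<noteq> 0" using \<open>det X \<noteq> 0\<close> by (simp add: poly_0_coeff_0)
  \<comment> \<open>\<open>E k\<close> is the coefficient of \<open>t^k\<close> in the adjugate. The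
    sequence \<open>e\<close> is its ampliation shifted by one, with \<open>e 0 = 0\<close> in place
    of a coefficient of index -1.\<close>
  define E where "E k = mat ?N ?N (\<lambda>(i, j). coeff (B $$ (i, j)) k)" for k
  define e where "e k = (case k of 0 \<Rightarrow> 0 | Suc k \<Rightarrow> amp2 n n m (E k))" for k
  have E: "E k \<in> carrier_mat ?N ?N" for k by (simp add: E_def)
  have ent: "(\<Sum>l<?N. ?T $$ (i, l) * B $$ (l, j)) = (if i = j then \<chi> else 0)" if "i < ?N" "j < ?N" for i j
  proof -
    have "(?T * B) $$ (i, j) = (\<chi> \<cdot>\<^sub>m 1\<^sub>m ?N) $$ (i, j)" using a(2) by simp
    then show ?thesis using that a(1) by (simp add: scalar_prod_def atLeast0LessThan)
  qed
  have rel: "(if k = 0 then 0\<^sub>m ?N ?N else E (k - 1)) - X * E k = coeff \<chi> k \<cdot>\<^sub>m 1\<^sub>m ?N" for k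
  proof (rule eq_matI)
    fix i j assume "i < dim_row (coeff \<chi> k \<cdot>\<^sub>m 1\<^sub>m ?N)" "j < dim_col (coeff \<chi> k \<cdot>\<^sub>m 1\<^sub>m ?N)"
    then have ij: "i < ?N" "j < ?N" by auto
    have "(\<Sum>l<?N. ?T $$ (i, l) * B $$ (l, j)) = (\<Sum>l<?N. (if i = l then [:0, 1:] * B $$ (l, j) else 0) - [:X $$ (i, l):] * B $$ (l, j))"
      by (rule sum.cong) (use ij in \<open>auto simp: left_diff_distrib\<close>)
    also have "\<dots> = [:0, 1:] * B $$ (i, j) - (\<Sum>l<?N. smult (X $$ (i, l)) (B $$ (l, j)))"
      using ij by (simp add: sum_subtractf)
    finally have "coeff ([:0, 1:] * B $$ (i, j) - (\<Sum>l<?N. smult (X $$ (i, l)) (B $$ (l, j)))) k = coeff (if i = j then \<chi> else 0) k"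
      using ent[OF ij] by simp
    then have "(if k = 0 then 0 else coeff (B $$ (i, j)) (k - 1)) - (\<Sum>l<?N. X $$ (i, l) * coeff (B $$ (l, j)) k) = (if i = j then coeff \<chi> k else 0)"
      by (simp add: coeff_sum coeff_pCons split: nat.splits if_splits)
    then show "((if k = 0 then 0\<^sub>m ?N ?N else E (k - 1)) - X * E k) $$ (i, j) = (coeff \<chi> k \<cdot>\<^sub>m 1\<^sub>m ?N) $$ (i, j)"
      using ij X(1) by (auto simp: scalar_prod_def E_def atLeast0LessThan)
  qed (use X(1) E in \<open>auto split: if_splits\<close>)
  have rel': "e k - P * e (Suc k) = dg (dg (coeff \<chi> k))" for k
  proof -
    have "amp2 n n m ((if k = 0 then 0\<^sub>m ?N ?N else E (k - 1)) - X * E k) = e k - P * e (Suc k)"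
      using X E by (subst amp2_diff) (auto simp: amp2_mult e_def X(2) split: nat.splits)
    moreover have "amp2 n n m (coeff \<chi> k \<cdot>\<^sub>m 1\<^sub>m ?N) = dg (dg (coeff \<chi> k))"
      by (simp add: amp2_smult amp2_one m P(2))
    ultimately show ?thesis using rel[of k] by simp
  qed
  have tel: "(\<Sum>k<K. P ^ k * dg (dg (coeff \<chi> k))) = - (P ^ K * e K)" for K
  proof (induction K)
    case (Suc K)
    have "P ^ K * dg (dg (coeff \<chi> K)) = P ^ K * e K - P ^ Suc K * e (Suc K)"
      unfolding rel'[symmetric] by (simp add: right_diff_distrib mult.assoc power_Suc2 del: power_Suc)
    then show ?case using Suc by simp
  qed (simp add: e_def)
  \<comment> \<open>Larger than the degree of every entry of the adjugate, so that
    \<open>E K = 0\<close> and the remainder of the telescoping sum vanishes.\<close>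
  define K where "K = Suc (\<Sum>i<?N. \<Sum>j<?N. degree (B $$ (i, j)))"
  have "E K = 0\<^sub>m ?N ?N"
  proof (rule eq_matI)
    fix i j assume ij: "i < dim_row (0\<^sub>m ?N ?N :: 'a mat)" "j < dim_col (0\<^sub>m ?N ?N :: 'a mat)"
    have "degree (B $$ (i, j)) \<le> (\<Sum>j<?N. degree (B $$ (i, j)))" 
      by (rule member_le_sum) (use ij in auto)
    also have "\<dots> \<le> (\<Sum>i<?N. \<Sum>j<?N. degree (B $$ (i, j)))"
      by (rule member_le_sum[where f = "\<lambda>i. \<Sum>j<?N. degree (B $$ (i, j))"]) (use ij in auto)
    finally have "degree (B $$ (i, j)) < K" unfolding K_def by simp
    then show "E K $$ (i, j) = 0\<^sub>m ?N ?N $$ (i, j)" using ij by (simp add: E_def coeff_eq_0)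
  qed (auto simp: E_def)
  then have "e (Suc K) = 0" by (simp add: e_def)
  then have z: "(\<Sum>k<Suc K. P ^ k * dg (dg (coeff \<chi> k))) = 0" using tel[of "Suc K"] by simp
  have "0 = W * (\<Sum>k<Suc K. P ^ k * dg (dg (coeff \<chi> k)))" using z by simp
  also have "\<dots> = W * dg (dg (coeff \<chi> 0)) + (\<Sum>k<K. W * (P ^ Suc k * dg (dg (coeff \<chi> (Suc k)))))"
    by (subst sum.lessThan_Suc_shift) (simp add: distrib_left sum_distrib_left)
  also have "(\<Sum>k<K. W * (P ^ Suc k * dg (dg (coeff \<chi> (Suc k))))) = (\<Sum>k<K. dg (dg (coeff \<chi> (Suc k))) * P ^ k)"
    using W by (intro sum.cong) (simp_all add: dg2_central flip: mult.assoc)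
  finally have "W * dg (dg (coeff \<chi> 0)) = - (\<Sum>k<K. dg (dg (coeff \<chi> (Suc k))) * P ^ k)"
    by (simp add: eq_neg_iff_add_eq_0)
  then have "W * dg (dg (coeff \<chi> 0)) * dg (dg (- inverse (coeff \<chi> 0))) =
      dg (dg (- inverse (coeff \<chi> 0))) * - (\<Sum>k<K. dg (dg (coeff \<chi> (Suc k))) * P ^ k)"
    by (simp only: dg2_central)
  moreover have "dg (dg (coeff \<chi> 0)) * dg (dg (- inverse (coeff \<chi> 0))) = - (1 :: 'a rfmat rfmat)"
    using \<chi>0 by (simp flip: dg_mult)
  ultimately have "W = (\<Sum>k<K. dg (dg (- inverse (coeff \<chi> 0) * coeff \<chi> (Suc k))) * P ^ k)"
    by (simp add: mult.assoc sum_distrib_left sum_negf minus_equation_iff[of W] eq_commute[of W])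
  then show ?thesis using that[of "\<lambda>k. - inverse (coeff \<chi> 0) * coeff \<chi> (Suc k)" K] by blast
qed

subsection \<open>Comparison with the evaluation at matrices\<close>

text \<open>The properties shared by the three ways in which \<open>n\<close> by \<open>n\<close>
  matrices enter the rings: \<open>amp\<close>, \<open>amp2\<close>, and \<open>amp2\<close> applied
  to \<open>I \<otimes> X\<close>. They suffice to pass between \<open>nc_eval\<close> and
  \<open>ev\<close>.\<close>

locale mat_emb =
  fixes n :: nat and \<theta> :: "'a::field mat \<Rightarrow> 'r::ring_1" and \<kappa> :: "'a \<Rightarrow> 'r"
  assumes emb_add: "X \<in> carrier_mat n n \<Longrightarrow> Y \<in> carrier_mat n n \<Longrightarrow> \<theta> (X + Y) = \<theta> X + \<theta> Y"
    and emb_mult: "X \<in> carrier_mat n n \<Longrightarrow> Y \<in> carrier_mat n n \<Longrightarrow> \<theta> (X * Y) = \<theta> X * \<theta> Y"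
    and emb_scal: "\<theta> (c \<cdot>\<^sub>m 1\<^sub>m n) = \<kappa> c" and emb_one: "\<kappa> 1 = 1"
    and emb_inj: "X \<in> carrier_mat n n \<Longrightarrow> Y \<in> carrier_mat n n \<Longrightarrow> \<theta> X = \<theta> Y \<Longrightarrow> X = Y"
begin

lemma emb_1: "\<theta> (1\<^sub>m n) = 1"
proof -
  have "1 \<cdot>\<^sub>m 1\<^sub>m n = (1\<^sub>m n :: 'a mat)" by (rule eq_matI) auto
  then show ?thesis using emb_scal[of 1] emb_one by simp
qed

lemma emb_0: "\<theta> (0\<^sub>m n n) = 0"
  using emb_add[of "0\<^sub>m n n" "0\<^sub>m n n"] by simp

lemma nc_eval_imp_ev:
  assumes X: "X \<in> mat_tuples d n"
  shows "nc_vars R \<subseteq> {..<d} \<Longrightarrow> nc_eval n X R = Some V \<Longrightarrow> V \<in> carrier_mat n n \<and> ev \<kappa> (\<lambda>k. \<theta> (X ! k)) R (\<theta> V)"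
proof (induction R arbitrary: V)
  case (Const c)
  then show ?case by (auto simp: emb_scal)
next
  case (Var k)
  then show ?case using X by (auto simp: mat_tuples_def)
next
  case (Add R S)
  then obtain M N where "nc_eval n X R = Some M" "nc_eval n X S = Some N" "V = M + N"
    by (auto simp: bind_eq_Some_conv)
  with Add show ?case by (auto simp: emb_add)
next
  case (Mul R S)
  then obtain M N where "nc_eval n X R = Some M" "nc_eval n X S = Some N" "V = M * N"
    by (auto simp: bind_eq_Some_conv)
  with Mul show ?case by (auto simp: emb_mult)
next
  case (Inv R)
  then obtain M where M: "nc_eval n X R = Some M" "mat_inverse M = Some V"
    by (auto simp: bind_eq_Some_conv)
  with Inv have "M \<in> carrier_mat n n" "ev \<kappa> (\<lambda>k. \<theta> (X ! k)) R (\<theta> M)" by auto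
  moreover from mat_inverse(2)[OF this(1) M(2)] have "V \<in> carrier_mat n n" "M * V = 1\<^sub>m n" "V * M = 1\<^sub>m n" by auto
  ultimately show ?case by (auto simp: emb_1 simp flip: emb_mult)
qed

lemma ev_imp_nc_eval:
  assumes X: "X \<in> mat_tuples d n"
  shows "nc_vars R \<subseteq> {..<d} \<Longrightarrow> ev \<kappa> (\<lambda>k. \<theta> (X ! k)) R W \<Longrightarrow> \<exists>V. nc_eval n X R = Some V"
proof (induction R arbitrary: W)
  case (Inv R)
  then obtain M' where M': "ev \<kappa> (\<lambda>k. \<theta> (X ! k)) R M'" "M' * W = 1" "W * M' = 1" by auto
  with Inv obtain M where M: "nc_eval n X R = Some M" by auto
  with nc_eval_imp_ev[OF X] Inv.prems have Mc: "M \<in> carrier_mat n n" "ev \<kappa> (\<lambda>k. \<theta> (X ! k)) R (\<theta> M)" by auto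
  then have M'M: "M' = \<theta> M" using M'(1) ev_unique by blast
  \<comment> \<open>An inverse in the large ring annihilates the kernel of \<open>M\<close>, which
    brings invertibility back to matrices.\<close>
  have "mat_inverse M \<noteq> None"
  proof
    assume "mat_inverse M = None"
    then have "det M = 0" using mat_inverse_None_det Mc(1) by blast
    then obtain V where V: "V \<in> carrier_mat n n" "M * V = 0\<^sub>m n n" "V \<noteq> 0\<^sub>m n n"
      using mat_kernel_square[OF Mc(1)] by blast
    have "\<theta> M * \<theta> V = 0" using emb_mult[OF Mc(1) V(1)] V(2) emb_0 by simp
    then have "W * M' * \<theta> V = 0" using M'M by (simp add: mult.assoc)
    then have "\<theta> V = \<theta> (0\<^sub>m n n)" using M'(3) emb_0 by simp
    then show False using emb_inj V by auto
  qed
  then show ?case using M by auto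
next
  case (Add R S)
  then have "\<exists>V. nc_eval n X R = Some V" "\<exists>V. nc_eval n X S = Some V" by auto
  then show ?case by auto
next
  case (Mul R S)
  then have "\<exists>V. nc_eval n X R = Some V" "\<exists>V. nc_eval n X S = Some V" by auto
  then show ?case by auto
qed auto

end

subsection \<open>Realizations in rings of matrices\<close>

lemma dg_mult_blk [simp]: "dg x * blk a b c e = blk (dg x * a) (dg x * b) (dg x * c) (dg x * e)"
  by (subst dg_blk) simp

lemma blk_mult_dg [simp]: "blk a b c e * dg x = blk (a * dg x) (b * dg x) (c * dg x) (e * dg x)"
  by (subst dg_blk) simp

lemma dg_plus_blk [simp]: "dg x + blk a b c e = blk (dg x + a) b c (dg x + e)"
  by (subst dg_blk) simp

lemma blk_minus_dg [simp]: "blk a b c e - dg x = blk (a - dg x) b c (e - dg x)"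
  by (subst dg_blk) simp

lemma one_minus_blk [simp]: "1 - blk a b c e = blk (1 - a) (- b) (- c) (1 - e)"
  by (subst one_blk) simp

text \<open>The data of a realization with each \<open>s * s\<close> block, as well as \<open>C\<close> and \<open>D\<close>, replaced by an element of a
  ring; points are row-finite matrices over that ring.\<close>
locale fm_ring =
  fixes d :: nat and a b :: "nat \<Rightarrow> 'q::ring_1 \<Rightarrow> 'q" and c d0 :: 'q and y :: "nat \<Rightarrow> 'q"
  assumes a_add: "a k (x + z) = a k x + a k z" and b_add: "b k (x + z) = b k x + b k z"
begin

lemma a_zero [simp]: "a k 0 = 0" using a_add[of k 0 0] by simp
lemma b_zero [simp]: "b k 0 = 0" using b_add[of k 0 0] by simp
lemma a_diff: "a k (x - z) = a k x - a k z" using a_add[of k "x - z" z] by simp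
lemma b_diff: "b k (x - z) = b k x - b k z" using b_add[of k "x - z" z] by simp
lemma a_sum: "a k (sum f S) = (\<Sum>x\<in>S. a k (f x))"
  by (induction S rule: infinite_finite_induct) (auto simp: a_add)
lemma b_sum: "b k (sum f S) = (\<Sum>x\<in>S. b k (f x))"
  by (induction S rule: infinite_finite_induct) (auto simp: b_add)

definition "AS \<delta> = (\<Sum>k<d. rmap (a k) (\<delta> k))"
definition "BS \<delta> = (\<Sum>k<d. rmap (b k) (\<delta> k))"
definition "dl P k = P k - dg (y k)"
definition "Lam P = 1 - AS (dl P)"

lemma ent_AS: "ent (AS \<delta>) I J = (\<Sum>k<d. a k (ent (\<delta> k) I J))"
  by (simp add: AS_def ent_rmap)
lemma ent_BS: "ent (BS \<delta>) I J = (\<Sum>k<d. b k (ent (\<delta> k) I J))"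
  by (simp add: BS_def ent_rmap)

lemma AS_add: "AS (\<lambda>k. f k + g k) = AS f + AS g"
  by (rule rfmat_eqI) (simp add: ent_AS a_add sum.distrib)
lemma BS_add: "BS (\<lambda>k. f k + g k) = BS f + BS g"
  by (rule rfmat_eqI) (simp add: ent_BS b_add sum.distrib)
lemma AS_diff: "AS (\<lambda>k. f k - g k) = AS f - AS g"
  by (rule rfmat_eqI) (simp add: ent_AS a_diff sum_subtractf)
lemma BS_diff: "BS (\<lambda>k. f k - g k) = BS f - BS g"
  by (rule rfmat_eqI) (simp add: ent_BS b_diff sum_subtractf)
lemma AS_zero [simp]: "AS (\<lambda>k. 0) = 0"
  by (rule rfmat_eqI) (simp add: ent_AS)
lemma BS_zero [simp]: "BS (\<lambda>k. 0) = 0"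
  by (rule rfmat_eqI) (simp add: ent_BS)
lemma AS_minus: "AS (\<lambda>k. - f k) = - AS f" using AS_diff[of "\<lambda>_. 0" f] by simp
lemma BS_minus: "BS (\<lambda>k. - f k) = - BS f" using BS_diff[of "\<lambda>_. 0" f] by simp
lemma AS_cong: "(\<And>k. k < d \<Longrightarrow> f k = g k) \<Longrightarrow> AS f = AS g" by (simp add: AS_def)
lemma BS_cong: "(\<And>k. k < d \<Longrightarrow> f k = g k) \<Longrightarrow> BS f = BS g" by (simp add: BS_def)

lemma AS_single: "k < d \<Longrightarrow> AS (\<lambda>i. if i = k then x else 0) = rmap (a k) x"
  by (rule rfmat_eqI) (simp add: ent_AS ent_rmap if_distrib[of "\<lambda>x. ent x _ _"] if_distrib[of "a _"] cong: if_cong)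
lemma BS_single: "k < d \<Longrightarrow> BS (\<lambda>i. if i = k then x else 0) = rmap (b k) x"
  by (rule rfmat_eqI) (simp add: ent_BS ent_rmap if_distrib[of "\<lambda>x. ent x _ _"] if_distrib[of "b _"] cong: if_cong)

lemma AS_blk: "AS (\<lambda>k. blk (p k) (q k) (u k) (v k)) = blk (AS p) (AS q) (AS u) (AS v)"
  by (simp add: AS_def rmap_blk blk_sum)
lemma BS_blk: "BS (\<lambda>k. blk (p k) (q k) (u k) (v k)) = blk (BS p) (BS q) (BS u) (BS v)"
  by (simp add: BS_def rmap_blk blk_sum)

lemma dl_blk: "dl (\<lambda>k. blk (p k) (q k) (u k) (v k)) = (\<lambda>k. blk (dl p k) (q k) (u k) (dl v k))"
  by (simp add: dl_def fun_eq_iff)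

lemma Lam_blk: "Lam (\<lambda>k. blk (p k) (q k) (u k) (v k)) = blk (Lam p) (- AS q) (- AS u) (Lam v)"
  by (simp add: Lam_def dl_blk AS_blk)

definition inverses :: "'q rfmat \<Rightarrow> 'q rfmat \<Rightarrow> bool" where
  "inverses x w \<longleftrightarrow> x * w = 1 \<and> w * x = 1"

text \<open>The inverse of the pencil is passed as the argument \<open>W\<close>, since the ring
  offers no inverse function; statements add \<open>inverses (Lam P) W\<close> or
  \<open>reg P W\<close>.\<close>

definition fval :: "(nat \<Rightarrow> 'q rfmat) \<Rightarrow> 'q rfmat \<Rightarrow> 'q rfmat" where
  "fval P W = dg d0 + dg c * W * BS (dl P)"

lemma Lam_fix: "w = W * BS (dl P) \<Longrightarrow> inverses (Lam P) W \<Longrightarrow> AS (dl P) * w + BS (dl P) = w"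
proof -
  assume w: "w = W * BS (dl P)" "inverses (Lam P) W"
  then have "Lam P * w = BS (dl P)" by (simp add: inverses_def flip: mult.assoc)
  then have "w - AS (dl P) * w = BS (dl P)" by (simp add: Lam_def left_diff_distrib)
  then show "AS (dl P) * w + BS (dl P) = w" by (simp add: algebra_simps)
qed

lemma inverses_tri:
  assumes "inverses (Lam U) WU" "inverses (Lam V) WV"
  shows "inverses (Lam (\<lambda>k. blk (U k) (Z k) 0 (V k))) (blk WU (WU * AS Z * WV) 0 WV)"
proof -
  have *: "Lam U * (WU * x) = x" "WU * (Lam U * x) = x" for x
    using assms(1) by (simp_all add: inverses_def flip: mult.assoc)
  have "WV * Lam V = 1" "Lam V * WV = 1" "WU * Lam U = 1" "Lam U * WU = 1" using assms by (simp_all add: inverses_def)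
  then show ?thesis by (simp add: inverses_def Lam_blk * mult.assoc)
qed

text \<open>The upper right block is the difference quotient of the values between \<open>U\<close>
  and \<open>V\<close> in the direction \<open>Z\<close>. Its last factor,
  \<open>AS Z * w + BS Z\<close> with \<open>w\<close> taken at \<open>V\<close>, is the form in
  which controllability will be applied.\<close>

lemma fval_tri:
  "fval (\<lambda>k. blk (U k) (Z k) 0 (V k)) (blk WU (WU * AS Z * WV) 0 WV) =
    blk (fval U WU) (dg c * WU * (AS Z * (WV * BS (dl V)) + BS Z)) 0 (fval V WV)"
  by (simp add: fval_def dl_blk BS_blk distrib_left mult.assoc add.commute)

lemma Lam_center: "Lam (\<lambda>k. dg (y k)) = 1" and BS_center: "BS (dl (\<lambda>k. dg (y k))) = 0"
proof -
  have "dl (\<lambda>k. dg (y k)) = (\<lambda>k. 0)" by (simp add: dl_def fun_eq_iff)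
  then show "Lam (\<lambda>k. dg (y k)) = 1" "BS (dl (\<lambda>k. dg (y k))) = 0" by (simp_all add: Lam_def)
qed

end

text \<open>The lost-abbey conditions over the subset \<open>In\<close>, which stands for the ampliations of \<open>s * s\<close> matrices.\<close>
locale fm_lla = fm_ring d a b c d0 y
  for d and a b :: "nat \<Rightarrow> 'q::ring_1 \<Rightarrow> 'q" and c d0 :: 'q and y :: "nat \<Rightarrow> 'q" +
  fixes In :: "'q set"
  assumes lla1: "S \<in> In \<Longrightarrow> S * d0 - d0 * S = c * (\<Sum>k<d. b k (S * y k - y k * S))"
    and lla2: "S \<in> In \<Longrightarrow> Z \<in> In \<Longrightarrow> i < d \<Longrightarrow>
      S * c * b i Z - c * b i (S * Z) = c * (\<Sum>k<d. a k (S * y k - y k * S)) * b i Z"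
    and lla3: "S \<in> In \<Longrightarrow> Z \<in> In \<Longrightarrow> i < d \<Longrightarrow>
      S * c * a i Z - c * a i (S * Z) = c * (\<Sum>k<d. a k (S * y k - y k * S)) * a i Z"
    and lla4: "S \<in> In \<Longrightarrow> Z \<in> In \<Longrightarrow> i < d \<Longrightarrow>
      b i (Z * S) - b i Z * S = a i Z * (\<Sum>k<d. b k (S * y k - y k * S))"
    and lla5: "S \<in> In \<Longrightarrow> Z \<in> In \<Longrightarrow> Z' \<in> In \<Longrightarrow> i < d \<Longrightarrow> j < d \<Longrightarrow>
      a i (Z * S) * b j Z' - a i Z * b j (S * Z') = a i Z * (\<Sum>k<d. a k (S * y k - y k * S)) * b j Z'"
    and lla6: "S \<in> In \<Longrightarrow> Z \<in> In \<Longrightarrow> Z' \<in> In \<Longrightarrow> i < d \<Longrightarrow> j < d \<Longrightarrow>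
      a i (Z * S) * a j Z' - a i Z * a j (S * Z') = a i Z * (\<Sum>k<d. a k (S * y k - y k * S)) * a j Z'"
    and In_mult: "x \<in> In \<Longrightarrow> z \<in> In \<Longrightarrow> x * z \<in> In" and In_diff: "x \<in> In \<Longrightarrow> z \<in> In \<Longrightarrow> x - z \<in> In"
    and In_zero: "0 \<in> In" and In_y: "k < d \<Longrightarrow> y k \<in> In"
begin

definition "Inn = {P. \<forall>I J. ent P I J \<in> In}"

lemma InnD: "P \<in> Inn \<Longrightarrow> ent P I J \<in> In" by (simp add: Inn_def)

lemma In_add: "x \<in> In \<Longrightarrow> z \<in> In \<Longrightarrow> x + z \<in> In"
  using In_diff[of x "0 - z"] In_diff[OF In_zero, of z] by simp

lemma In_sum: "(\<And>x. x \<in> S \<Longrightarrow> f x \<in> In) \<Longrightarrow> sum f S \<in> In"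
  by (induction S rule: infinite_finite_induct) (auto intro: In_zero In_add)

lemma Inn_closed: "P \<in> Inn \<Longrightarrow> Q \<in> Inn \<Longrightarrow> P * Q \<in> Inn" "P \<in> Inn \<Longrightarrow> Q \<in> Inn \<Longrightarrow> P - Q \<in> Inn"
  "x \<in> In \<Longrightarrow> dg x \<in> Inn"
  by (auto simp: Inn_def times_rfmat.rep_eq ent_dg intro!: In_sum In_mult In_diff In_zero)

abbreviation "br T k \<equiv> T * dg (y k) - dg (y k) * T"

lemma ent_br: "ent (br T k) I J = ent T I J * y k - y k * ent T I J"
  by simp

lemma LLA1: "T \<in> Inn \<Longrightarrow> T * dg d0 - dg d0 * T = dg c * BS (br T)"
  by (rule rfmat_eqI) (simp add: ent_BS lla1 InnD)

text \<open>Entries of \<open>T\<close> and \<open>Z\<close> satisfy the conditions over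
  \<open>In\<close>. As \<open>a i\<close> and \<open>b i\<close> are additive, summation over the
  inner index turns these into one identity of matrices.\<close>

lemma LLA23:
  assumes "T \<in> Inn" "Z \<in> Inn" "i < d"
  shows "T * dg c * rmap (b i) Z = dg c * rmap (b i) (T * Z) + dg c * AS (br T) * rmap (b i) Z"
    and "T * dg c * rmap (a i) Z = dg c * rmap (a i) (T * Z) + dg c * AS (br T) * rmap (a i) Z"
proof -
  let ?F = "\<lambda>I. {K. ent T I K \<noteq> 0}"
  have F: "finite (?F I)" for I by (rule finite_ent)
  have 1: "ent (T * dg c * R) I J = (\<Sum>K\<in>?F I. ent T I K * c * ent R K J)" for R I J
    by (subst ent_times_supp[OF F]) auto
  have 2: "ent (T * Z) I J = (\<Sum>K\<in>?F I. ent T I K * ent Z K J)" for I J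
    by (rule ent_times_supp[OF F]) auto
  have 3: "ent (dg c * AS (br T) * R) I J = (\<Sum>K\<in>?F I. c * ent (AS (br T)) I K * ent R K J)" for R I J
    by (subst ent_times_supp[OF F[of I]]) (auto simp: ent_AS)
  have 4: "ent T I K * c * b i (ent Z K J) = c * b i (ent T I K * ent Z K J) + c * ent (AS (br T)) I K * b i (ent Z K J)"
    "ent T I K * c * a i (ent Z K J) = c * a i (ent T I K * ent Z K J) + c * ent (AS (br T)) I K * a i (ent Z K J)" for I J K
    unfolding ent_AS ent_br lla2[OF InnD[OF assms(1)] InnD[OF assms(2)] assms(3), symmetric]
      lla3[OF InnD[OF assms(1)] InnD[OF assms(2)] assms(3), symmetric] by simp_all
  show "T * dg c * rmap (b i) Z = dg c * rmap (b i) (T * Z) + dg c * AS (br T) * rmap (b i) Z"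
    by (rule rfmat_eqI, unfold ent_add 1 3)
      (simp add: 2 4 ent_rmap b_sum sum_distrib_left sum.distrib)
  show "T * dg c * rmap (a i) Z = dg c * rmap (a i) (T * Z) + dg c * AS (br T) * rmap (a i) Z"
    by (rule rfmat_eqI, unfold ent_add 1 3)
      (simp add: 2 4 ent_rmap a_sum sum_distrib_left sum.distrib)
qed

lemma LLA4:
  assumes "T \<in> Inn" "Z \<in> Inn" "i < d"
  shows "rmap (b i) (Z * T) = rmap (b i) Z * T + rmap (a i) Z * BS (br T)"
proof (rule rfmat_eqI)
  fix I J
  let ?F = "{K. ent Z I K \<noteq> 0}"
  have F: "finite ?F" by (rule finite_ent)
  have 1: "ent (Z * T) I J = (\<Sum>K\<in>?F. ent Z I K * ent T K J)"
    by (rule ent_times_supp[OF F]) auto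
  have 2: "ent (rmap (b i) Z * T) I J = (\<Sum>K\<in>?F. b i (ent Z I K) * ent T K J)"
    by (subst ent_times_supp[OF F]) (auto simp: ent_rmap)
  have 3: "ent (rmap (a i) Z * BS (br T)) I J = (\<Sum>K\<in>?F. a i (ent Z I K) * ent (BS (br T)) K J)"
    by (subst ent_times_supp[OF F]) (auto simp: ent_rmap)
  have 4: "b i (ent Z I K * ent T K J) = b i (ent Z I K) * ent T K J + a i (ent Z I K) * ent (BS (br T)) K J" for K
    unfolding ent_BS ent_br lla4[OF InnD[OF assms(1)] InnD[OF assms(2)] assms(3), symmetric] by simp
  show "ent (rmap (b i) (Z * T)) I J = ent (rmap (b i) Z * T + rmap (a i) Z * BS (br T)) I J"
    unfolding ent_add 2 3 by (simp add: 1 4 ent_rmap b_sum sum.distrib)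
qed

lemma LLA56:
  assumes "T \<in> Inn" "Z \<in> Inn" "Z' \<in> Inn" "i < d" "j < d"
  shows "rmap (a i) (Z * T) * rmap (b j) Z' = rmap (a i) Z * rmap (b j) (T * Z') + rmap (a i) Z * AS (br T) * rmap (b j) Z'"
    and "rmap (a i) (Z * T) * rmap (a j) Z' = rmap (a i) Z * rmap (a j) (T * Z') + rmap (a i) Z * AS (br T) * rmap (a j) Z'"
proof -
  let ?F = "\<lambda>I. {K. ent Z I K \<noteq> 0}"
  \<comment> \<open>The product has two inner indices. This finite set contains every second index
    that can contribute, whatever the first one is, so the two sums can be exchanged.\<close>
  let ?G = "\<lambda>I. \<Union>K\<in>?F I. {M. ent T K M \<noteq> 0}"
  have F: "finite (?F I)" and G: "finite (?G I)" for I using finite_ent by blast+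
  have 0: "ent (Z * T) I J = (\<Sum>K\<in>?F I. ent Z I K * ent T K J)" for I J
    by (rule ent_times_supp[OF F]) auto
  have 1: "ent (rmap (a i) (Z * T) * R) I J = (\<Sum>K\<in>?F I. \<Sum>M\<in>?G I. a i (ent Z I K * ent T K M) * ent R M J)" for R I J
  proof -
    have "ent (rmap (a i) (Z * T) * R) I J = (\<Sum>M\<in>?G I. (\<Sum>K\<in>?F I. a i (ent Z I K * ent T K M)) * ent R M J)"
    proof (subst ent_times_supp[OF G[of I]])
      fix M assume "ent (rmap (a i) (Z * T)) I M \<noteq> 0"
      then have "(\<Sum>K\<in>?F I. a i (ent Z I K * ent T K M)) \<noteq> 0" by (simp add: ent_rmap 0 a_sum)
      then obtain K where "K \<in> ?F I" "a i (ent Z I K * ent T K M) \<noteq> 0" by (rule sum.not_neutral_contains_not_neutral)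
      then show "M \<in> ?G I" by auto
    qed (simp add: ent_rmap 0 a_sum)
    then show ?thesis unfolding sum_distrib_right by (subst sum.swap)
  qed
  have 2: "ent (T * Z') K J = (\<Sum>M\<in>?G I. ent T K M * ent Z' M J)" if "K \<in> ?F I" for I K J
    by (rule ent_times_supp[OF G]) (use that in auto)
  have 3: "ent (AS (br T) * R) K J = (\<Sum>M\<in>?G I. ent (AS (br T)) K M * ent R M J)"
    if "K \<in> ?F I" for R I K J
    by (subst ent_times_supp[OF G[of I]]) (use that in \<open>auto simp: ent_AS\<close>)
  have 4: "ent (rmap (a i) Z * R) I J = (\<Sum>K\<in>?F I. a i (ent Z I K) * ent R K J)" for R I J
    by (subst ent_times_supp[OF F]) (auto simp: ent_rmap)
  have 5: "a i (ent Z I K * ent T K M) * b j (ent Z' M J) = a i (ent Z I K) * b j (ent T K M * ent Z' M J)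
      + a i (ent Z I K) * (ent (AS (br T)) K M * b j (ent Z' M J))"
    "a i (ent Z I K * ent T K M) * a j (ent Z' M J) = a i (ent Z I K) * a j (ent T K M * ent Z' M J)
      + a i (ent Z I K) * (ent (AS (br T)) K M * a j (ent Z' M J))" for I J K M
    unfolding ent_AS ent_br mult.assoc[symmetric] lla5[OF InnD[OF assms(1)] InnD[OF assms(2)] InnD[OF assms(3)] assms(4,5), symmetric]
      lla6[OF InnD[OF assms(1)] InnD[OF assms(2)] InnD[OF assms(3)] assms(4,5), symmetric] by simp_all
  have "ent (rmap (a i) (Z * T) * rmap (b j) Z') I J =
    ent (rmap (a i) Z * (rmap (b j) (T * Z') + AS (br T) * rmap (b j) Z')) I J" for I J
    unfolding 1 4
  proof (rule sum.cong[OF refl])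
    fix K assume K: "K \<in> ?F I"
    show "(\<Sum>M\<in>?G I. a i (ent Z I K * ent T K M) * ent (rmap (b j) Z') M J) =
        a i (ent Z I K) * ent (rmap (b j) (T * Z') + AS (br T) * rmap (b j) Z') K J"
      unfolding ent_add 3[OF K] by (simp add: ent_rmap 2[OF K] b_sum 5 distrib_left sum_distrib_left sum.distrib)
  qed
  then show "rmap (a i) (Z * T) * rmap (b j) Z' = rmap (a i) Z * rmap (b j) (T * Z') + rmap (a i) Z * AS (br T) * rmap (b j) Z'"
    unfolding mult.assoc distrib_left[symmetric] by (rule rfmat_eqI)
  have "ent (rmap (a i) (Z * T) * rmap (a j) Z') I J =
    ent (rmap (a i) Z * (rmap (a j) (T * Z') + AS (br T) * rmap (a j) Z')) I J" for I J
    unfolding 1 4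
  proof (rule sum.cong[OF refl])
    fix K assume K: "K \<in> ?F I"
    show "(\<Sum>M\<in>?G I. a i (ent Z I K * ent T K M) * ent (rmap (a j) Z') M J) =
        a i (ent Z I K) * ent (rmap (a j) (T * Z') + AS (br T) * rmap (a j) Z') K J"
      unfolding ent_add 3[OF K] by (simp add: ent_rmap 2[OF K] a_sum 5 distrib_left sum_distrib_left sum.distrib)
  qed
  then show "rmap (a i) (Z * T) * rmap (a j) Z' = rmap (a i) Z * rmap (a j) (T * Z') + rmap (a i) Z * AS (br T) * rmap (a j) Z'"
    unfolding mult.assoc distrib_left[symmetric] by (rule rfmat_eqI)
qed

lemma LLA_sums:
  assumes T: "T \<in> Inn" and Z: "\<And>k. k < d \<Longrightarrow> \<zeta> k \<in> Inn"
  shows "T * dg c * BS \<zeta> = dg c * BS (\<lambda>k. T * \<zeta> k) + dg c * AS (br T) * BS \<zeta>"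
    and "T * dg c * AS \<zeta> = dg c * AS (\<lambda>k. T * \<zeta> k) + dg c * AS (br T) * AS \<zeta>"
    and "BS (\<lambda>k. \<zeta> k * T) = BS \<zeta> * T + AS \<zeta> * BS (br T)"
proof -
  show "T * dg c * BS \<zeta> = dg c * BS (\<lambda>k. T * \<zeta> k) + dg c * AS (br T) * BS \<zeta>"
    unfolding BS_def sum_distrib_left sum.distrib[symmetric]
    by (rule sum.cong) (use assms in \<open>auto intro!: LLA23(1)\<close>)
  show "BS (\<lambda>k. \<zeta> k * T) = BS \<zeta> * T + AS \<zeta> * BS (br T)"
    unfolding BS_def[of \<zeta>] BS_def[of "\<lambda>k. \<zeta> k * T"] AS_def sum_distrib_right sum.distrib[symmetric]
    by (rule sum.cong) (use assms in \<open>auto intro!: LLA4\<close>)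
  show "T * dg c * AS \<zeta> = dg c * AS (\<lambda>k. T * \<zeta> k) + dg c * AS (br T) * AS \<zeta>"
    unfolding AS_def[of \<zeta>] AS_def[of "\<lambda>k. T * \<zeta> k"] sum_distrib_left sum.distrib[symmetric]
    by (rule sum.cong) (use assms in \<open>auto intro!: LLA23(2)\<close>)
qed

lemma LLA_sums2:
  assumes T: "T \<in> Inn" and Z: "\<And>k. k < d \<Longrightarrow> \<zeta> k \<in> Inn" and X: "\<And>k. k < d \<Longrightarrow> \<xi> k \<in> Inn"
  shows "AS (\<lambda>k. \<zeta> k * T) * BS \<xi> = AS \<zeta> * BS (\<lambda>k. T * \<xi> k) + AS \<zeta> * AS (br T) * BS \<xi>"
    and "AS (\<lambda>k. \<zeta> k * T) * AS \<xi> = AS \<zeta> * AS (\<lambda>k. T * \<xi> k) + AS \<zeta> * AS (br T) * AS \<xi>"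
proof -
  show "AS (\<lambda>k. \<zeta> k * T) * BS \<xi> = AS \<zeta> * BS (\<lambda>k. T * \<xi> k) + AS \<zeta> * AS (br T) * BS \<xi>"
    unfolding BS_def AS_def[of \<zeta>] AS_def[of "\<lambda>k. \<zeta> k * T"]
      sum_distrib_right[of _ _ "AS (br T)"] sum_product sum.distrib[symmetric]
    by (intro sum.cong refl LLA56(1)) (use assms in auto)
  show "AS (\<lambda>k. \<zeta> k * T) * AS \<xi> = AS \<zeta> * AS (\<lambda>k. T * \<xi> k) + AS \<zeta> * AS (br T) * AS \<xi>"
    unfolding AS_def[of \<zeta>] AS_def[of \<xi>] AS_def[of "\<lambda>k. T * \<xi> k"] AS_def[of "\<lambda>k. \<zeta> k * T"]
      sum_distrib_right[of _ _ "AS (br T)"] sum_product sum.distrib[symmetric]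
    by (intro sum.cong refl LLA56(2)) (use assms in auto)
qed

context
  fixes P P' T
  assumes T: "T \<in> Inn" and P: "\<And>k. k < d \<Longrightarrow> P k \<in> Inn" and P': "\<And>k. k < d \<Longrightarrow> P' k \<in> Inn"
    and PT: "\<And>k. k < d \<Longrightarrow> P' k * T = T * P k"
begin

lemma dl_Inn: "k < d \<Longrightarrow> dl P k \<in> Inn" "k < d \<Longrightarrow> dl P' k \<in> Inn"
  using P P' In_y Inn_closed by (auto simp: dl_def)

lemma dl_T: "k < d \<Longrightarrow> dl P' k * T = T * dl P k + br T k"
  using PT by (simp add: dl_def algebra_simps)

lemma AS_dl_T: "AS (\<lambda>k. dl P' k * T) = AS (\<lambda>k. T * dl P k) + AS (br T)"
  unfolding AS_add[symmetric] by (rule AS_cong) (rule dl_T)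

lemma BS_dl_T: "BS (\<lambda>k. dl P' k * T) = BS (\<lambda>k. T * dl P k) + BS (br T)"
  unfolding BS_add[symmetric] by (rule BS_cong) (rule dl_T)

text \<open>The vector \<open>w = \<Lambda>^-1 B\<close> at \<open>P\<close> has blocks of
  \<open>L\<close> rows while \<open>T\<close> acts on blocks of \<open>s\<close> rows, so
  \<open>T w\<close> has no meaning that could be compared with the vector at \<open>P'\<close>. Its
  substitute \<open>w'\<close> lets \<open>A\<close> and \<open>B\<close> absorb \<open>T\<close> in
  their arguments. The conditions show that \<open>w'\<close> solves the fixed point equation at
  \<open>P'\<close> with right side \<open>B T\<close>, and that \<open>C w'\<close> and
  \<open>T C w\<close> differ by the commutator of \<open>T\<close> and \<open>D\<close>.\<close>

lemma fval_intertwine: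
  assumes W: "inverses (Lam P) W" and W': "inverses (Lam P') W'"
  shows "fval P' W' * T = T * fval P W"
proof -
  define w where "w = W * BS (dl P)"
  have w: "AS (dl P) * w + BS (dl P) = w" by (rule Lam_fix[OF w_def W])
  define p where "p = BS (br T)"
  define q where "q = AS (br T)"
  define x where "x = AS (\<lambda>k. T * dl P k)"
  define z where "z = BS (\<lambda>k. T * dl P k)"
  \<comment> \<open>By \<open>AS_dl_T\<close> and \<open>BS_dl_T\<close> this is
    \<open>AS (dl P' * T) * w + BS (dl P' * T)\<close>.\<close>
  define w' where "w' = (x + q) * w + (z + p)"
  note S = LLA_sums[OF T dl_Inn(1), of "\<lambda>k. k"] LLA_sums2[OF T dl_Inn(2) dl_Inn(1), of "\<lambda>k. k" "\<lambda>k. k"] LLA_sums(3)[OF T dl_Inn(2), of "\<lambda>k. k"]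
  note S = S[folded p_def q_def x_def z_def, unfolded AS_dl_T BS_dl_T, folded p_def q_def x_def z_def]
  have "(x + q) * w = (x + q) * (AS (dl P) * w + BS (dl P))" using w by simp
  also have "\<dots> = (x + q) * AS (dl P) * w + (x + q) * BS (dl P)"
    by (simp only: distrib_left mult.assoc)
  also have "\<dots> = AS (dl P') * (x * w) + AS (dl P') * z + AS (dl P') * q * (AS (dl P) * w + BS (dl P))"
  proof -
    have S4: "(x + q) * BS (dl P) = AS (dl P') * z + AS (dl P') * q * BS (dl P)" by (rule S(4))
    have S5: "(x + q) * AS (dl P) = AS (dl P') * x + AS (dl P') * q * AS (dl P)" by (rule S(5))
    show ?thesis unfolding S4 S5 by (simp add: distrib_left distrib_right mult.assoc)
  qed
  finally have 1: "(x + q) * w = AS (dl P') * (x * w + z + q * w)" using w by (simp add: distrib_left mult.assoc)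
  have S6: "z + p = BS (dl P') * T + AS (dl P') * p" by (rule S(6))
  have "w' = x * w + z + q * w + p" by (simp add: w'_def algebra_simps)
  moreover have "w' = AS (dl P') * (x * w + z + q * w) + (BS (dl P') * T + AS (dl P') * p)"
    unfolding w'_def 1 S6 by simp
  ultimately have "w' = AS (dl P') * w' + BS (dl P') * T"
    by (simp add: distrib_left algebra_simps)
  then have "Lam P' * w' = BS (dl P') * T" by (simp add: Lam_def left_diff_distrib algebra_simps)
  then have "W' * (Lam P' * w') = W' * BS (dl P') * T" by (simp add: mult.assoc)
  then have w': "w' = W' * BS (dl P') * T" using W' by (simp add: inverses_def flip: mult.assoc)
  have "T * dg c * w = T * dg c * AS (dl P) * w + T * dg c * BS (dl P)"
    using arg_cong[OF w, of "\<lambda>v. T * dg c * v"] by (simp add: distrib_left mult.assoc)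
  also have "\<dots> = dg c * x * w + dg c * z + dg c * q * (AS (dl P) * w + BS (dl P))"
  proof -
    have S1: "T * dg c * BS (dl P) = dg c * z + dg c * q * BS (dl P)" by (rule S(1))
    have S2: "T * dg c * AS (dl P) = dg c * x + dg c * q * AS (dl P)" by (rule S(2))
    show ?thesis unfolding S1 S2 by (simp add: distrib_left distrib_right mult.assoc)
  qed
  also have "\<dots> = dg c * w' - dg c * p"
    unfolding w by (simp add: w'_def algebra_simps)
  finally have "T * dg c * w = dg c * w' - dg c * p" .
  then have "dg c * w' = T * dg c * w + (T * dg d0 - dg d0 * T)"
    unfolding LLA1[OF T] p_def by simp
  then have "dg c * (W' * BS (dl P') * T) + dg d0 * T = T * dg c * w + T * dg d0"
    unfolding w' by (simp add: algebra_simps)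
  then show ?thesis unfolding fval_def w_def by (simp add: distrib_left distrib_right mult.assoc add.commute)
qed

text \<open>\<open>T' * T = 1\<close> can be inserted in the argument of a coefficient, but the
  conditions let \<open>T\<close> move on only into a second coefficient. So \<open>A\<close> itself
  does not factor, while \<open>A * A\<close> does. Now \<open>(1 + A) * Lam P = 1 - A * A\<close>,
  and the correction with \<open>\<alpha>\<close> restores the missing \<open>A * A\<close>.\<close>

lemma Lam_left_inverse:
  assumes T': "T' \<in> Inn" "T' * T = 1" and W': "inverses (Lam P') W'"
  shows "\<exists>G. G * Lam P = 1"
proof -
  define q where "q = AS (br T)"
  define x where "x = AS (\<lambda>k. T * dl P k)"
  define \<alpha> where "\<alpha> = AS (\<lambda>k. dl P k * T')"
  define A where "A = AS (dl P)"
  define A' where "A' = AS (dl P')"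
  have L: "Lam P = 1 - A" "Lam P' = 1 - A'" by (simp_all add: Lam_def A_def A'_def)
  have "(\<lambda>k. dl P k * T' * T) = dl P" using T' by (simp add: mult.assoc)
  then have 1: "A * A = \<alpha> * (x + q * A)"
    using LLA_sums2(2)[OF T Inn_closed(1)[OF dl_Inn(1) T'(1)] dl_Inn(1), of "\<lambda>k. k" "\<lambda>k. k"]
    by (simp add: A_def \<alpha>_def x_def q_def distrib_left mult.assoc)
  have 2: "(x + q) * A = A' * (x + q * A)"
    using LLA_sums2(2)[OF T dl_Inn(2) dl_Inn(1), of "\<lambda>k. k" "\<lambda>k. k"] AS_dl_T
    by (simp add: A_def A'_def x_def q_def distrib_left mult.assoc)
  \<comment> \<open>This replaces the meaningless \<open>T * Lam P = Lam P' * T\<close>; multiplied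
    by \<open>W'\<close> it carries invertibility from \<open>P'\<close> to
    \<open>P\<close>.\<close>
  have "(x + q - A' * q) * Lam P = Lam P' * (x + q)"
    unfolding L using 2 by (simp add: algebra_simps)
  then have 3: "W' * (x + q - A' * q) * Lam P = x + q"
    using W' by (simp add: inverses_def mult.assoc) (simp flip: mult.assoc)
  have "(1 + A + \<alpha> * (W' * (x + q - A' * q) - q)) * Lam P = (1 + A) * Lam P + \<alpha> * (W' * (x + q - A' * q) * Lam P - q * Lam P)"
    by (simp add: left_diff_distrib distrib_right mult.assoc)
  also have "\<dots> = 1 - A * A + \<alpha> * (x + q * A)"
    unfolding 3 unfolding L by (simp add: algebra_simps)
  also have "\<dots> = 1" using 1 by simp
  finally show ?thesis by blast
qed

end

end

subsection \<open>Extension of the coefficients of a realization\<close>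

definition um :: "nat \<Rightarrow> nat \<Rightarrow> nat \<Rightarrow> 'a::{zero,one} mat" where
  "um s p q = mat s s (\<lambda>(i, j). if i = p \<and> j = q then 1 else 0)"

lemma um_carrier [simp]: "um s p q \<in> carrier_mat s s" by (simp add: um_def)

text \<open>The extension of a linear map \<open>T\<close> on matrices over \<open>'a\<close> to matrices over a ring that receives \<open>'a\<close>
  along \<open>\<iota>\<close>; only the entries of the argument with indices below \<open>s\<close> matter.\<close>
definition lx :: "nat \<Rightarrow> nat \<Rightarrow> nat \<Rightarrow> ('a::comm_ring_1 mat \<Rightarrow> 'a mat) \<Rightarrow> ('a \<Rightarrow> 'b::comm_ring_1) \<Rightarrow> 'b rfmat \<Rightarrow> 'b rfmat"
  where "lx s nr nc T \<iota> z = (\<Sum>p<s. \<Sum>q<s. rmap \<iota> (amp nr nc (T (um s p q))) * dg (ent z p q))"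

lemma lx_add: "lx s nr nc T \<iota> (x + z) = lx s nr nc T \<iota> x + lx s nr nc T \<iota> z"
  by (simp add: lx_def distrib_left sum.distrib)

lemma dg_comm: "dg (c :: 'b::comm_ring_1) * x = x * dg c"
  by (rule dg_central) (rule mult.commute)

lemma lx_scal: "lx s nr nc T \<iota> (dg c * z) = dg c * lx s nr nc T \<iota> z"
proof -
  have "rmap \<iota> x * (dg c * dg (ent z p q)) = dg c * (rmap \<iota> x * dg (ent z p q))" for x p q
    by (metis dg_comm mult.assoc)
  then show ?thesis by (simp add: lx_def sum_distrib_left)
qed

lemma rmap_amp: "h 0 = 0 \<Longrightarrow> M \<in> carrier_mat nr nc \<Longrightarrow> rmap h (amp nr nc M) = amp nr nc (map_mat h M)"
  by (rule rfmat_eqI) (auto simp: ent_rmap ent_amp)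

lemma rmap_comp: "f 0 = 0 \<Longrightarrow> h 0 = 0 \<Longrightarrow> rmap h (rmap f P) = rmap (\<lambda>x. h (f x)) P"
  by (rule rfmat_eqI) (simp add: ent_rmap)

lemma rmap_id [simp]: "rmap (\<lambda>x. x) P = P" "rmap id P = P"
  by (rule rfmat_eqI, simp add: ent_rmap)+

lemma lx_hom:
  fixes h :: "'b::comm_ring_1 \<Rightarrow> 'c::comm_ring_1"
  assumes "rhom h" "\<iota> 0 = 0"
  shows "rmap h (lx s nr nc T \<iota> z) = lx s nr nc T (\<lambda>x. h (\<iota> x)) (rmap h z)"
proof -
  interpret rhom h by fact
  interpret m: rhom "rmap h" by (rule rmap_rhom)
  show ?thesis by (simp add: lx_def m.sum m.mult rmap_dg rmap_comp assms ent_rmap)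
qed

lemma lx_Amp:
  assumes "\<And>p q. p < s \<Longrightarrow> q < s \<Longrightarrow> T (um s p q) \<in> carrier_mat nr nc" "\<iota> 0 = 0"
  shows "lx s nr nc T \<iota> z \<in> Amp nr nc"
proof -
  have "rmap \<iota> (amp nr nc (T (um s p q))) * dg x \<in> Amp nr nc" if "p < s" "q < s" for p q x
    using assms that by (simp add: rmap_amp dg_comm[of x, symmetric] flip: amp_smult[of _ nr nc])
      (rule amp_in_Amp, simp)
  then show ?thesis unfolding lx_def by (intro Amp_sum) auto
qed

lemma lx_amp:
  fixes T :: "'a::field mat \<Rightarrow> 'a mat"
  assumes T: "mat_linear s nr nc T" and Z: "Z \<in> carrier_mat s s"
  shows "lx s nr nc T id (amp s s Z) = amp nr nc (T Z)"
proof -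
  note Tc = T[unfolded mat_linear_def, THEN conjunct1, rule_format]
    and Ta = T[unfolded mat_linear_def, THEN conjunct2, THEN conjunct1, rule_format]
    and Ts = T[unfolded mat_linear_def, THEN conjunct2, THEN conjunct2, rule_format]
  \<comment> \<open>\<open>M S\<close> keeps the entries of \<open>Z\<close> at the positions in
    \<open>S\<close> and erases the others; linearity is applied one position at a time.\<close>
  define M where "M S = mat s s (\<lambda>ij. if ij \<in> S then Z $$ ij else 0)" for S
  have M: "M S \<in> carrier_mat s s" for S by (simp add: M_def)
  have T0: "amp nr nc (T (0\<^sub>m s s)) = 0"
  proof -
    have "0 \<cdot>\<^sub>m 0\<^sub>m s s = (0\<^sub>m s s :: 'a mat)" by (rule eq_matI) auto
    then have "T (0\<^sub>m s s) = 0 \<cdot>\<^sub>m T (0\<^sub>m s s)" using Ts[of "0\<^sub>m s s" 0] by simp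
    then have "amp nr nc (T (0\<^sub>m s s)) = dg 0 * amp nr nc (T (0\<^sub>m s s))"
      using amp_smult[OF Tc[of "0\<^sub>m s s"]] by (metis zero_carrier_mat)
    then show ?thesis by simp
  qed
  have "amp nr nc (T (M S)) = (\<Sum>(p, q)\<in>S. dg (Z $$ (p, q)) * amp nr nc (T (um s p q)))"
    if "finite S" "S \<subseteq> {..<s} \<times> {..<s}" for S
    using that
  proof (induction S)
    case empty
    have "M {} = 0\<^sub>m s s" by (rule eq_matI) (auto simp: M_def)
    then show ?case using T0 by simp
  next
    case (insert x S)
    obtain p q where x: "x = (p, q)" by fastforce
    have "M (insert x S) = M S + Z $$ (p, q) \<cdot>\<^sub>m um s p q"
      by (rule eq_matI) (use insert x in \<open>auto simp: M_def um_def\<close>)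
    then have "amp nr nc (T (M (insert x S))) = amp nr nc (T (M S)) + dg (Z $$ (p, q)) * amp nr nc (T (um s p q))"
      using Ta[OF M, of "Z $$ (p, q) \<cdot>\<^sub>m um s p q"] Ts[of "um s p q"] Tc[OF M] Tc[of "um s p q"]
      by (simp add: amp_add amp_smult)
    then show ?case using insert x by (simp add: add.commute)
  qed
  from this[of "{..<s} \<times> {..<s}"]
  have "amp nr nc (T (M ({..<s} \<times> {..<s}))) = (\<Sum>p<s. \<Sum>q<s. dg (Z $$ (p, q)) * amp nr nc (T (um s p q)))"
    by (simp add: sum.cartesian_product)
  also have "M ({..<s} \<times> {..<s}) = Z" using Z by (intro eq_matI) (auto simp: M_def)
  also have "(\<Sum>p<s. \<Sum>q<s. dg (Z $$ (p, q)) * amp nr nc (T (um s p q))) = lx s nr nc T id (amp s s Z)"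
    unfolding lx_def by (intro sum.cong) (auto simp: ent_amp dg_comm)
  finally show ?thesis by simp
qed

lemma per_rmap:
  assumes "per n n' m P" "f 0 = 0" "\<And>z. f z \<in> Amp nr nc"
  shows "per nr nc m (rmap f P)"
  unfolding per_def
proof (intro conjI allI)
  fix I J
  show "ent (rmap f P) I J = (if I div m = J div m then ent (rmap f P) (I mod m) (J mod m) else 0)"
    using per_ent[OF assms(1), of I J] assms(2) by (simp add: ent_rmap)
qed (use assms per_pos in \<open>auto simp: ent_rmap\<close>)

subsection \<open>Controllability and observability\<close>

lemma observable_kernel:
  fixes r :: "'a::field fm_data"
  assumes o: "observable s d r" and X: "X \<in> carrier_mat (fmL r) nc" and C: "fmC r \<in> carrier_mat s (fmL r)"
    and p: "\<And>w. w \<in> fm_words s d \<Longrightarrow> fm_prod r w \<in> carrier_mat (fmL r) (fmL r)"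
    and 0: "\<And>w. w \<in> fm_words s d \<Longrightarrow> fmC r * fm_prod r w * X = 0\<^sub>m s nc"
  shows "X = 0\<^sub>m (fmL r) nc"
proof -
  have "col X j = 0\<^sub>v (fmL r)" if j: "j < nc" for j
  proof -
    have "col X j \<in> mat_kernel (fmC r * fm_prod r w)" if w: "w \<in> fm_words s d" for w
    proof (rule mat_kernelI)
      show "fmC r * fm_prod r w \<in> carrier_mat s (fmL r)" using C p[OF w] by simp
      show "col X j \<in> carrier_vec (fmL r)" using X j by simp
      have "col (fmC r * fm_prod r w * X) j = (fmC r * fm_prod r w) *\<^sub>v col X j"
        by (rule col_mult2) (use C p[OF w] X j in auto)
      then show "(fmC r * fm_prod r w) *\<^sub>v col X j = 0\<^sub>v s" using 0[OF w] j by simp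
    qed
    then have "col X j \<in> {0\<^sub>v (fmL r)}" using o unfolding observable_def by blast
    then show ?thesis by simp
  qed
  then show ?thesis using X by (intro eq_matI) (auto, metis carrier_matD col_def index_vec index_zero_vec(1))
qed

lemma submodule_kernel:
  fixes X :: "'a::field mat"
  assumes X: "X \<in> carrier_mat nr n"
  shows "submodule class_ring {v \<in> carrier_vec n. X *\<^sub>v v = 0\<^sub>v nr} (module_vec TYPE('a) n)"
proof -
  interpret vec_space "TYPE('a)" n .
  show ?thesis
  proof
    show "{v \<in> carrier_vec n. X *\<^sub>v v = 0\<^sub>v nr} \<subseteq> carrier V" by (auto simp: module_vec_simps)
  qed (use X in \<open>auto simp: module_vec_simps mult_add_distrib_mat_vec mult_mat_vec\<close>)
qed

text \<open>The vectors annihilated by \<open>X\<close> form a subspace. It contains all the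
  generating column spaces, hence their span, which is everything.\<close>

lemma controllable_kernel:
  fixes r :: "'a::field fm_data"
  assumes c: "controllable s d r" and X: "X \<in> carrier_mat nr (fmL r)"
    and p: "\<And>w. w \<in> fm_words s d \<Longrightarrow> fm_prod r w \<in> carrier_mat (fmL r) (fmL r)"
    and B: "\<And>k Z. k < d \<Longrightarrow> Z \<in> carrier_mat s s \<Longrightarrow> fmB r k Z \<in> carrier_mat (fmL r) s"
    and 0: "\<And>w k Z. w \<in> fm_words s d \<Longrightarrow> k < d \<Longrightarrow> Z \<in> carrier_mat s s \<Longrightarrow> X * (fm_prod r w * fmB r k Z) = 0\<^sub>m nr s"
  shows "X = 0\<^sub>m nr (fmL r)"
proof -
  interpret vec_space "TYPE('a)" "fmL r" .
  let ?N = "{v \<in> carrier_vec (fmL r). X *\<^sub>v v = 0\<^sub>v nr}"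
  have sub: "S \<subseteq> ?N \<Longrightarrow> span S \<subseteq> ?N" for S
    using span_is_subset submodule_kernel[OF X] by blast
  have "col_space (fm_prod r w * fmB r k Z) \<subseteq> ?N" if w: "w \<in> fm_words s d" "k < d" "Z \<in> carrier_mat s s" for w k Z
    unfolding col_space_def
  proof (rule sub, rule subsetI)
    let ?M = "fm_prod r w * fmB r k Z"
    have M: "?M \<in> carrier_mat (fmL r) s" using mult_carrier_mat[OF p B, OF w] .
    fix v assume "v \<in> set (cols ?M)"
    then obtain j where j: "j < s" "v = col ?M j" using M by (auto simp: cols_def)
    have "X *\<^sub>v v = col (X * ?M) j" unfolding j using X M j by (intro col_mult2[symmetric]) auto
    also have "\<dots> = 0\<^sub>v nr" unfolding 0[OF w] using j by simp
    finally show "v \<in> ?N" using M j by auto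
  qed
  then have "(\<Union>w\<in>fm_words s d. \<Union>k<d. \<Union>Z\<in>carrier_mat s s. col_space (fm_prod r w * fmB r k Z)) \<subseteq> ?N"
    by (intro UN_least) simp
  from sub[OF this] have "carrier_vec (fmL r) \<subseteq> ?N"
    using c unfolding controllable_def by simp
  then have "X *\<^sub>v unit_vec (fmL r) j = 0\<^sub>v nr" for j using unit_vec_carrier[of "fmL r" j] by blast
  note unit = this
  have "col X j = 0\<^sub>v nr" if "j < fmL r" for j
  proof (rule eq_vecI)
    fix i assume i: "i < dim_vec (0\<^sub>v nr :: 'a vec)"
    have "(X *\<^sub>v unit_vec (fmL r) j) $ i = X $$ (i, j)" using X i that by simp
    then show "col X j $ i = 0\<^sub>v nr $ i" using unit[of j] X i that by simp
  qed (use X in auto)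
  then show ?thesis using X by (intro eq_matI) (auto, metis carrier_matD col_def index_vec index_zero_vec(1))
qed

subsection \<open>Rows that meet finitely many blocks\<close>

text \<open>An entry of a product depends on finitely many rows of the second factor. An identity
  known for \<open>Fin\<close> arguments therefore extends to arguments with entries in
  \<open>Amp n n\<close> that are not periodic, such as those cut out by the selections
  \<open>ej\<close> and \<open>ei\<close> below: a periodic tuple that matches the relevant rows is
  enough.\<close>

lemma Fin_agreeing_rows:
  fixes \<zeta> :: "nat \<Rightarrow> 'b::comm_ring_1 rfmat rfmat"
  assumes \<zeta>: "\<And>k I J. ent (\<zeta> k) I J \<in> Amp n n"
  obtains \<zeta>' where "\<And>k. Fin n n (\<zeta>' k)" "\<And>k K J. k < d \<Longrightarrow> K < N \<Longrightarrow> ent (\<zeta>' k) K J = ent (\<zeta> k) K J"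
proof -
  have "finite (\<Union>k\<in>{..<d}. \<Union>K\<in>{..<N}. {J. ent (\<zeta> k) K J \<noteq> 0})" using finite_ent by blast
  then obtain m0 where m0: "\<And>k K J. k < d \<Longrightarrow> K < N \<Longrightarrow> ent (\<zeta> k) K J \<noteq> 0 \<Longrightarrow> J < m0"
    unfolding finite_nat_set_iff_bounded by blast
  \<comment> \<open>The period exceeds \<open>N\<close> and every column index met by the first
    \<open>N\<close> rows, so these rows fit into one window.\<close>
  define m where "m = Suc (m0 + N)"
  define f where "f k I J = (if I div m = J div m \<and> I mod m < N then ent (\<zeta> k) (I mod m) (J mod m) else 0)" for k I J
  have "finite {J. f k I J \<noteq> 0}" for k I
  proof -
    have "{J. f k I J \<noteq> 0} \<subseteq> {J. J < (I div m) * m + m}"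
      by (auto simp: f_def split: if_splits)
        (metis div_mult_mod_eq m_def mod_less_divisor nat_add_left_cancel_less zero_less_Suc)
    then show ?thesis by (rule finite_subset) simp
  qed
  then have e: "ent (Rfmat (f k)) = f k" for k by (rule ent_Rfmat)
  have "per n n m (Rfmat (f k))" for k
    unfolding per_def e by (auto simp: f_def m_def \<zeta> Amp_closed)
  moreover have "ent (Rfmat (f k)) K J = ent (\<zeta> k) K J" if "k < d" "K < N" for k K J
  proof -
    have K: "K < m" "K div m = 0" "K mod m = K" using that by (auto simp: m_def)
    show ?thesis
    proof (cases "J < m")
      case True
      then show ?thesis using K that by (simp add: e f_def)
    next
      case False
      then have "J div m \<noteq> 0" by (simp add: m_def div_eq_0_iff)
      moreover have "ent (\<zeta> k) K J = 0" using m0[OF that, of J] False by (auto simp: m_def)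
      ultimately show ?thesis using K by (simp add: e f_def)
    qed
  qed
  ultimately show ?thesis using that[of "\<lambda>k. Rfmat (f k)"] unfolding Fin_def by blast
qed

lemma rows_bound: obtains N where "\<And>K. ent X I K \<noteq> 0 \<Longrightarrow> K < N"
  using finite_ent[of X I] unfolding finite_nat_set_iff_bounded by auto

lemma mult_cong_rows:
  assumes "\<And>K. ent X I K \<noteq> 0 \<Longrightarrow> ent Q K J = ent Q' K J"
  shows "ent (X * Q) I J = ent (X * Q') I J"
  unfolding times_rfmat.rep_eq using assms by (intro sum.cong) auto

text \<open>Selection of the even indices: \<open>ej\<close> is the first block column of the identity matrix in the
  block notation of \<open>blk\<close>, and \<open>ei\<close> is the first block row.\<close>
lift_definition ej :: "'r::ring_1 rfmat" is "\<lambda>i k. if i = 2 * k then 1 else 0"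
proof -
  fix i :: nat
  have "{k. (if i = 2 * k then 1 else (0::'r)) \<noteq> 0} \<subseteq> {..i}" by auto
  then show "finite {k. (if i = 2 * k then 1 else (0::'r)) \<noteq> 0}" by (rule finite_subset) simp
qed

lift_definition ei :: "'r::ring_1 rfmat" is "\<lambda>k i. if i = 2 * k then 1 else 0"
  by simp

lemma ent_mult_ej: "ent (X * ej) i k = ent X i (2 * k)"
  by (subst ent_sum_supp[of "{2 * k}"]) (auto simp: ej.rep_eq)
lemma ent_ei_mult: "ent (ei * X) k i = ent X (2 * k) i"
  by (subst ent_sum_supp[of "{2 * k}"]) (auto simp: ei.rep_eq)
lemma ent_ej_mult: "ent (ej * X) i k = (if even i then ent X (i div 2) k else 0)"
  by (subst ent_sum_supp[of "if even i then {i div 2} else {}"]) (auto simp: ej.rep_eq)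
lemma ent_mult_ei: "ent (X * ei) k i = (if even i then ent X k (i div 2) else 0)"
  by (subst ent_sum_supp[of "if even i then {i div 2} else {}"]) (auto simp: ei.rep_eq)

lemma ej_mult: "ej * X = blk X 0 0 0 * ej"
  by (rule rfmat_eqI) (simp add: ent_ej_mult ent_mult_ej ent_blk)
lemma mult_ei: "X * ei = ei * blk X 0 0 0"
  by (rule rfmat_eqI) (simp add: ent_ei_mult ent_mult_ei ent_blk)
lemma ej_ei: "ej * ei = blk 1 0 0 0"
  by (rule rfmat_eqI) (auto simp: ent_ej_mult ei.rep_eq ent_blk ent_1)
lemma blk_ej_zero: "blk p 0 q 0 * ej = 0 \<Longrightarrow> p = 0 \<and> q = 0"
proof -
  assume "blk p 0 q 0 * ej = 0"
  then have "blk p 0 q 0 * ej * ei = 0" by simp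
  then show ?thesis by (simp add: mult.assoc ej_ei)
qed
lemma ei_blk_zero: "ei * blk p q 0 0 = 0 \<Longrightarrow> p = 0 \<and> q = 0"
proof -
  assume "ei * blk p q 0 0 = 0"
  then have "ej * ei * blk p q 0 0 = 0" by (simp add: mult.assoc)
  then show ?thesis by (simp add: ej_ei)
qed
lemma rmap_mult_ej: "f 0 = 0 \<Longrightarrow> rmap f (X * ej) = rmap f X * ej"
  by (rule rfmat_eqI) (simp add: ent_rmap ent_mult_ej)
lemma rmap_ei_mult: "f 0 = 0 \<Longrightarrow> rmap f (ei * X) = ei * rmap f X"
  by (rule rfmat_eqI) (simp add: ent_rmap ent_ei_mult)

section \<open>The given realization inside the ring\<close>

locale fm =
  fixes s d :: nat and Y :: "'a::field mat list" and r :: "'a fm_data"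
  assumes s: "0 < s" and d: "0 < d" and real: "fm_realization s d Y r"
begin

abbreviation "L \<equiv> fmL r"
definition "ia k = lx s L L (fmA r k) id"
definition "ib k = lx s L s (fmB r k) id"
definition "ic = amp s L (fmC r)"
definition "id0 = amp s s (fmD r)"
text \<open>Tuples are functions on all indices; the value \<open>0\<close> from \<open>d\<close> on
  keeps the centre inside \<open>Amp s s\<close> everywhere.\<close>

definition "iy k = (if k < d then amp s s (Y ! k) else 0)"

sublocale fm_ring d ia ib ic id0 iy
  by unfold_locales (simp_all add: ia_def ib_def lx_add)

lemma Y_carrier: "k < d \<Longrightarrow> Y ! k \<in> carrier_mat s s"
  using real by (auto simp: fm_realization_def mat_tuples_def)
lemma D_carrier: "fmD r \<in> carrier_mat s s" and C_carrier: "fmC r \<in> carrier_mat s L"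
  using real by (auto simp: fm_realization_def)
lemma A_linear: "k < d \<Longrightarrow> mat_linear s L L (fmA r k)" and B_linear: "k < d \<Longrightarrow> mat_linear s L s (fmB r k)"
  using real by (auto simp: fm_realization_def)
lemma A_carrier: "k < d \<Longrightarrow> Z \<in> carrier_mat s s \<Longrightarrow> fmA r k Z \<in> carrier_mat L L"
  using A_linear by (auto simp: mat_linear_def)
lemma B_carrier: "k < d \<Longrightarrow> Z \<in> carrier_mat s s \<Longrightarrow> fmB r k Z \<in> carrier_mat L s"
  using B_linear by (auto simp: mat_linear_def)

lemma ia_amp: "k < d \<Longrightarrow> Z \<in> carrier_mat s s \<Longrightarrow> ia k (amp s s Z) = amp L L (fmA r k Z)"
  unfolding ia_def by (rule lx_amp[OF A_linear])
lemma ib_amp: "k < d \<Longrightarrow> Z \<in> carrier_mat s s \<Longrightarrow> ib k (amp s s Z) = amp L s (fmB r k Z)"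
  unfolding ib_def by (rule lx_amp[OF B_linear])

lemma ia_Amp: "k < d \<Longrightarrow> ia k z \<in> Amp L L" and ib_Amp: "k < d \<Longrightarrow> ib k z \<in> Amp L s"
  unfolding ia_def ib_def by (rule lx_Amp; simp add: A_carrier B_carrier)+

lemma iy_Amp: "iy k \<in> Amp s s"
  by (simp add: iy_def Y_carrier amp_in_Amp Amp_closed)
lemma ic_Amp: "ic \<in> Amp s L" and id0_Amp: "id0 \<in> Amp s s"
  by (simp_all add: ic_def id0_def C_carrier D_carrier amp_in_Amp)

lemma Fin_A: "Fin s s z \<Longrightarrow> k < d \<Longrightarrow> Fin L L (rmap (ia k) z)"
  unfolding Fin_def using per_rmap[where f = "ia k", OF _ a_zero[of k] ia_Amp] by blast
lemma Fin_B: "Fin s s z \<Longrightarrow> k < d \<Longrightarrow> Fin L s (rmap (ib k) z)"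
  unfolding Fin_def using per_rmap[where f = "ib k", OF _ b_zero[of k] ib_Amp] by blast
lemma Fin_AS: "(\<And>k. Fin s s (z k)) \<Longrightarrow> Fin L L (AS z)"
  unfolding AS_def by (rule Fin_sum) (auto intro: Fin_A)
lemma Fin_BS: "(\<And>k. Fin s s (z k)) \<Longrightarrow> Fin L s (BS z)"
  unfolding BS_def by (rule Fin_sum) (auto intro: Fin_B)

definition "pts = {P. \<forall>k. Fin s s (P k)}"

lemma ptsD: "P \<in> pts \<Longrightarrow> Fin s s (P k)" by (simp add: pts_def)

lemma dl_pts: "P \<in> pts \<Longrightarrow> dl P \<in> pts"
  by (simp add: pts_def dl_def Fin_diff Fin_dg iy_Amp)

lemma center_pts: "(\<lambda>k. dg (iy k)) \<in> pts" by (simp add: pts_def Fin_dg iy_Amp)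

lemma blk_pts: "P \<in> pts \<Longrightarrow> Q \<in> pts \<Longrightarrow> Q' \<in> pts \<Longrightarrow> P' \<in> pts \<Longrightarrow> (\<lambda>k. blk (P k) (Q k) (Q' k) (P' k)) \<in> pts"
  by (simp add: pts_def Fin_blk)

lemma zero_pts: "(\<lambda>k. 0) \<in> pts" by (simp add: pts_def Fin_zero)

lemma Fin_Lam_inverse:
  assumes "P \<in> pts" "inverses (Lam P) W" "0 < L"
  shows "Fin L L W"
proof (rule Fin_left_inverse(1))
  show "Fin L L (Lam P)"
    unfolding Lam_def using assms by (intro Fin_diff Fin_one Fin_AS) (auto intro: ptsD dl_pts)
qed (use assms in \<open>auto simp: inverses_def\<close>)

text \<open>Ampliations in dimension \<open>0\<close> vanish while the unit of the ring does not.
  For \<open>L = 0\<close> the pencil is \<open>1\<close> without being an ampliated matrix, which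
  is why \<open>0 < L\<close> is separated in many arguments below.\<close>

lemma Fin_dim0: "Fin 0 nc G \<Longrightarrow> G = 0" "Fin nr 0 G \<Longrightarrow> G = 0"
proof -
  assume "Fin 0 nc G" show "G = 0"
    by (rule rfmat_eqI) (use Fin_ent[OF \<open>Fin 0 nc G\<close>] in \<open>auto simp: Amp_def\<close>)
next
  assume "Fin nr 0 G" show "G = 0"
    by (rule rfmat_eqI) (use Fin_ent[OF \<open>Fin nr 0 G\<close>] in \<open>auto simp: Amp_def\<close>)
qed

lemma fm_prod_carrier: "w \<in> fm_words s d \<Longrightarrow> fm_prod r w \<in> carrier_mat L L"
  by (induction w) (auto simp: fm_prod_def fm_words_def intro!: A_carrier mult_carrier_mat)

lemma fm_prod_Cons: "fm_prod r ((k, Z) # w) = fmA r k Z * fm_prod r w"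
  by (simp add: fm_prod_def)

text \<open>Observability in terms of invariant sets: a set killed by \<open>C\<close> and stable
  under all \<open>A(Z)\<close> is killed by \<open>C\<close> times every word. The words are built
  one letter at a time from the constant arguments \<open>dg (amp s s Z)\<close>, and entries are
  then read off.\<close>

lemma obs_closed:
  assumes o: "observable s d r"
    and C: "\<And>G. G \<in> \<G> \<Longrightarrow> dg ic * G = 0"
    and A: "\<And>G k Z. G \<in> \<G> \<Longrightarrow> k < d \<Longrightarrow> Fin s s Z \<Longrightarrow> rmap (ia k) Z * G \<in> \<G>"
    and G: "G \<in> \<G>" "Fin L nc G"
  shows "G = 0"
proof (rule rfmat_eqI)
  have w: "dg (amp L L (fm_prod r w)) * G \<in> \<G>" if "w \<in> fm_words s d" for w
    using that
  proof (induction w)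
    case Nil
    show ?case
    proof (cases "0 < L")
      case True
      then show ?thesis using G by (simp add: fm_prod_def amp_one)
    next
      case False
      then have "G = 0" using G(2) Fin_dim0 by simp
      then show ?thesis using G(1) by simp
    qed
  next
    case (Cons kZ w)
    obtain k Z where kZ: "kZ = (k, Z)" by fastforce
    have k: "k < d" "Z \<in> carrier_mat s s" "w \<in> fm_words s d" using Cons.prems kZ by (auto simp: fm_words_def)
    have "rmap (ia k) (dg (amp s s Z)) * (dg (amp L L (fm_prod r w)) * G) \<in> \<G>"
      using k Cons.IH by (intro A Fin_dg amp_in_Amp)
    moreover have "rmap (ia k) (dg (amp s s Z)) = dg (amp L L (fmA r k Z))"
      by (rule rfmat_eqI) (simp add: ent_rmap ent_dg ia_amp k)
    ultimately show ?case
      using amp_mult[OF A_carrier[OF k(1,2)] fm_prod_carrier[OF k(3)]]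
      by (simp add: kZ fm_prod_Cons mult.assoc)
  qed
  fix I J
  obtain X where X: "X \<in> carrier_mat L nc" "ent G I J = amp L nc X" using Fin_ent[OF G(2)] unfolding Amp_def by blast
  have "fmC r * fm_prod r w * X = 0\<^sub>m s nc" if "w \<in> fm_words s d" for w
  proof (rule amp_inj)
    have "amp s nc (fmC r * fm_prod r w * X) = ic * amp L L (fm_prod r w) * amp L nc X"
      using amp_mult[OF mult_carrier_mat[OF C_carrier fm_prod_carrier[OF that]] X(1)]
        amp_mult[OF C_carrier fm_prod_carrier[OF that]] by (simp add: ic_def)
    also have "\<dots> = ent (dg ic * (dg (amp L L (fm_prod r w)) * G)) I J" by (simp add: X(2) mult.assoc)
    also have "\<dots> = 0" using C[OF w[OF that]] by simp
    finally show "amp s nc (fmC r * fm_prod r w * X) = amp s nc (0\<^sub>m s nc)" by simp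
  qed (use C_carrier fm_prod_carrier[OF that] X in auto)
  with observable_kernel[OF o X(1) C_carrier fm_prod_carrier] have "X = 0\<^sub>m L nc" by blast
  then show "ent G I J = ent 0 I J" using X by simp
qed

lemma ctrl_closed:
  assumes c: "controllable s d r"
    and B: "\<And>H k Z. H \<in> \<H> \<Longrightarrow> k < d \<Longrightarrow> Fin s s Z \<Longrightarrow> H * rmap (ib k) Z = 0"
    and A: "\<And>H k Z. H \<in> \<H> \<Longrightarrow> k < d \<Longrightarrow> Fin s s Z \<Longrightarrow> H * rmap (ia k) Z \<in> \<H>"
    and H: "H \<in> \<H>" "Fin nr L H"
  shows "H = 0"
proof (rule rfmat_eqI)
  have w: "H * dg (amp L L (fm_prod r w)) \<in> \<H>" if "w \<in> fm_words s d" "H \<in> \<H>" "Fin nr L H" for w H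
    using that
  proof (induction w arbitrary: H)
    case Nil
    show ?case
    proof (cases "0 < L")
      case True
      then show ?thesis using Nil by (simp add: fm_prod_def amp_one)
    next
      case False
      then have "H = 0" using Nil Fin_dim0 by simp
      then show ?thesis using Nil by simp
    qed
  next
    case (Cons kZ w)
    obtain k Z where kZ: "kZ = (k, Z)" by fastforce
    have k: "k < d" "Z \<in> carrier_mat s s" "w \<in> fm_words s d" using Cons.prems kZ by (auto simp: fm_words_def)
    have F: "Fin s s (dg (amp s s Z))" using k by (intro Fin_dg amp_in_Amp)
    have "H * rmap (ia k) (dg (amp s s Z)) * dg (amp L L (fm_prod r w)) \<in> \<H>"
      using k Cons F by (intro Cons.IH A Fin_mult[OF _ Fin_A])
    moreover have "rmap (ia k) (dg (amp s s Z)) = dg (amp L L (fmA r k Z))"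
      by (rule rfmat_eqI) (simp add: ent_rmap ent_dg ia_amp k)
    ultimately show ?case
      using amp_mult[OF A_carrier[OF k(1,2)] fm_prod_carrier[OF k(3)]]
      by (simp add: kZ fm_prod_Cons mult.assoc)
  qed
  fix I J
  obtain X where X: "X \<in> carrier_mat nr L" "ent H I J = amp nr L X" using Fin_ent[OF H(2)] unfolding Amp_def by blast
  have "X * (fm_prod r w * fmB r k Z) = 0\<^sub>m nr s" if that: "w \<in> fm_words s d" "k < d" "Z \<in> carrier_mat s s" for w k Z
  proof (rule amp_inj)
    have M: "fm_prod r w * fmB r k Z \<in> carrier_mat L s" using mult_carrier_mat[OF fm_prod_carrier B_carrier, OF that] .
    have r: "rmap (ib k) (dg (amp s s Z)) = dg (amp L s (fmB r k Z))"
      by (rule rfmat_eqI) (simp add: ent_rmap ent_dg ib_amp that)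
    have "amp nr s (X * (fm_prod r w * fmB r k Z)) = amp nr L X * (amp L L (fm_prod r w) * amp L s (fmB r k Z))"
      using amp_mult[OF X(1) M] amp_mult[OF fm_prod_carrier B_carrier, OF that] by simp
    also have "\<dots> = ent (H * dg (amp L L (fm_prod r w)) * rmap (ib k) (dg (amp s s Z))) I J"
      unfolding r by (simp only: ent_mult_dg X(2)) (simp only: mult.assoc)
    also have "\<dots> = 0" using B[OF w[OF that(1) H] that(2), of "dg (amp s s Z)"] that(3) by (simp add: Fin_dg amp_in_Amp)
    finally show "amp nr s (X * (fm_prod r w * fmB r k Z)) = amp nr s (0\<^sub>m nr s)" by simp
    show "X * (fm_prod r w * fmB r k Z) \<in> carrier_mat nr s" using X(1) M by auto
  qed simp
  with controllable_kernel[OF c X(1) fm_prod_carrier B_carrier] have "X = 0\<^sub>m nr L" by blast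
  then show "ent H I J = ent 0 I J" using X by simp
qed

end

lemma ent_mult_cong_left:
  assumes "\<And>l. ent P i l = ent P' i l" shows "ent (P * Q) i j = ent (P' * Q) i j"
  unfolding times_rfmat.rep_eq assms ..

context fm
begin

section \<open>Test points and the cancellation of coefficients\<close>

definition "reg P W \<longleftrightarrow> P \<in> pts \<and> inverses (Lam P) W"

text \<open>Triangular extensions with arbitrary corners are what the cancellations consume. The set
  is a parameter because of its two instances: all regular points, and the regular points at which a
  given expression is defined.\<close>

definition tri_closed :: "(nat \<Rightarrow> 'a rfmat rfmat) set \<Rightarrow> bool" where
  "tri_closed \<U> \<longleftrightarrow> \<U> \<noteq> {} \<and> (\<forall>U\<in>\<U>. \<exists>W. reg U W) \<and>
     (\<forall>U\<in>\<U>. \<forall>V\<in>\<U>. \<forall>Z\<in>pts. (\<lambda>k. blk (U k) (Z k) 0 (V k)) \<in> \<U>)"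

definition single :: "nat \<Rightarrow> 'a rfmat rfmat \<Rightarrow> nat \<Rightarrow> 'a rfmat rfmat" where
  "single k Z = (\<lambda>i. if i = k then Z else 0)"

lemma single_pts: "Fin s s Z \<Longrightarrow> single k Z \<in> pts"
  by (simp add: pts_def single_def Fin_zero)

lemma AS_single': "k < d \<Longrightarrow> AS (single k Z) = rmap (ia k) Z"
  and BS_single': "k < d \<Longrightarrow> BS (single k Z) = rmap (ib k) Z"
  unfolding single_def by (rule AS_single BS_single, simp)+

lemma Lam_L0: "L = 0 \<Longrightarrow> P \<in> pts \<Longrightarrow> Lam P = 1"
  using Fin_AS[OF ptsD[OF dl_pts, of P]] Fin_dim0(1)[of L "AS (dl P)"] by (simp add: Lam_def)

lemma reg_expand: "reg P W \<Longrightarrow> W = 1 + W * AS (dl P)" "reg P W \<Longrightarrow> W = 1 + AS (dl P) * W"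
  by (simp_all add: reg_def inverses_def Lam_def algebra_simps)

text \<open>The set \<open>\<G>\<close> below is stable under \<open>W = \<Lambda>\<^sub>U\<^sup>-\<^sup>1\<close>, hence, by the Cayley--Hamilton theorem, under
  \<open>\<Lambda>\<^sub>U\<close>; this removes the factor \<open>\<Lambda>\<^sub>U\<^sup>-\<^sup>1\<close> from \<open>\<Lambda>\<^sub>U\<^sup>-\<^sup>1 A(Z) G \<in> \<G>\<close>.\<close>
lemma obs_points:
  assumes o: "observable s d r" and \<U>: "tri_closed \<U>"
    and G: "Fin L nc G" "dg ic * G = 0"
    and hyp: "\<And>U W k Z. U \<in> \<U> \<Longrightarrow> reg U W \<Longrightarrow> k < d \<Longrightarrow> Fin s s Z \<Longrightarrow> dg ic * W * (rmap (ia k) Z * G) = 0"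
  shows "G = 0"
proof (cases "0 < L")
  case False
  then show ?thesis using G Fin_dim0 by simp
next
  case L: True
  define \<G> where "\<G> = {G. Fin L nc G \<and> dg ic * G = 0 \<and>
    (\<forall>U\<in>\<U>. \<forall>W k Z. reg U W \<longrightarrow> k < d \<longrightarrow> Fin s s Z \<longrightarrow> dg ic * W * (rmap (ia k) Z * G) = 0)}"
  \<comment> \<open>The defining property of \<open>\<G>\<close>, extended from \<open>Fin\<close>
    arguments to arguments that are not periodic.\<close>
  have inn: "dg ic * W * (rmap (ia k) \<zeta> * G) = 0"
    if h: "G \<in> \<G>" "U \<in> \<U>" "reg U W" "k < d" and \<zeta>: "\<And>I J. ent \<zeta> I J \<in> Amp s s" for G U W k \<zeta>
  proof (rule rfmat_eqI)
    fix I J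
    obtain N where N: "\<And>K. ent (dg ic * W) I K \<noteq> 0 \<Longrightarrow> K < N" using rows_bound[of "dg ic * W" I] by blast
    obtain \<zeta>' where \<zeta>': "Fin s s (\<zeta>' (0::nat))" "\<And>K J. K < N \<Longrightarrow> ent (\<zeta>' 0) K J = ent \<zeta> K J"
      using Fin_agreeing_rows[of "\<lambda>_. \<zeta>" s 1 N] \<zeta> by (metis less_one)
    have "ent (dg ic * W * (rmap (ia k) \<zeta> * G)) I J = ent (dg ic * W * (rmap (ia k) (\<zeta>' 0) * G)) I J"
      by (intro mult_cong_rows ent_mult_cong_left) (use N \<zeta>'(2) in \<open>simp add: ent_rmap\<close>)
    then show "ent (dg ic * W * (rmap (ia k) \<zeta> * G)) I J = ent 0 I J"
      using h \<zeta>'(1) by (simp add: \<G>_def)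
  qed
  have step: "W * (rmap (ia k) Z * G) \<in> \<G>"
    if h: "G \<in> \<G>" "U \<in> \<U>" "reg U W" "k < d" and Z: "Fin s s Z" for G U W k Z
  proof -
    have "Fin L nc (W * (rmap (ia k) Z * G))"
      using h Z L Fin_Lam_inverse Fin_A by (auto simp: \<G>_def reg_def intro!: Fin_mult)
    moreover have "dg ic * (W * (rmap (ia k) Z * G)) = 0"
      using h Z by (simp add: \<G>_def flip: mult.assoc[of "dg ic" W])
    moreover have "dg ic * W' * (rmap (ia k') Z' * (W * (rmap (ia k) Z * G))) = 0"
      if h': "U' \<in> \<U>" "reg U' W'" "k' < d" "Fin s s Z'" for U' W' k' Z'
    proof -
      \<comment> \<open>At this larger point the argument is the block column \<open>[0; Z]\<close>.
        Multiplied by \<open>C \<Lambda>^-1\<close> it produces the blocks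
        \<open>C W' A(Z') W A(Z) G\<close> and \<open>C W A(Z) G\<close>. The factor
        \<open>ej\<close> drops the second block column, so that the hypothesis applies to
        \<open>G\<close> itself and not to a doubled version of it.\<close>
      let ?Q = "\<lambda>i. blk (U' i) (single k' Z' i) 0 (U i)"
      let ?W = "blk W' (W' * AS (single k' Z') * W) 0 W"
      have Q: "?Q \<in> \<U>" using \<U> h h' single_pts unfolding tri_closed_def by blast
      moreover have "reg ?Q ?W" using h(3) h'(2,4) unfolding reg_def
        by (auto intro: blk_pts inverses_tri single_pts zero_pts)
      moreover have "ent (blk 0 0 Z 0 * ej) I J \<in> Amp s s" for I J
        using Fin_ent[OF Z] by (simp add: ent_mult_ej ent_blk Amp_closed)
      ultimately have "dg ic * ?W * (rmap (ia k) (blk 0 0 Z 0 * ej) * G) = 0"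
        using inn[OF h(1)] h(4) by blast
      also have "rmap (ia k) (blk 0 0 Z 0 * ej) * G = blk 0 0 (rmap (ia k) Z) 0 * blk G 0 0 0 * ej"
        by (simp add: rmap_mult_ej rmap_blk mult.assoc ej_mult ent_rmap) (simp add: rmap_def zero_rfmat_def[symmetric] flip: mult.assoc)
      finally have "blk (dg ic * (W' * AS (single k' Z') * W) * (rmap (ia k) Z * G)) 0 (dg ic * W * (rmap (ia k) Z * G)) 0 * ej = 0"
        by (simp add: mult.assoc[symmetric])
      then show ?thesis using blk_ej_zero h'(3) by (auto simp: AS_single' mult.assoc)
    qed
    ultimately show ?thesis by (simp add: \<G>_def)
  qed
  have add: "G \<in> \<G> \<Longrightarrow> G' \<in> \<G> \<Longrightarrow> G + G' \<in> \<G>" for G G'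
    by (simp add: \<G>_def Fin_add distrib_left)
  have scal: "dg (dg c) * G \<in> \<G>" if "G \<in> \<G>" for c G
  proof -
    have 1: "x * (dg (dg c) * G) = dg (dg c) * (x * G)" for x G :: "'a rfmat rfmat"
      by (simp only: dg2_central[of c x] flip: mult.assoc)
    have "dg ic * (dg (dg c) * G) = 0" unfolding 1[of "dg ic"] using that by (simp add: \<G>_def)
    moreover have "dg ic * W * (rmap (ia k) Z * (dg (dg c) * G)) = 0"
      if "U \<in> \<U>" "reg U W" "k < d" "Fin s s Z" for U W k Z
      unfolding 1[of "rmap (ia k) Z"] 1[of "dg ic * W"] using \<open>G \<in> \<G>\<close> that by (simp add: \<G>_def)
    ultimately show ?thesis using that by (simp add: \<G>_def Fin_scal)
  qed
  have zero: "0 \<in> \<G>" by (simp add: \<G>_def Fin_zero)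
  have sum: "(\<And>x. x \<in> S \<Longrightarrow> f x \<in> \<G>) \<Longrightarrow> sum f S \<in> \<G>" for f :: "nat \<Rightarrow> _" and S
    by (induction S rule: infinite_finite_induct) (auto intro: add zero)
  have W_closed: "W * G \<in> \<G>" if h: "G \<in> \<G>" "U \<in> \<U>" "reg U W" for G U W
  proof -
    \<comment> \<open>One step of the resolvent identity writes \<open>W\<close> through products
      that \<open>step\<close> already covers.\<close>
    have "W * G = (1 + W * AS (dl U)) * G" using reg_expand(1)[OF h(3)] by simp
    also have "\<dots> = G + (\<Sum>k<d. W * (rmap (ia k) (dl U k) * G))"
      by (simp add: AS_def distrib_right sum_distrib_left sum_distrib_right mult.assoc)
    also have "\<dots> \<in> \<G>" using h by (intro add sum step) (auto intro: ptsD dl_pts simp: reg_def)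
    finally show ?thesis .
  qed
  have A_closed: "rmap (ia k) Z * G \<in> \<G>" if h: "G \<in> \<G>" "k < d" "Fin s s Z" for G k Z
  proof -
    obtain U W where U: "U \<in> \<U>" "reg U W" using \<U> unfolding tri_closed_def by blast
    have FW: "Fin L L W" using U(2) L Fin_Lam_inverse by (auto simp: reg_def)
    have "Lam U * W = 1" using U(2) by (simp add: reg_def inverses_def)
    then obtain n c where n: "Lam U = (\<Sum>i<n. dg (dg (c i)) * W ^ i)"
      by (rule cayley_hamilton_inverse[OF FW L])
    define g where "g = W * (rmap (ia k) Z * G)"
    have g: "g \<in> \<G>" unfolding g_def using h U by (intro step)
    have "W ^ i * g \<in> \<G>" for i
      by (induction i) (use g U W_closed in \<open>auto simp: mult.assoc\<close>)
    then have "(\<Sum>i<n. dg (dg (c i)) * (W ^ i * g)) \<in> \<G>" by (intro sum scal)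
    also have "(\<Sum>i<n. dg (dg (c i)) * (W ^ i * g)) = Lam U * g"
      by (simp add: n sum_distrib_right mult.assoc)
    also have "\<dots> = rmap (ia k) Z * G"
      using U(2) unfolding g_def by (simp add: reg_def inverses_def flip: mult.assoc)
    finally show ?thesis .
  qed
  have "G \<in> \<G>" using G hyp by (simp add: \<G>_def)
  then show ?thesis
  proof (rule obs_closed[OF o _ _ _ G(1), rotated -1])
    show "\<And>G. G \<in> \<G> \<Longrightarrow> dg ic * G = 0" by (simp add: \<G>_def)
  qed (rule A_closed)
qed

text \<open>The mirror image of \<open>obs_points\<close>. The vectors
  \<open>A(\<zeta>) w + B(\<zeta>)\<close> are those in the corners of triangular points; right
  multiplication by \<open>W\<close> and by \<open>A(Z)\<close> preserves the set
  \<open>\<H>\<close>, and \<open>B(Z)\<close> annihilates it.\<close>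

lemma ctrl_points:
  assumes c: "controllable s d r" and \<U>: "tri_closed \<U>"
    and H: "Fin nr L H"
    and hyp: "\<And>V W \<zeta>. V \<in> \<U> \<Longrightarrow> reg V W \<Longrightarrow> \<zeta> \<in> pts \<Longrightarrow> H * (AS \<zeta> * (W * BS (dl V)) + BS \<zeta>) = 0"
  shows "H = 0"
proof (cases "0 < L")
  case False
  then show ?thesis using H Fin_dim0 by simp
next
  case L: True
  define \<H> where "\<H> = {H. Fin nr L H \<and>
    (\<forall>V\<in>\<U>. \<forall>W. \<forall>\<zeta>\<in>pts. reg V W \<longrightarrow> H * (AS \<zeta> * (W * BS (dl V)) + BS \<zeta>) = 0)}"
  have inn: "H * (AS \<zeta> * (W * BS (dl V)) + BS \<zeta>) = 0"
    if h: "H \<in> \<H>" "V \<in> \<U>" "reg V W" and \<zeta>: "\<And>k I J. ent (\<zeta> k) I J \<in> Amp s s" for H V W \<zeta>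
  proof (rule rfmat_eqI)
    fix I J
    obtain N where N: "\<And>K. ent H I K \<noteq> 0 \<Longrightarrow> K < N" using rows_bound[of H I] by blast
    obtain \<zeta>' where \<zeta>': "\<And>k. Fin s s (\<zeta>' k)" "\<And>k K J. k < d \<Longrightarrow> K < N \<Longrightarrow> ent (\<zeta>' k) K J = ent (\<zeta> k) K J"
      using Fin_agreeing_rows[of \<zeta> s d N] \<zeta> by metis
    have "ent (AS \<zeta> * (W * BS (dl V)) + BS \<zeta>) K J = ent (AS \<zeta>' * (W * BS (dl V)) + BS \<zeta>') K J" if "K < N" for K
      unfolding ent_add
      by (intro arg_cong2[where f = "(+)"] ent_mult_cong_left) (use \<zeta>'(2) that in \<open>simp_all add: ent_AS ent_BS\<close>)
    then have "ent (H * (AS \<zeta> * (W * BS (dl V)) + BS \<zeta>)) I J = ent (H * (AS \<zeta>' * (W * BS (dl V)) + BS \<zeta>')) I J"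
      by (intro mult_cong_rows) (use N in blast)
    then show "ent (H * (AS \<zeta> * (W * BS (dl V)) + BS \<zeta>)) I J = ent 0 I J"
      using h \<zeta>'(1) by (simp add: \<H>_def pts_def)
  qed
  have step: "H * rmap (ia k) Z * W \<in> \<H>"
    if h: "H \<in> \<H>" "V \<in> \<U>" "reg V W" "k < d" and Z: "Fin s s Z" for H V W k Z
  proof -
    have "Fin nr L (H * rmap (ia k) Z * W)"
      using h Z L Fin_Lam_inverse Fin_A by (auto simp: \<H>_def reg_def intro!: Fin_mult)
    moreover have "H * rmap (ia k) Z * W * (AS \<zeta> * (W' * BS (dl V')) + BS \<zeta>) = 0"
      if h': "V' \<in> \<U>" "reg V' W'" "\<zeta> \<in> pts" for V' W' \<zeta>
    proof -
      let ?Q = "\<lambda>i. blk (V i) (\<zeta> i) 0 (V' i)"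
      let ?W = "blk W (W * AS \<zeta> * W') 0 W'"
      let ?w = "W' * BS (dl V')"
      have Q: "?Q \<in> \<U>" using \<U> h h' unfolding tri_closed_def by blast
      have R: "reg ?Q ?W" using h(3) h'(2,3) unfolding reg_def
        by (auto intro: blk_pts inverses_tri zero_pts)
      \<comment> \<open>The block row \<open>[Z 0]\<close>, cut out by \<open>ei\<close>; it selects
        the upper half of the vector at the triangular point.\<close>
      let ?\<zeta> = "\<lambda>i. ei * blk (single k Z i) 0 0 0"
      have "ent (?\<zeta> i) I J \<in> Amp s s" for i I J
        using Fin_ent[OF Z] by (simp add: ent_ei_mult ent_blk Amp_closed single_def)
      from inn[OF h(1) Q R this] have "H * (AS ?\<zeta> * (?W * BS (dl ?Q)) + BS ?\<zeta>) = 0" .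
      moreover have "AS ?\<zeta> = ei * blk (rmap (ia k) Z) 0 0 0"
      proof -
        have "AS ?\<zeta> = ei * AS (\<lambda>i. blk (single k Z i) 0 0 0)"
          by (simp add: AS_def rmap_ei_mult sum_distrib_left)
        then show ?thesis using h(4) by (simp add: AS_blk AS_single')
      qed
      moreover have "BS ?\<zeta> = ei * blk (rmap (ib k) Z) 0 0 0"
      proof -
        have "BS ?\<zeta> = ei * BS (\<lambda>i. blk (single k Z i) 0 0 0)"
          by (simp add: BS_def rmap_ei_mult sum_distrib_left)
        then show ?thesis using h(4) by (simp add: BS_blk BS_single')
      qed
      moreover have "?W * BS (dl ?Q) = blk (W * BS (dl V)) (W * (AS \<zeta> * ?w + BS \<zeta>)) 0 ?w"
        by (simp add: dl_blk BS_blk distrib_left mult.assoc add.commute)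
      ultimately have "H * (ei * (blk (rmap (ia k) Z) 0 0 0 * blk (W * BS (dl V)) (W * (AS \<zeta> * ?w + BS \<zeta>)) 0 ?w + blk (rmap (ib k) Z) 0 0 0)) = 0"
        by (simp only: distrib_left mult.assoc)
      then have "ei * (blk H 0 0 0 * (blk (rmap (ia k) Z) 0 0 0 * blk (W * BS (dl V)) (W * (AS \<zeta> * ?w + BS \<zeta>)) 0 ?w + blk (rmap (ib k) Z) 0 0 0)) = 0"
        by (simp only: mult_ei[of H] flip: mult.assoc)
      then have "ei * blk (H * (rmap (ia k) Z * (W * BS (dl V)) + rmap (ib k) Z)) (H * (rmap (ia k) Z * (W * (AS \<zeta> * ?w + BS \<zeta>)))) 0 0 = 0"
        by simp
      from ei_blk_zero[OF this] show ?thesis by (simp add: mult.assoc)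
    qed
    ultimately show ?thesis by (simp add: \<H>_def)
  qed
  have add: "H \<in> \<H> \<Longrightarrow> H' \<in> \<H> \<Longrightarrow> H + H' \<in> \<H>" for H H'
    by (simp add: \<H>_def Fin_add distrib_right)
  have scal: "dg (dg c) * H \<in> \<H>" if "H \<in> \<H>" for c H
    using that by (simp add: \<H>_def Fin_scal mult.assoc)
  have zero: "0 \<in> \<H>" by (simp add: \<H>_def Fin_zero)
  have sum: "(\<And>x. x \<in> S \<Longrightarrow> f x \<in> \<H>) \<Longrightarrow> sum f S \<in> \<H>" for f :: "nat \<Rightarrow> _" and S
    by (induction S rule: infinite_finite_induct) (auto intro: add zero)
  have W_closed: "H * W \<in> \<H>" if h: "H \<in> \<H>" "U \<in> \<U>" "reg U W" for H U W
  proof -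
    have "H * W = H * (1 + AS (dl U) * W)" using reg_expand(2)[OF h(3)] by simp
    also have "\<dots> = H + (\<Sum>k<d. H * rmap (ia k) (dl U k) * W)"
      by (simp add: AS_def distrib_left sum_distrib_left sum_distrib_right mult.assoc)
    also have "\<dots> \<in> \<H>" using h by (intro add sum step) (auto intro: ptsD dl_pts simp: reg_def)
    finally show ?thesis .
  qed
  have A_closed: "H * rmap (ia k) Z \<in> \<H>" if h: "H \<in> \<H>" "k < d" "Fin s s Z" for H k Z
  proof -
    obtain U W where U: "U \<in> \<U>" "reg U W" using \<U> unfolding tri_closed_def by blast
    have FW: "Fin L L W" using U(2) L Fin_Lam_inverse by (auto simp: reg_def)
    have "Lam U * W = 1" using U(2) by (simp add: reg_def inverses_def)
    then obtain n c where n: "Lam U = (\<Sum>i<n. dg (dg (c i)) * W ^ i)"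
      by (rule cayley_hamilton_inverse[OF FW L])
    define g where "g = H * rmap (ia k) Z * W"
    have g: "g \<in> \<H>" unfolding g_def using h U by (intro step)
    have "g * W ^ i \<in> \<H>" for i
      by (induction i) (use g U W_closed in \<open>auto simp: power_Suc2 simp del: power_Suc simp flip: mult.assoc\<close>)
    then have "(\<Sum>i<n. dg (dg (c i)) * (g * W ^ i)) \<in> \<H>" by (intro sum scal)
    also have "(\<Sum>i<n. dg (dg (c i)) * (g * W ^ i)) = g * Lam U"
      unfolding n sum_distrib_left by (intro sum.cong refl) (simp only: dg2_central mult.assoc)
    also have "\<dots> = H * rmap (ia k) Z"
      using U(2) unfolding g_def by (simp add: reg_def inverses_def mult.assoc)
    finally show ?thesis .
  qed
  have B_zero: "H * rmap (ib k) Z = 0" if h: "H \<in> \<H>" "k < d" "Fin s s Z" for H k Z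
  proof -
    obtain V W where V: "V \<in> \<U>" "reg V W" using \<U> unfolding tri_closed_def by blast
    have "H * (AS (single k Z) * (W * BS (dl V)) + BS (single k Z)) = 0"
      using h V single_pts by (simp add: \<H>_def)
    \<comment> \<open>In the direction \<open>dl V\<close> the test vector is the fixed point
      \<open>w\<close> itself, so this says \<open>H A(Z) w = 0\<close>. Subtraction from the
      previous equation leaves \<open>H B(Z) = 0\<close>.\<close>
    moreover have "H * rmap (ia k) Z * (AS (dl V) * (W * BS (dl V)) + BS (dl V)) = 0"
      using A_closed[OF h] V dl_pts by (simp add: \<H>_def reg_def)
    moreover have "AS (dl V) * (W * BS (dl V)) + BS (dl V) = W * BS (dl V)"
      using V(2) by (intro Lam_fix) (auto simp: reg_def)
    ultimately show ?thesis using h(2) by (simp add: AS_single' BS_single' distrib_left mult.assoc)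
  qed
  have "H \<in> \<H>" using H hyp by (simp add: \<H>_def)
  then show ?thesis
  proof (rule ctrl_closed[OF c _ _ _ H, rotated -1])
    show "\<And>H k Z. H \<in> \<H> \<Longrightarrow> k < d \<Longrightarrow> Fin s s Z \<Longrightarrow> H * rmap (ib k) Z = 0" by (rule B_zero)
  qed (rule A_closed)
qed


section \<open>The lost-abbey conditions as identities in the ring\<close>

definition lla_in :: bool where
  "lla_in \<longleftrightarrow> (\<forall>S\<in>Amp s s. \<forall>Z\<in>Amp s s. \<forall>Z'\<in>Amp s s. \<forall>i<d. \<forall>j<d.
    S * id0 - id0 * S = ic * (\<Sum>k<d. ib k (S * iy k - iy k * S)) \<and>
    S * ic * ib i Z - ic * ib i (S * Z) = ic * (\<Sum>k<d. ia k (S * iy k - iy k * S)) * ib i Z \<and>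
    S * ic * ia i Z - ic * ia i (S * Z) = ic * (\<Sum>k<d. ia k (S * iy k - iy k * S)) * ia i Z \<and>
    ib i (Z * S) - ib i Z * S = ia i Z * (\<Sum>k<d. ib k (S * iy k - iy k * S)) \<and>
    ia i (Z * S) * ib j Z' - ia i Z * ib j (S * Z') = ia i Z * (\<Sum>k<d. ia k (S * iy k - iy k * S)) * ib j Z' \<and>
    ia i (Z * S) * ia j Z' - ia i Z * ia j (S * Z') = ia i Z * (\<Sum>k<d. ia k (S * iy k - iy k * S)) * ia j Z')"

lemma amp_msum:
  "(\<And>k. k < d \<Longrightarrow> M k \<in> carrier_mat nr nc) \<Longrightarrow> amp nr nc (msum nr nc d M) = (\<Sum>k<d. amp nr nc (M k))"
  by (rule rfmat_eqI) (auto simp: ent_amp msum_def)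

lemma msum_carrier [simp]: "msum nr nc n M \<in> carrier_mat nr nc" by (simp add: msum_def)

text \<open>On matrices of fixed size \<open>amp\<close> is injective and respects products and
  differences, so each of the six equations holds exactly if its ampliation does. Most of the proof
  records sizes.\<close>

lemma lla_iff: "linearized_lost_abbey s d Y r \<longleftrightarrow> lla_in"
proof -
  let ?AS = "\<lambda>S. msum L L d (\<lambda>k. fmA r k (commutator S (Y ! k)))"
  let ?BS = "\<lambda>S. msum L s d (\<lambda>k. fmB r k (commutator S (Y ! k)))"
  note D = D_carrier and C = C_carrier and A = A_carrier and B = B_carrier
  have com: "commutator S (Y ! k) \<in> carrier_mat s s" "amp s s (commutator S (Y ! k)) = amp s s S * iy k - iy k * amp s s S"
    if "S \<in> carrier_mat s s" "k < d" for S k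
    using that Y_carrier[OF that(2)] unfolding commutator_def
    by (auto simp: amp_diff amp_mult iy_def minus_carrier_mat)
  have AS: "amp L L (?AS S) = (\<Sum>k<d. ia k (amp s s S * iy k - iy k * amp s s S))" if "S \<in> carrier_mat s s" for S
    using that com A by (subst amp_msum) (auto simp: ia_amp simp flip: com(2))
  have BS: "amp L s (?BS S) = (\<Sum>k<d. ib k (amp s s S * iy k - iy k * amp s s S))" if "S \<in> carrier_mat s s" for S
    using that com B by (subst amp_msum) (auto simp: ib_amp simp flip: com(2))
  have inj: "X = X' \<longleftrightarrow> amp nr nc X = amp nr nc X'"
    if "X \<in> carrier_mat nr nc" "X' \<in> carrier_mat nr nc" for X X' :: "'a mat" and nr nc
    using amp_inj that by blast
  have eqs: "(S * fmD r - fmD r * S = fmC r * ?BS S \<and>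
        S * fmC r * fmB r i Z - fmC r * fmB r i (S * Z) = fmC r * ?AS S * fmB r i Z \<and>
        S * fmC r * fmA r i Z - fmC r * fmA r i (S * Z) = fmC r * ?AS S * fmA r i Z \<and>
        fmB r i (Z * S) - fmB r i Z * S = fmA r i Z * ?BS S \<and>
        fmA r i (Z * S) * fmB r j Z' - fmA r i Z * fmB r j (S * Z') = fmA r i Z * ?AS S * fmB r j Z' \<and>
        fmA r i (Z * S) * fmA r j Z' - fmA r i Z * fmA r j (S * Z') = fmA r i Z * ?AS S * fmA r j Z') \<longleftrightarrow>
    (amp s s S * id0 - id0 * amp s s S = ic * (\<Sum>k<d. ib k (amp s s S * iy k - iy k * amp s s S)) \<and>
    amp s s S * ic * ib i (amp s s Z) - ic * ib i (amp s s S * amp s s Z) = ic * (\<Sum>k<d. ia k (amp s s S * iy k - iy k * amp s s S)) * ib i (amp s s Z) \<and>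
    amp s s S * ic * ia i (amp s s Z) - ic * ia i (amp s s S * amp s s Z) = ic * (\<Sum>k<d. ia k (amp s s S * iy k - iy k * amp s s S)) * ia i (amp s s Z) \<and>
    ib i (amp s s Z * amp s s S) - ib i (amp s s Z) * amp s s S = ia i (amp s s Z) * (\<Sum>k<d. ib k (amp s s S * iy k - iy k * amp s s S)) \<and>
    ia i (amp s s Z * amp s s S) * ib j (amp s s Z') - ia i (amp s s Z) * ib j (amp s s S * amp s s Z') = ia i (amp s s Z) * (\<Sum>k<d. ia k (amp s s S * iy k - iy k * amp s s S)) * ib j (amp s s Z') \<and>
    ia i (amp s s Z * amp s s S) * ia j (amp s s Z') - ia i (amp s s Z) * ia j (amp s s S * amp s s Z') = ia i (amp s s Z) * (\<Sum>k<d. ia k (amp s s S * iy k - iy k * amp s s S)) * ia j (amp s s Z'))"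
    if h: "S \<in> carrier_mat s s" "Z \<in> carrier_mat s s" "Z' \<in> carrier_mat s s" "i < d" "j < d" for S Z Z' i j
  proof -
    have c: "?AS S \<in> carrier_mat L L" "?BS S \<in> carrier_mat L s" "S * Z \<in> carrier_mat s s" "S * Z' \<in> carrier_mat s s" "Z * S \<in> carrier_mat s s" 
      "fmA r i Z \<in> carrier_mat L L" "fmA r j Z' \<in> carrier_mat L L" "fmB r i Z \<in> carrier_mat L s" "fmB r j Z' \<in> carrier_mat L s"
      "fmA r i (S * Z) \<in> carrier_mat L L" "fmA r j (S * Z') \<in> carrier_mat L L" "fmB r i (S * Z) \<in> carrier_mat L s" "fmB r j (S * Z') \<in> carrier_mat L s"
      "fmA r i (Z * S) \<in> carrier_mat L L" "fmB r i (Z * S) \<in> carrier_mat L s"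
      "S * fmD r \<in> carrier_mat s s" "fmD r * S \<in> carrier_mat s s" "S * fmC r \<in> carrier_mat s L"
      using h A B C D by (auto intro!: A B)
    have c2: "fmC r * ?AS S \<in> carrier_mat s L" "fmA r i Z * ?AS S \<in> carrier_mat L L" "fmC r * ?BS S \<in> carrier_mat s s"
      "fmB r i Z * S \<in> carrier_mat L s" "fmA r i Z * ?BS S \<in> carrier_mat L s"
      using c C h by (auto intro!: mult_carrier_mat)
    note m = amp_mult[OF h(1) h(2)] amp_mult[OF h(2) h(1)] amp_mult[OF h(1) h(3)]
    note m2 = amp_mult[OF c(18) c(8)] amp_mult[OF c(18) c(6)] amp_mult[OF c2(1) c(8)] amp_mult[OF c2(1) c(6)]
      amp_mult[OF h(1) C] amp_mult[OF C c(1)] amp_mult[OF C c(2)] amp_mult[OF h(1) D] amp_mult[OF D h(1)]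
      amp_mult[OF C c(12)] amp_mult[OF C c(10)] amp_mult[OF c(8) h(1)] amp_mult[OF c(6) c(2)] amp_mult[OF c(6) c(1)]
      amp_mult[OF c(14) c(9)] amp_mult[OF c(14) c(7)] amp_mult[OF c(6) c(13)] amp_mult[OF c(6) c(11)]
      amp_mult[OF c2(2) c(9)] amp_mult[OF c2(2) c(7)]
    note i = ia_amp[OF h(4) h(2)] ia_amp[OF h(5) h(3)] ib_amp[OF h(4) h(2)] ib_amp[OF h(5) h(3)]
      ia_amp[OF h(4) c(3)] ia_amp[OF h(5) c(4)] ib_amp[OF h(4) c(3)] ib_amp[OF h(5) c(4)]
      ia_amp[OF h(4) c(5)] ib_amp[OF h(4) c(5)]
    note p = mult_carrier_mat[OF c(18) c(8)] mult_carrier_mat[OF c(18) c(6)] mult_carrier_mat[OF c2(1) c(8)] mult_carrier_mat[OF c2(1) c(6)]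
      mult_carrier_mat[OF C c(12)] mult_carrier_mat[OF C c(10)]
      mult_carrier_mat[OF c(14) c(9)] mult_carrier_mat[OF c(14) c(7)] mult_carrier_mat[OF c(6) c(13)] mult_carrier_mat[OF c(6) c(11)]
      mult_carrier_mat[OF c2(2) c(9)] mult_carrier_mat[OF c2(2) c(7)] c c2
    have df: "X - X' = X'' \<longleftrightarrow> amp nr nc X - amp nr nc X' = amp nr nc X''"
      if "X \<in> carrier_mat nr nc" "X' \<in> carrier_mat nr nc" "X'' \<in> carrier_mat nr nc" for X X' X'' :: "'a mat" and nr nc
      using inj[OF minus_carrier_mat[OF that(2)] that(3)] amp_diff[OF that(1,2)] by simp
    show ?thesis
      unfolding AS[OF h(1), symmetric] BS[OF h(1), symmetric] m[symmetric] i ic_def id0_def m2[symmetric]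
      by (intro arg_cong2[where f = "(\<and>)"] df; rule p)
  qed
  show ?thesis
    unfolding linearized_lost_abbey_def lla_in_def Let_def Amp_def ball_simps
    using eqs by (auto simp: image_iff) 
qed


section \<open>From intertwined values to the conditions\<close>

abbreviation "cen \<equiv> (\<lambda>k. dg (iy k))"

lemma reg_cen: "reg cen 1"
  by (simp add: reg_def center_pts Lam_center inverses_def)

lemma reg_tri: "reg U W \<Longrightarrow> reg V W' \<Longrightarrow> Z \<in> pts \<Longrightarrow>
    reg (\<lambda>k. blk (U k) (Z k) 0 (V k)) (blk W (W * AS Z * W') 0 W')"
  unfolding reg_def by (auto intro: blk_pts inverses_tri zero_pts)

lemma tri_closed_reg: "tri_closed {U. \<exists>W. reg U W}"
  unfolding tri_closed_def using reg_cen reg_tri by blast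

text \<open>All that the implication from (1) to (2) retains of a rational function.
  \<open>T\<close> ranges over the whole ring, which admits columns and corners of block
  matrices.\<close>

definition commuting_values :: bool where
  "commuting_values \<longleftrightarrow> (\<forall>P P' W W' T. reg P W \<longrightarrow> reg P' W' \<longrightarrow> (\<forall>k<d. P' k * T = T * P k) \<longrightarrow>
     fval P' W' * T = T * fval P W)"

text \<open>Apply the hypothesis to the points \<open>[\<alpha> \<beta>; 0 \<gamma>]\<close> and \<open>\<gamma>\<close>, which the column \<open>[T; 1]\<close> intertwines.\<close>
lemma value_difference:
  assumes cv: "commuting_values" and \<alpha>: "reg \<alpha> W\<alpha>" and \<gamma>: "reg \<gamma> W\<gamma>" and \<beta>: "\<beta> \<in> pts"
    and T: "\<And>k. k < d \<Longrightarrow> \<beta> k = T * \<gamma> k - \<alpha> k * T"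
  shows "T * fval \<gamma> W\<gamma> - fval \<alpha> W\<alpha> * T = dg ic * W\<alpha> * (AS \<beta> * (W\<gamma> * BS (dl \<gamma>)) + BS \<beta>)"
proof -
  let ?P = "\<lambda>k. blk (\<gamma> k) 0 0 (\<gamma> k)" and ?P' = "\<lambda>k. blk (\<alpha> k) (\<beta> k) 0 (\<gamma> k)"
  let ?W = "blk W\<gamma> (W\<gamma> * AS (\<lambda>k. 0) * W\<gamma>) 0 W\<gamma>" and ?W' = "blk W\<alpha> (W\<alpha> * AS \<beta> * W\<gamma>) 0 W\<gamma>"
  have "\<forall>k<d. ?P' k * blk T 0 1 0 = blk T 0 1 0 * ?P k" using T by simp
  then have "fval ?P' ?W' * blk T 0 1 0 = blk T 0 1 0 * fval ?P ?W"
    using cv reg_tri[OF \<alpha> \<gamma> \<beta>] reg_tri[OF \<gamma> \<gamma> zero_pts] unfolding commuting_values_def by blast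
  then show ?thesis unfolding fval_tri by (simp add: algebra_simps)
qed

text \<open>At the triangular point with diagonal \<open>cen\<close> and \<open>V\<close> the vector
  \<open>W * BS\<close> has \<open>AS \<zeta> * w + BS \<zeta>\<close> as its upper right block,
  because \<open>BS\<close> vanishes at the centre. This is the test vector of
  \<open>ctrl_points\<close>.\<close>

lemma ctrl_value:
  assumes c: "controllable s d r" and H: "Fin nr L H"
    and hyp: "\<And>V W. reg V W \<Longrightarrow> blk H 0 0 0 * (W * BS (dl V)) = 0"
  shows "H = 0"
proof (rule ctrl_points[OF c tri_closed_reg H])
  fix V W and \<zeta> :: "nat \<Rightarrow> 'a rfmat rfmat" assume "reg V W" "\<zeta> \<in> pts"
  from hyp[OF reg_tri[OF reg_cen this]]
  show "H * (AS \<zeta> * (W * BS (dl V)) + BS \<zeta>) = 0"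
    by (simp add: dl_blk BS_blk BS_center distrib_left mult.assoc add.commute)
qed

text \<open>In \<open>blk 0 0 G 0\<close> the block \<open>G\<close> is hit by the corner of the
  inverse at a triangular point. A zero corner and a corner with a single nonzero component supply
  the two assumptions of \<open>obs_points\<close>.\<close>

lemma obs_value:
  assumes o: "observable s d r" and G: "Fin L nc G"
    and hyp: "\<And>U W. reg U W \<Longrightarrow> dg ic * W * blk 0 0 G 0 = 0"
  shows "G = 0"
proof (rule obs_points[OF o tri_closed_reg G])
  show "dg ic * G = 0" using hyp[OF reg_tri[OF reg_cen reg_cen zero_pts]] by simp
next
  fix U W k and Z :: "'a rfmat rfmat" assume "reg U W" "k < d" "Fin s s Z"
  with hyp[OF reg_tri[OF this(1) reg_cen single_pts[OF this(3), of k]]]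
  show "dg ic * W * (rmap (ia k) Z * G) = 0" by (simp add: AS_single' mult.assoc)
qed

definition brk :: "'a rfmat \<Rightarrow> nat \<Rightarrow> 'a rfmat rfmat" where
  "brk S k = dg S * dg (iy k) - dg (iy k) * dg S"

lemma brk_pts: "S \<in> Amp s s \<Longrightarrow> brk S \<in> pts"
  by (simp add: pts_def brk_def Fin_diff Fin_mult[of s s _ s] Fin_dg iy_Amp)

lemma left_pts: "S \<in> Amp s s \<Longrightarrow> Z \<in> pts \<Longrightarrow> (\<lambda>k. dg S * Z k) \<in> pts"
  and right_pts: "S \<in> Amp s s \<Longrightarrow> Z \<in> pts \<Longrightarrow> (\<lambda>k. Z k * dg S) \<in> pts"
  and minus_pts: "Z \<in> pts \<Longrightarrow> (\<lambda>k. - Z k) \<in> pts"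
  unfolding pts_def by (blast intro: Fin_mult Fin_dg Fin_uminus)+

lemma brk_blk: "AS (brk S) = blk (AS (brk S)) 0 0 (AS (brk S))" "BS (brk S) = blk (BS (brk S)) 0 0 (BS (brk S))"
proof -
  have "brk S k = dg (S * iy k - iy k * S)" for k by (simp add: brk_def)
  then have "AS (brk S) = dg (\<Sum>k<d. ia k (S * iy k - iy k * S))" "BS (brk S) = dg (\<Sum>k<d. ib k (S * iy k - iy k * S))"
    by (auto intro!: rfmat_eqI simp: ent_AS ent_BS ent_dg)
  note b = this
  show "AS (brk S) = blk (AS (brk S)) 0 0 (AS (brk S))" unfolding b by (rule dg_blk)
  show "BS (brk S) = blk (BS (brk S)) 0 0 (BS (brk S))" unfolding b by (rule dg_blk)
qed

lemma AS_brk_mult [simp]: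
  "AS (brk S) * blk p q u v = blk (AS (brk S) * p) (AS (brk S) * q) (AS (brk S) * u) (AS (brk S) * v)"
  by (subst brk_blk(1)) simp

lemma mult_BS_brk [simp]:
  "blk p q u v * BS (brk S) = blk (p * BS (brk S)) (q * BS (brk S)) (u * BS (brk S)) (v * BS (brk S))"
  by (subst brk_blk(2)) simp

lemma mult_AS_brk [simp]:
  "blk p q u v * AS (brk S) = blk (p * AS (brk S)) (q * AS (brk S)) (u * AS (brk S)) (v * AS (brk S))"
  by (subst brk_blk(1)) simp

lemma lla_from_values1:
  assumes cv: "commuting_values" and S: "S \<in> Amp s s"
  shows "dg S * dg id0 - dg id0 * dg S = dg ic * BS (brk S)"
  using value_difference[OF cv reg_cen reg_cen brk_pts[OF S], of "dg S"]
  by (simp add: brk_def fval_def BS_center)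

text \<open>\<open>value_difference\<close> with \<open>T = [S 0; 0 0]\<close> between the doubled
  centre and \<open>[cen \<zeta>; 0 V]\<close>, read in the upper right block.\<close>

lemma lla_from_values2:
  assumes cv: "commuting_values" and S: "S \<in> Amp s s" and \<zeta>: "\<zeta> \<in> pts" and V: "reg V W"
  shows "dg S * dg ic * (AS \<zeta> * (W * BS (dl V)) + BS \<zeta>) =
    dg ic * (AS (brk S) * (AS \<zeta> * (W * BS (dl V)) + BS \<zeta>) + AS (\<lambda>k. dg S * \<zeta> k) * (W * BS (dl V)) + BS (\<lambda>k. dg S * \<zeta> k))"
proof -
  let ?\<beta> = "\<lambda>k. blk (brk S k) (dg S * \<zeta> k) 0 0"
  have "?\<beta> \<in> pts" using S \<zeta> by (intro blk_pts brk_pts left_pts zero_pts)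
  moreover have "?\<beta> k = blk (dg S) 0 0 0 * blk (cen k) (\<zeta> k) 0 (V k) - blk (cen k) 0 0 (cen k) * blk (dg S) 0 0 0" for k
    by (simp add: brk_def)
  ultimately have "blk (dg S) 0 0 0 * fval (\<lambda>k. blk (cen k) (\<zeta> k) 0 (V k)) (blk 1 (1 * AS \<zeta> * W) 0 W)
      - fval (\<lambda>k. blk (cen k) 0 0 (cen k)) (blk 1 (1 * AS (\<lambda>k. 0) * 1) 0 1) * blk (dg S) 0 0 0 =
    dg ic * blk 1 (1 * AS (\<lambda>k. 0) * 1) 0 1 * (AS ?\<beta> * (blk 1 (1 * AS \<zeta> * W) 0 W * BS (dl (\<lambda>k. blk (cen k) (\<zeta> k) 0 (V k)))) + BS ?\<beta>)"
    by (intro value_difference[OF cv reg_tri[OF reg_cen reg_cen zero_pts] reg_tri[OF reg_cen V \<zeta>]])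
  then show ?thesis
    unfolding fval_tri by (simp add: AS_blk BS_blk dl_blk BS_center distrib_left mult.assoc algebra_simps)
qed

text \<open>\<open>value_difference\<close> with \<open>T = [0 0; S 0]\<close> between
  \<open>[U Z; 0 cen]\<close> and the doubled centre, where the vector vanishes; read in the upper
  left block.\<close>

lemma lla_from_values4:
  assumes cv: "commuting_values" and S: "S \<in> Amp s s" and Z: "Z \<in> pts" and U: "reg U W"
  shows "dg ic * W * (BS (\<lambda>k. Z k * dg S) - BS Z * dg S - AS Z * BS (brk S)) = 0"
proof -
  let ?\<beta> = "\<lambda>k. blk (- (Z k * dg S)) 0 (brk S k) 0"
  have "?\<beta> \<in> pts" using S Z by (intro blk_pts brk_pts right_pts minus_pts zero_pts)
  moreover have "?\<beta> k = blk 0 0 (dg S) 0 * blk (cen k) 0 0 (cen k) - blk (U k) (Z k) 0 (cen k) * blk 0 0 (dg S) 0" for k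
    by (simp add: brk_def)
  ultimately have "blk 0 0 (dg S) 0 * fval (\<lambda>k. blk (cen k) 0 0 (cen k)) (blk 1 (1 * AS (\<lambda>k. 0) * 1) 0 1)
      - fval (\<lambda>k. blk (U k) (Z k) 0 (cen k)) (blk W (W * AS Z * 1) 0 1) * blk 0 0 (dg S) 0 =
    dg ic * blk W (W * AS Z * 1) 0 1 * (AS ?\<beta> * (blk 1 (1 * AS (\<lambda>k. 0) * 1) 0 1 * BS (dl (\<lambda>k. blk (cen k) 0 0 (cen k)))) + BS ?\<beta>)"
    by (intro value_difference[OF cv reg_tri[OF U reg_cen Z] reg_tri[OF reg_cen reg_cen zero_pts]])
  then show ?thesis
    unfolding fval_tri by (simp add: AS_blk BS_blk dl_blk BS_center BS_minus distrib_left right_diff_distrib mult.assoc algebra_simps)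
qed

text \<open>Both extensions at once: \<open>T = [0 0; S 0]\<close> between
  \<open>[U Z; 0 cen]\<close> and \<open>[cen \<zeta>; 0 V]\<close>. In the upper right block both
  products of \<open>T\<close> with a value are zero, so only the coefficients remain.\<close>

lemma lla_from_values56:
  assumes cv: "commuting_values" and S: "S \<in> Amp s s" and Z: "Z \<in> pts" and U: "reg U W'"
    and \<zeta>: "\<zeta> \<in> pts" and V: "reg V W"
  shows "dg ic * W' * (AS (\<lambda>k. Z k * dg S) * (AS \<zeta> * (W * BS (dl V)) + BS \<zeta>)
    - AS Z * (AS (brk S) * (AS \<zeta> * (W * BS (dl V)) + BS \<zeta>) + AS (\<lambda>k. dg S * \<zeta> k) * (W * BS (dl V)) + BS (\<lambda>k. dg S * \<zeta> k))) = 0"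
proof -
  let ?\<beta> = "\<lambda>k. blk (- (Z k * dg S)) 0 (brk S k) (dg S * \<zeta> k)"
  have "?\<beta> \<in> pts" using S Z \<zeta> by (intro blk_pts brk_pts right_pts left_pts minus_pts zero_pts)
  moreover have "?\<beta> k = blk 0 0 (dg S) 0 * blk (cen k) (\<zeta> k) 0 (V k) - blk (U k) (Z k) 0 (cen k) * blk 0 0 (dg S) 0" for k
    by (simp add: brk_def)
  ultimately have "blk 0 0 (dg S) 0 * fval (\<lambda>k. blk (cen k) (\<zeta> k) 0 (V k)) (blk 1 (1 * AS \<zeta> * W) 0 W)
      - fval (\<lambda>k. blk (U k) (Z k) 0 (cen k)) (blk W' (W' * AS Z * 1) 0 1) * blk 0 0 (dg S) 0 =
    dg ic * blk W' (W' * AS Z * 1) 0 1 * (AS ?\<beta> * (blk 1 (1 * AS \<zeta> * W) 0 W * BS (dl (\<lambda>k. blk (cen k) (\<zeta> k) 0 (V k)))) + BS ?\<beta>)"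
    by (intro value_difference[OF cv reg_tri[OF U reg_cen Z] reg_tri[OF reg_cen V \<zeta>]])
  then show ?thesis
    unfolding fval_tri by (simp add: AS_blk BS_blk dl_blk BS_center AS_minus BS_minus distrib_left right_diff_distrib mult.assoc algebra_simps)
qed

text \<open>The centre as \<open>V\<close>, where \<open>w = 0\<close>, gives the identities that
  end in \<open>B\<close>. What then remains of the general case is a multiple of \<open>w\<close>,
  which controllability cancels; this gives those that end in \<open>A\<close>. A factor
  \<open>C W\<close> on the left is removed beforehand by observability.\<close>

lemma values_imp_tuple_identities:
  assumes cv: "commuting_values" and o: "observable s d r" and c: "controllable s d r"
    and S: "S \<in> Amp s s" and Z: "Z \<in> pts" and \<zeta>: "\<zeta> \<in> pts"
  shows "dg S * dg ic * BS \<zeta> - dg ic * BS (\<lambda>k. dg S * \<zeta> k) = dg ic * AS (brk S) * BS \<zeta>"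
    and "dg S * dg ic * AS \<zeta> - dg ic * AS (\<lambda>k. dg S * \<zeta> k) = dg ic * AS (brk S) * AS \<zeta>"
    and "BS (\<lambda>k. Z k * dg S) - BS Z * dg S = AS Z * BS (brk S)"
    and "AS (\<lambda>k. Z k * dg S) * BS \<zeta> - AS Z * BS (\<lambda>k. dg S * \<zeta> k) = AS Z * AS (brk S) * BS \<zeta>"
    and "AS (\<lambda>k. Z k * dg S) * AS \<zeta> - AS Z * AS (\<lambda>k. dg S * \<zeta> k) = AS Z * AS (brk S) * AS \<zeta>"
proof -
  have F: "Fin L L (AS \<xi>)" "Fin L s (BS \<xi>)" if "\<xi> \<in> pts" for \<xi>
    using Fin_AS[of \<xi>] Fin_BS[of \<xi>] ptsD[OF that] by auto
  note FS = Fin_dg[OF S] and Fc = Fin_dg[OF ic_Amp]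
  have B: "dg S * dg ic * BS \<zeta> - dg ic * BS (\<lambda>k. dg S * \<zeta> k) = dg ic * AS (brk S) * BS \<zeta>" if "\<zeta> \<in> pts" for \<zeta>
    using lla_from_values2[OF cv S that reg_cen] by (simp add: BS_center distrib_left mult.assoc)
  show "dg S * dg ic * BS \<zeta> - dg ic * BS (\<lambda>k. dg S * \<zeta> k) = dg ic * AS (brk S) * BS \<zeta>" by (rule B[OF \<zeta>])
  define H where "H \<zeta> = dg S * dg ic * AS \<zeta> - dg ic * AS (\<lambda>k. dg S * \<zeta> k) - dg ic * AS (brk S) * AS \<zeta>" for \<zeta>
  have H: "H \<zeta> * (W * BS (dl V)) = 0" if "\<zeta> \<in> pts" "reg V W" for \<zeta> V W
    using lla_from_values2[OF cv S that] B[OF that(1)] by (simp add: H_def algebra_simps)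
  have "H \<zeta> = 0"
  proof (rule ctrl_value[OF c])
    show "Fin s L (H \<zeta>)" unfolding H_def using S \<zeta>
      by (intro Fin_diff Fin_mult[OF Fin_mult[OF FS Fc]] Fin_mult[OF Fin_mult[of s L _ L, OF Fc]] Fin_mult[OF Fc] F left_pts brk_pts)
    fix V W assume "reg V W"
    \<comment> \<open>A direction padded with zero blocks produces the padded \<open>H\<close> that
      \<open>ctrl_value\<close> expects.\<close>
    then have "H (\<lambda>k. blk (\<zeta> k) 0 0 0) * (W * BS (dl V)) = 0" using \<zeta> by (intro H blk_pts zero_pts)
    moreover have "H (\<lambda>k. blk (\<zeta> k) 0 0 0) = blk (H \<zeta>) 0 0 0"
      by (simp add: H_def AS_blk mult.assoc)
    ultimately show "blk (H \<zeta>) 0 0 0 * (W * BS (dl V)) = 0" by simp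
  qed
  then show "dg S * dg ic * AS \<zeta> - dg ic * AS (\<lambda>k. dg S * \<zeta> k) = dg ic * AS (brk S) * AS \<zeta>"
    by (simp add: H_def)
  define G where "G Z = BS (\<lambda>k. Z k * dg S) - BS Z * dg S - AS Z * BS (brk S)" for Z
  have "G Z = 0"
  proof (rule obs_value[OF o])
    show "Fin L s (G Z)" unfolding G_def using S Z
      by (intro Fin_diff Fin_mult[OF _ FS] Fin_mult[of L L] F right_pts brk_pts)
    fix U W assume U: "reg U W"
    have "(\<lambda>k. blk 0 0 (Z k) 0) \<in> pts" using Z by (intro blk_pts zero_pts)
    from lla_from_values4[OF cv S this U] have "dg ic * W * G (\<lambda>k. blk 0 0 (Z k) 0) = 0" by (simp only: G_def)
    moreover have "G (\<lambda>k. blk 0 0 (Z k) 0) = blk 0 0 (G Z) 0"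
      by (simp add: G_def AS_blk BS_blk)
    ultimately show "dg ic * W * blk 0 0 (G Z) 0 = 0" by simp
  qed
  then show "BS (\<lambda>k. Z k * dg S) - BS Z * dg S = AS Z * BS (brk S)" by (simp add: G_def)
  define x where "x \<zeta> w = AS \<zeta> * w + BS \<zeta>" for \<zeta> w
  define K where "K \<zeta> w Z = AS (\<lambda>k. Z k * dg S) * x \<zeta> w
    - AS Z * (AS (brk S) * x \<zeta> w + AS (\<lambda>k. dg S * \<zeta> k) * w + BS (\<lambda>k. dg S * \<zeta> k))" for \<zeta> w Z
  have K: "K \<zeta> (W * BS (dl V)) Z = 0" if Z: "Z \<in> pts" and \<zeta>: "\<zeta> \<in> pts" and V: "reg V W" for Z \<zeta> V W
  proof (cases "0 < L")
    case True
    have w: "Fin L s (W * BS (dl V))" using V True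
      by (intro Fin_mult[OF Fin_Lam_inverse F(2)]) (auto simp: reg_def dl_pts)
    show ?thesis
    proof (rule obs_value[OF o])
      show "Fin L s (K \<zeta> (W * BS (dl V)) Z)" unfolding K_def x_def using S Z \<zeta>
        by (intro w Fin_diff Fin_add Fin_mult[of L L] F right_pts left_pts brk_pts)
      fix U W' assume U: "reg U W'"
      have "(\<lambda>k. blk 0 0 (Z k) 0) \<in> pts" using Z by (intro blk_pts zero_pts)
      moreover have "(\<lambda>k. blk (\<zeta> k) 0 0 (\<zeta> k)) \<in> pts" using \<zeta> by (intro blk_pts zero_pts)
      ultimately have "dg ic * W' * K (\<lambda>k. blk (\<zeta> k) 0 0 (\<zeta> k)) (blk W (W * AS (\<lambda>k. 0) * W) 0 W * BS (dl (\<lambda>k. blk (V k) 0 0 (V k)))) (\<lambda>k. blk 0 0 (Z k) 0) = 0"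
        using lla_from_values56[OF cv S _ U _ reg_tri[OF V V zero_pts]] by (simp only: K_def x_def)
      moreover have "K (\<lambda>k. blk (\<zeta> k) 0 0 (\<zeta> k)) (blk W (W * AS (\<lambda>k. 0) * W) 0 W * BS (dl (\<lambda>k. blk (V k) 0 0 (V k)))) (\<lambda>k. blk 0 0 (Z k) 0) = blk 0 0 (K \<zeta> (W * BS (dl V)) Z) 0"
        by (simp add: K_def x_def AS_blk BS_blk dl_blk)
      ultimately show "dg ic * W' * blk 0 0 (K \<zeta> (W * BS (dl V)) Z) 0 = 0" by simp
    qed
  next
    case False
    have A: "AS Z = 0" "AS (\<lambda>k. Z k * dg S) = 0" 
      using False Fin_dim0(1) F(1)[OF Z] F(1)[OF right_pts[OF S Z]] by auto
    show ?thesis unfolding K_def A by simp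
  qed
  have B5: "AS (\<lambda>k. Z k * dg S) * BS \<zeta> - AS Z * BS (\<lambda>k. dg S * \<zeta> k) = AS Z * AS (brk S) * BS \<zeta>" if "Z \<in> pts" "\<zeta> \<in> pts" for Z \<zeta>
    using K[OF that reg_cen] by (simp add: K_def x_def BS_center algebra_simps)
  show "AS (\<lambda>k. Z k * dg S) * BS \<zeta> - AS Z * BS (\<lambda>k. dg S * \<zeta> k) = AS Z * AS (brk S) * BS \<zeta>" by (rule B5[OF Z \<zeta>])
  define M where "M Z \<zeta> = AS (\<lambda>k. Z k * dg S) * AS \<zeta> - AS Z * AS (\<lambda>k. dg S * \<zeta> k) - AS Z * AS (brk S) * AS \<zeta>" for Z \<zeta>
  have M: "M Z \<zeta> * (W * BS (dl V)) = 0" if "Z \<in> pts" "\<zeta> \<in> pts" "reg V W" for Z \<zeta> V W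
    using K[OF that] B5[OF that(1,2)] by (simp add: M_def K_def x_def algebra_simps)
  have "M Z \<zeta> = 0"
  proof (rule ctrl_value[OF c])
    show "Fin L L (M Z \<zeta>)" unfolding M_def using S Z \<zeta>
      by (intro Fin_diff Fin_mult[of L L] F right_pts left_pts brk_pts)
    fix V W assume V: "reg V W"
    have "M (\<lambda>k. blk (Z k) 0 0 0) (\<lambda>k. blk (\<zeta> k) 0 0 0) * (W * BS (dl V)) = 0"
      using Z \<zeta> V by (intro M blk_pts zero_pts)
    moreover have "M (\<lambda>k. blk (Z k) 0 0 0) (\<lambda>k. blk (\<zeta> k) 0 0 0) = blk (M Z \<zeta>) 0 0 0"
      by (simp add: M_def AS_blk)
    ultimately show "blk (M Z \<zeta>) 0 0 0 * (W * BS (dl V)) = 0" by simp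
  qed
  then show "AS (\<lambda>k. Z k * dg S) * AS \<zeta> - AS Z * AS (\<lambda>k. dg S * \<zeta> k) = AS Z * AS (brk S) * AS \<zeta>"
    by (simp add: M_def)
qed

theorem values_imp_lla:
  assumes cv: "commuting_values" and o: "observable s d r" and c: "controllable s d r"
  shows "linearized_lost_abbey s d Y r"
  unfolding lla_iff lla_in_def
proof (intro ballI allI impI)
  fix S Z Z' :: "'a rfmat" and i j assume S: "S \<in> Amp s s" and Z: "Z \<in> Amp s s" and Z': "Z' \<in> Amp s s" and i: "i < d" and j: "j < d"
  note p = single_pts[OF Fin_dg[OF Z], of i] single_pts[OF Fin_dg[OF Z'], of j]
  have e: "(\<lambda>k. dg S * single j (dg x) k) = single j (dg (S * x))" "(\<lambda>k. single j (dg x) k * dg S) = single j (dg (x * S))" for x j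
    by (auto simp: single_def)
  have A: "AS (single k (dg x)) = dg (ia k x)" "BS (single k (dg x)) = dg (ib k x)" if "k < d" for k x
    using that by (simp_all add: AS_single' BS_single') (auto intro!: rfmat_eqI simp: ent_rmap ent_dg)
  have b: "AS (brk S) = dg (\<Sum>k<d. ia k (S * iy k - iy k * S))" "BS (brk S) = dg (\<Sum>k<d. ib k (S * iy k - iy k * S))"
    by (auto intro!: rfmat_eqI simp: ent_AS ent_BS ent_dg brk_def)
  have inj: "dg x - dg x' = dg x'' \<Longrightarrow> x - x' = x''" for x x' x'' :: "'a rfmat"
    by (simp flip: dg_hom)
  note I = values_imp_tuple_identities[OF cv o c S, unfolded b]
  show "S * id0 - id0 * S = ic * (\<Sum>k<d. ib k (S * iy k - iy k * S)) \<and>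
    S * ic * ib i Z - ic * ib i (S * Z) = ic * (\<Sum>k<d. ia k (S * iy k - iy k * S)) * ib i Z \<and>
    S * ic * ia i Z - ic * ia i (S * Z) = ic * (\<Sum>k<d. ia k (S * iy k - iy k * S)) * ia i Z \<and>
    ib i (Z * S) - ib i Z * S = ia i Z * (\<Sum>k<d. ib k (S * iy k - iy k * S)) \<and>
    ia i (Z * S) * ib j Z' - ia i Z * ib j (S * Z') = ia i Z * (\<Sum>k<d. ia k (S * iy k - iy k * S)) * ib j Z' \<and>
    ia i (Z * S) * ia j Z' - ia i Z * ia j (S * Z') = ia i Z * (\<Sum>k<d. ia k (S * iy k - iy k * S)) * ia j Z'"
    using lla_from_values1[OF cv S, unfolded b] I(1)[OF p(1) p(1)] I(2)[OF p(1) p(1)] I(3)[OF p(1) p(1)] I(4)[OF p] I(5)[OF p]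
    unfolding e A[OF i] A[OF j] dg_mult[symmetric] by (intro conjI inj)
qed

end

subsection \<open>Kronecker products and periodic elements\<close>

lemma kron_carrier: "P \<in> carrier_mat a b \<Longrightarrow> Q \<in> carrier_mat p q \<Longrightarrow> kron P Q \<in> carrier_mat (a * p) (b * q)"
  by (auto simp: kron_def)

lemma kron_one_left_index:
  assumes "X \<in> carrier_mat n n" "i < m * n" "j < m * n"
  shows "kron (1\<^sub>m m) (X :: 'b::semiring_1 mat) $$ (i, j) = (if i div n = j div n then X $$ (i mod n, j mod n) else 0)"
proof -
  have "i div n < m" "j div n < m" using assms by (auto simp: less_mult_imp_div_less)
  then show ?thesis using assms by (auto simp: kron_def)
qed

lemma div_mod_nested:
  "(i::nat) mod (m * n) div n = i div n mod m" "i mod (m * n) mod n = i mod n" "i div (m * n) = i div n div m"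
proof -
  show "i mod (m * n) div n = i div n mod m"
    unfolding mult.commute[of m] mod_mult2_eq by (cases "n = 0") auto
qed (simp_all add: div_mult2_eq mod_mod_cancel mult.commute[of m])

lemma div_eq_nested: "0 < (m::nat) \<Longrightarrow> (i div (m * n) = j div (m * n) \<and> i div n mod m = j div n mod m) \<longleftrightarrow> i div n = j div n"
  unfolding div_mod_nested(3) by (metis div_mult_mod_eq)

lemma amp_kron_left:
  assumes X: "X \<in> carrier_mat n n" and "0 < m" "0 < n"
  shows "amp (m * n) (m * n) (kron (1\<^sub>m m) X) = amp n n (X :: 'b::comm_ring_1 mat)"
proof (rule rfmat_eqI)
  fix i j
  have "i mod (m * n) < m * n" "j mod (m * n) < m * n" using assms by auto
  then show "ent (amp (m * n) (m * n) (kron (1\<^sub>m m) X)) i j = ent (amp n n X) i j"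
    using assms div_eq_nested[of m i n j]
    by (auto simp: ent_amp kron_one_left_index[OF X] div_mod_nested(1,2))
qed

lemma kron_left_hom:
  fixes X Z :: "'b::comm_ring_1 mat"
  assumes X: "X \<in> carrier_mat n n" and Z: "Z \<in> carrier_mat n n" and "0 < m" "0 < n"
  shows "kron (1\<^sub>m m) (X + Z) = kron (1\<^sub>m m) X + kron (1\<^sub>m m) Z"
    "kron (1\<^sub>m m) (X * Z) = kron (1\<^sub>m m) X * kron (1\<^sub>m m) Z"
    "kron (1\<^sub>m m) X = kron (1\<^sub>m m) Z \<Longrightarrow> X = Z"
proof -
  note k = kron_carrier[OF one_carrier_mat X, of m] kron_carrier[OF one_carrier_mat Z, of m]
  have a: "amp (m * n) (m * n) (kron (1\<^sub>m m) X) = amp n n X" if "X \<in> carrier_mat n n" for X :: "'b mat"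
    by (rule amp_kron_left[OF that assms(3,4)])
  have kc: "kron (1\<^sub>m m) X \<in> carrier_mat (m * n) (m * n)" if "X \<in> carrier_mat n n" for X :: "'b mat"
    using kron_carrier[OF one_carrier_mat that] .
  show "kron (1\<^sub>m m) (X + Z) = kron (1\<^sub>m m) X + kron (1\<^sub>m m) Z"
    by (rule amp_inj[of _ "m * n" "m * n"]) (use X Z k kc in \<open>simp_all add: a amp_add\<close>)
  show "kron (1\<^sub>m m) (X * Z) = kron (1\<^sub>m m) X * kron (1\<^sub>m m) Z"
    by (rule amp_inj[of _ "m * n" "m * n"]) (use X Z k kc mult_carrier_mat[OF k] in \<open>simp_all add: a amp_mult[of _ _ "m * n"] amp_mult[of _ _ n]\<close>)
  show "kron (1\<^sub>m m) X = kron (1\<^sub>m m) Z \<Longrightarrow> X = Z"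
    using amp_inj[OF X Z] a[OF X] a[OF Z] by simp
qed

lemma kron_left_scalar:
  assumes "0 < m" "0 < n"
  shows "kron (1\<^sub>m m) (c \<cdot>\<^sub>m 1\<^sub>m n) = c \<cdot>\<^sub>m (1\<^sub>m (m * n) :: 'b::comm_ring_1 mat)"
proof (rule amp_inj[of _ "m * n" "m * n"])
  show "kron (1\<^sub>m m) (c \<cdot>\<^sub>m 1\<^sub>m n) \<in> carrier_mat (m * n) (m * n)"
    by (rule kron_carrier) auto
  show "amp (m * n) (m * n) (kron (1\<^sub>m m) (c \<cdot>\<^sub>m 1\<^sub>m n)) = amp (m * n) (m * n) (c \<cdot>\<^sub>m 1\<^sub>m (m * n))"
    using assms by (simp add: amp_kron_left amp_smult amp_one)
qed simp

lemma amp2_kron_left: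
  fixes X :: "'b::comm_ring_1 mat"
  assumes X: "X \<in> carrier_mat (s * m) (s * m)" and "0 < m" "0 < s"
  shows "amp2 s s (s * m) (kron (1\<^sub>m s) X) = amp2 s s m X"
proof (rule rfmat_eqI)
  fix I J
  have "bl s s (kron (1\<^sub>m s) X) (I mod (s * m)) (J mod (s * m)) =
    (if I div m mod s = J div m mod s then bl s s X (I mod m) (J mod m) else 0\<^sub>m s s)"
  proof (rule eq_matI)
    fix a b assume "a < dim_row (if I div m mod s = J div m mod s then bl s s X (I mod m) (J mod m) else 0\<^sub>m s s)"
      "b < dim_col (if I div m mod s = J div m mod s then bl s s X (I mod m) (J mod m) else 0\<^sub>m s s)"
    then have ab: "a < s" "b < s" by (auto simp: bl_def split: if_splits)
    have lt: "I mod (s * m) * s + a < s * (s * m)" "J mod (s * m) * s + b < s * (s * m)"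
      using ab assms by (auto intro: block_index_less)
    have div: "(K mod (s * m) * s + e) div (s * m) = K div m mod s" "(K mod (s * m) * s + e) mod (s * m) = K mod m * s + e"
      if "e < s" for K e
    proof -
      have "(K mod (s * m) * s + e) div (s * m) = (K mod (s * m) * s + e) div s div m" by (simp add: div_mult2_eq)
      also have "(K mod (s * m) * s + e) div s = K mod (s * m)" using that by simp
      finally show "(K mod (s * m) * s + e) div (s * m) = K div m mod s" by (simp add: div_mod_nested)
      show "(K mod (s * m) * s + e) mod (s * m) = K mod m * s + e"
        unfolding mod_mult2_eq[of "K mod (s * m) * s + e" s m] using that by (simp add: mod_mod_cancel)
    qed
    show "bl s s (kron (1\<^sub>m s) X) (I mod (s * m)) (J mod (s * m)) $$ (a, b) =
      (if I div m mod s = J div m mod s then bl s s X (I mod m) (J mod m) else 0\<^sub>m s s) $$ (a, b)"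
      using ab by (simp add: bl_def kron_one_left_index[OF X lt] div)
  qed (auto simp: bl_def)
  then show "ent (amp2 s s (s * m) (kron (1\<^sub>m s) X)) I J = ent (amp2 s s m X) I J"
    using assms div_eq_nested[of s I m J] by (auto simp: ent_amp2)
qed

lemma bl_kron_diag:
  assumes "Z \<in> carrier_mat s s" "I < m" "J < m"
  shows "bl s s (kron (1\<^sub>m m) (Z :: 'b::comm_ring_1 mat)) I J = (if I = J then Z else 0\<^sub>m s s)"
proof (rule eq_matI)
  fix a b assume "a < dim_row (if I = J then Z else 0\<^sub>m s s)" "b < dim_col (if I = J then Z else 0\<^sub>m s s)"
  then have ab: "a < s" "b < s" using assms by (auto split: if_splits)
  have "I * s + a < m * s" "J * s + b < m * s"
    using ab assms block_index_less[of I m a s] block_index_less[of J m b s] by (auto simp: mult.commute)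
  then show "bl s s (kron (1\<^sub>m m) Z) I J $$ (a, b) = (if I = J then Z else 0\<^sub>m s s) $$ (a, b)"
    using ab by (simp add: bl_def kron_one_left_index[OF assms(1)])
qed (use assms in \<open>auto simp: bl_def\<close>)

lemma amp2_kron_diag:
  assumes Z: "Z \<in> carrier_mat s s" and m: "0 < m"
  shows "amp2 s s m (kron (1\<^sub>m m) Z) = dg (amp s s (Z :: 'b::comm_ring_1 mat))"
proof (rule rfmat_eqI)
  fix I J
  show "ent (amp2 s s m (kron (1\<^sub>m m) Z)) I J = ent (dg (amp s s Z)) I J"
    using m div_mod_eqI[of m I J] by (cases "I = J") (auto simp: ent_amp2 bl_kron_diag[OF Z] ent_dg)
qed

lemma bl_block_ext:
  assumes "I < m" "J < m" "T (mat_block s X I J) \<in> carrier_mat nr nc"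
  shows "bl nr nc (block_ext s nr nc m T X) I J = T (mat_block s X I J)"
proof (rule eq_matI)
  fix a b assume "a < dim_row (T (mat_block s X I J))" "b < dim_col (T (mat_block s X I J))"
  then have ab: "a < nr" "b < nc" using assms by auto
  then have "I * nr + a < nr * m" "J * nc + b < nc * m" using assms by (auto intro: block_index_less)
  then show "bl nr nc (block_ext s nr nc m T X) I J $$ (a, b) = T (mat_block s X I J) $$ (a, b)"
    using ab by (simp add: bl_def block_ext_def)
qed (use assms in \<open>auto simp: bl_def\<close>)

lemma block_ext_carrier [simp]: "block_ext s nr nc m T X \<in> carrier_mat (nr * m) (nc * m)"
  by (simp add: block_ext_def)

lemma amp2_msum:
  "(\<And>k. k < d \<Longrightarrow> M k \<in> carrier_mat (nr * m) (nc * m)) \<Longrightarrow>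
    amp2 nr nc m (msum (nr * m) (nc * m) d M) = (\<Sum>k<d. amp2 nr nc m (M k))"
proof (induction d)
  case 0
  have "msum (nr * m) (nc * m) 0 M = 0\<^sub>m (nr * m) (nc * m)" by (rule eq_matI) (auto simp: msum_def)
  then show ?case by simp
next
  case (Suc d)
  have "msum (nr * m) (nc * m) (Suc d) M = msum (nr * m) (nc * m) d M + M d"
    by (rule eq_matI) (use Suc.prems[of d] in \<open>auto simp: msum_def\<close>)
  moreover have "msum (nr * m) (nc * m) d M \<in> carrier_mat (nr * m) (nc * m)" by (simp add: msum_def)
  ultimately show ?case using Suc by (simp add: amp2_add)
qed

lemma mat_emb_amp2: "0 < s \<Longrightarrow> 0 < m \<Longrightarrow> mat_emb (s * m) (amp2 s s m) (\<lambda>c::'a::field. dg (dg c))"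
  by unfold_locales (auto simp: amp2_add amp2_mult amp2_smult amp2_one intro: amp2_inj)

lemma mat_emb_amp: "0 < n \<Longrightarrow> mat_emb n (amp n n) (\<lambda>c::'a::field. dg c)"
  by unfold_locales (auto simp: amp_add amp_mult amp_smult amp_one intro: amp_inj)

lemma mat_emb_kron:
  assumes "0 < s" "0 < n"
  shows "mat_emb n (\<lambda>X. amp2 s s n (kron (1\<^sub>m s) X)) (\<lambda>c::'a::field. dg (dg c))"
proof -
  have k: "kron (1\<^sub>m s) X \<in> carrier_mat (s * n) (s * n)" if "X \<in> carrier_mat n n" for X :: "'a mat"
    using kron_carrier[OF one_carrier_mat that] .
  show ?thesis
    by unfold_locales
      (use assms k in \<open>auto simp: kron_left_hom kron_left_scalar amp2_add amp2_mult amp2_smult amp2_one dest: amp2_inj[OF assms(2) k k] intro: kron_left_hom(3)\<close>)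
qed

section \<open>Matrix tuples as points of the ring\<close>

context fm
begin

definition ptm :: "nat \<Rightarrow> 'a mat list \<Rightarrow> nat \<Rightarrow> 'a rfmat rfmat" where
  "ptm m X k = (if k < d then amp2 s s m (X ! k) else 0)"

lemma mat_tuplesD: "X \<in> mat_tuples d n \<Longrightarrow> k < d \<Longrightarrow> X ! k \<in> carrier_mat n n"
  by (auto simp: mat_tuples_def)

lemma ptm_pts: "0 < m \<Longrightarrow> ptm m X \<in> pts"
  using per_amp2[of m s s] by (auto simp: pts_def ptm_def Fin_zero) (auto simp: Fin_def)

lemma pts_imp_ptm:
  assumes "P \<in> pts"
  obtains m X where "0 < m" "X \<in> mat_tuples d (s * m)" "\<And>k. k < d \<Longrightarrow> P k = ptm m X k"
proof -
  obtain m where m: "0 < m" "\<And>k. k < d \<Longrightarrow> per s s m (P k)"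
    using Fin_family[of d s s P] ptsD[OF assms] by blast
  then have "\<forall>k<d. \<exists>Z\<in>carrier_mat (s * m) (s * m). P k = amp2 s s m Z" by (meson per_imp_amp2)
  then obtain Z where Z: "\<And>k. k < d \<Longrightarrow> Z k \<in> carrier_mat (s * m) (s * m) \<and> P k = amp2 s s m (Z k)" by metis
  have "map Z [0..<d] \<in> mat_tuples d (s * m)" using Z by (auto simp: mat_tuples_def)
  moreover have "P k = ptm m (map Z [0..<d]) k" if "k < d" for k using Z that by (simp add: ptm_def)
  ultimately show ?thesis using that m(1) by blast
qed

lemma Lam_cong: "(\<And>k. k < d \<Longrightarrow> P k = P' k) \<Longrightarrow> Lam P = Lam P'"
  and fval_cong: "(\<And>k. k < d \<Longrightarrow> P k = P' k) \<Longrightarrow> fval P W = fval P' W"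
  by (simp_all add: Lam_def fval_def dl_def cong: AS_cong BS_cong)

lemma block_ext_amp2:
  assumes m: "0 < m" and k: "k < d" and X: "X \<in> carrier_mat (s * m) (s * m)"
  shows "amp2 L L m (block_ext s L L m (fmA r k) X) = rmap (ia k) (amp2 s s m X)"
    and "amp2 L s m (block_ext s L s m (fmB r k) X) = rmap (ib k) (amp2 s s m X)"
proof -
  have b: "mat_block s X I J = bl s s X I J" for I J by (simp add: mat_block_def bl_def)
  have c: "mat_block s X I J \<in> carrier_mat s s" for I J by (simp add: mat_block_def)
  show "amp2 L L m (block_ext s L L m (fmA r k) X) = rmap (ia k) (amp2 s s m X)"
    by (rule rfmat_eqI) (use m k in \<open>auto simp: ent_rmap ent_amp2 ia_amp b[symmetric] bl_block_ext[where T = "fmA r k", OF _ _ A_carrier[OF k c]] c\<close>)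
  show "amp2 L s m (block_ext s L s m (fmB r k) X) = rmap (ib k) (amp2 s s m X)"
    by (rule rfmat_eqI) (use m k in \<open>auto simp: ent_rmap ent_amp2 ib_amp b[symmetric] bl_block_ext[where T = "fmB r k", OF _ _ B_carrier[OF k c]] c\<close>)
qed

lemma dl_ptm:
  assumes m: "0 < m" and X: "X \<in> mat_tuples d (s * m)" and k: "k < d"
  shows "X ! k - kron (1\<^sub>m m) (Y ! k) \<in> carrier_mat (s * m) (s * m)"
    "amp2 s s m (X ! k - kron (1\<^sub>m m) (Y ! k)) = dl (ptm m X) k"
proof -
  have K: "kron (1\<^sub>m m) (Y ! k) \<in> carrier_mat (s * m) (s * m)"
    using kron_carrier[OF one_carrier_mat Y_carrier[OF k], of m] by (simp add: mult.commute)
  then show "X ! k - kron (1\<^sub>m m) (Y ! k) \<in> carrier_mat (s * m) (s * m)" by (rule minus_carrier_mat)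
  show "amp2 s s m (X ! k - kron (1\<^sub>m m) (Y ! k)) = dl (ptm m X) k"
    using k by (simp add: amp2_diff[OF mat_tuplesD[OF X k] K] amp2_kron_diag[OF Y_carrier[OF k] m] dl_def ptm_def iy_def)
qed

lemma fm_Lambda_carrier: "fm_Lambda s d Y r m X \<in> carrier_mat (L * m) (L * m)"
  unfolding fm_Lambda_def by (rule minus_carrier_mat) simp

lemma amp2_fm_Lambda:
  assumes m: "0 < m" and X: "X \<in> mat_tuples d (s * m)" and L: "0 < L"
  shows "amp2 L L m (fm_Lambda s d Y r m X) = Lam (ptm m X)"
proof -
  have "amp2 L L m (fm_Lambda s d Y r m X) = 1 - (\<Sum>k<d. rmap (ia k) (dl (ptm m X) k))"
    unfolding fm_Lambda_def
    using m L by (simp add: amp2_diff amp2_one amp2_msum block_ext_amp2 dl_ptm[OF m X])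
  then show ?thesis by (simp add: Lam_def AS_def)
qed

lemma fm_Omega_iff_reg:
  assumes m: "0 < m" and X: "X \<in> mat_tuples d (s * m)"
  shows "X \<in> fm_Omega s d Y r m \<longleftrightarrow> (\<exists>W. reg (ptm m X) W)"
proof (cases "0 < L")
  case L: True
  show ?thesis
  proof
    assume "X \<in> fm_Omega s d Y r m"
    then have "det (fm_Lambda s d Y r m X) \<noteq> 0" by (simp add: fm_Omega_def)
    then obtain W where "Lam (ptm m X) * amp2 L L m W = 1" "amp2 L L m W * Lam (ptm m X) = 1"
      using det_nonzero_unit[OF fm_Lambda_carrier m L] amp2_fm_Lambda[OF m X L] by metis
    then show "\<exists>W. reg (ptm m X) W" using ptm_pts[OF m] unfolding reg_def inverses_def by blast
  next
    assume "\<exists>W. reg (ptm m X) W"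
    then obtain W where "W * amp2 L L m (fm_Lambda s d Y r m X) = 1"
      using amp2_fm_Lambda[OF m X L] unfolding reg_def inverses_def by auto
    from left_inverse_det_nonzero[OF fm_Lambda_carrier m this]
    show "X \<in> fm_Omega s d Y r m" using X by (simp add: fm_Omega_def)
  qed
next
  case False
  have "fm_Lambda s d Y r m X \<in> carrier_mat 0 0" using fm_Lambda_carrier False by simp
  then have "det (fm_Lambda s d Y r m X) = 1" by (rule det_dim_zero)
  moreover have "reg (ptm m X) 1"
    using False Lam_L0 ptm_pts[OF m] by (simp add: reg_def inverses_def)
  ultimately show ?thesis using X by (auto simp: fm_Omega_def)
qed

lemma amp2_kron_C: "0 < m \<Longrightarrow> amp2 s L m (kron (1\<^sub>m m) (fmC r)) = dg ic"
  "kron (1\<^sub>m m) (fmC r) \<in> carrier_mat (s * m) (L * m)"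
proof -
  show kc: "kron (1\<^sub>m m) (fmC r) \<in> carrier_mat (s * m) (L * m)"
    using kron_carrier[OF one_carrier_mat C_carrier, of m] by (simp add: mult.commute)
  assume m: "0 < m"
  have b: "bl s L (kron (1\<^sub>m m) (fmC r)) I J = (if I = J then fmC r else 0\<^sub>m s L)" if "I < m" "J < m" for I J
  proof (rule eq_matI)
    fix a b assume "a < dim_row (if I = J then fmC r else 0\<^sub>m s L)" "b < dim_col (if I = J then fmC r else 0\<^sub>m s L)"
    then have ab: "a < s" "b < L" using C_carrier by (auto split: if_splits)
    have "I * s + a < m * s" "J * L + b < m * L"
      using ab that block_index_less[of I m a s] block_index_less[of J m b L] by (auto simp: mult.commute)
    then show "bl s L (kron (1\<^sub>m m) (fmC r)) I J $$ (a, b) = (if I = J then fmC r else 0\<^sub>m s L) $$ (a, b)"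
      using ab that C_carrier by (auto simp: bl_def kron_def)
  qed (use C_carrier in \<open>auto simp: bl_def\<close>)
  show "amp2 s L m (kron (1\<^sub>m m) (fmC r)) = dg ic"
  proof (rule rfmat_eqI)
    fix I J
    show "ent (amp2 s L m (kron (1\<^sub>m m) (fmC r))) I J = ent (dg ic) I J"
      using m div_mod_eqI[of m I J] by (cases "I = J") (auto simp: ent_amp2 b ent_dg ic_def)
  qed
qed

lemma fm_eval_fval:
  assumes m: "0 < m" and X: "X \<in> mat_tuples d (s * m)" and W: "reg (ptm m X) W"
  shows "fm_eval s d Y r m X \<in> carrier_mat (s * m) (s * m)"
    and "amp2 s s m (fm_eval s d Y r m X) = fval (ptm m X) W"
proof -
  have "X \<in> fm_Omega s d Y r m" using fm_Omega_iff_reg[OF m X] W by blast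
  then have dt: "det (fm_Lambda s d Y r m X) \<noteq> 0" by (simp add: fm_Omega_def)
  obtain V where V: "V \<in> carrier_mat (L * m) (L * m)" "mat_inverse (fm_Lambda s d Y r m X) = Some V"
    "fm_Lambda s d Y r m X * V = 1\<^sub>m (L * m)"
    using det_nonzero_inverse[OF fm_Lambda_carrier dt] by metis
  let ?B = "msum (L * m) (s * m) d (\<lambda>k. block_ext s L s m (fmB r k) (X ! k - kron (1\<^sub>m m) (Y ! k)))"
  have D: "kron (1\<^sub>m m) (fmD r) \<in> carrier_mat (s * m) (s * m)"
    using kron_carrier[OF one_carrier_mat D_carrier, of m] by (simp add: mult.commute)
  note C = amp2_kron_C(2)[of m]
  have CV: "kron (1\<^sub>m m) (fmC r) * V \<in> carrier_mat (s * m) (L * m)" using C V by simp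
  have e: "fm_eval s d Y r m X = kron (1\<^sub>m m) (fmD r) + kron (1\<^sub>m m) (fmC r) * V * ?B"
    unfolding fm_eval_def V(2) by simp
  then show "fm_eval s d Y r m X \<in> carrier_mat (s * m) (s * m)"
    using D CV by (auto intro!: add_carrier_mat mult_carrier_mat[OF CV])
  have B: "amp2 L s m ?B = BS (dl (ptm m X))"
    by (simp add: amp2_msum block_ext_amp2 dl_ptm[OF m X] m BS_def)
  have "amp2 s s m (fm_eval s d Y r m X) = dg id0 + dg ic * amp2 L L m V * amp2 L s m ?B"
    unfolding e amp2_add[OF D mult_carrier_mat[OF CV msum_carrier]] amp2_mult[OF CV msum_carrier] amp2_mult[OF C V(1)]
      amp2_kron_C(1)[OF m] amp2_kron_diag[OF D_carrier m] id0_def ..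
  also have "dg ic * amp2 L L m V * amp2 L s m ?B = dg ic * W * BS (dl (ptm m X))"
  proof (cases "0 < L")
    case True
    have "Lam (ptm m X) * amp2 L L m V = 1"
      using amp2_mult[OF fm_Lambda_carrier V(1)] V(3) amp2_fm_Lambda[OF m X True] amp2_one[OF True m] by metis
    have "W * Lam (ptm m X) = 1" using W by (simp add: reg_def inverses_def)
    have "W * (Lam (ptm m X) * amp2 L L m V) = W * Lam (ptm m X) * amp2 L L m V" by (simp only: mult.assoc)
    then have "amp2 L L m V = W"
      unfolding \<open>Lam (ptm m X) * amp2 L L m V = 1\<close> \<open>W * Lam (ptm m X) = 1\<close> by simp
    then show ?thesis unfolding B by simp
  next
    case False
    then have "ic = 0" by (simp add: ic_def)
    then show ?thesis by simp
  qed
  finally show "amp2 s s m (fm_eval s d Y r m X) = fval (ptm m X) W" by (simp add: fval_def)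
qed

end

subsection \<open>Nc rational functions\<close>

lemma rat_fun_member:
  assumes "F \<in> nc_rat_funs d" "S \<in> F"
  shows "nc_vars S \<subseteq> {..<d}"
  using assms by (auto simp: nc_rat_funs_def quotient_def nc_equiv_def nc_rat_exprs_def)

text \<open>The value of a function rests on a choice of representative. Later arguments do not use
  which one was chosen: they extract it here and treat it as an arbitrary member.\<close>

lemma rat_eval_member:
  assumes "X \<in> rat_dom d n F"
  obtains S where "S \<in> F" "X \<in> nc_dom d n S" "nc_eval n X S = Some (rat_eval d n F X)"
proof -
  have "\<exists>S. S \<in> F \<and> X \<in> nc_dom d n S" using assms by (auto simp: rat_dom_def)
  then have *: "(SOME S. S \<in> F \<and> X \<in> nc_dom d n S) \<in> F \<and> X \<in> nc_dom d n (SOME S. S \<in> F \<and> X \<in> nc_dom d n S)"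
    by (rule someI_ex)
  then have "nc_eval n X (SOME S. S \<in> F \<and> X \<in> nc_dom d n S) = Some (rat_eval d n F X)"
    by (auto simp: nc_dom_def rat_eval_def)
  then show ?thesis using that * by blast
qed

context fm
begin

definition rep_blocks :: "'a nc_expr set \<Rightarrow> bool" where
  "rep_blocks F \<longleftrightarrow> (\<forall>m\<ge>1. rat_dom d (s * m) F = fm_Omega s d Y r m \<and>
            (\<forall>X \<in> rat_dom d (s * m) F. rat_eval d (s * m) F X = fm_eval s d Y r m X))"

definition rep_kron :: "'a nc_expr set \<Rightarrow> bool" where
  "rep_kron F \<longleftrightarrow> (\<forall>n\<ge>1. rat_dom d n F =
              {X \<in> mat_tuples d n. map (kron (1\<^sub>m s)) X \<in> fm_Omega s d Y r n} \<and>
            (\<forall>X \<in> rat_dom d n F.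
               kron (1\<^sub>m s) (rat_eval d n F X) = fm_eval s d Y r n (map (kron (1\<^sub>m s)) X)))"

text \<open>Two points may lie in the domains of different representatives. Their direct sum is a
  single regular point, so one representative \<open>S\<close> has a value there; \<open>T\<close>
  placed in the corner commutes with this point and, by \<open>ev_intertwine\<close>, with the
  value.\<close>

lemma rep_blocks_imp_commuting:
  assumes F: "F \<in> nc_rat_funs d" and rep: "rep_blocks F"
  shows "commuting_values"
  unfolding commuting_values_def
proof (intro allI impI)
  fix P P' W W' T
  assume P: "reg P W" and P': "reg P' W'" and T: "\<forall>k<d. P' k * T = T * P k"
  let ?Q = "\<lambda>k. blk (P' k) 0 0 (P k)" and ?W = "blk W' (W' * AS (\<lambda>k. 0) * W) 0 W"
  have Q: "reg ?Q ?W" by (rule reg_tri[OF P' P zero_pts])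
  then obtain m X where m: "0 < m" and X: "X \<in> mat_tuples d (s * m)" and QX: "\<And>k. k < d \<Longrightarrow> ?Q k = ptm m X k"
    using pts_imp_ptm unfolding reg_def by blast
  have R: "reg (ptm m X) ?W" using Q Lam_cong[OF QX] ptm_pts[OF m] unfolding reg_def by simp
  then have "X \<in> rat_dom d (s * m) F"
    using rep m fm_Omega_iff_reg[OF m X] unfolding rep_blocks_def by (auto simp: Suc_le_eq)
  moreover from this obtain S where S: "S \<in> F" "nc_eval (s * m) X S = Some (rat_eval d (s * m) F X)"
    using rat_eval_member by blast
  ultimately have ev1: "nc_eval (s * m) X S = Some (fm_eval s d Y r m X)"
    using rep m unfolding rep_blocks_def by (auto simp: Suc_le_eq)
  have vars: "nc_vars S \<subseteq> {..<d}" by (rule rat_fun_member[OF F S(1)])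
  interpret e: mat_emb "s * m" "amp2 s s m" "\<lambda>c::'a. dg (dg c)" by (rule mat_emb_amp2[OF s m])
  have "ev (\<lambda>c. dg (dg c)) (\<lambda>k. amp2 s s m (X ! k)) S (amp2 s s m (fm_eval s d Y r m X))"
    using e.nc_eval_imp_ev[OF X vars ev1] by blast
  then have "ev (\<lambda>c. dg (dg c)) ?Q S (fval (ptm m X) ?W)"
    unfolding fm_eval_fval(2)[OF m X R]
    by (subst ev_cong[of _ _ "\<lambda>k. amp2 s s m (X ! k)"]) (use vars QX in \<open>auto simp: ptm_def\<close>)
  then have e: "ev (\<lambda>c. dg (dg c)) ?Q S (fval ?Q ?W)" using fval_cong[of ?Q "ptm m X" ?W, OF QX] by simp
  have "fval ?Q ?W * blk 0 T 0 0 = blk 0 T 0 0 * fval ?Q ?W"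
    by (rule ev_intertwine[OF _ _ e e]) (use T vars in \<open>auto simp: dg2_central\<close>)
  then show "fval P' W' * T = T * fval P W" unfolding fval_tri by simp
qed

lemma rep_blocks_imp_lla:
  "F \<in> nc_rat_funs d \<Longrightarrow> rep_blocks F \<Longrightarrow> observable s d r \<Longrightarrow> controllable s d r \<Longrightarrow> linearized_lost_abbey s d Y r"
  using rep_blocks_imp_commuting values_imp_lla by blast

lemma kron_tuples: "X \<in> mat_tuples d n \<Longrightarrow> map (kron (1\<^sub>m s)) X \<in> mat_tuples d (s * n)"
  using kron_carrier[OF one_carrier_mat, of _ n n s] by (auto simp: mat_tuples_def)

lemma ptm_kron:
  assumes m: "0 < m" and X: "X \<in> mat_tuples d (s * m)"
  shows "ptm (s * m) (map (kron (1\<^sub>m s)) X) = ptm m X"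
proof
  fix k
  show "ptm (s * m) (map (kron (1\<^sub>m s)) X) k = ptm m X k"
    using amp2_kron_left[OF mat_tuplesD[OF X] m s] X by (auto simp: ptm_def mat_tuples_def)
qed

text \<open>The hypothesis is used for tuples of size \<open>n = s * m\<close>; by
  \<open>ptm_kron\<close>, \<open>I \<otimes> X\<close> and \<open>X\<close> are then the same point
  of the ring.\<close>

lemma rep_kron_imp_rep_blocks:
  assumes F: "F \<in> nc_rat_funs d" and rep: "rep_kron F"
  shows "rep_blocks F"
  unfolding rep_blocks_def
proof (intro allI impI conjI ballI)
  fix m :: nat assume "1 \<le> m"
  then have m: "0 < m" "0 < s * m" "1 \<le> s * m" using s by (auto simp: Suc_le_eq)
  note rep' = rep[unfolded rep_kron_def, rule_format, OF m(3)]
  have dom: "rat_dom d (s * m) F = {X \<in> mat_tuples d (s * m). map (kron (1\<^sub>m s)) X \<in> fm_Omega s d Y r (s * m)}"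
    using rep' by blast
  show eq: "rat_dom d (s * m) F = fm_Omega s d Y r m"
  proof -
    have "map (kron (1\<^sub>m s)) X \<in> fm_Omega s d Y r (s * m) \<longleftrightarrow> X \<in> fm_Omega s d Y r m" if "X \<in> mat_tuples d (s * m)" for X
      unfolding fm_Omega_iff_reg[OF m(1) that] fm_Omega_iff_reg[OF m(2) kron_tuples[OF that]] ptm_kron[OF m(1) that] ..
    moreover have "fm_Omega s d Y r m \<subseteq> mat_tuples d (s * m)" by (auto simp: fm_Omega_def)
    ultimately show ?thesis unfolding dom by blast
  qed
  fix X assume X: "X \<in> rat_dom d (s * m) F"
  then have Xt: "X \<in> mat_tuples d (s * m)" using dom by blast
  obtain W where W: "reg (ptm m X) W" using X eq fm_Omega_iff_reg[OF m(1) Xt] by blast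
  then have W': "reg (ptm (s * m) (map (kron (1\<^sub>m s)) X)) W" using ptm_kron[OF m(1) Xt] by simp
  obtain S where S: "S \<in> F" "nc_eval (s * m) X S = Some (rat_eval d (s * m) F X)"
    using rat_eval_member[OF X] by blast
  interpret e: mat_emb "s * m" "amp2 s s m" "\<lambda>c::'a. dg (dg c)" by (rule mat_emb_amp2[OF s m(1)])
  have c: "rat_eval d (s * m) F X \<in> carrier_mat (s * m) (s * m)"
    using e.nc_eval_imp_ev[OF Xt rat_fun_member[OF F S(1)] S(2)] by blast
  have "amp2 s s m (rat_eval d (s * m) F X) = amp2 s s (s * m) (kron (1\<^sub>m s) (rat_eval d (s * m) F X))"
    using amp2_kron_left[OF c m(1) s] by simp
  also have "\<dots> = amp2 s s (s * m) (fm_eval s d Y r (s * m) (map (kron (1\<^sub>m s)) X))" using rep' X by simp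
  also have "\<dots> = fval (ptm m X) W"
    using fm_eval_fval(2)[OF m(2) kron_tuples[OF Xt] W'] ptm_kron[OF m(1) Xt] by simp
  also have "\<dots> = amp2 s s m (fm_eval s d Y r m X)" using fm_eval_fval(2)[OF m(1) Xt W] by simp
  finally show "rat_eval d (s * m) F X = fm_eval s d Y r m X"
    by (rule amp2_inj[OF m(1) c fm_eval_fval(1)[OF m(1) Xt W]])
qed

end

subsection \<open>Values under the lost-abbey conditions\<close>

lemma amp_scalar: "0 < s \<Longrightarrow> amp s s (c \<cdot>\<^sub>m 1\<^sub>m s) = dg (c :: 'b::comm_ring_1)"
  by (simp add: amp_smult amp_one)

lemma kron_one_right_index:
  assumes "X \<in> carrier_mat n n" "i < n * s" "j < n * s"
  shows "kron X (1\<^sub>m s :: 'b::semiring_1 mat) $$ (i, j) = (if i mod s = j mod s then X $$ (i div s, j div s) else 0)"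
proof -
  have "0 < s" using assms by (auto intro: gr0I)
  then show ?thesis using assms by (auto simp: kron_def)
qed

lemma amp2_kron_right:
  fixes X :: "'b::comm_ring_1 mat"
  assumes X: "X \<in> carrier_mat n n" and "0 < n" "0 < s"
  shows "amp2 s s n (kron X (1\<^sub>m s)) = rmap dg (amp n n X)"
proof (rule rfmat_eqI)
  fix I J
  have "bl s s (kron X (1\<^sub>m s)) (I mod n) (J mod n) = X $$ (I mod n, J mod n) \<cdot>\<^sub>m 1\<^sub>m s"
  proof (rule eq_matI)
    fix a b assume "a < dim_row (X $$ (I mod n, J mod n) \<cdot>\<^sub>m 1\<^sub>m s)" "b < dim_col (X $$ (I mod n, J mod n) \<cdot>\<^sub>m 1\<^sub>m s)"
    then have ab: "a < s" "b < s" by auto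
    then have "I mod n * s + a < n * s" "J mod n * s + b < n * s"
      using assms block_index_less[of "I mod n" n a s] block_index_less[of "J mod n" n b s] by (auto simp: mult.commute)
    then show "bl s s (kron X (1\<^sub>m s)) (I mod n) (J mod n) $$ (a, b) = (X $$ (I mod n, J mod n) \<cdot>\<^sub>m 1\<^sub>m s) $$ (a, b)"
      using ab by (simp add: bl_def kron_one_right_index[OF X])
  qed (auto simp: bl_def)
  then show "ent (amp2 s s n (kron X (1\<^sub>m s))) I J = ent (rmap dg (amp n n X)) I J"
    using assms by (simp add: ent_amp2 ent_rmap ent_amp amp_scalar)
qed

text \<open>Commuting with the matrix unit \<open>um s 0 i\<close> moves row \<open>i\<close> of
  \<open>B\<close> into row \<open>0\<close>, where it must be \<open>B $$ (0, 0)\<close> times a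
  unit row.\<close>

lemma scalar_if_commuting:
  assumes B: "B \<in> carrier_mat s s" and "0 < s"
    and com: "\<And>S. S \<in> carrier_mat s s \<Longrightarrow> amp s s B * amp s s S = amp s s S * amp s s (B :: 'a::field mat)"
  shows "B = B $$ (0, 0) \<cdot>\<^sub>m 1\<^sub>m s"
proof (rule eq_matI)
  fix i j assume "i < dim_row (B $$ (0, 0) \<cdot>\<^sub>m 1\<^sub>m s)" "j < dim_col (B $$ (0, 0) \<cdot>\<^sub>m 1\<^sub>m s)"
  then have ij: "i < s" "j < s" by auto
  let ?S = "um s 0 i :: 'a mat"
  have "amp s s (B * ?S) = amp s s (?S * B)" using com[of ?S] B by (simp add: amp_mult[of _ _ s])
  then have e: "B * ?S = ?S * B"
    by (rule amp_inj[rotated 2]) (rule mult_carrier_mat[OF B um_carrier] mult_carrier_mat[OF um_carrier B])+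
  have "(B * ?S) $$ (0, j) = (\<Sum>l<s. B $$ (0, l) * ?S $$ (l, j))"
    using B ij assms by (simp add: scalar_prod_def atLeast0LessThan um_def)
  also have "\<dots> = (\<Sum>l<s. if l = 0 then if j = i then B $$ (0, 0) else 0 else 0)"
    by (rule sum.cong) (use ij in \<open>auto simp: um_def\<close>)
  finally have 1: "(B * ?S) $$ (0, j) = (if j = i then B $$ (0, 0) else 0)" using assms by simp
  have "(?S * B) $$ (0, j) = (\<Sum>l<s. ?S $$ (0, l) * B $$ (l, j))"
    using B ij assms by (simp add: scalar_prod_def atLeast0LessThan um_def)
  also have "\<dots> = (\<Sum>l<s. if l = i then B $$ (i, j) else 0)"
    by (rule sum.cong) (use ij assms in \<open>auto simp: um_def\<close>)
  finally have "(?S * B) $$ (0, j) = B $$ (i, j)" using ij by simp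
  then show "B $$ (i, j) = (B $$ (0, 0) \<cdot>\<^sub>m 1\<^sub>m s) $$ (i, j)" using 1 e ij by simp
qed (use B in auto)

text \<open>The permutation that exchanges the two tensor factors.\<close>
definition swap_mat :: "nat \<Rightarrow> nat \<Rightarrow> 'b::{zero,one} mat" where
  "swap_mat s n = mat (s * n) (s * n) (\<lambda>(i, j). if j = i mod n * s + i div n then 1 else 0)"

lemma swap_index:
  fixes i j s n :: nat
  assumes "i < s * n" "j < s * n"
  shows "j = i mod n * s + i div n \<longleftrightarrow> i = j mod s * n + j div s"
    and "i mod n * s + i div n < s * n" "j mod s * n + j div s < s * n"
proof -
  have n: "0 < n" "0 < s" using assms by (auto intro: gr0I)
  have id: "i div n < s" "j div s < n" using assms by (auto simp: less_mult_imp_div_less mult.commute)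
  show "j = i mod n * s + i div n \<longleftrightarrow> i = j mod s * n + j div s"
  proof
    assume "j = i mod n * s + i div n"
    then have "j mod s = i div n" "j div s = i mod n" using id n by auto
    then show "i = j mod s * n + j div s" by simp
  next
    assume "i = j mod s * n + j div s"
    then have "i mod n = j div s" "i div n = j mod s" using id n by auto
    then show "j = i mod n * s + i div n" by simp
  qed
  show "i mod n * s + i div n < s * n" "j mod s * n + j div s < s * n"
    using block_index_less[of "i mod n" n "i div n" s] block_index_less[of "j mod s" s "j div s" n] id n
    by (simp_all add: mult.commute)
qed

lemma swap_mat_carrier [simp]: "swap_mat s n \<in> carrier_mat (s * n) (s * n)" by (simp add: swap_mat_def)

lemma mult_swap_mat:
  fixes K :: "'b::comm_ring_1 mat"
  assumes K: "K \<in> carrier_mat (s * n) (s * n)" and ij: "i < s * n" "j < s * n"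
  shows "(K * swap_mat s n) $$ (i, j) = K $$ (i, j mod s * n + j div s)"
    and "(swap_mat s n * K) $$ (i, j) = K $$ (i mod n * s + i div n, j)"
proof -
  have "(K * swap_mat s n) $$ (i, j) = (\<Sum>l<s * n. K $$ (i, l) * swap_mat s n $$ (l, j))"
    using K ij by (simp add: scalar_prod_def atLeast0LessThan swap_mat_def)
  also have "\<dots> = (\<Sum>l<s * n. if l = j mod s * n + j div s then K $$ (i, l) else 0)"
    by (rule sum.cong) (use ij swap_index(1)[of _ s n j] in \<open>auto simp: swap_mat_def\<close>)
  finally show "(K * swap_mat s n) $$ (i, j) = K $$ (i, j mod s * n + j div s)"
    using swap_index(3)[OF ij] by simp
  have "(swap_mat s n * K) $$ (i, j) = (\<Sum>l<s * n. swap_mat s n $$ (i, l) * K $$ (l, j))"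
    using K ij by (simp add: scalar_prod_def atLeast0LessThan swap_mat_def)
  also have "\<dots> = (\<Sum>l<s * n. if l = i mod n * s + i div n then K $$ (l, j) else 0)"
    by (rule sum.cong) (use ij in \<open>auto simp: swap_mat_def\<close>)
  finally show "(swap_mat s n * K) $$ (i, j) = K $$ (i mod n * s + i div n, j)"
    using swap_index(2)[OF ij] by simp
qed

lemma swap_mat_kron:
  fixes X :: "'b::comm_ring_1 mat"
  assumes X: "X \<in> carrier_mat n n"
  shows "kron (1\<^sub>m s) X * swap_mat s n = swap_mat s n * kron X (1\<^sub>m s)"
proof (rule eq_matI)
  have K: "kron (1\<^sub>m s) X \<in> carrier_mat (s * n) (s * n)" using kron_carrier[OF one_carrier_mat X] .
  have K': "kron X (1\<^sub>m s) \<in> carrier_mat (s * n) (s * n)" using kron_carrier[OF X one_carrier_mat, of s] by (simp add: mult.commute)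
  fix i j assume "i < dim_row (swap_mat s n * kron X (1\<^sub>m s))" "j < dim_col (swap_mat s n * kron X (1\<^sub>m s))"
  then have ij: "i < s * n" "j < s * n" using K' by (auto simp: swap_mat_def)
  have id: "i div n < s" "j div s < n" using ij by (auto simp: less_mult_imp_div_less mult.commute)
  note lt = swap_index(2,3)[OF ij]
  show "(kron (1\<^sub>m s) X * swap_mat s n) $$ (i, j) = (swap_mat s n * kron X (1\<^sub>m s)) $$ (i, j)"
    unfolding mult_swap_mat(1)[OF K ij] mult_swap_mat(2)[OF K' ij]
      kron_one_left_index[OF X ij(1) lt(2)] 
    using kron_one_right_index[OF X, of "i mod n * s + i div n" s j] ij lt id by (auto simp: mult.commute)
next
  show "dim_row (kron (1\<^sub>m s) X * swap_mat s n) = dim_row (swap_mat s n * kron X (1\<^sub>m s))"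
    "dim_col (kron (1\<^sub>m s) X * swap_mat s n) = dim_col (swap_mat s n * kron X (1\<^sub>m s))"
    using X by (auto simp: kron_def swap_mat_def)
qed

lemma swap_mat_inverse:
  "transpose_mat (swap_mat s n) * swap_mat s n = (1\<^sub>m (s * n) :: 'b::comm_ring_1 mat)"
  "swap_mat s n * transpose_mat (swap_mat s n) = (1\<^sub>m (s * n) :: 'b::comm_ring_1 mat)"
proof -
  let ?T = "transpose_mat (swap_mat s n) :: 'b mat"
  have T: "?T \<in> carrier_mat (s * n) (s * n)" by (simp add: swap_mat_def)
  have t: "?T $$ (i, j) = (if i = j mod n * s + j div n then 1 else 0)" if "i < s * n" "j < s * n" for i j
    using that by (auto simp: swap_mat_def)
  show "?T * swap_mat s n = 1\<^sub>m (s * n)"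
  proof (rule eq_matI)
    fix i j assume "i < dim_row (1\<^sub>m (s * n) :: 'b mat)" "j < dim_col (1\<^sub>m (s * n) :: 'b mat)"
    then have ij: "i < s * n" "j < s * n" by auto
    have "j mod s * n + j div s < s * n" by (rule swap_index(3)[OF ij])
    then have "(?T * swap_mat s n) $$ (i, j) = (if j mod s * n + j div s = i mod s * n + i div s then 1 else 0)"
      unfolding mult_swap_mat(1)[OF T ij] using t[OF ij(1)] swap_index(1)[OF _ ij(1)] by auto
    moreover have "j mod s * n + j div s = i mod s * n + i div s \<longleftrightarrow> i = j"
      using swap_index(1)[of "j mod s * n + j div s" s n i] swap_index(1)[of "j mod s * n + j div s" s n j]
        swap_index(3)[OF ij] ij by auto
    ultimately show "(?T * swap_mat s n) $$ (i, j) = 1\<^sub>m (s * n) $$ (i, j)" using ij by simp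
  qed (use T in \<open>auto simp: swap_mat_def\<close>)
  show "swap_mat s n * ?T = 1\<^sub>m (s * n)"
  proof (rule eq_matI)
    fix i j assume "i < dim_row (1\<^sub>m (s * n) :: 'b mat)" "j < dim_col (1\<^sub>m (s * n) :: 'b mat)"
    then have ij: "i < s * n" "j < s * n" by auto
    have lt: "i mod n * s + i div n < s * n" by (rule swap_index(2)[OF ij])
    have "(swap_mat s n * ?T) $$ (i, j) = (if i mod n * s + i div n = j mod n * s + j div n then 1 else 0)"
      unfolding mult_swap_mat(2)[OF T ij] t[OF lt ij(2)] ..
    moreover have "i mod n * s + i div n = j mod n * s + j div n \<longleftrightarrow> i = j"
      using swap_index(1)[OF ij(1) lt] swap_index(1)[OF ij(2) lt] by auto
    ultimately show "(swap_mat s n * ?T) $$ (i, j) = 1\<^sub>m (s * n) $$ (i, j)" using ij by simp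
  qed (use T in \<open>auto simp: swap_mat_def\<close>)
qed

context fm
begin

lemma fm_lla_instance:
  assumes "linearized_lost_abbey s d Y r"
  shows "fm_lla d ia ib ic id0 iy (Amp s s)"
proof -
  have l: lla_in using assms lla_iff by blast
  show ?thesis
    by unfold_locales (use l d in \<open>auto simp: lla_in_def iy_Amp intro: Amp_closed\<close>)
qed

lemma Fin_Inn: "linearized_lost_abbey s d Y r \<Longrightarrow> Fin s s (P :: 'a rfmat rfmat) \<Longrightarrow> P \<in> fm_lla.Inn (Amp s s)"
  by (auto simp: fm_lla.Inn_def[OF fm_lla_instance] Fin_ent)

text \<open>The direction matters: an intertwiner with a left inverse pulls invertibility of the
  pencil back from \<open>P'\<close> to \<open>P\<close>. Finite size makes the resulting left
  inverse two-sided.\<close>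

lemma reg_transfer:
  assumes lla: "linearized_lost_abbey s d Y r"
    and T: "Fin s s T" "Fin s s T'" "T' * T = 1" and P: "P \<in> pts" and P': "reg P' W'"
    and PT: "\<And>k. k < d \<Longrightarrow> P' k * T = T * P k"
  shows "\<exists>W. reg P W"
proof (cases "0 < L")
  case True
  interpret fm_lla d ia ib ic id0 iy "Amp s s" by (rule fm_lla_instance[OF lla])
  have i: "Fin s s Q \<Longrightarrow> Q \<in> Inn" for Q :: "'a rfmat rfmat" by (rule Fin_Inn[OF lla])
  have "\<exists>G. G * Lam P = 1"
    by (rule Lam_left_inverse[of T P P' T' W']) (use T P P' PT i in \<open>auto simp: reg_def pts_def\<close>)
  then obtain G where G: "G * Lam P = 1" by blast
  have "Fin L L (Lam P)"
    unfolding Lam_def using P True by (intro Fin_diff Fin_one Fin_AS) (auto intro: ptsD dl_pts)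
  from Fin_left_inverse(2)[OF this True G] show ?thesis using G P unfolding reg_def inverses_def by blast
next
  case False
  then show ?thesis using Lam_L0[OF _ P] P by (auto simp: reg_def inverses_def)
qed

lemma reg_intertwine:
  assumes lla: "linearized_lost_abbey s d Y r" and T: "Fin s s T" and P: "reg P W" and P': "reg P' W'"
    and PT: "\<And>k. k < d \<Longrightarrow> P' k * T = T * P k"
  shows "fval P' W' * T = T * fval P W"
proof -
  interpret fm_lla d ia ib ic id0 iy "Amp s s" by (rule fm_lla_instance[OF lla])
  have i: "Fin s s Q \<Longrightarrow> Q \<in> Inn" for Q :: "'a rfmat rfmat" by (rule Fin_Inn[OF lla])
  show ?thesis by (rule fval_intertwine) (use T P P' PT i in \<open>auto simp: reg_def pts_def\<close>)
qed

text \<open>The point \<open>X \<otimes> I\<^sub>s\<close>, which \<open>swap_mat\<close> intertwines with \<open>I\<^sub>s \<otimes> X\<close>.\<close>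
definition spt :: "nat \<Rightarrow> 'a mat list \<Rightarrow> nat \<Rightarrow> 'a rfmat rfmat" where
  "spt n X k = (if k < d then rmap dg (amp n n (X ! k)) else 0)"

lemma spt_ptm:
  assumes "0 < n" "X \<in> mat_tuples d n"
  shows "spt n X = ptm n (map (\<lambda>x. kron x (1\<^sub>m s)) X)" "map (\<lambda>x. kron x (1\<^sub>m s)) X \<in> mat_tuples d (s * n)"
proof -
  show "spt n X = ptm n (map (\<lambda>x. kron x (1\<^sub>m s)) X)"
    using assms amp2_kron_right[OF mat_tuplesD[OF assms(2)] assms(1) s]
    by (auto simp: fun_eq_iff spt_def ptm_def mat_tuples_def)
  show "map (\<lambda>x. kron x (1\<^sub>m s)) X \<in> mat_tuples d (s * n)"
    using assms kron_carrier[OF _ one_carrier_mat, of _ n n s] by (auto simp: mat_tuples_def mult.commute)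
qed

lemma kron_spt:
  assumes n: "0 < n" and X: "X \<in> mat_tuples d n" and k: "k < d"
  shows "ptm n (map (kron (1\<^sub>m s)) X) k * amp2 s s n (swap_mat s n) = amp2 s s n (swap_mat s n) * spt n X k"
proof -
  have K: "kron (1\<^sub>m s) (X ! k) \<in> carrier_mat (s * n) (s * n)" using kron_carrier[OF one_carrier_mat mat_tuplesD[OF X k]] .
  have K': "kron (X ! k) (1\<^sub>m s) \<in> carrier_mat (s * n) (s * n)"
    using kron_carrier[OF mat_tuplesD[OF X k] one_carrier_mat, of s] by (simp add: mult.commute)
  have "ptm n (map (kron (1\<^sub>m s)) X) k * amp2 s s n (swap_mat s n) = amp2 s s n (kron (1\<^sub>m s) (X ! k) * swap_mat s n)"
    using k X by (simp add: ptm_def amp2_mult[OF K swap_mat_carrier] mat_tuples_def)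
  also have "\<dots> = amp2 s s n (swap_mat s n * kron (X ! k) (1\<^sub>m s))"
    by (simp add: swap_mat_kron[OF mat_tuplesD[OF X k]])
  also have "\<dots> = amp2 s s n (swap_mat s n) * spt n X k"
    using k amp2_kron_right[OF mat_tuplesD[OF X k] n s] by (simp add: spt_def amp2_mult[OF swap_mat_carrier K'])
  finally show ?thesis .
qed

lemma swap_units:
  assumes n: "0 < n"
  shows "Fin s s (amp2 s s n (swap_mat s n :: 'a mat))" "Fin s s (amp2 s s n (transpose_mat (swap_mat s n) :: 'a mat))"
    "amp2 s s n (transpose_mat (swap_mat s n)) * amp2 s s n (swap_mat s n) = (1 :: 'a rfmat rfmat)"
    "amp2 s s n (swap_mat s n) * amp2 s s n (transpose_mat (swap_mat s n)) = (1 :: 'a rfmat rfmat)"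
proof -
  have t: "transpose_mat (swap_mat s n :: 'a mat) \<in> carrier_mat (s * n) (s * n)" by (simp add: swap_mat_def)
  show "Fin s s (amp2 s s n (swap_mat s n :: 'a mat))" "Fin s s (amp2 s s n (transpose_mat (swap_mat s n) :: 'a mat))"
    using per_amp2[OF n] unfolding Fin_def by blast+
  show "amp2 s s n (transpose_mat (swap_mat s n)) * amp2 s s n (swap_mat s n) = (1 :: 'a rfmat rfmat)"
    "amp2 s s n (swap_mat s n) * amp2 s s n (transpose_mat (swap_mat s n)) = (1 :: 'a rfmat rfmat)"
    unfolding amp2_mult[OF t swap_mat_carrier, symmetric] amp2_mult[OF swap_mat_carrier t, symmetric] swap_mat_inverse
    by (rule amp2_one[OF s n])+
qed

text \<open>As \<open>reg_transfer\<close> works in one direction, it is applied to the permutation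
  and to its inverse.\<close>

lemma kron_Omega_iff:
  assumes lla: "linearized_lost_abbey s d Y r" and n: "0 < n" and X: "X \<in> mat_tuples d n"
  shows "map (kron (1\<^sub>m s)) X \<in> fm_Omega s d Y r n \<longleftrightarrow> (\<exists>W. reg (spt n X) W)"
proof -
  let ?T = "amp2 s s n (swap_mat s n)" and ?T' = "amp2 s s n (transpose_mat (swap_mat s n))"
  let ?P = "ptm n (map (kron (1\<^sub>m s)) X)"
  note u = swap_units[OF n]
  have sp: "spt n X \<in> pts" using spt_ptm[OF n X] ptm_pts[OF n] by simp
  have bk: "spt n X k * ?T' = ?T' * ?P k" if "k < d" for k
  proof -
    have "?T' * (?P k * ?T) * ?T' = ?T' * (?T * spt n X k) * ?T'" using kron_spt[OF n X that] by simp
    moreover have "?T' * (?P k * ?T) * ?T' = ?T' * ?P k" using u(4) by (simp add: mult.assoc)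
    moreover have "?T' * (?T * spt n X k) * ?T' = spt n X k * ?T'" using u(3) by (simp flip: mult.assoc)
    ultimately show ?thesis by simp
  qed
  show ?thesis unfolding fm_Omega_iff_reg[OF n kron_tuples[OF X]]
    using reg_transfer[OF lla u(1,2,3) sp _ kron_spt[OF n X]] reg_transfer[OF lla u(2,1,4) ptm_pts[OF n] _ bk] by blast
qed

text \<open>Every block of \<open>X \<otimes> I\<close> is scalar, so each constant
  \<open>dg x\<close> intertwines this point with itself and commutes with the value. Hence the
  blocks of the value commute with all matrices and are scalar too.\<close>

lemma scalar_value:
  assumes lla: "linearized_lost_abbey s d Y r" and n: "0 < n" and X: "X \<in> mat_tuples d n" and W: "reg (spt n X) W"
  obtains \<phi> where "\<phi> \<in> carrier_mat n n" "fval (spt n X) W = rmap dg (amp n n \<phi>)"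
proof -
  note sp = spt_ptm[OF n X]
  obtain E where E: "E \<in> carrier_mat (s * n) (s * n)" "fval (spt n X) W = amp2 s s n E"
    using fm_eval_fval[OF n sp(2)] W sp(1) by metis
  define \<phi> where "\<phi> = mat n n (\<lambda>(I, J). E $$ (I * s, J * s))"
  have cm: "fval (spt n X) W * dg x = dg x * fval (spt n X) W" if "x \<in> Amp s s" for x
    by (rule reg_intertwine[OF lla Fin_dg[OF that] W W])
      (auto intro!: rfmat_eqI simp: spt_def ent_rmap dg_comm)
  have b: "bl s s E I J = E $$ (I * s, J * s) \<cdot>\<^sub>m 1\<^sub>m s" if "I < n" "J < n" for I J
  proof -
    have "bl s s E I J = bl s s E I J $$ (0, 0) \<cdot>\<^sub>m 1\<^sub>m s"
    proof (rule scalar_if_commuting[OF bl_carrier s])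
      fix S :: "'a mat" assume "S \<in> carrier_mat s s"
      then have "ent (fval (spt n X) W * dg (amp s s S)) I J = ent (dg (amp s s S) * fval (spt n X) W) I J"
        using cm[OF amp_in_Amp] by simp
      then show "amp s s (bl s s E I J) * amp s s S = amp s s S * amp s s (bl s s E I J)"
        using that n by (simp add: E(2) ent_amp2)
    qed
    then show ?thesis using s by (simp add: bl_def)
  qed
  have "fval (spt n X) W = rmap dg (amp n n \<phi>)"
    unfolding E(2) by (rule rfmat_eqI) (use n s in \<open>auto simp: ent_amp2 b ent_rmap ent_amp amp_scalar \<phi>_def\<close>)
  then show ?thesis using that[of \<phi>] by (simp add: \<phi>_def)
qed

lemma kron_value:
  assumes lla: "linearized_lost_abbey s d Y r" and n: "0 < n" and X: "X \<in> mat_tuples d n" and W: "reg (spt n X) W"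
    and \<phi>: "\<phi> \<in> carrier_mat n n" "fval (spt n X) W = rmap dg (amp n n \<phi>)"
  shows "fm_eval s d Y r n (map (kron (1\<^sub>m s)) X) = kron (1\<^sub>m s) \<phi>"
proof -
  let ?T = "amp2 s s n (swap_mat s n)" and ?T' = "amp2 s s n (transpose_mat (swap_mat s n))"
  let ?P = "ptm n (map (kron (1\<^sub>m s)) X)"
  note u = swap_units[OF n] and kt = kron_tuples[OF X]
  have K: "kron (1\<^sub>m s) \<phi> \<in> carrier_mat (s * n) (s * n)" using kron_carrier[OF one_carrier_mat \<phi>(1)] .
  have K': "kron \<phi> (1\<^sub>m s) \<in> carrier_mat (s * n) (s * n)"
    using kron_carrier[OF \<phi>(1) one_carrier_mat, of s] by (simp add: mult.commute)
  obtain W' where W': "reg ?P W'"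
    using kron_Omega_iff[OF lla n X] W fm_Omega_iff_reg[OF n kt] by blast
  have "fval ?P W' * ?T = ?T * amp2 s s n (kron \<phi> (1\<^sub>m s))"
    using reg_intertwine[OF lla u(1) W W' kron_spt[OF n X]] \<phi>(2) amp2_kron_right[OF \<phi>(1) n s] by simp
  also have "\<dots> = amp2 s s n (kron (1\<^sub>m s) \<phi>) * ?T"
    unfolding amp2_mult[OF swap_mat_carrier K', symmetric] swap_mat_kron[OF \<phi>(1), symmetric]
    by (rule amp2_mult[OF K swap_mat_carrier])
  finally have "fval ?P W' * ?T * ?T' = amp2 s s n (kron (1\<^sub>m s) \<phi>) * ?T * ?T'" by simp
  then have "fval ?P W' = amp2 s s n (kron (1\<^sub>m s) \<phi>)" using u(4) by (simp add: mult.assoc)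
  then show ?thesis
    using fm_eval_fval[OF n kt W'] amp2_inj[OF n _ K] by metis
qed

end

subsection \<open>Families of matrices as matrices of matrices\<close>

text \<open>A matrix with entries in \<open>'b rfmat\<close> as a matrix over \<open>'b rfmat\<close>: the two levels are exchanged.\<close>
definition psi :: "nat \<Rightarrow> nat \<Rightarrow> (nat \<Rightarrow> nat \<Rightarrow> 'b::comm_ring_1 rfmat) \<Rightarrow> 'b rfmat rfmat" where
  "psi nr nc F = Rfmat (\<lambda>I J. amp nr nc (mat nr nc (\<lambda>(i, j). ent (F i j) I J)))"

definition unpsi :: "'b::comm_ring_1 rfmat rfmat \<Rightarrow> nat \<Rightarrow> nat \<Rightarrow> 'b rfmat" where
  "unpsi P i j = Rfmat (\<lambda>I J. ent (ent P I J) i j)"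

lemma ent_psi: "ent (psi nr nc F) I J = amp nr nc (mat nr nc (\<lambda>(i, j). ent (F i j) I J))"
proof -
  let ?f = "\<lambda>I J. amp nr nc (mat nr nc (\<lambda>(i, j). ent (F i j) I J))"
  have "finite {J. ?f I J \<noteq> 0}" for I
  proof (rule finite_subset)
    show "finite (\<Union>i\<in>{..<nr}. \<Union>j\<in>{..<nc}. {J. ent (F i j) I J \<noteq> 0})" using finite_ent by blast
    show "{J. ?f I J \<noteq> 0} \<subseteq> (\<Union>i\<in>{..<nr}. \<Union>j\<in>{..<nc}. {J. ent (F i j) I J \<noteq> 0})"
    proof
      fix J assume J: "J \<in> {J. ?f I J \<noteq> 0}"
      show "J \<in> (\<Union>i\<in>{..<nr}. \<Union>j\<in>{..<nc}. {J. ent (F i j) I J \<noteq> 0})"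
      proof (rule ccontr)
        assume "J \<notin> (\<Union>i\<in>{..<nr}. \<Union>j\<in>{..<nc}. {J. ent (F i j) I J \<noteq> 0})"
        then have "mat nr nc (\<lambda>(i, j). ent (F i j) I J) = 0\<^sub>m nr nc" by (intro eq_matI) auto
        then show False using J by simp
      qed
    qed
  qed
  then show ?thesis unfolding psi_def by (subst ent_Rfmat) auto
qed

lemma ent_unpsi: "ent (unpsi P i j) I J = ent (ent P I J) i j"
proof -
  have "finite {J. ent (ent P I J) i j \<noteq> 0}" for I
    by (rule finite_subset[OF _ finite_ent[of P I]]) auto
  then show ?thesis unfolding unpsi_def by (subst ent_Rfmat) auto
qed

lemma ent_ent_psi: "ent (ent (psi nr nc F) I J) i j =
    (if 0 < nr \<and> 0 < nc \<and> i div nr = j div nc then ent (F (i mod nr) (j mod nc)) I J else 0)"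
  by (simp add: ent_psi ent_amp)

lemma rfmat2_eqI: "(\<And>I J i j. ent (ent P I J) i j = ent (ent Q I J) i j) \<Longrightarrow> P = Q"
  by (intro rfmat_eqI)

lemma psi_unpsi: "Fin nr nc P \<Longrightarrow> psi nr nc (unpsi P) = P"
proof (rule rfmat2_eqI)
  fix I J i j assume "Fin nr nc P"
  then obtain M where M: "M \<in> carrier_mat nr nc" "ent P I J = amp nr nc M" using Fin_ent unfolding Amp_def by blast
  then show "ent (ent (psi nr nc (unpsi P)) I J) i j = ent (ent P I J) i j"
    by (simp add: ent_ent_psi ent_unpsi ent_amp)
qed

lemma psi_inj: "psi nr nc F = psi nr nc G \<Longrightarrow> i < nr \<Longrightarrow> j < nc \<Longrightarrow> F i j = G i j"
proof (rule rfmat_eqI)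
  fix I J assume h: "psi nr nc F = psi nr nc G" "i < nr" "j < nc"
  then have "ent (ent (psi nr nc F) I J) i j = ent (ent (psi nr nc G) I J) i j" by simp
  then show "ent (F i j) I J = ent (G i j) I J" using h(2,3) by (simp add: ent_ent_psi split: if_splits)
qed

lemma psi_cong: "(\<And>i j. i < nr \<Longrightarrow> j < nc \<Longrightarrow> F i j = G i j) \<Longrightarrow> psi nr nc F = psi nr nc G"
  by (rule rfmat2_eqI) (simp add: ent_ent_psi)

lemma psi_add: "psi nr nc (\<lambda>i j. F i j + G i j) = psi nr nc F + psi nr nc G"
  and psi_diff: "psi nr nc (\<lambda>i j. F i j - G i j) = psi nr nc F - psi nr nc G"
  and psi_zero: "psi nr nc (\<lambda>i j. 0) = 0"
  and psi_scal: "psi nr nc (\<lambda>i j. dg c * F i j) = dg (dg c) * psi nr nc F"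
  by (rule rfmat2_eqI, simp add: ent_ent_psi)+

lemma psi_sum: "psi nr nc (\<lambda>i j. \<Sum>k\<in>S. F k i j) = (\<Sum>k\<in>S. psi nr nc (F k))"
  by (rule rfmat2_eqI) (simp add: ent_ent_psi)

lemma psi_one: "0 < n \<Longrightarrow> psi n n (\<lambda>i j. if i = j then 1 else 0) = 1"
  by (rule rfmat2_eqI) (auto simp: ent_ent_psi ent_1 dest: div_mod_eqI)

lemma psi_mult: "psi nr nk F * psi nk nc G = psi nr nc (\<lambda>i j. \<Sum>l<nk. F i l * G l j)"
proof (rule rfmat2_eqI)
  fix I J i j
  let ?S = "\<Union>i\<in>{..<nr}. \<Union>l\<in>{..<nk}. {K. ent (F i l) I K \<noteq> 0}"
  have S: "finite ?S" using finite_ent by blast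
  let ?M = "\<lambda>K. mat nr nk (\<lambda>(i, j). ent (F i j) I K)" and ?N = "\<lambda>K. mat nk nc (\<lambda>(i, j). ent (G i j) K J)"
  have "ent (psi nr nk F * psi nk nc G) I J = (\<Sum>K\<in>?S. ent (psi nr nk F) I K * ent (psi nk nc G) K J)"
  proof (rule ent_times_supp[OF S])
    fix K assume K: "ent (psi nr nk F) I K \<noteq> 0"
    show "K \<in> ?S"
    proof (rule ccontr)
      assume "K \<notin> ?S"
      then have "?M K = 0\<^sub>m nr nk" by (intro eq_matI) auto
      then show False using K by (simp add: ent_psi)
    qed
  qed
  also have "\<dots> = (\<Sum>K\<in>?S. amp nr nc (?M K * ?N K))" by (simp add: ent_psi amp_mult[of _ nr nk _ nc])
  finally have 1: "ent (psi nr nk F * psi nk nc G) I J = (\<Sum>K\<in>?S. amp nr nc (?M K * ?N K))" .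
  show "ent (ent (psi nr nk F * psi nk nc G) I J) i j = ent (ent (psi nr nc (\<lambda>i j. \<Sum>l<nk. F i l * G l j)) I J) i j"
  proof (cases "0 < nr \<and> 0 < nc \<and> i div nr = j div nc")
    case True
    let ?i = "i mod nr" and ?j = "j mod nc"
    have "ent (ent (psi nr nk F * psi nk nc G) I J) i j = (\<Sum>K\<in>?S. \<Sum>l<nk. ent (F ?i l) I K * ent (G l ?j) K J)"
      unfolding 1 using True by (simp add: ent_amp scalar_prod_def atLeast0LessThan)
    also have "\<dots> = (\<Sum>l<nk. \<Sum>K\<in>?S. ent (F ?i l) I K * ent (G l ?j) K J)" by (rule sum.swap)
    also have "\<dots> = (\<Sum>l<nk. ent (F ?i l * G l ?j) I J)"
      using True by (intro sum.cong refl ent_times_supp[OF S, symmetric]) auto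
    finally show ?thesis using True by (simp add: ent_ent_psi)
  next
    case False
    have "ent (\<Sum>K\<in>?S. amp nr nc (?M K * ?N K)) i j = 0" unfolding ent_sum using False by (intro sum.neutral) (auto simp: ent_amp)
    moreover have "ent (ent (psi nr nc (\<lambda>i j. \<Sum>l<nk. F i l * G l j)) I J) i j = 0"
      unfolding ent_ent_psi using False by (rule if_not_P)
    ultimately show ?thesis unfolding 1 by (rule trans[OF _ sym])
  qed
qed

fun fpow :: "nat \<Rightarrow> (nat \<Rightarrow> nat \<Rightarrow> 'r::ring_1) \<Rightarrow> nat \<Rightarrow> nat \<Rightarrow> nat \<Rightarrow> 'r" where
  "fpow n F 0 i j = (if i = j then 1 else 0)"
| "fpow n F (Suc k) i j = (\<Sum>l<n. F i l * fpow n F k l j)"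

lemma psi_fpow: "0 < n \<Longrightarrow> psi n n (fpow n F k) = psi n n F ^ k"
proof (induction k)
  case 0
  have "fpow n F 0 = (\<lambda>i j. if i = j then 1 else 0)" by (simp add: fun_eq_iff)
  then show ?case using 0 by (simp add: psi_one)
next
  case (Suc k)
  have "fpow n F (Suc k) = (\<lambda>i j. \<Sum>l<n. F i l * fpow n F k l j)" by (simp add: fun_eq_iff)
  then show ?case using Suc psi_mult[of n n F n "fpow n F k"] by simp
qed

subsection \<open>Elimination on matrices of expressions\<close>

fun esum :: "(nat \<Rightarrow> 'a::zero nc_expr) \<Rightarrow> nat \<Rightarrow> 'a nc_expr" where
  "esum f 0 = Const 0"
| "esum f (Suc n) = Add (esum f n) (f n)"

lemma ev_esum: "\<kappa> 0 = 0 \<Longrightarrow> (\<And>k. k < n \<Longrightarrow> ev \<kappa> x (f k) (v k)) \<Longrightarrow> ev \<kappa> x (esum f n) (\<Sum>k<n. v k)"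
  by (induction n) auto

lemma vars_esum: "nc_vars (esum f n) = (\<Union>k<n. nc_vars (f k))"
  by (induction n) (auto simp: less_Suc_eq)

fun epow :: "nat \<Rightarrow> (nat \<Rightarrow> nat \<Rightarrow> 'a::zero_neq_one nc_expr) \<Rightarrow> nat \<Rightarrow> nat \<Rightarrow> nat \<Rightarrow> 'a nc_expr" where
  "epow n F 0 i j = Const (if i = j then 1 else 0)"
| "epow n F (Suc k) i j = esum (\<lambda>l. Mul (F i l) (epow n F k l j)) n"

lemma ev_MulI: "ev \<kappa> x R a \<Longrightarrow> ev \<kappa> x S b \<Longrightarrow> ev \<kappa> x (Mul R S) (a * b)"
  and ev_AddI: "ev \<kappa> x R a \<Longrightarrow> ev \<kappa> x S b \<Longrightarrow> ev \<kappa> x (Add R S) (a + b)"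
  by auto

lemma ev_epow:
  assumes "\<kappa> 0 = 0" "\<kappa> 1 = 1" "\<And>i j. ev \<kappa> x (F i j) (f i j)"
  shows "ev \<kappa> x (epow n F k i j) (fpow n f k i j)"
proof (induction k arbitrary: i j)
  case (Suc k)
  then show ?case unfolding epow.simps fpow.simps by (intro ev_esum ev_MulI assms)
qed (use assms in auto)

lemma vars_epow: "(\<And>i j. nc_vars (F i j) \<subseteq> V) \<Longrightarrow> nc_vars (epow n F k i j) \<subseteq> V"
  by (induction k arbitrary: i j) (auto simp: vars_esum, blast)

text \<open>Iterated Schur complements with the pivots at \<open>0, ..., p - 1\<close>. All entries
  of a stage share the same pivots, so, if the entries of \<open>E\<close> have values, one defined
  entry makes the whole stage defined.\<close>

fun elim :: "nat \<Rightarrow> (nat \<Rightarrow> nat \<Rightarrow> 'a::field nc_expr) \<Rightarrow> nat \<Rightarrow> nat \<Rightarrow> 'a nc_expr" where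
  "elim 0 E i j = E i j"
| "elim (Suc p) E i j = Add (elim p E i j)
     (Mul (Const (-1)) (Mul (elim p E i p) (Mul (Inv (elim p E p p)) (elim p E p j))))"

lemma vars_elim: "(\<And>i j. nc_vars (E i j) \<subseteq> V) \<Longrightarrow> nc_vars (elim p E i j) \<subseteq> V"
proof (induction p arbitrary: i j)
  case (Suc p)
  then have "nc_vars (elim p E i j) \<subseteq> V" for i j by blast
  then show ?case by auto
qed auto

text \<open>Elimination leaves an identity block unchanged: each pivot is \<open>1\<close> and the
  entries subtracted from the rest of the block are zero.\<close>

lemma elim_defined:
  fixes x :: "nat \<Rightarrow> 'r::ring_1"
  assumes \<kappa>: "\<kappa> (-1) = -1" and E: "\<And>i j. ev \<kappa> x (E i j) (e i j)"
    and one: "\<And>i j. i < N \<Longrightarrow> j < N \<Longrightarrow> e i j = (if i = j then 1 else 0)"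
  shows "p \<le> N \<Longrightarrow> \<exists>f. (\<forall>i j. ev \<kappa> x (elim p E i j) (f i j)) \<and>
    (\<forall>i j. p \<le> i \<longrightarrow> i < N \<longrightarrow> p \<le> j \<longrightarrow> j < N \<longrightarrow> f i j = (if i = j then 1 else 0))"
proof (induction p)
  case 0
  then show ?case using E one by (intro exI[of _ e]) auto
next
  case (Suc p)
  then obtain f where f: "\<And>i j. ev \<kappa> x (elim p E i j) (f i j)"
    "\<And>i j. p \<le> i \<Longrightarrow> i < N \<Longrightarrow> p \<le> j \<Longrightarrow> j < N \<Longrightarrow> f i j = (if i = j then 1 else 0)"
    by (metis Suc_leD)
  have p: "f p p = 1" using f(2)[of p p] Suc.prems by simp
  have "ev \<kappa> x (Inv (elim p E p p)) 1" unfolding ev.simps by (rule exI[of _ 1]) (use f(1)[of p p] p in simp)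
  then have "ev \<kappa> x (elim (Suc p) E i j) (f i j + (-1) * (f i p * (1 * f p j)))" for i j
    unfolding elim.simps by (intro ev_AddI ev_MulI f(1)) (use \<kappa> in simp_all)
  moreover have "f i j + (-1) * (f i p * (1 * f p j)) = (if i = j then 1 else 0)"
    if "Suc p \<le> i" "i < N" "Suc p \<le> j" "j < N" for i j
    using f(2)[of i p] f(2)[of i j] that by simp
  ultimately show ?case by (intro exI[of _ "\<lambda>i j. f i j + (-1) * (f i p * (1 * f p j))"]) auto
qed

text \<open>Vectors annihilated by the first \<open>p\<close> rows are tracked, so that no inverse
  of \<open>e\<close> is involved. On these vectors the reduced matrix gives the same products in
  the remaining rows, and the coordinates before \<open>p\<close> vanish if the others do.\<close>

lemma elim_solves:
  fixes x :: "nat \<Rightarrow> 'r::ring_1"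
  assumes \<kappa>: "\<kappa> (-1) = -1" and E: "\<And>i j. ev \<kappa> x (E i j) (e i j)"
  shows "p \<le> N \<Longrightarrow> ev \<kappa> x (elim p E i0 j0) V0 \<Longrightarrow> \<exists>f. (\<forall>i j. ev \<kappa> x (elim p E i j) (f i j)) \<and>
    (\<forall>v. (\<forall>i<p. (\<Sum>j\<le>N. e i j * v j) = 0) \<longrightarrow>
      (\<forall>i\<ge>p. (\<Sum>j\<in>{p..N}. f i j * v j) = (\<Sum>j\<le>N. e i j * v j)) \<and>
      ((\<forall>j\<in>{p..N}. v j = 0) \<longrightarrow> (\<forall>j\<le>N. v j = 0)))"
proof (induction p arbitrary: i0 j0 V0)
  case 0
  then show ?case using E by (intro exI[of _ e]) (auto simp: atLeast0AtMost)
next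
  case (Suc p)
  then obtain V where V: "ev \<kappa> x (elim p E i0 j0) V" by auto
  have p: "p \<le> N" using Suc.prems(1) by simp
  from Suc.IH[OF p V] obtain f where f': "\<forall>i j. ev \<kappa> x (elim p E i j) (f i j)"
    and s: "\<forall>v. (\<forall>i<p. (\<Sum>j\<le>N. e i j * v j) = 0) \<longrightarrow>
      (\<forall>i\<ge>p. (\<Sum>j\<in>{p..N}. f i j * v j) = (\<Sum>j\<le>N. e i j * v j)) \<and>
      ((\<forall>j\<in>{p..N}. v j = 0) \<longrightarrow> (\<forall>j\<le>N. v j = 0))" by blast
  have f: "ev \<kappa> x (elim p E i j) (f i j)" for i j using f' by blast
  have s1: "(\<Sum>j\<in>{p..N}. f i j * v j) = (\<Sum>j\<le>N. e i j * v j)" if "\<forall>i<p. (\<Sum>j\<le>N. e i j * v j) = 0" "p \<le> i" for v i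
    using s that by blast
  have s2: "\<forall>j\<le>N. v j = 0" if "\<forall>i<p. (\<Sum>j\<le>N. e i j * v j) = 0" "\<forall>j\<in>{p..N}. v j = 0" for v
    using s that by blast
  from Suc.prems obtain M w where M: "ev \<kappa> x (elim p E p p) M" "M * w = 1" "w * M = 1" by auto
  have tw: "f p p * w = 1" "w * f p p = 1" using M ev_unique[OF M(1) f] by auto
  have "ev \<kappa> x (Inv (elim p E p p)) w" unfolding ev.simps using f tw by blast
  then have g: "ev \<kappa> x (elim (Suc p) E i j) (f i j + (-1) * (f i p * (w * f p j)))" for i j
    unfolding elim.simps by (intro ev_AddI ev_MulI f) (use \<kappa> in simp_all)
  have split: "(\<Sum>j\<in>{p..N}. h j) = h p + (\<Sum>j\<in>{Suc p..N}. h j)" for h :: "nat \<Rightarrow> 'r"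
    using Suc.prems(1) by (simp add: sum.atLeast_Suc_atMost)
  have main: "(\<forall>i\<ge>Suc p. (\<Sum>j\<in>{Suc p..N}. (f i j + (-1) * (f i p * (w * f p j))) * v j) = (\<Sum>j\<le>N. e i j * v j)) \<and>
      ((\<forall>j\<in>{Suc p..N}. v j = 0) \<longrightarrow> (\<forall>j\<le>N. v j = 0))"
    if v: "\<forall>i<Suc p. (\<Sum>j\<le>N. e i j * v j) = 0" for v
  proof (intro conjI allI impI)
    have v': "\<forall>i<p. (\<Sum>j\<le>N. e i j * v j) = 0" using v by simp
    have "f p p * v p + (\<Sum>j\<in>{Suc p..N}. f p j * v j) = 0"
      using s1[OF v', of p] v split[of "\<lambda>j. f p j * v j"] by simp
    then have r: "(\<Sum>j\<in>{Suc p..N}. f p j * v j) = - (f p p * v p)" by (simp add: eq_neg_iff_add_eq_0 add.commute)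
    fix i assume i: "Suc p \<le> i"
    have "(\<Sum>j\<in>{Suc p..N}. (f i j + (-1) * (f i p * (w * f p j))) * v j) =
      (\<Sum>j\<in>{Suc p..N}. f i j * v j) - f i p * w * (\<Sum>j\<in>{Suc p..N}. f p j * v j)"
      by (simp add: left_diff_distrib sum_subtractf sum_distrib_left mult.assoc)
    also have "\<dots> = (\<Sum>j\<in>{Suc p..N}. f i j * v j) + f i p * (w * f p p) * v p"
      unfolding r by (simp add: mult.assoc)
    also have "\<dots> = (\<Sum>j\<in>{p..N}. f i j * v j)" unfolding split tw by simp
    also have "\<dots> = (\<Sum>j\<le>N. e i j * v j)" using s1[OF v', of i] i by simp
    finally show "(\<Sum>j\<in>{Suc p..N}. (f i j + (-1) * (f i p * (w * f p j))) * v j) = (\<Sum>j\<le>N. e i j * v j)" .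
  next
    fix j assume z: "\<forall>j\<in>{Suc p..N}. v j = 0" and j: "j \<le> N"
    have v': "\<forall>i<p. (\<Sum>j\<le>N. e i j * v j) = 0" using v by simp
    have "f p p * v p + (\<Sum>j\<in>{Suc p..N}. f p j * v j) = 0"
      using s1[OF v', of p] v split[of "\<lambda>j. f p j * v j"] by simp
    then have "f p p * v p = 0" using z by simp
    then have "w * f p p * v p = 0" by (simp add: mult.assoc)
    then have "v p = 0" using tw by simp
    then have "\<forall>j\<in>{p..N}. v j = 0" using z by (metis atLeastAtMost_iff le_neq_implies_less not_less_eq_eq Suc_leI)
    then show "v j = 0" using s2[OF v'] j by blast
  qed
  show ?case using g main by (intro exI[of _ "\<lambda>i j. f i j + (-1) * (f i p * (w * f p j))"]) auto
qed

section \<open>An expression for the value at a point\<close>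

context fm
begin

text \<open>At \<open>X \<otimes> I\<close> every block is a multiple of the identity, so only the
  values of the coefficients at \<open>1\<close> and at the centre enter. The pencil thus becomes a
  matrix of affine expressions in the variables.\<close>

definition "ea k = fmA r k (1\<^sub>m s)"
definition "ey k = fmA r k (Y ! k)"
definition "eb k = fmB r k (1\<^sub>m s)"
definition "ez k = fmB r k (Y ! k)"

definition "eLam i j = Add (Const (if i = j then 1 else 0))
  (Mul (Const (-1)) (esum (\<lambda>k. Add (Mul (Const (ea k $$ (i, j))) (Var k)) (Const (- ey k $$ (i, j)))) d))"
definition "vLam x i j = (if i = j then 1 else 0) + (-1) * (\<Sum>k<d. dg (ea k $$ (i, j)) * x k + dg (- ey k $$ (i, j)))"

definition "eB i j = esum (\<lambda>k. Add (Mul (Const (eb k $$ (i, j))) (Var k)) (Const (- ez k $$ (i, j)))) d"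
definition "vB x i j = (\<Sum>k<d. dg (eb k $$ (i, j)) * x k + dg (- ez k $$ (i, j)))"

lemma ev_eLam: "ev dg x (eLam i j) (vLam x i j)"
  unfolding eLam_def vLam_def by (intro ev_AddI ev_MulI ev_esum) auto

lemma ev_eB: "ev dg x (eB i j) (vB x i j)"
  unfolding eB_def vB_def by (intro ev_AddI ev_MulI ev_esum) auto

lemma vars_eLam: "nc_vars (eLam i j) \<subseteq> {..<d}" and vars_eB: "nc_vars (eB i j) \<subseteq> {..<d}"
  by (auto simp: eLam_def eB_def vars_esum)

lemma ia_dg: "k < d \<Longrightarrow> ia k (dg c) = dg c * amp L L (ea k)" and ib_dg: "k < d \<Longrightarrow> ib k (dg c) = dg c * amp L s (eb k)"
proof -
  assume k: "k < d"
  have "ia k (dg c * amp s s (1\<^sub>m s)) = dg c * ia k (amp s s (1\<^sub>m s))" "ib k (dg c * amp s s (1\<^sub>m s)) = dg c * ib k (amp s s (1\<^sub>m s))"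
    unfolding ia_def ib_def by (rule lx_scal)+
  then show "ia k (dg c) = dg c * amp L L (ea k)" "ib k (dg c) = dg c * amp L s (eb k)"
    using s k by (simp_all add: amp_one ia_amp[OF k, symmetric] ib_amp[OF k, symmetric] ea_def eb_def)
qed

lemma psi_dl_spt:
  assumes k: "k < d"
  shows "rmap (ia k) (dl (spt n X) k) = psi L L (\<lambda>i j. dg (ea k $$ (i, j)) * amp n n (X ! k) + dg (- ey k $$ (i, j)))"
    and "rmap (ib k) (dl (spt n X) k) = psi L s (\<lambda>i j. dg (eb k $$ (i, j)) * amp n n (X ! k) + dg (- ez k $$ (i, j)))"
proof -
  have y: "ia k (iy k) = amp L L (ey k)" "ib k (iy k) = amp L s (ez k)"
    using k Y_carrier[OF k] by (simp_all add: iy_def ia_amp ib_amp ey_def ez_def)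
  show "rmap (ia k) (dl (spt n X) k) = psi L L (\<lambda>i j. dg (ea k $$ (i, j)) * amp n n (X ! k) + dg (- ey k $$ (i, j)))"
    by (rule rfmat2_eqI) (use k in \<open>auto simp: ent_rmap dl_def spt_def a_diff ia_dg y ent_ent_psi ent_dg ent_amp\<close>)
  show "rmap (ib k) (dl (spt n X) k) = psi L s (\<lambda>i j. dg (eb k $$ (i, j)) * amp n n (X ! k) + dg (- ez k $$ (i, j)))"
    by (rule rfmat2_eqI) (use k s in \<open>auto simp: ent_rmap dl_def spt_def b_diff ib_dg y ent_ent_psi ent_dg ent_amp\<close>)
qed

abbreviation "xt n X \<equiv> (\<lambda>k. amp n n (X ! k))"

lemma psi_vLam: "0 < L \<Longrightarrow> Lam (spt n X) = psi L L (vLam (xt n X))"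
proof -
  assume L: "0 < L"
  have "vLam (xt n X) = (\<lambda>i j. (if i = j then 1 else 0) - (\<Sum>k<d. dg (ea k $$ (i, j)) * amp n n (X ! k) + dg (- ey k $$ (i, j))))"
    by (simp add: vLam_def fun_eq_iff)
  then have "psi L L (vLam (xt n X)) = 1 - (\<Sum>k<d. psi L L (\<lambda>i j. dg (ea k $$ (i, j)) * amp n n (X ! k) + dg (- ey k $$ (i, j))))"
    by (simp add: psi_diff psi_one[OF L] psi_sum)
  then show ?thesis by (simp add: Lam_def AS_def psi_dl_spt)
qed

lemma psi_vB: "BS (dl (spt n X)) = psi L s (vB (xt n X))"
proof -
  have "psi L s (vB (xt n X)) = (\<Sum>k<d. psi L s (\<lambda>i j. dg (eb k $$ (i, j)) * amp n n (X ! k) + dg (- ez k $$ (i, j))))"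
    unfolding vB_def by (rule psi_sum)
  then show ?thesis by (simp add: BS_def psi_dl_spt)
qed

lemma psi_const: "M \<in> carrier_mat nr nc \<Longrightarrow> dg (amp nr nc M) = psi nr nc (\<lambda>i j. dg (M $$ (i, j) :: 'a))"
  by (rule rfmat2_eqI) (auto simp: ent_ent_psi ent_dg ent_amp)

definition "eP K c i j = esum (\<lambda>k. Mul (Const (c k)) (epow L eLam k i j)) K"
definition "vP K c x i j = (\<Sum>k<K. dg (c k) * fpow L (vLam x) k i j)"

lemma ev_eP: "ev dg x (eP K c i j) (vP K c x i j)"
  unfolding eP_def vP_def by (intro ev_MulI ev_esum ev_epow ev_eLam) auto

lemma vars_eP: "nc_vars (eP K c i j) \<subseteq> {..<d}"
  using vars_epow[of eLam "{..<d}" L, OF vars_eLam] unfolding eP_def vars_esum nc_vars.simps by blast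

definition "eM K c i j =
  (if i < L then if j < L then esum (\<lambda>l. Mul (eP K c i l) (eLam l j)) L
     else Mul (Const (-1)) (esum (\<lambda>l. Mul (eP K c i l) (eB l 0)) L)
   else if j < L then Const (fmC r $$ (0, j)) else Const (fmD r $$ (0, 0)))"
definition "vM K c x i j =
  (if i < L then if j < L then (\<Sum>l<L. vP K c x i l * vLam x l j)
     else (-1) * (\<Sum>l<L. vP K c x i l * vB x l 0)
   else if j < L then dg (fmC r $$ (0, j)) else dg (fmD r $$ (0, 0)))"

lemma ev_eM: "ev dg x (eM K c i j) (vM K c x i j)"
proof -
  have "ev dg x (esum (\<lambda>l. Mul (eP K c i l) (eLam l j)) L) (\<Sum>l<L. vP K c x i l * vLam x l j)"
    by (intro ev_MulI ev_esum ev_eP ev_eLam) auto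
  moreover have "ev dg x (Mul (Const (-1)) (esum (\<lambda>l. Mul (eP K c i l) (eB l 0)) L)) ((-1) * (\<Sum>l<L. vP K c x i l * vB x l 0))"
    by (intro ev_MulI ev_esum ev_eP ev_eB) auto
  ultimately show ?thesis unfolding eM_def vM_def by auto
qed

lemma vars_eM: "nc_vars (eM K c i j) \<subseteq> {..<d}"
  using vars_eP vars_eLam vars_eB by (auto simp: eM_def vars_esum split: if_splits) blast+

text \<open>Eliminating the first \<open>L\<close> rows of \<open>[p(\<Lambda>) \<Lambda>, -p(\<Lambda>) B; C, D]\<close> leaves \<open>D + C \<Lambda>\<^sup>-\<^sup>1 B\<close> in the corner; one column of
  \<open>B\<close>, one row of \<open>C\<close> and one entry of \<open>D\<close> suffice since the value is \<open>\<phi> \<otimes> I\<^sub>s\<close>. With \<open>p(\<Lambda>) = \<Lambda>\<^sup>-\<^sup>1\<close> at a given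
  point all pivots are \<open>1\<close> there, and wherever the elimination can be performed, \<open>\<Lambda>\<close> is injective.\<close>
definition "eR K c = elim L (eM K c) L L"

lemma vars_eR: "nc_vars (eR K c) \<subseteq> {..<d}"
  unfolding eR_def by (rule vars_elim) (rule vars_eM)

lemma eR_defined:
  assumes n: "0 < n" and X: "X \<in> mat_tuples d n" and W: "reg (spt n X) W"
  obtains K c V where "ev dg (xt n X) (eR K c) V"
proof -
  have "\<exists>K c. \<forall>i<L. \<forall>j<L. (\<Sum>l<L. vP K c (xt n X) i l * vLam (xt n X) l j) = (if i = j then 1 else 0)"
  proof (cases "0 < L")
    case L: True
    have sp: "spt n X \<in> pts" using W by (simp add: reg_def)
    have FL: "Fin L L (Lam (spt n X))"
      unfolding Lam_def using sp L by (intro Fin_diff Fin_one Fin_AS) (auto intro: ptsD dl_pts)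
    have WL: "W * Lam (spt n X) = 1" using W by (simp add: reg_def inverses_def)
    obtain K c where c: "W = (\<Sum>k<K. dg (dg (c k)) * Lam (spt n X) ^ k)"
      using WL by (rule cayley_hamilton_inverse[OF FL L])
    have "psi L L (vP K c (xt n X)) = W"
      unfolding c vP_def psi_vLam[OF L] by (simp add: psi_sum psi_scal psi_fpow[OF L])
    then have "psi L L (\<lambda>i j. \<Sum>l<L. vP K c (xt n X) i l * vLam (xt n X) l j) = psi L L (\<lambda>i j. if i = j then 1 else 0)"
      using WL by (simp add: psi_vLam[OF L] psi_one[OF L] flip: psi_mult)
    from psi_inj[OF this] show ?thesis by blast
  qed auto
  then obtain K c where "\<And>i j. i < L \<Longrightarrow> j < L \<Longrightarrow> vM K c (xt n X) i j = (if i = j then 1 else 0)"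
    by (auto simp: vM_def)
  then have "\<exists>f. (\<forall>i j. ev dg (xt n X) (elim L (eM K c) i j) (f i j)) \<and>
    (\<forall>i j. L \<le> i \<longrightarrow> i < L \<longrightarrow> L \<le> j \<longrightarrow> j < L \<longrightarrow> f i j = (if i = j then 1 else 0))"
    by (intro elim_defined[OF _ ev_eM]) auto
  then show ?thesis using that unfolding eR_def by blast
qed

text \<open>\<open>K\<close> and \<open>c\<close> are arbitrary: an expression made for one point is
  evaluated at another, where \<open>p(\<Lambda>)\<close> need not be the inverse of
  \<open>\<Lambda>\<close>. Still \<open>elim_solves\<close> applies, to vectors
  \<open>(v, 0)\<close> with \<open>\<Lambda> v = 0\<close> for regularity and to
  \<open>(w, 1)\<close> with \<open>\<Lambda> w = B\<close> for the value.\<close>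

lemma eR_value:
  assumes n: "0 < n" and X: "X \<in> mat_tuples d n" and V: "ev dg (xt n X) (eR K c) V"
  shows "\<exists>W. reg (spt n X) W" and "reg (spt n X) W \<Longrightarrow> unpsi (fval (spt n X) W) 0 0 = V"
proof -
  let ?x = "xt n X"
  have sp: "spt n X \<in> pts" using spt_ptm[OF n X] ptm_pts[OF n] by simp
  have m1: "dg (-1) = (-1 :: 'a rfmat)" by simp
  obtain f where f': "\<forall>i j. ev dg ?x (elim L (eM K c) i j) (f i j)"
    and sol: "\<forall>v. (\<forall>i<L. (\<Sum>j\<le>L. vM K c ?x i j * v j) = 0) \<longrightarrow>
      (\<forall>i\<ge>L. (\<Sum>j\<in>{L..L}. f i j * v j) = (\<Sum>j\<le>L. vM K c ?x i j * v j)) \<and>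
      ((\<forall>j\<in>{L..L}. v j = 0) \<longrightarrow> (\<forall>j\<le>L. v j = 0))"
    using elim_solves[of dg ?x "eM K c" "vM K c ?x", OF m1 ev_eM le_refl V[unfolded eR_def]] by blast
  have f: "ev dg ?x (elim L (eM K c) i j) (f i j)" for i j using f' by blast
  have s1: "(\<Sum>j\<in>{L..L}. f L j * v j) = (\<Sum>j\<le>L. vM K c ?x L j * v j)"
    if "\<forall>i<L. (\<Sum>j\<le>L. vM K c ?x i j * v j) = 0" for v using sol that by blast
  have s2: "\<forall>j\<le>L. v j = 0"
    if "\<forall>i<L. (\<Sum>j\<le>L. vM K c ?x i j * v j) = 0" "\<forall>j\<in>{L..L}. v j = 0" for v using sol that by blast
  have fV: "f L L = V" using ev_unique[OF f V[unfolded eR_def]] .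
  \<comment> \<open>Row \<open>i\<close> of the system is row \<open>i\<close> of
    \<open>p(\<Lambda>)\<close> times \<open>\<Lambda> v - B v_L\<close>.\<close>
  have row: "(\<Sum>j\<le>L. vM K c ?x i j * v j) = (\<Sum>l<L. vP K c ?x i l * ((\<Sum>j<L. vLam ?x l j * v j) - vB ?x l 0 * v L))"
    if "i < L" for i v
  proof -
    have "(\<Sum>j\<le>L. vM K c ?x i j * v j) = (\<Sum>j<L. vM K c ?x i j * v j) + vM K c ?x i L * v L"
      by (simp add: lessThan_Suc_atMost[symmetric])
    also have "(\<Sum>j<L. vM K c ?x i j * v j) = (\<Sum>j<L. \<Sum>l<L. vP K c ?x i l * (vLam ?x l j * v j))"
      using that by (simp add: vM_def sum_distrib_right mult.assoc)
    also have "\<dots> = (\<Sum>l<L. \<Sum>j<L. vP K c ?x i l * (vLam ?x l j * v j))" by (rule sum.swap)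
    finally show ?thesis using that
      by (simp add: vM_def sum_distrib_left sum_distrib_right right_diff_distrib sum_subtractf sum_negf mult.assoc)
  qed
  show "\<exists>W. reg (spt n X) W"
  proof (cases "0 < L")
    case L: True
    have FL: "Fin L L (Lam (spt n X))"
      unfolding Lam_def using sp L by (intro Fin_diff Fin_one Fin_AS) (auto intro: ptsD dl_pts)
    have "v = 0" if v: "Fin L L v" "Lam (spt n X) * v = 0" for v
    proof -
      have "psi L L (\<lambda>i j. \<Sum>l<L. vLam ?x i l * unpsi v l j) = psi L L (\<lambda>i j. 0)"
        using v psi_unpsi[OF v(1)] by (simp add: psi_zero psi_vLam[OF L] flip: psi_mult)
      from psi_inj[OF this] have z: "(\<Sum>l<L. vLam ?x i l * unpsi v l j) = 0" if "i < L" "j < L" for i j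
        using that by blast
      have "unpsi v i j = 0" if "i < L" "j < L" for i j
      proof -
        let ?v = "\<lambda>l. if l < L then unpsi v l j else 0"
        have "\<forall>j'\<le>L. ?v j' = 0"
          by (rule s2) (use z that(2) in \<open>auto simp: row\<close>)
        from spec[OF this, of i] show ?thesis using that(1) by simp
      qed
      then have "psi L L (unpsi v) = psi L L (\<lambda>i j. 0)" by (rule psi_cong)
      then show ?thesis using psi_unpsi[OF v(1)] by (simp add: psi_zero)
    qed
    from Fin_inj_imp_unit[OF FL L this] show ?thesis using sp unfolding reg_def inverses_def by blast
  next
    case False
    then show ?thesis using Lam_L0[OF _ sp] sp by (auto simp: reg_def inverses_def)
  qed
  show "unpsi (fval (spt n X) W) 0 0 = V" if W: "reg (spt n X) W"
  proof -
    define w where "w = W * BS (dl (spt n X))"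
    have Fw: "Fin L s w"
    proof (cases "0 < L")
      case True
      have "Fin L s (BS (dl (spt n X)))" using sp by (intro Fin_BS) (auto intro: ptsD dl_pts)
      then show ?thesis unfolding w_def using Fin_Lam_inverse[of "spt n X" W] W True by (auto simp: reg_def intro: Fin_mult)
    next
      case False
      have "BS (dl (spt n X)) = 0" using Fin_dim0(1)[of s] Fin_BS[of "dl (spt n X)"] False sp by (auto intro: ptsD dl_pts)
      then show ?thesis by (simp add: w_def Fin_zero)
    qed
    have eq: "(\<Sum>l<L. vLam ?x i l * unpsi w l 0) = vB ?x i 0" if i: "i < L" for i
    proof -
      have L: "0 < L" using i by simp
      have "Lam (spt n X) * w = BS (dl (spt n X))"
        using W by (simp add: w_def reg_def inverses_def flip: mult.assoc)
      then have "psi L s (\<lambda>i j. \<Sum>l<L. vLam ?x i l * unpsi w l j) = psi L s (vB ?x)"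
        using psi_unpsi[OF Fw] by (simp add: psi_vLam[OF L] psi_vB flip: psi_mult)
      from psi_inj[OF this i s] show ?thesis .
    qed
    have "(\<Sum>j\<in>{L..L}. f L j * (if j < L then unpsi w j 0 else 1)) = (\<Sum>j\<le>L. vM K c ?x L j * (if j < L then unpsi w j 0 else 1))"
      by (rule s1) (simp add: row eq)
    also have "\<dots> = (\<Sum>j<L. dg (fmC r $$ (0, j)) * unpsi w j 0) + dg (fmD r $$ (0, 0))"
      by (simp add: lessThan_Suc_atMost[symmetric] vM_def)
    finally have V': "V = (\<Sum>j<L. dg (fmC r $$ (0, j)) * unpsi w j 0) + dg (fmD r $$ (0, 0))" using fV by simp
    have "fval (spt n X) W = psi s s (\<lambda>i j. dg (fmD r $$ (i, j)) + (\<Sum>l<L. dg (fmC r $$ (i, l)) * unpsi w l j))"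
    proof -
      have "fval (spt n X) W = dg id0 + dg ic * psi L s (unpsi w)"
        unfolding psi_unpsi[OF Fw] by (simp add: fval_def w_def mult.assoc)
      also have "\<dots> = psi s s (\<lambda>i j. dg (fmD r $$ (i, j))) + psi s L (\<lambda>i j. dg (fmC r $$ (i, j))) * psi L s (unpsi w)"
        unfolding id0_def ic_def psi_const[OF C_carrier] psi_const[OF D_carrier] ..
      finally show ?thesis unfolding psi_mult psi_add .
    qed
    then have "unpsi (fval (spt n X) W) 0 0 = dg (fmD r $$ (0, 0)) + (\<Sum>l<L. dg (fmC r $$ (0, l)) * unpsi w l 0)"
      by (intro rfmat_eqI) (use s in \<open>simp add: ent_unpsi ent_ent_psi\<close>)
    then show ?thesis using V' by simp
  qed
qed

end

subsection \<open>Matrices over polynomials and their specializations\<close>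

text \<open>The entry in row \<open>\<alpha>\<close> and column \<open>\<beta>\<close> of
  multiplication by \<open>p\<close> on \<open>K[t]/(g)\<close>, in the basis of powers of
  \<open>t\<close>.\<close>

definition mon_coeff :: "'a::field poly \<Rightarrow> nat \<Rightarrow> nat \<Rightarrow> 'a poly \<Rightarrow> 'a" where
  "mon_coeff g \<alpha> \<beta> p = coeff ((monom 1 \<beta> * p) mod g) \<alpha>"

lemma mon_coeff_add: "mon_coeff g \<alpha> \<beta> (p + q) = mon_coeff g \<alpha> \<beta> p + mon_coeff g \<alpha> \<beta> q"
  by (simp add: mon_coeff_def distrib_left poly_mod_add_left)

lemma mon_coeff_smult: "mon_coeff g \<alpha> \<beta> ([:c:] * p) = c * mon_coeff g \<alpha> \<beta> p"
  by (simp add: mon_coeff_def mod_smult_left)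

lemma mon_coeff_zero [simp]: "mon_coeff g \<alpha> \<beta> 0 = 0" by (simp add: mon_coeff_def)

lemma mon_coeff_sum: "mon_coeff g \<alpha> \<beta> (sum f S) = (\<Sum>x\<in>S. mon_coeff g \<alpha> \<beta> (f x))"
  by (induction S rule: infinite_finite_induct) (auto simp: mon_coeff_add)

lemma mon_coeff_one:
  assumes "\<alpha> < degree g" "\<beta> < degree g"
  shows "mon_coeff g \<alpha> \<beta> 1 = (if \<alpha> = \<beta> then 1 else 0)"
proof -
  have "monom 1 \<beta> mod g = monom 1 \<beta>"
    using assms by (intro mod_poly_less) (simp add: degree_monom_eq)
  then show ?thesis by (simp add: mon_coeff_def)
qed

lemma mon_coeff_mult:
  assumes "0 < degree g"
  shows "mon_coeff g \<alpha> \<beta> (p * q) = (\<Sum>\<gamma><degree g. mon_coeff g \<alpha> \<gamma> p * mon_coeff g \<gamma> \<beta> q)"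
proof -
  let ?u = "(monom 1 \<beta> * q) mod g"
  have g: "g \<noteq> 0" using assms by auto
  have d: "degree ?u < degree g" using degree_mod_less[OF g, of "monom 1 \<beta> * q"] assms by auto
  have u: "?u = (\<Sum>\<gamma><degree g. monom (coeff ?u \<gamma>) \<gamma>)"
  proof (rule poly_eqI)
    fix i
    show "coeff ?u i = coeff (\<Sum>\<gamma><degree g. monom (coeff ?u \<gamma>) \<gamma>) i"
      using d coeff_eq_0[of ?u i] by (simp add: coeff_sum coeff_monom)
  qed
  have "(monom 1 \<beta> * (p * q)) mod g = (p * ?u) mod g"
    by (simp add: mod_mult_right_eq mult_ac)
  also have "p * ?u = (\<Sum>\<gamma><degree g. [:coeff ?u \<gamma>:] * (monom 1 \<gamma> * p))"
    by (subst u) (simp add: sum_distrib_left mult.commute[of p] smult_monom_mult monom_altdef)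
  finally have "mon_coeff g \<alpha> \<beta> (p * q) = mon_coeff g \<alpha> 0 (\<Sum>\<gamma><degree g. [:coeff ?u \<gamma>:] * (monom 1 \<gamma> * p))"
    by (simp add: mon_coeff_def monom_0)
  also have "\<dots> = (\<Sum>\<gamma><degree g. coeff ?u \<gamma> * mon_coeff g \<alpha> 0 (monom 1 \<gamma> * p))"
    unfolding mon_coeff_sum mon_coeff_smult ..
  finally show ?thesis by (simp add: mon_coeff_def monom_0 mult.commute)
qed

lemma mon_coeff_dvd: "g dvd p \<Longrightarrow> mon_coeff g \<alpha> \<beta> p = 0"
  by (simp add: mon_coeff_def dvd_mult mod_eq_0_iff_dvd)

text \<open>Column \<open>0\<close> lists the coefficients of \<open>p\<close> itself as long as its
  degree is below that of \<open>g\<close>.\<close>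

lemma mon_coeff_faithful: "degree p < degree g \<Longrightarrow> (\<And>\<alpha>. \<alpha> < degree g \<Longrightarrow> mon_coeff g \<alpha> 0 p = 0) \<Longrightarrow> p = 0"
  by (rule poly_eqI) (metis coeff_0 coeff_eq_0 le_less_trans linorder_not_le mod_poly_less mon_coeff_def monom_0 mult.left_neutral one_pCons less_imp_le_nat)

text \<open>The ring \<open>K[t]/(g)\<close> acts on itself by multiplication; the powers of \<open>t\<close> form a basis, and
  \<open>rho g\<close> replaces each polynomial by the matrix of its action. Over a finite field this supplies
  the points that evaluation at elements of the field cannot.\<close>
definition rho :: "'a::field poly \<Rightarrow> 'a poly rfmat rfmat \<Rightarrow> 'a rfmat rfmat" where
  "rho g P = Rfmat (\<lambda>I J. rmap (mon_coeff g (I mod degree g) (J mod degree g)) (ent P (I div degree g) (J div degree g)))"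

lemma finite_div_preimage: "0 < (k::nat) \<Longrightarrow> finite S \<Longrightarrow> finite {J. J div k \<in> S}"
proof -
  assume k: "0 < k" and S: "finite S"
  have "{J. J div k \<in> S} \<subseteq> (\<lambda>(K, \<gamma>). K * k + \<gamma>) ` (S \<times> {..<k})"
  proof
    fix J assume "J \<in> {J. J div k \<in> S}"
    then have "J = (\<lambda>(K, \<gamma>). K * k + \<gamma>) (J div k, J mod k)" "(J div k, J mod k) \<in> S \<times> {..<k}" using k by auto
    then show "J \<in> (\<lambda>(K, \<gamma>). K * k + \<gamma>) ` (S \<times> {..<k})" by (rule image_eqI)
  qed
  then show ?thesis by (rule finite_subset) (use S in simp)
qed

lemma ent_rho:
  assumes "0 < degree g"
  shows "ent (rho g P) I J = rmap (mon_coeff g (I mod degree g) (J mod degree g)) (ent P (I div degree g) (J div degree g))"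
proof -
  let ?k = "degree g"
  have "finite {J. rmap (mon_coeff g (I mod ?k) (J mod ?k)) (ent P (I div ?k) (J div ?k)) \<noteq> 0}" for I
  proof (rule finite_subset)
    show "finite {J. J div ?k \<in> {K. ent P (I div ?k) K \<noteq> 0}}" by (rule finite_div_preimage[OF assms finite_ent])
    show "{J. rmap (mon_coeff g (I mod ?k) (J mod ?k)) (ent P (I div ?k) (J div ?k)) \<noteq> 0} \<subseteq> {J. J div ?k \<in> {K. ent P (I div ?k) K \<noteq> 0}}"
    proof
      fix J assume J: "J \<in> {J. rmap (mon_coeff g (I mod ?k) (J mod ?k)) (ent P (I div ?k) (J div ?k)) \<noteq> 0}"
      have "rmap (mon_coeff g (I mod ?k) (J mod ?k)) 0 = 0" by (rule rfmat_eqI) (simp add: ent_rmap)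
      then show "J \<in> {J. J div ?k \<in> {K. ent P (I div ?k) K \<noteq> 0}}" using J by auto
    qed
  qed
  then show ?thesis unfolding rho_def by (subst ent_Rfmat) auto
qed

lemma rmap_mon_coeff_mult:
  assumes "0 < degree g"
  shows "rmap (mon_coeff g \<alpha> \<beta>) (x * z) = (\<Sum>\<gamma><degree g. rmap (mon_coeff g \<alpha> \<gamma>) x * rmap (mon_coeff g \<gamma> \<beta>) z)"
proof (rule rfmat_eqI)
  fix i j
  let ?S = "{l. ent x i l \<noteq> 0}"
  have S: "finite ?S" by (rule finite_ent)
  have "ent (x * z) i j = (\<Sum>l\<in>?S. ent x i l * ent z l j)" by (rule ent_times_supp[OF S]) auto
  then have "ent (rmap (mon_coeff g \<alpha> \<beta>) (x * z)) i j =
    (\<Sum>l\<in>?S. \<Sum>\<gamma><degree g. mon_coeff g \<alpha> \<gamma> (ent x i l) * mon_coeff g \<gamma> \<beta> (ent z l j))"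
    by (simp add: ent_rmap mon_coeff_sum mon_coeff_mult[OF assms])
  also have "\<dots> = (\<Sum>\<gamma><degree g. \<Sum>l\<in>?S. mon_coeff g \<alpha> \<gamma> (ent x i l) * mon_coeff g \<gamma> \<beta> (ent z l j))"
    by (rule sum.swap)
  also have "\<dots> = (\<Sum>\<gamma><degree g. ent (rmap (mon_coeff g \<alpha> \<gamma>) x * rmap (mon_coeff g \<gamma> \<beta>) z) i j)"
  proof (rule sum.cong[OF refl])
    fix \<gamma>
    have "ent (rmap (mon_coeff g \<alpha> \<gamma>) x * rmap (mon_coeff g \<gamma> \<beta>) z) i j =
      (\<Sum>l\<in>?S. ent (rmap (mon_coeff g \<alpha> \<gamma>) x) i l * ent (rmap (mon_coeff g \<gamma> \<beta>) z) l j)"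
      by (rule ent_times_supp[OF S]) (auto simp: ent_rmap)
    then show "(\<Sum>l\<in>?S. mon_coeff g \<alpha> \<gamma> (ent x i l) * mon_coeff g \<gamma> \<beta> (ent z l j)) =
      ent (rmap (mon_coeff g \<alpha> \<gamma>) x * rmap (mon_coeff g \<gamma> \<beta>) z) i j" by (simp add: ent_rmap)
  qed
  finally show "ent (rmap (mon_coeff g \<alpha> \<beta>) (x * z)) i j =
    ent (\<Sum>\<gamma><degree g. rmap (mon_coeff g \<alpha> \<gamma>) x * rmap (mon_coeff g \<gamma> \<beta>) z) i j" by simp
qed

lemma rho_rhom:
  assumes g: "0 < degree g"
  shows "rhom (rho g)"
proof
  let ?k = "degree g"
  have add: "rmap (mon_coeff g \<alpha> \<beta>) (x + z) = rmap (mon_coeff g \<alpha> \<beta>) x + rmap (mon_coeff g \<alpha> \<beta>) z" for \<alpha> \<beta> x z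
    by (rule rfmat_eqI) (simp add: ent_rmap mon_coeff_add)
  have zero: "rmap (mon_coeff g \<alpha> \<beta>) 0 = 0" for \<alpha> \<beta> by (rule rfmat_eqI) (simp add: ent_rmap)
  have sum: "rmap (mon_coeff g \<alpha> \<beta>) (sum f S) = (\<Sum>x\<in>S. rmap (mon_coeff g \<alpha> \<beta>) (f x))" for \<alpha> \<beta> S and f :: "nat \<Rightarrow> _"
    by (induction S rule: infinite_finite_induct) (auto simp: add zero)
  fix P Q :: "'a poly rfmat rfmat"
  show "rho g (P + Q) = rho g P + rho g Q" by (rule rfmat_eqI) (simp add: ent_rho[OF g] add)
  show "rho g 1 = 1"
  proof (rule rfmat2_eqI)
    fix I J i j
    have "I mod ?k < ?k" "J mod ?k < ?k" using g by auto
    then show "ent (ent (rho g 1) I J) i j = ent (ent 1 I J) i j"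
      using g div_mod_eqI[of ?k I J] by (auto simp: ent_rho[OF g] ent_1 ent_rmap mon_coeff_one)
  qed
  show "rho g (P * Q) = rho g P * rho g Q"
  proof (rule rfmat_eqI)
    fix I J
    let ?I = "I div ?k" and ?J = "J div ?k" and ?\<alpha> = "I mod ?k" and ?\<beta> = "J mod ?k"
    let ?S = "{K. ent P ?I K \<noteq> 0}"
    have S: "finite ?S" by (rule finite_ent)
    let ?T = "(\<lambda>(K, \<gamma>). K * ?k + \<gamma>) ` (?S \<times> {..<?k})"
    have inj: "inj_on (\<lambda>(K, \<gamma>). K * ?k + \<gamma>) (?S \<times> {..<?k})"
    proof (rule inj_onI, clarify)
      fix K \<gamma> K' \<gamma>' assume h: "\<gamma> < ?k" "\<gamma>' < ?k" "K * ?k + \<gamma> = K' * ?k + \<gamma>'"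
      have "(K * ?k + \<gamma>) div ?k = (K' * ?k + \<gamma>') div ?k" using h(3) by simp
      then have "K = K'" using h(1,2) by simp
      then show "K = K' \<and> \<gamma> = \<gamma>'" using h(3) by simp
    qed
    have "ent (rho g P * rho g Q) I J = (\<Sum>L\<in>?T. ent (rho g P) I L * ent (rho g Q) L J)"
    proof (rule ent_times_supp)
      fix L assume "ent (rho g P) I L \<noteq> 0"
      then have "ent P ?I (L div ?k) \<noteq> 0" using zero by (auto simp: ent_rho[OF g])
      then have "(L div ?k, L mod ?k) \<in> ?S \<times> {..<?k}" using g by simp
      moreover have "L = (\<lambda>(K, \<gamma>). K * ?k + \<gamma>) (L div ?k, L mod ?k)" by simp
      ultimately show "L \<in> ?T" by (rule rev_image_eqI)
    qed (use S in simp)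
    also have "\<dots> = (\<Sum>(K, \<gamma>)\<in>?S \<times> {..<?k}. ent (rho g P) I (K * ?k + \<gamma>) * ent (rho g Q) (K * ?k + \<gamma>) J)"
      by (subst sum.reindex[OF inj]) (simp add: case_prod_unfold)
    also have "\<dots> = (\<Sum>K\<in>?S. \<Sum>\<gamma><?k. ent (rho g P) I (K * ?k + \<gamma>) * ent (rho g Q) (K * ?k + \<gamma>) J)"
      by (simp add: sum.cartesian_product)
    also have "\<dots> = (\<Sum>K\<in>?S. rmap (mon_coeff g ?\<alpha> ?\<beta>) (ent P ?I K * ent Q K ?J))"
      unfolding rmap_mon_coeff_mult[OF g] by (intro sum.cong refl) (simp add: ent_rho[OF g])
    also have "\<dots> = rmap (mon_coeff g ?\<alpha> ?\<beta>) (\<Sum>K\<in>?S. ent P ?I K * ent Q K ?J)" by (simp add: sum)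
    also have "(\<Sum>K\<in>?S. ent P ?I K * ent Q K ?J) = ent (P * Q) ?I ?J"
      by (rule ent_times_supp[OF S, symmetric]) auto
    finally show "ent (rho g (P * Q)) I J = ent (rho g P * rho g Q) I J" by (simp add: ent_rho[OF g])
  qed
qed

lemma rmap_Amp: "f 0 = 0 \<Longrightarrow> x \<in> Amp nr nc \<Longrightarrow> rmap f x \<in> Amp nr nc"
  unfolding Amp_def by (auto simp: rmap_amp)

lemma Fin_rho:
  assumes g: "0 < degree g" and P: "Fin nr nc P"
  shows "Fin nr nc (rho g P)"
proof -
  let ?k = "degree g"
  obtain m where m: "per nr nc m P" using P unfolding Fin_def by blast
  have "per nr nc (?k * m) (rho g P)"
    unfolding per_def
  proof (intro conjI allI)
    show "0 < ?k * m" using g per_pos[OF m] by simp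
    show "ent (rho g P) I J \<in> Amp nr nc" for I J
      using per_Amp[OF m] by (simp add: ent_rho[OF g] rmap_Amp)
    fix I J
    have 1: "(I mod (?k * m)) mod ?k = I mod ?k" "(I mod (?k * m)) div ?k = (I div ?k) mod m"
      "I div (?k * m) = (I div ?k) div m" for I
      using g by (simp_all add: mod_mult2_eq div_mult2_eq)
    have z: "rmap (mon_coeff g \<alpha> \<beta>) 0 = 0" for \<alpha> \<beta> by (rule rfmat_eqI) (simp add: ent_rmap)
    show "ent (rho g P) I J = (if I div (?k * m) = J div (?k * m)
       then ent (rho g P) (I mod (?k * m)) (J mod (?k * m)) else 0)"
      unfolding ent_rho[OF g] 1 using per_ent[OF m, of "I div ?k" "J div ?k"] z by simp
  qed
  then show ?thesis unfolding Fin_def by blast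
qed

lemma Fin_rmap: "f 0 = 0 \<Longrightarrow> Fin nr nc P \<Longrightarrow> Fin nr nc (rmap (rmap f) P)"
proof -
  assume f: "f 0 = 0" and "Fin nr nc P"
  then obtain m where m: "per nr nc m P" unfolding Fin_def by blast
  have z: "rmap f 0 = 0" by (rule rfmat_eqI) (simp add: ent_rmap f)
  have "per nr nc m (rmap (rmap f) P)"
    unfolding per_def
  proof (intro conjI allI)
    show "0 < m" by (rule per_pos[OF m])
    show "ent (rmap (rmap f) P) I J \<in> Amp nr nc" for I J
      using per_Amp[OF m] by (simp add: ent_rmap z rmap_Amp f)
    show "ent (rmap (rmap f) P) I J = (if I div m = J div m then ent (rmap (rmap f) P) (I mod m) (J mod m) else 0)" for I J
      using per_ent[OF m, of I J] z by (simp add: ent_rmap)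
  qed
  then show ?thesis unfolding Fin_def by blast
qed

text \<open>A periodic element has finitely many different entries; the sum of their degrees is a
  bound.\<close>

lemma Fin_degree_bound:
  assumes "Fin nr nc (P :: 'a::field poly rfmat rfmat)"
  obtains N where "\<And>I J i j. degree (ent (ent P I J) i j) \<le> N"
proof -
  obtain m X where m: "0 < m" and X: "X \<in> carrier_mat (nr * m) (nc * m)" "P = amp2 nr nc m X"
    using assms unfolding Fin_def per_iff_amp2 by blast
  let ?N = "\<Sum>i<nr * m. \<Sum>j<nc * m. degree (X $$ (i, j))"
  have "degree (ent (ent P I J) i j) \<le> ?N" for I J i j
  proof (cases "I div m = J div m \<and> 0 < nr \<and> 0 < nc \<and> i div nr = j div nc")
    case True
    let ?i = "I mod m * nr + i mod nr" and ?j = "J mod m * nc + j mod nc"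
    have lt: "?i < nr * m" "?j < nc * m" using True m by (auto intro: block_index_less)
    have "degree (X $$ (?i, ?j)) \<le> (\<Sum>j<nc * m. degree (X $$ (?i, j)))"
      by (rule member_le_sum[where f = "\<lambda>j. degree (X $$ (?i, j))"]) (use lt in auto)
    also have "\<dots> \<le> ?N"
      by (rule member_le_sum[where f = "\<lambda>i. \<Sum>j<nc * m. degree (X $$ (i, j))"]) (use lt in auto)
    finally show ?thesis using True m by (simp add: X(2) ent_amp2 ent_amp bl_def)
  next
    case False
    then show ?thesis by (auto simp: X(2) ent_amp2 ent_amp)
  qed
  then show ?thesis using that by blast
qed

lemma rho_faithful:
  assumes g: "0 < degree g" and d: "\<And>I J i j. degree (ent (ent P I J) i j) < degree g" and z: "rho g P = 0"
  shows "P = 0"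
proof (rule rfmat2_eqI)
  fix I J i j
  have "mon_coeff g \<alpha> 0 (ent (ent P I J) i j) = 0" if "\<alpha> < degree g" for \<alpha>
  proof -
    have "ent (ent (rho g P) (I * degree g + \<alpha>) (J * degree g)) i j = 0" using z by simp
    then show ?thesis using that g by (simp add: ent_rho[OF g] ent_rmap)
  qed
  then show "ent (ent P I J) i j = ent (ent 0 I J) i j"
    using mon_coeff_faithful[OF d] by simp
qed

abbreviation "eta \<equiv> (\<lambda>q. dg (dg q))"

lemma eta_rhom: "rhom (eta :: 'b::comm_ring_1 \<Rightarrow> _)"
  by unfold_locales simp_all

lemma rho_unit:
  assumes g: "0 < degree g" and "g dvd q * q' - 1"
  shows "unit (rho g (eta q))"
proof -
  interpret rhom "rho g" by (rule rho_rhom[OF g])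
  have "rho g (eta p) = 0" if "g dvd p" for p
    by (rule rfmat2_eqI) (simp add: ent_rho[OF g] ent_dg ent_rmap mon_coeff_dvd[OF that])
  from this[OF assms(2)] have "rho g (eta q * eta q' - 1) = 0" by simp
  then have "rho g (eta q) * rho g (eta q') = 1" unfolding diff mult one by simp
  moreover have "rho g (eta q) * rho g (eta q') = rho g (eta q') * rho g (eta q)"
    unfolding mult[symmetric] by (rule arg_cong[OF dg2_central])
  ultimately show ?thesis unfolding unit_def by (intro exI[of _ "rho g (eta q')"]) simp
qed

text \<open>With \<open>g = t\<^sup>N q + 1\<close> the polynomial \<open>q\<close> is invertible modulo \<open>g\<close>, and the degree is as large as desired.\<close>
lemma exists_modulus:
  fixes q :: "'a::field poly"
  assumes "q \<noteq> 0"
  obtains g where "N < degree g" "unit (rho g (eta q))"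
proof -
  define g where "g = monom 1 (Suc N) * q + 1"
  have "degree (monom 1 (Suc N) * q) = Suc N + degree q"
    using assms by (simp add: degree_mult_eq degree_monom_eq)
  then have d: "degree g = Suc N + degree q" unfolding g_def by (subst degree_add_eq_left) auto
  have "q * (- monom 1 (Suc N)) - 1 = - g" by (simp add: g_def mult.commute)
  then have "g dvd q * (- monom 1 (Suc N)) - 1" by simp
  from rho_unit[OF _ this] show ?thesis using that[of g] d by simp
qed

lemma eta_cancel:
  fixes P :: "'a::field poly rfmat rfmat"
  assumes "q \<noteq> 0" "P * eta q = P' * eta q" shows "P = P'"
proof (rule rfmat2_eqI)
  fix I J i j
  have "ent (ent (P * eta q) I J) i j = ent (ent (P' * eta q) I J) i j" using assms by simp
  then show "ent (ent P I J) i j = ent (ent P' I J) i j" using assms(1) by simp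
qed

definition evp :: "'a::field \<Rightarrow> 'a poly rfmat rfmat \<Rightarrow> 'a rfmat rfmat" where
  "evp a = rmap (rmap (\<lambda>p. poly p a))"

definition cp :: "'a::field \<Rightarrow> 'a poly" where "cp c = [:c:]"

definition cst :: "'a::field rfmat rfmat \<Rightarrow> 'a poly rfmat rfmat" where
  "cst = rmap (rmap cp)"

lemma evp_rhom: "rhom (evp a)"
  unfolding evp_def by (intro rhom.rmap_rhom) (unfold_locales, auto)

lemma cp_rhom: "rhom cp" by unfold_locales (auto simp: cp_def one_pCons)

lemma cst_rhom: "rhom cst"
  unfolding cst_def by (intro rhom.rmap_rhom cp_rhom)

lemma ent_evp: "ent (ent (evp a P) I J) i j = poly (ent (ent P I J) i j) a"
proof -
  have "rmap (\<lambda>p. poly p a) 0 = 0" by (rule rfmat_eqI) (simp add: ent_rmap)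
  then show ?thesis by (simp add: evp_def ent_rmap)
qed

lemma cp_0 [simp]: "cp 0 = 0" by (simp add: cp_def)

lemma ent_cst: "ent (ent (cst P) I J) i j = cp (ent (ent P I J) i j)"
proof -
  have "rmap cp 0 = (0 :: 'a poly rfmat)" by (rule rfmat_eqI) (simp add: ent_rmap)
  then show ?thesis by (simp add: cst_def ent_rmap)
qed

lemma evp_cst [simp]: "evp a (cst P) = P"
  by (rule rfmat2_eqI) (simp add: ent_evp ent_cst cp_def)

lemma evp_eta [simp]: "evp a (eta q) = eta (poly q a)"
  by (rule rfmat2_eqI) (simp add: ent_evp ent_dg)

lemma Fin_evp: "Fin nr nc P \<Longrightarrow> Fin nr nc (evp a P)" and Fin_cst: "Fin nr nc P' \<Longrightarrow> Fin nr nc (cst P')"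
  unfolding evp_def cst_def by (rule Fin_rmap; simp)+

lemma evp_blk: "evp a (blk p q u v) = blk (evp a p) (evp a q) (evp a u) (evp a v)"
  unfolding evp_def by (rule rmap_blk) (rule rfmat_eqI, simp add: ent_rmap)

lemma unit_eta: "c \<noteq> 0 \<Longrightarrow> unit (eta (c :: 'a::field))"
  unfolding unit_def by (rule exI[of _ "eta (inverse c)"]) (simp flip: dg_mult)

abbreviation "kp \<equiv> (\<lambda>c. eta (cp c))"

lemma evp_amp2: "X \<in> carrier_mat (n * m) (n * m) \<Longrightarrow> evp a (amp2 n n m X) = amp2 n n m (map_mat (\<lambda>p. poly p a) X)"
proof (rule rfmat2_eqI)
  fix I J i j assume X: "X \<in> carrier_mat (n * m) (n * m)"
  show "ent (ent (evp a (amp2 n n m X)) I J) i j = ent (ent (amp2 n n m (map_mat (\<lambda>p. poly p a) X)) I J) i j"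
    using X by (auto simp: ent_evp ent_amp2 ent_amp bl_def block_index_less)
qed

lemma adjugate_at:
  fixes P :: "'a::field poly rfmat rfmat"
  assumes P: "Fin n n P" "0 < n" and W: "W * evp a P = 1"
  obtains N q where "Fin n n N" "P * N = eta q" "N * P = eta q" "poly q a \<noteq> 0"
proof -
  obtain m X N where *: "0 < m" "X \<in> carrier_mat (n * m) (n * m)" "P = amp2 n n m X"
    "Fin n n N" "P * N = eta (det X)" "N * P = eta (det X)"
    using Fin_adjugate[OF P] by blast
  have "W * amp2 n n m (map_mat (\<lambda>p. poly p a) X) = 1" using W *(3) evp_amp2[OF *(2)] by simp
  then have "det (map_mat (\<lambda>p. poly p a) X) \<noteq> 0" by (intro left_inverse_det_nonzero[OF _ *(1)]) (use * in auto)
  then have "poly (det X) a \<noteq> 0" by (simp add: comm_ring_hom.hom_det[OF poly_hom.comm_ring_hom_axioms])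
  then show ?thesis using that * by blast
qed

text \<open>Along a polynomial family the value becomes a fraction without a pole at
  \<open>a\<close>. For an inverse, the numerator \<open>M\<close> of the subexpression is
  invertible at \<open>a\<close>, so its adjugate and determinant provide \<open>N\<close> and
  \<open>p\<close> with \<open>p\<close> nonzero there.\<close>

lemma pev_exists:
  fixes Q :: "nat \<Rightarrow> 'a::field poly rfmat rfmat"
  assumes n: "0 < n" and Q: "\<And>k. Fin n n (Q k)"
  shows "ev eta (\<lambda>k. evp a (Q k)) R V \<Longrightarrow> \<exists>M q. pev kp eta Q R M q \<and> Fin n n M \<and> poly q a \<noteq> 0"
proof (induction R arbitrary: V)
  case (Const c)
  have "Fin n n (eta (cp c))" using Fin_scal[OF Fin_one[OF n], of "cp c"] by simp
  then show ?case by simp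
next
  case (Var k)
  then show ?case using Q by simp
next
  case (Add R S)
  then obtain M1 q1 M2 q2 where "pev kp eta Q R M1 q1" "Fin n n M1" "poly q1 a \<noteq> 0"
    "pev kp eta Q S M2 q2" "Fin n n M2" "poly q2 a \<noteq> 0" by fastforce
  moreover from this have "Fin n n (M1 * eta q2 + M2 * eta q1)"
    unfolding dg2_central[symmetric] by (intro Fin_add Fin_scal)
  ultimately show ?case
    by (intro exI[of _ "M1 * eta q2 + M2 * eta q1"] exI[of _ "q1 * q2"]) auto
next
  case (Mul R S)
  then obtain M1 q1 M2 q2 where "pev kp eta Q R M1 q1" "Fin n n M1" "poly q1 a \<noteq> 0"
    "pev kp eta Q S M2 q2" "Fin n n M2" "poly q2 a \<noteq> 0" by fastforce
  then show ?case
    by (intro exI[of _ "M1 * M2"] exI[of _ "q1 * q2"]) (auto intro: Fin_mult)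
next
  case (Inv R)
  then obtain V0 where V0: "ev eta (\<lambda>k. evp a (Q k)) R V0" "V0 * V = 1" "V * V0 = 1" by auto
  with Inv.IH obtain M q where M: "pev kp eta Q R M q" "Fin n n M" "poly q a \<noteq> 0" by blast
  interpret e: rhom "evp a" by (rule evp_rhom)
  have k: "eta c = evp a (kp c)" for c :: 'a by (simp add: cp_def)
  have u: "unit (evp a (eta q))" using unit_eta[OF M(3)] by simp
  obtain V1 where V1: "ev eta (\<lambda>k. evp a (Q k)) R V1" "V1 * evp a (eta q) = evp a M"
    using e.pev_hom[OF k eta_rhom dg2_central M(1) u] by blast
  have V01: "V1 = V0" using ev_unique[OF V1(1) V0(1)] .
  \<comment> \<open>\<open>evp a M\<close> is the value \<open>V0\<close> times the nonzero scalar
    \<open>poly q a\<close>; this exhibits a left inverse of it.\<close>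
  have "eta (inverse (poly q a)) * V * evp a M = eta (inverse (poly q a)) * (V * V0) * eta (poly q a)"
    using V1(2) V01 by (simp add: mult.assoc)
  also have "\<dots> = 1" using V0(3) M(3) by (simp flip: dg_mult)
  finally obtain N p where N: "Fin n n N" "M * N = eta p" "N * M = eta p" "poly p a \<noteq> 0"
    using adjugate_at[OF M(2) n] by metis
  have "pev kp eta Q (Inv R) (eta q * eta q * N) (q * p)" using M(1) N by auto
  moreover have "Fin n n (eta q * eta q * N)" using N(1) by (simp add: mult.assoc Fin_scal)
  moreover have "poly (q * p) a \<noteq> 0" using M N by simp
  ultimately show ?case by blast
qed

definition line :: "(nat \<Rightarrow> 'a::field rfmat rfmat) \<Rightarrow> (nat \<Rightarrow> 'a rfmat rfmat) \<Rightarrow> nat \<Rightarrow> 'a poly rfmat rfmat" where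
  "line P0 P1 k = cst (P0 k) + eta [:0, 1:] * cst (P1 k - P0 k)"

lemma evp_line: "evp 0 (line P0 P1 k) = P0 k" "evp 1 (line P0 P1 k) = P1 k"
proof -
  interpret e: rhom "evp a" for a by (rule evp_rhom)
  show "evp 0 (line P0 P1 k) = P0 k" "evp 1 (line P0 P1 k) = P1 k"
    by (simp_all add: line_def e.add e.mult)
qed

lemma Fin_line: "Fin nr nc (P0 k) \<Longrightarrow> Fin nr nc (P1 k) \<Longrightarrow> Fin nr nc (line P0 P1 k)"
  unfolding line_def by (intro Fin_add Fin_scal Fin_cst Fin_diff)

section \<open>The realization over polynomials\<close>

context fm
begin

definition "iap k = lx s L L (fmA r k) cp"
definition "ibp k = lx s L s (fmB r k) cp"

sublocale p: fm_ring d iap ibp "rmap cp ic" "rmap cp id0" "\<lambda>k. rmap cp (iy k)"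
  by unfold_locales (simp_all add: iap_def ibp_def lx_add)

text \<open>Formulated for maps that are additive and linear over constants, so as to cover
  \<open>mon_coeff g \<alpha> \<beta>\<close>, which is in general not multiplicative.\<close>

lemma rmap_lx_linear:
  fixes f :: "'a poly \<Rightarrow> 'a"
  assumes add: "\<And>x z. f (x + z) = f x + f z" and lin: "\<And>c x. f ([:c:] * x) = c * f x"
  shows "rmap f (lx s nr nc T cp z) = lx s nr nc T id (rmap f z)"
proof (rule rfmat_eqI)
  fix i j
  have 0: "f 0 = 0" using lin[of 0 0] by simp
  have sum: "f (sum g S) = (\<Sum>x\<in>S. f (g x))" for g :: "nat \<Rightarrow> _" and S
    by (induction S rule: infinite_finite_induct) (auto simp: add 0)
  show "ent (rmap f (lx s nr nc T cp z)) i j = ent (lx s nr nc T id (rmap f z)) i j"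
    by (simp add: lx_def ent_rmap 0 sum lin[folded cp_def])
qed

lemma cst_AS: "cst (AS \<delta>) = p.AS (\<lambda>k. cst (\<delta> k))" and cst_BS: "cst (BS \<delta>) = p.BS (\<lambda>k. cst (\<delta> k))"
proof -
  interpret c: rhom "rmap cp" by (rule rhom.rmap_rhom[OF cp_rhom])
  have z: "rmap cp (ia k x) = iap k (rmap cp x)" "rmap cp (ib k x) = ibp k (rmap cp x)" for k x
    unfolding ia_def ib_def iap_def ibp_def by (simp_all add: lx_hom[OF cp_rhom])
  show "cst (AS \<delta>) = p.AS (\<lambda>k. cst (\<delta> k))" "cst (BS \<delta>) = p.BS (\<lambda>k. cst (\<delta> k))"
    by (rule rfmat_eqI; simp add: cst_def ent_rmap ent_AS ent_BS p.ent_AS p.ent_BS c.sum z)+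
qed

lemma cst_dg: "cst (dg x) = dg (rmap cp x)"
  unfolding cst_def by (rule rhom.rmap_dg[OF rhom.rmap_rhom[OF cp_rhom]])

lemma cst_Lam: "cst (Lam P) = p.Lam (\<lambda>k. cst (P k))"
  and cst_BS_dl: "cst (BS (dl P)) = p.BS (p.dl (\<lambda>k. cst (P k)))"
proof -
  interpret c: rhom cst by (rule cst_rhom)
  have "(\<lambda>k. cst (dl P k)) = p.dl (\<lambda>k. cst (P k))"
    by (simp add: fun_eq_iff dl_def p.dl_def c.diff cst_dg)
  then show "cst (Lam P) = p.Lam (\<lambda>k. cst (P k))" "cst (BS (dl P)) = p.BS (p.dl (\<lambda>k. cst (P k)))"
    by (simp_all add: Lam_def p.Lam_def c.diff c.one cst_AS cst_BS)
qed

text \<open>The properties shared by the evaluations \<open>evp a\<close> and the representations \<open>rho g\<close>.\<close>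
definition special :: "('a poly rfmat rfmat \<Rightarrow> 'a rfmat rfmat) \<Rightarrow> bool" where
  "special \<Theta> \<longleftrightarrow> rhom \<Theta> \<and> (\<forall>x. \<Theta> (dg (rmap cp x)) = dg x) \<and> (\<forall>\<delta>. \<Theta> (p.AS \<delta>) = AS (\<lambda>k. \<Theta> (\<delta> k))) \<and>
     (\<forall>\<delta>. \<Theta> (p.BS \<delta>) = BS (\<lambda>k. \<Theta> (\<delta> k))) \<and> (\<forall>P nr nc. Fin nr nc P \<longrightarrow> Fin nr nc (\<Theta> P))"

lemma special_evp: "special (evp a)"
proof -
  interpret e: rhom "rmap (\<lambda>q. poly q a)" by (rule rhom.rmap_rhom) (unfold_locales, auto)
  have z: "rmap (\<lambda>q. poly q a) (iap k x) = ia k (rmap (\<lambda>q. poly q a) x)"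
    "rmap (\<lambda>q. poly q a) (ibp k x) = ib k (rmap (\<lambda>q. poly q a) x)" for k x
    unfolding ia_def ib_def iap_def ibp_def by (rule rmap_lx_linear; simp)+
  have "evp a (dg (rmap cp x)) = dg x" for x
    by (rule rfmat2_eqI) (simp add: ent_evp ent_dg ent_rmap cp_def)
  moreover have "evp a (p.AS \<delta>) = AS (\<lambda>k. evp a (\<delta> k))" "evp a (p.BS \<delta>) = BS (\<lambda>k. evp a (\<delta> k))" for \<delta>
    by (rule rfmat_eqI; simp add: evp_def ent_rmap ent_AS ent_BS p.ent_AS p.ent_BS e.sum z)+
  ultimately show ?thesis by (simp add: special_def evp_rhom Fin_evp)
qed

lemma special_rho:
  assumes g: "0 < degree g" shows "special (rho g)"
proof -
  have add: "rmap (mon_coeff g \<alpha> \<beta>) (x + z) = rmap (mon_coeff g \<alpha> \<beta>) x + rmap (mon_coeff g \<alpha> \<beta>) z" for \<alpha> \<beta> x z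
    by (rule rfmat_eqI) (simp add: ent_rmap mon_coeff_add)
  have zero: "rmap (mon_coeff g \<alpha> \<beta>) 0 = 0" for \<alpha> \<beta> by (rule rfmat_eqI) (simp add: ent_rmap)
  have sum: "rmap (mon_coeff g \<alpha> \<beta>) (sum f S) = (\<Sum>x\<in>S. rmap (mon_coeff g \<alpha> \<beta>) (f x))" for \<alpha> \<beta> S and f :: "nat \<Rightarrow> _"
    by (induction S rule: infinite_finite_induct) (auto simp: add zero)
  have z: "rmap (mon_coeff g \<alpha> \<beta>) (iap k x) = ia k (rmap (mon_coeff g \<alpha> \<beta>) x)"
    "rmap (mon_coeff g \<alpha> \<beta>) (ibp k x) = ib k (rmap (mon_coeff g \<alpha> \<beta>) x)" for \<alpha> \<beta> k x
    unfolding ia_def ib_def iap_def ibp_def by (rule rmap_lx_linear; simp add: mon_coeff_add mon_coeff_smult[simplified])+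
  have "rho g (dg (rmap cp x)) = dg x" for x
  proof (rule rfmat2_eqI)
    fix I J i j
    have "mon_coeff g (I mod degree g) (J mod degree g) (cp c) = (if I mod degree g = J mod degree g then c else 0)" for c
      using mon_coeff_smult[of g "I mod degree g" "J mod degree g" c 1] g by (simp add: mon_coeff_one cp_def)
    then show "ent (ent (rho g (dg (rmap cp x))) I J) i j = ent (ent (dg x) I J) i j"
      using g div_mod_eqI[of "degree g" I J] by (auto simp: ent_rho[OF g] ent_dg ent_rmap)
  qed
  moreover have "rho g (p.AS \<delta>) = AS (\<lambda>k. rho g (\<delta> k))" "rho g (p.BS \<delta>) = BS (\<lambda>k. rho g (\<delta> k))" for \<delta>
    by (rule rfmat_eqI; simp add: ent_rho[OF g] ent_AS ent_BS p.ent_AS p.ent_BS sum z)+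
  ultimately show ?thesis by (simp add: special_def rho_rhom[OF g] Fin_rho[OF g])
qed

lemma special_Lam:
  assumes "special \<Theta>"
  shows "\<Theta> (p.Lam Q) = Lam (\<lambda>k. \<Theta> (Q k))" and "\<Theta> (p.BS (p.dl Q)) = BS (dl (\<lambda>k. \<Theta> (Q k)))"
    and "\<Theta> (kp c) = eta c" and "Q \<in> pts \<Longrightarrow> (\<lambda>k. \<Theta> (Q k)) \<in> pts"
proof -
  have T: "rhom \<Theta>" "\<And>x. \<Theta> (dg (rmap cp x)) = dg x" "\<And>\<delta>. \<Theta> (p.AS \<delta>) = AS (\<lambda>k. \<Theta> (\<delta> k))"
    "\<And>\<delta>. \<Theta> (p.BS \<delta>) = BS (\<lambda>k. \<Theta> (\<delta> k))" "\<And>P nr nc. Fin nr nc P \<Longrightarrow> Fin nr nc (\<Theta> P)"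
    using assms unfolding special_def by blast+
  interpret h: rhom \<Theta> by (rule T)
  have "(\<lambda>k. \<Theta> (p.dl Q k)) = dl (\<lambda>k. \<Theta> (Q k))" by (simp add: fun_eq_iff dl_def p.dl_def h.diff T)
  then show "\<Theta> (p.Lam Q) = Lam (\<lambda>k. \<Theta> (Q k))" "\<Theta> (p.BS (p.dl Q)) = BS (dl (\<lambda>k. \<Theta> (Q k)))"
    by (simp_all add: Lam_def p.Lam_def h.diff h.one T)
  show "\<Theta> (kp c) = eta c" by (subst rhom.rmap_dg[OF cp_rhom, symmetric]) (rule T(2))
  show "Q \<in> pts \<Longrightarrow> (\<lambda>k. \<Theta> (Q k)) \<in> pts" by (simp add: pts_def T)
qed

lemma special_pev:
  assumes "special \<Theta>" "pev kp eta Q S M q" "unit (\<Theta> (eta q))"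
  obtains V where "ev eta (\<lambda>k. \<Theta> (Q k)) S V" "V * \<Theta> (eta q) = \<Theta> M"
  using rhom.pev_hom[of \<Theta>, OF _ special_Lam(3)[OF assms(1), symmetric] eta_rhom dg2_central assms(2,3)] assms(1)
  unfolding special_def by blast

lemma Fin_AS_p: "Q \<in> pts \<Longrightarrow> Fin L L (p.AS Q)" and Fin_BS_p: "Q \<in> pts \<Longrightarrow> Fin L s (p.BS Q)"
proof -
  have A: "iap k z \<in> Amp L L" "ibp k z \<in> Amp L s" if "k < d" for k z
    unfolding iap_def ibp_def using that by (intro lx_Amp; simp add: A_carrier B_carrier)+
  have F: "Fin L L (rmap (iap k) z)" "Fin L s (rmap (ibp k) z)" if "k < d" "Fin s s z" for k z
    using that per_rmap[where f = "iap k", OF _ p.a_zero[of k] A(1)] per_rmap[where f = "ibp k", OF _ p.b_zero[of k] A(2)]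
    unfolding Fin_def by blast+
  show "Q \<in> pts \<Longrightarrow> Fin L L (p.AS Q)" "Q \<in> pts \<Longrightarrow> Fin L s (p.BS Q)"
    unfolding p.AS_def p.BS_def pts_def by (auto intro!: Fin_sum F)
qed

lemma dl_pts_p: "Q \<in> pts \<Longrightarrow> p.dl Q \<in> pts"
  by (simp add: pts_def p.dl_def Fin_diff Fin_dg rmap_Amp iy_Amp)

lemma Fin_Lam_p: "0 < L \<Longrightarrow> Q \<in> pts \<Longrightarrow> Fin L L (p.Lam Q)"
  unfolding p.Lam_def by (intro Fin_diff Fin_one Fin_AS_p dl_pts_p)

text \<open>An identity between matrices of polynomials may be tested at \<open>rho g\<close> for a single modulus \<open>g\<close> of
  large degree.\<close>
lemma specialization_eq:
  fixes X X' :: "'a poly rfmat rfmat"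
  assumes "Fin nr nc X" "Fin nr nc X'" "q \<noteq> 0"
    and eq: "\<And>\<Theta>. special \<Theta> \<Longrightarrow> unit (\<Theta> (eta q)) \<Longrightarrow> \<Theta> X = \<Theta> X'"
  shows "X = X'"
proof -
  obtain N where N: "\<And>I J i j. degree (ent (ent (X - X') I J) i j) \<le> N"
    using Fin_degree_bound[OF Fin_diff[OF assms(1,2)]] by blast
  obtain g where g: "N < degree g" "unit (rho g (eta q))" using exists_modulus[OF assms(3)] by blast
  then have g0: "0 < degree g" by simp
  interpret rhom "rho g" by (rule rho_rhom[OF g0])
  have "rho g (X - X') = 0" using eq[OF special_rho[OF g0] g(2)] by (simp add: diff)
  then have "X - X' = 0" using rho_faithful[OF g0] N g(1) by (meson le_less_trans)
  then show ?thesis by simp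
qed

lemma unit_factors:
  assumes "special \<Theta>" "unit (\<Theta> (eta (q * q')))" shows "unit (\<Theta> (eta q))" "unit (\<Theta> (eta q'))"
proof -
  interpret h: rhom \<Theta> using assms(1) unfolding special_def by blast
  have c: "\<Theta> (eta q) * \<Theta> (eta q') = \<Theta> (eta q') * \<Theta> (eta q)"
    unfolding h.mult[symmetric] by (rule arg_cong[OF dg2_central])
  have u: "unit (\<Theta> (eta q) * \<Theta> (eta q'))" using assms(2) by (simp add: h.mult)
  show "unit (\<Theta> (eta q))" by (rule unit_leftI[OF u c])
  show "unit (\<Theta> (eta q'))" by (rule unit_leftI[OF u[unfolded c] c[symmetric]])
qed

lemma special_eta_central:
  assumes "special \<Theta>" shows "\<Theta> (eta q) * \<Theta> x = \<Theta> x * \<Theta> (eta q)"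
proof -
  interpret h: rhom \<Theta> using assms unfolding special_def by blast
  show ?thesis unfolding h.mult[symmetric] by (rule arg_cong[OF dg2_central])
qed

lemma eta_right_commute: "X * eta (q :: 'b::comm_ring_1) * eta q' = X * eta q' * eta q"
  unfolding mult.assoc by (rule arg_cong[OF dg2_central])

section \<open>Equivalence of expressions along lines\<close>

definition agree :: "'a nc_expr \<Rightarrow> 'a nc_expr \<Rightarrow> bool" where
  "agree R S \<longleftrightarrow> (\<forall>P\<in>pts. \<forall>V V'. ev eta P R V \<longrightarrow> ev eta P S V' \<longrightarrow> V = V')"

text \<open>Under a specialization that makes both denominators units, both expressions have values,
  and these agree; \<open>specialization_eq\<close> turns this into equality of the
  fractions.\<close>

lemma pev_agree:
  assumes a: "agree S S'" and Q: "Q \<in> pts"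
    and S: "pev kp eta Q S M q" "Fin s s M" "q \<noteq> 0" and S': "pev kp eta Q S' M' q'" "Fin s s M'" "q' \<noteq> 0"
  shows "M * eta q' = M' * eta q"
proof (rule specialization_eq)
  show "Fin s s (M * eta q')" "Fin s s (M' * eta q)"
    unfolding dg2_central[symmetric] using S(2) S'(2) by (auto intro: Fin_scal)
  show "q * q' \<noteq> 0" using S S' by simp
  fix \<Theta> assume T: "special \<Theta>" and u: "unit (\<Theta> (eta (q * q')))"
  interpret h: rhom \<Theta> using T unfolding special_def by blast
  note u' = unit_factors[OF T u]
  obtain V where V: "ev eta (\<lambda>k. \<Theta> (Q k)) S V" "V * \<Theta> (eta q) = \<Theta> M" using special_pev[OF T S(1) u'(1)] .
  obtain V' where V': "ev eta (\<lambda>k. \<Theta> (Q k)) S' V'" "V' * \<Theta> (eta q') = \<Theta> M'" using special_pev[OF T S'(1) u'(2)] .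
  have "V = V'" using a V(1) V'(1) special_Lam(4)[OF T Q] unfolding agree_def by blast
  then show "\<Theta> (M * eta q') = \<Theta> (M' * eta q)"
    unfolding h.mult V(2)[symmetric] V'(2)[symmetric]
    using special_eta_central[OF T, of q "eta q'"] by (simp add: mult.assoc)
qed

text \<open>A point \<open>P0\<close> common to \<open>S\<close> and \<open>S'\<close> need not lie
  in the domain of \<open>R\<close>. On the line from \<open>P0\<close> to a point \<open>P1\<close>
  of that domain all three expressions have fractions with nonzero denominators, so the fraction of
  \<open>R\<close> can be eliminated before returning to \<open>P0\<close>.\<close>

lemma agree_trans:
  assumes "agree S R" "agree S' R" and P1: "P1 \<in> pts" "ev eta P1 R V1"
  shows "agree S S'"
  unfolding agree_def
proof (intro ballI allI impI)
  fix P0 V V' assume P0: "P0 \<in> pts" and V: "ev eta P0 S V" and V': "ev eta P0 S' V'"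
  define Q where "Q = line P0 P1"
  have FQ: "Fin s s (Q k)" for k using P0 P1(1) by (simp add: Q_def Fin_line ptsD)
  then have Q: "Q \<in> pts" by (simp add: pts_def)
  have e: "(\<lambda>k. evp 0 (Q k)) = P0" "(\<lambda>k. evp 1 (Q k)) = P1" by (simp_all add: Q_def evp_line)
  have v0: "ev eta (\<lambda>k. evp 0 (Q k)) S V" and v1: "ev eta (\<lambda>k. evp 0 (Q k)) S' V'"
    and v2: "ev eta (\<lambda>k. evp 1 (Q k)) R V1"
    using V V' P1(2) by (simp_all only: e)
  obtain M q where M: "pev kp eta Q S M q" "Fin s s M" "poly q 0 \<noteq> 0" using pev_exists[OF s FQ v0] by blast
  obtain M' q' where M': "pev kp eta Q S' M' q'" "Fin s s M'" "poly q' 0 \<noteq> 0" using pev_exists[OF s FQ v1] by blast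
  obtain N p where N: "pev kp eta Q R N p" "Fin s s N" "poly p 1 \<noteq> 0" using pev_exists[OF s FQ v2] by blast
  have nz: "q \<noteq> 0" "q' \<noteq> 0" "p \<noteq> 0" using M(3) M'(3) N(3) by auto
  have 1: "M * eta p = N * eta q" by (rule pev_agree[OF assms(1) Q M(1,2) nz(1) N(1,2) nz(3)])
  have 2: "M' * eta p = N * eta q'" by (rule pev_agree[OF assms(2) Q M'(1,2) nz(2) N(1,2) nz(3)])
  have "M * eta q' * eta p = M * eta p * eta q'" by (rule eta_right_commute)
  also have "\<dots> = N * eta q' * eta q" unfolding 1 by (rule eta_right_commute)
  also have "\<dots> = M' * eta q * eta p" unfolding 2[symmetric] by (rule eta_right_commute)
  finally have MM: "M * eta q' = M' * eta q" by (rule eta_cancel[OF nz(3)])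
  interpret h: rhom "evp 0" by (rule evp_rhom)
  have u: "unit (evp 0 (eta q))" "unit (evp 0 (eta q'))" using M(3) M'(3) by (simp_all add: unit_eta)
  obtain W where W: "ev eta P0 S W" "W * evp 0 (eta q) = evp 0 M"
    using special_pev[OF special_evp M(1) u(1), unfolded e(1)] by blast
  obtain W' where W': "ev eta P0 S' W'" "W' * evp 0 (eta q') = evp 0 M'"
    using special_pev[OF special_evp M'(1) u(2), unfolded e(1)] by blast
  have "W * (evp 0 (eta q) * evp 0 (eta q')) = evp 0 (M * eta q')" using W(2) by (simp add: h.mult flip: mult.assoc)
  also have "\<dots> = W' * (evp 0 (eta q') * evp 0 (eta q))" unfolding MM using W'(2) by (simp add: h.mult flip: mult.assoc)
  also have "evp 0 (eta q') * evp 0 (eta q) = evp 0 (eta q) * evp 0 (eta q')"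
    by (rule special_eta_central[OF special_evp])
  finally have "W = W'" by (rule unit_cancel_right[OF unit_multI[OF u]])
  then show "V = V'" using ev_unique[OF V W(1)] ev_unique[OF V' W'(1)] by simp
qed

section \<open>Regularity at every point of the domain\<close>

definition represents :: "'a nc_expr \<Rightarrow> bool" where
  "represents S \<longleftrightarrow> (\<forall>P\<in>pts. \<forall>V W. ev eta P S V \<longrightarrow> reg P W \<longrightarrow> V = fval P W)"

lemma special_inverse_central:
  assumes T: "special \<Theta>" and i: "\<Theta> (eta h) * i = 1" "i * \<Theta> (eta h) = 1"
  shows "i * \<Theta> x = \<Theta> x * i"
proof -
  have "i * \<Theta> x = i * (\<Theta> x * (\<Theta> (eta h) * i))" using i by simp
  also have "\<dots> = i * (\<Theta> (eta h) * \<Theta> x) * i" using special_eta_central[OF T, of h x] by (simp add: mult.assoc)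
  also have "\<dots> = i * \<Theta> (eta h) * \<Theta> x * i" by (simp add: mult.assoc)
  finally show ?thesis using i by simp
qed

text \<open>The fraction \<open>N / h\<close> specializes to a true inverse as soon as
  \<open>h\<close> becomes a unit.\<close>

lemma special_reg:
  assumes T: "special \<Theta>" and Q: "Q \<in> pts" and N: "p.Lam Q * N = eta h" "N * p.Lam Q = eta h"
    and i: "\<Theta> (eta h) * i = 1" "i * \<Theta> (eta h) = 1"
  shows "reg (\<lambda>k. \<Theta> (Q k)) (\<Theta> N * i)"
  unfolding reg_def inverses_def
proof (intro conjI)
  interpret t: rhom \<Theta> using T unfolding special_def by blast
  have 1: "Lam (\<lambda>k. \<Theta> (Q k)) * \<Theta> N = \<Theta> (eta h)" "\<Theta> N * Lam (\<lambda>k. \<Theta> (Q k)) = \<Theta> (eta h)"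
    unfolding special_Lam(1)[OF T, symmetric] t.mult[symmetric] N by simp_all
  show "(\<lambda>k. \<Theta> (Q k)) \<in> pts" by (rule special_Lam(4)[OF T Q])
  show "Lam (\<lambda>k. \<Theta> (Q k)) * (\<Theta> N * i) = 1" using 1(1) i by (simp flip: mult.assoc)
  show "\<Theta> N * i * Lam (\<lambda>k. \<Theta> (Q k)) = 1"
    using 1(2) i by (simp add: special_inverse_central[OF T i, symmetric] mult.assoc)
qed

text \<open>The two fractions for the value are compared where \<open>q\<close> and \<open>h\<close>
  both become units. The resulting polynomial identity also holds at zeros of \<open>h\<close>,
  where it constrains \<open>N\<close>.\<close>

lemma pev_represents:
  assumes S: "represents S" and Q: "Q \<in> pts" and M: "pev kp eta Q S M q" "Fin s s M" "q \<noteq> 0"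
    and N: "Fin L L N" "p.Lam Q * N = eta h" "N * p.Lam Q = eta h" "h \<noteq> 0"
  shows "M * eta h = (eta h * dg (rmap cp id0) + dg (rmap cp ic) * N * p.BS (p.dl Q)) * eta q"
proof (rule specialization_eq)
  show "Fin s s (M * eta h)" unfolding dg2_central[symmetric] using M(2) by (rule Fin_scal)
  show "Fin s s ((eta h * dg (rmap cp id0) + dg (rmap cp ic) * N * p.BS (p.dl Q)) * eta q)"
    unfolding dg2_central[of q, symmetric] using Q N(1)
    by (intro Fin_scal Fin_add Fin_mult[of s L _ s] Fin_mult[of s L _ L] Fin_dg rmap_Amp id0_Amp ic_Amp Fin_BS_p dl_pts_p) auto
  show "q * h \<noteq> 0" using M N by simp
  fix \<Theta> assume T: "special \<Theta>" and u: "unit (\<Theta> (eta (q * h)))"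
  interpret t: rhom \<Theta> using T unfolding special_def by blast
  have Td: "\<Theta> (dg (rmap cp x)) = dg x" for x using T unfolding special_def by blast
  note u' = unit_factors[OF T u]
  obtain V where V: "ev eta (\<lambda>k. \<Theta> (Q k)) S V" "V * \<Theta> (eta q) = \<Theta> M" using special_pev[OF T M(1) u'(1)] .
  obtain i where i: "\<Theta> (eta h) * i = 1" "i * \<Theta> (eta h) = 1" using u'(2) unfolding unit_def by blast
  have ci: "i * \<Theta> x = \<Theta> x * i" for x by (rule special_inverse_central[OF T i])
  have "reg (\<lambda>k. \<Theta> (Q k)) (\<Theta> N * i)" by (rule special_reg[OF T Q N(2,3) i])
  then have "V = dg id0 + dg ic * (\<Theta> N * i) * BS (dl (\<lambda>k. \<Theta> (Q k)))"
    using S V(1) unfolding represents_def fval_def reg_def by blast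
  then have "V * \<Theta> (eta h) = \<Theta> (eta h * dg (rmap cp id0) + dg (rmap cp ic) * N * p.BS (p.dl Q))"
  proof -
    have "dg ic * (\<Theta> N * i) * BS (dl (\<lambda>k. \<Theta> (Q k))) * \<Theta> (eta h) = dg ic * \<Theta> N * (i * \<Theta> (p.BS (p.dl Q))) * \<Theta> (eta h)"
      by (simp add: special_Lam(2)[OF T] mult.assoc)
    also have "\<dots> = dg ic * \<Theta> N * \<Theta> (p.BS (p.dl Q)) * (i * \<Theta> (eta h))" unfolding ci by (simp add: mult.assoc i)
    also have "\<dots> = \<Theta> (dg (rmap cp ic) * N * p.BS (p.dl Q))" using i by (simp add: t.mult Td)
    finally have e: "dg ic * (\<Theta> N * i) * BS (dl (\<lambda>k. \<Theta> (Q k))) * \<Theta> (eta h) = \<Theta> (dg (rmap cp ic) * N * p.BS (p.dl Q))" .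
    have "dg id0 * \<Theta> (eta h) = \<Theta> (eta h * dg (rmap cp id0))"
      using special_eta_central[OF T, of h "dg (rmap cp id0)"] by (simp add: t.mult Td)
    then show ?thesis unfolding \<open>V = _\<close> by (simp only: distrib_right e t.add)
  qed
  then have "\<Theta> ((eta h * dg (rmap cp id0) + dg (rmap cp ic) * N * p.BS (p.dl Q)) * eta q) = V * \<Theta> (eta h) * \<Theta> (eta q)"
    by (simp add: t.mult)
  also have "\<dots> = \<Theta> (M * eta h)"
    unfolding t.mult V(2)[symmetric] using special_eta_central[OF T, of h "eta q"] by (simp add: mult.assoc)
  finally show "\<Theta> (M * eta h) = \<Theta> ((eta h * dg (rmap cp id0) + dg (rmap cp ic) * N * p.BS (p.dl Q)) * eta q)" by simp
qed


text \<open>Nonemptiness is the issue: \<open>S\<close> is defined at \<open>P0\<close>, which may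
  be singular, and the centre is regular, but \<open>S\<close> may be undefined there. On the line
  between them both denominators are nonzero polynomials, and a quotient \<open>K[t]/(g)\<close> in
  which they are units supplies a point of both kinds, even over a finite field.\<close>

lemma tri_closed_domain:
  assumes P0: "P0 \<in> pts" "ev eta P0 S V0" and L: "0 < L"
  shows "tri_closed {U\<in>pts. (\<exists>V. ev eta U S V) \<and> (\<exists>W. reg U W)}"
proof -
  define Q where "Q = line P0 cen"
  have FQ: "Fin s s (Q k)" for k using P0(1) by (simp add: Q_def Fin_line ptsD center_pts ptsD[OF center_pts])
  then have Q: "Q \<in> pts" by (simp add: pts_def)
  have e: "(\<lambda>k. evp 0 (Q k)) = P0" "(\<lambda>k. evp 1 (Q k)) = cen" by (simp_all add: Q_def evp_line)
  have v0: "ev eta (\<lambda>k. evp 0 (Q k)) S V0" using P0(2) by (simp only: e)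
  obtain M q where M: "pev kp eta Q S M q" "Fin s s M" "poly q 0 \<noteq> 0" using pev_exists[OF s FQ v0] by blast
  have "1 * evp 1 (p.Lam Q) = 1"
    using reg_cen unfolding special_Lam(1)[OF special_evp] e by (simp add: reg_def inverses_def)
  then obtain N h where N: "Fin L L N" "p.Lam Q * N = eta h" "N * p.Lam Q = eta h" "poly h 1 \<noteq> 0"
    using adjugate_at[OF Fin_Lam_p[OF L Q] L] by blast
  have "q * h \<noteq> 0" using M(3) N(4) by auto
  then obtain g where g: "0 < degree g" "unit (rho g (eta (q * h)))" using exists_modulus by blast
  note T = special_rho[OF g(1)]
  note u = unit_factors[OF T g(2)]
  obtain V where "ev eta (\<lambda>k. rho g (Q k)) S V" using special_pev[OF T M(1) u(1)] .
  moreover obtain i where "rho g (eta h) * i = 1" "i * rho g (eta h) = 1" using u(2) unfolding unit_def by blast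
  then have "reg (\<lambda>k. rho g (Q k)) (rho g N * i)" by (rule special_reg[OF T Q N(2,3)])
  ultimately have "{U\<in>pts. (\<exists>V. ev eta U S V) \<and> (\<exists>W. reg U W)} \<noteq> {}" using special_Lam(4)[OF T Q] by blast
  moreover have "(\<lambda>k. blk (U k) (Z k) 0 (V k)) \<in> {U\<in>pts. (\<exists>V. ev eta U S V) \<and> (\<exists>W. reg U W)}"
    if U: "U \<in> {U\<in>pts. (\<exists>V. ev eta U S V) \<and> (\<exists>W. reg U W)}" and V: "V \<in> {U\<in>pts. (\<exists>V. ev eta U S V) \<and> (\<exists>W. reg U W)}"
      and Z: "Z \<in> pts" for U V Z :: "nat \<Rightarrow> 'a rfmat rfmat"
  proof -
    have p: "U \<in> pts" "V \<in> pts" using U V by auto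
    obtain u v w w' where "ev eta U S u" "ev eta V S v" "reg U w" "reg V w'" using U V by blast
    from this(1,2) obtain z where "ev eta (\<lambda>k. blk (U k) (Z k) 0 (V k)) S (blk u z 0 v)"
      using ev_tri[OF dg_blk] by blast
    with \<open>reg U w\<close> \<open>reg V w'\<close> show ?thesis using reg_tri[of U w V w' Z] blk_pts[OF p(1) Z zero_pts p(2)] Z by blast
  qed
  ultimately show ?thesis unfolding tri_closed_def by blast
qed

text \<open>One diagonal block has a true inverse \<open>W\<close>, the other the fraction
  \<open>N / h\<close>; \<open>W\<close> is multiplied by \<open>h\<close> to reach the common
  denominator.\<close>

lemma p_tri_inverse1:
  assumes "p.Lam \<alpha> * W = 1" "W * p.Lam \<alpha> = 1" "p.Lam \<gamma> * N = eta h" "N * p.Lam \<gamma> = eta h"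
  shows "p.Lam (\<lambda>k. blk (\<alpha> k) (\<beta> k) 0 (\<gamma> k)) * blk (eta h * W) (W * p.AS \<beta> * N) 0 N = eta h"
    and "blk (eta h * W) (W * p.AS \<beta> * N) 0 N * p.Lam (\<lambda>k. blk (\<alpha> k) (\<beta> k) 0 (\<gamma> k)) = eta h"
proof -
  have z: "p.AS (\<lambda>k. 0) = 0" using p.AS_blk[of "\<lambda>k. 0" "\<lambda>k. 0" "\<lambda>k. 0" "\<lambda>k. 0"] by (simp add: p.AS_def)
  have b: "eta h = blk (eta h) 0 0 (eta h)" by (rule dg_blk)
  have c: "p.Lam \<alpha> * eta h * W = eta h" using assms(1) by (simp only: dg2_central[symmetric]) (simp add: mult.assoc)
  have c': "W * (p.AS \<beta> * eta h) = eta h * (W * p.AS \<beta>)" using dg2_central[of h "W * p.AS \<beta>"] by (simp add: mult.assoc)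
  show "p.Lam (\<lambda>k. blk (\<alpha> k) (\<beta> k) 0 (\<gamma> k)) * blk (eta h * W) (W * p.AS \<beta> * N) 0 N = eta h"
    by (rule trans[OF _ b[symmetric]]) (simp add: p.Lam_blk z c assms flip: mult.assoc)
  show "blk (eta h * W) (W * p.AS \<beta> * N) 0 N * p.Lam (\<lambda>k. blk (\<alpha> k) (\<beta> k) 0 (\<gamma> k)) = eta h"
    by (rule trans[OF _ b[symmetric]]) (simp add: p.Lam_blk z c' assms mult.assoc)
qed

lemma p_tri_inverse2:
  assumes "p.Lam \<alpha> * N = eta h" "N * p.Lam \<alpha> = eta h" "p.Lam \<gamma> * W = 1" "W * p.Lam \<gamma> = 1"
  shows "p.Lam (\<lambda>k. blk (\<alpha> k) (\<beta> k) 0 (\<gamma> k)) * blk N (N * p.AS \<beta> * W) 0 (eta h * W) = eta h"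
    and "blk N (N * p.AS \<beta> * W) 0 (eta h * W) * p.Lam (\<lambda>k. blk (\<alpha> k) (\<beta> k) 0 (\<gamma> k)) = eta h"
proof -
  have z: "p.AS (\<lambda>k. 0) = 0" using p.AS_blk[of "\<lambda>k. 0" "\<lambda>k. 0" "\<lambda>k. 0" "\<lambda>k. 0"] by (simp add: p.AS_def)
  have b: "eta h = blk (eta h) 0 0 (eta h)" by (rule dg_blk)
  have c: "p.Lam \<gamma> * (eta h * W) = eta h" using assms(3) by (simp only: mult.assoc[symmetric] dg2_central[symmetric]) (simp add: mult.assoc)
  have c': "p.AS \<beta> * (eta h * W) = eta h * (p.AS \<beta> * W)" by (simp flip: mult.assoc) (simp only: dg2_central)
  show "p.Lam (\<lambda>k. blk (\<alpha> k) (\<beta> k) 0 (\<gamma> k)) * blk N (N * p.AS \<beta> * W) 0 (eta h * W) = eta h"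
  proof -
    have "p.Lam \<alpha> * (N * p.AS \<beta> * W) - p.AS \<beta> * (eta h * W) = 0"
      unfolding c' using assms(1) by (simp flip: mult.assoc)
    then show ?thesis by (intro trans[OF _ b[symmetric]]) (simp add: p.Lam_blk z c assms)
  qed
  show "blk N (N * p.AS \<beta> * W) 0 (eta h * W) * p.Lam (\<lambda>k. blk (\<alpha> k) (\<beta> k) 0 (\<gamma> k)) = eta h"
    by (rule trans[OF _ b[symmetric]]) (simp add: p.Lam_blk z assms mult.assoc)
qed

lemma cst_reg:
  assumes "reg U W" shows "p.Lam (\<lambda>k. cst (U k)) * cst W = 1" "cst W * p.Lam (\<lambda>k. cst (U k)) = 1"
proof -
  interpret c: rhom cst by (rule cst_rhom)
  show "p.Lam (\<lambda>k. cst (U k)) * cst W = 1" "cst W * p.Lam (\<lambda>k. cst (U k)) = 1"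
    unfolding cst_Lam[symmetric] c.mult[symmetric] using assms by (simp_all add: reg_def inverses_def c.one)
qed

text \<open>Test \<open>S\<close> at \<open>[\<alpha> \<beta>; 0 \<gamma>]\<close> with \<open>\<alpha> = [U Z; 0 Q]\<close>, \<open>\<beta> = [0 0; \<zeta> 0]\<close>, \<open>\<gamma> = [V 0; 0 V]\<close>: the
  value there involves \<open>\<Lambda>\<^sup>-\<^sup>1 = N / h\<close> at \<open>Q\<close>, and its upper right block must stay regular where \<open>h\<close> vanishes.\<close>
lemma residue_vanishes:
  assumes S: "represents S" and Q: "Q \<in> pts" "ev eta (\<lambda>k. evp 0 (Q k)) S V0" and L: "0 < L"
    and N: "Fin L L N" "p.Lam Q * N = eta h" "N * p.Lam Q = eta h" "h \<noteq> 0" "poly h 0 = 0"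
    and U: "U \<in> pts" "ev eta U S u" "reg U W'" and V: "V \<in> pts" "ev eta V S v" "reg V W"
    and Z: "Z \<in> pts" and \<zeta>: "\<zeta> \<in> pts"
  defines "x \<equiv> AS \<zeta> * (W * BS (dl V)) + BS \<zeta>"
  shows "dg ic * evp 0 N * x = 0" "dg ic * W' * AS Z * evp 0 N * x = 0"
proof -
  interpret c: rhom cst by (rule cst_rhom)
  interpret e: rhom "evp 0" by (rule evp_rhom)
  let ?cU = "\<lambda>k. cst (U k)" and ?cV = "\<lambda>k. cst (V k)" and ?cZ = "\<lambda>k. cst (Z k)" and ?c\<zeta> = "\<lambda>k. cst (\<zeta> k)"
  define \<alpha> where "\<alpha> = (\<lambda>k. blk (?cU k) (?cZ k) 0 (Q k))"
  define \<beta> where "\<beta> = (\<lambda>k. blk 0 0 (?c\<zeta> k) 0)"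
  define \<gamma> where "\<gamma> = (\<lambda>k. blk (?cV k) 0 0 (?cV k))"
  define N\<alpha> where "N\<alpha> = blk (eta h * cst W') (cst W' * p.AS ?cZ * N) 0 N"
  define G where "G = blk (cst W) 0 0 (cst W)"
  define X where "X = (\<lambda>k. blk (\<alpha> k) (\<beta> k) 0 (\<gamma> k))"
  define NX where "NX = blk N\<alpha> (N\<alpha> * p.AS \<beta> * G) 0 (eta h * G)"
  have cp: "?cU \<in> pts" "?cV \<in> pts" "?cZ \<in> pts" "?c\<zeta> \<in> pts"
    using U(1) V(1) Z \<zeta> by (simp_all add: pts_def Fin_cst)
  have z: "(\<lambda>k. 0) \<in> (pts :: (nat \<Rightarrow> 'a poly rfmat rfmat) set)" by (rule zero_pts)
  have ab: "\<alpha> \<in> pts" "\<beta> \<in> pts" "\<gamma> \<in> pts"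
    unfolding \<alpha>_def \<beta>_def \<gamma>_def by (intro blk_pts cp Q(1) z)+
  have X: "X \<in> pts" unfolding X_def by (intro blk_pts ab z)
  have FX: "Fin s s (X k)" for k by (rule ptsD[OF X])
  have pz: "p.AS (\<lambda>k. 0) = 0" "p.BS (\<lambda>k. 0) = 0" by (simp_all add: p.AS_def p.BS_def)
  have N\<alpha>: "p.Lam \<alpha> * N\<alpha> = eta h" "N\<alpha> * p.Lam \<alpha> = eta h"
    unfolding \<alpha>_def N\<alpha>_def by (intro p_tri_inverse1 cst_reg[OF U(3)] N(2,3))+
  have G: "p.Lam \<gamma> * G = 1" "G * p.Lam \<gamma> = 1"
    unfolding \<gamma>_def G_def by (simp_all add: p.Lam_blk pz cst_reg[OF V(3)])
  have NX: "p.Lam X * NX = eta h" "NX * p.Lam X = eta h"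
    unfolding X_def NX_def by (intro p_tri_inverse2 N\<alpha> G)+
  have FW: "Fin L L W" "Fin L L W'" using U V L by (auto simp: reg_def intro: Fin_Lam_inverse)
  have FN: "Fin L L NX"
    unfolding NX_def N\<alpha>_def G_def
    by (intro Fin_blk Fin_mult[of _ L _ L] Fin_scal Fin_cst FW Fin_AS_p ab cp N(1) Fin_zero)
  \<comment> \<open>\<open>S\<close> is defined at \<open>U\<close>, at \<open>V\<close> and at
    \<open>t = 0\<close> on the line, hence by \<open>ev_tri\<close> at the nested triangular point,
    whatever its corners.\<close>
  obtain v1 where v1: "ev eta (\<lambda>k. blk (U k) (Z k) 0 (evp 0 (Q k))) S v1"
    using ev_tri[OF dg_blk U(2) Q(2), of Z] by blast
  obtain v2 where v2: "ev eta (\<lambda>k. blk (V k) 0 0 (V k)) S v2"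
    using ev_tri[OF dg_blk V(2) V(2), of "\<lambda>k. 0"] by blast
  obtain v3 where v3: "ev eta (\<lambda>k. blk (blk (U k) (Z k) 0 (evp 0 (Q k))) (blk 0 0 (\<zeta> k) 0) 0 (blk (V k) 0 0 (V k))) S v3"
    using ev_tri[OF dg_blk v1 v2, of "\<lambda>k. blk 0 0 (\<zeta> k) 0"] by blast
  have "(\<lambda>k. evp 0 (X k)) = (\<lambda>k. blk (blk (U k) (Z k) 0 (evp 0 (Q k))) (blk 0 0 (\<zeta> k) 0) 0 (blk (V k) 0 0 (V k)))"
    by (simp add: X_def \<alpha>_def \<beta>_def \<gamma>_def evp_blk e.zero)
  then have "ev eta (\<lambda>k. evp 0 (X k)) S v3" using v3 by simp
  then obtain M q where M: "pev kp eta X S M q" "Fin s s M" "poly q 0 \<noteq> 0" using pev_exists[where Q = X, OF s FX] by blast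
  have q0: "q \<noteq> 0" using M(3) by auto
  \<comment> \<open>At \<open>t = 0\<close> the factor \<open>h\<close> vanishes while
    \<open>q\<close> does not, which forces the numerator \<open>C NX B\<close> to vanish
    there.\<close>
  have "evp 0 (M * eta h) = evp 0 ((eta h * dg (rmap cp id0) + dg (rmap cp ic) * NX * p.BS (p.dl X)) * eta q)"
    by (rule arg_cong[OF pev_represents[OF S X M(1,2) q0 FN NX N(4)]])
  then have "evp 0 (dg (rmap cp ic) * NX * p.BS (p.dl X)) * eta (poly q 0) = 0 * eta (poly q 0)"
    by (simp add: e.mult e.add N(5))
  then have *: "evp 0 (dg (rmap cp ic) * NX * p.BS (p.dl X)) = 0"
    by (rule unit_cancel_right[OF unit_eta[OF M(3)], rotated -1])
  \<comment> \<open>\<open>\<beta>\<close> carries \<open>cst x\<close> into the lower left block,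
    where it meets the column of \<open>N\<alpha>\<close> that contains \<open>N\<close> and its
    product with the data of \<open>U\<close>.\<close>
  have "dg (rmap cp ic) * (N\<alpha> * (p.AS \<beta> * (G * p.BS (p.dl \<gamma>)) + p.BS \<beta>))
      = blk (dg (rmap cp ic) * (cst W' * p.AS ?cZ * N * cst x)) 0 (dg (rmap cp ic) * (N * cst x)) 0"
  proof -
    have "cst x = p.AS ?c\<zeta> * (cst W * p.BS (p.dl ?cV)) + p.BS ?c\<zeta>"
      by (simp only: x_def c.add c.mult cst_AS cst_BS_dl) (simp only: cst_BS)
    then have "p.AS \<beta> * (G * p.BS (p.dl \<gamma>)) + p.BS \<beta> = blk 0 0 (cst x) 0"
      by (simp add: \<beta>_def G_def \<gamma>_def p.AS_blk p.BS_blk p.dl_blk pz)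
    then show ?thesis by (subst dg_blk) (simp add: N\<alpha>_def)
  qed
  moreover have "\<exists>y y'. dg (rmap cp ic) * NX * p.BS (p.dl X)
      = blk y (dg (rmap cp ic) * (N\<alpha> * (p.AS \<beta> * (G * p.BS (p.dl \<gamma>)) + p.BS \<beta>))) 0 y'"
    by (subst dg_blk) (simp add: NX_def X_def p.dl_blk p.BS_blk pz distrib_left mult.assoc add.commute)
  ultimately have "evp 0 (dg (rmap cp ic) * (cst W' * p.AS ?cZ * N * cst x)) = 0" "evp 0 (dg (rmap cp ic) * (N * cst x)) = 0"
    using * by (auto simp: evp_blk)
  moreover have "evp 0 (dg (rmap cp ic)) = dg ic" using special_evp[of 0] unfolding special_def by blast
  ultimately show "dg ic * evp 0 N * x = 0" "dg ic * W' * AS Z * evp 0 N * x = 0"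
    by (simp_all add: e.mult mult.assoc flip: cst_AS)
qed

lemma evp_0_divisible:
  fixes N :: "'a poly rfmat rfmat"
  assumes "Fin nr nc N" "evp 0 N = 0"
  obtains N' where "Fin nr nc N'" "N = eta [:0, 1:] * N'"
proof
  let ?f = "\<lambda>p :: 'a poly. p div [:0, 1:]"
  show "Fin nr nc (rmap (rmap ?f) N)" using assms(1) by (intro Fin_rmap) simp_all
  have z: "rmap ?f 0 = 0" by (rule rfmat_eqI) (simp add: ent_rmap)
  show "N = eta [:0, 1:] * rmap (rmap ?f) N"
  proof (rule rfmat2_eqI)
    fix I J i j
    have "poly (ent (ent N I J) i j) 0 = 0" using assms(2) ent_evp[of 0 N I J i j] by simp
    then have "[:0, 1:] dvd ent (ent N I J) i j" by (simp add: poly_eq_0_iff_dvd)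
    then have "ent (ent N I J) i j = [:0, 1:] * ?f (ent (ent N I J) i j)" by (rule dvd_mult_div_cancel[symmetric])
    then show "ent (ent N I J) i j = ent (ent (eta [:0, 1:] * rmap (rmap ?f) N) I J) i j"
      using z by (simp add: ent_rmap del: mult_pCons_left)
  qed
qed

theorem represents_imp_reg:
  assumes obs: "observable s d r" and ctrl: "controllable s d r"
    and S: "represents S" and P0: "P0 \<in> pts" "ev eta P0 S V0"
  shows "\<exists>W. reg P0 W"
proof (cases "0 < L")
  case False
  then show ?thesis using Lam_L0[OF _ P0(1)] P0(1) by (auto simp: reg_def inverses_def)
next
  case L: True
  define Q where "Q = line P0 cen"
  have FQ: "Fin s s (Q k)" for k using P0(1) by (simp add: Q_def Fin_line ptsD ptsD[OF center_pts])
  then have Q: "Q \<in> pts" by (simp add: pts_def)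
  have e: "(\<lambda>k. evp 0 (Q k)) = P0" "(\<lambda>k. evp 1 (Q k)) = cen" by (simp_all add: Q_def evp_line)
  have v0: "ev eta (\<lambda>k. evp 0 (Q k)) S V0" using P0(2) by (simp only: e)
  \<comment> \<open>Pairs that express the inverse along the line as \<open>N / h\<close>. The
    centre, at \<open>t = 1\<close>, is regular, so such a pair exists; one with \<open>h\<close> of
    least degree is chosen.\<close>
  define good where "good = (\<lambda>(N, h). Fin L L N \<and> p.Lam Q * N = eta h \<and> N * p.Lam Q = eta h \<and> h \<noteq> 0)"
  have "1 * evp 1 (p.Lam Q) = 1"
    using reg_cen unfolding special_Lam(1)[OF special_evp] e by (simp add: reg_def inverses_def)
  then obtain N0 h0 where N0: "Fin L L N0" "p.Lam Q * N0 = eta h0" "N0 * p.Lam Q = eta h0" "poly h0 1 \<noteq> 0"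
    using adjugate_at[OF Fin_Lam_p[OF L Q] L] by blast
  have "h0 \<noteq> 0" using N0(4) by auto
  then have "good (N0, h0)" using N0 by (simp add: good_def)
  then obtain Nh where Nh: "good Nh" "\<And>Nh'. good Nh' \<Longrightarrow> degree (snd Nh) \<le> degree (snd Nh')"
    using ex_has_least_nat[of good "(N0, h0)" "\<lambda>x. degree (snd x)"] by blast
  obtain N h where [simp]: "Nh = (N, h)" by (cases Nh)
  have N: "Fin L L N" "p.Lam Q * N = eta h" "N * p.Lam Q = eta h" "h \<noteq> 0" using Nh(1) by (simp_all add: good_def)
  interpret ev0: rhom "evp 0" by (rule evp_rhom)
  show ?thesis
  proof (cases "poly h 0 = 0")
    case True
    let ?\<U> = "{U\<in>pts. (\<exists>V. ev eta U S V) \<and> (\<exists>W. reg U W)}"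
    have \<U>: "tri_closed ?\<U>" by (rule tri_closed_domain[OF P0 L])
    \<comment> \<open>The relations of \<open>residue_vanishes\<close> are those that
      \<open>obs_points\<close> asks of \<open>evp 0 N * ?x\<close>, and the vectors
      \<open>?x\<close> are those of \<open>ctrl_points\<close>.\<close>
    have "evp 0 N = 0"
    proof (rule ctrl_points[OF ctrl \<U> Fin_evp[OF N(1)]])
      fix V W and \<zeta> :: "nat \<Rightarrow> 'a rfmat rfmat"
      assume V: "V \<in> ?\<U>" "reg V W" and \<zeta>: "\<zeta> \<in> pts"
      let ?x = "AS \<zeta> * (W * BS (dl V)) + BS \<zeta>"
      obtain v where v: "V \<in> pts" "ev eta V S v" using V(1) by blast
      note res = residue_vanishes[OF S Q v0 L N True _ _ _ v V(2) _ \<zeta>]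
      have FW: "Fin L L W" using V(2) L by (auto simp: reg_def intro: Fin_Lam_inverse)
      have "Fin L s ?x"
        by (intro Fin_add Fin_mult[of L L _ s] Fin_AS Fin_BS FW ptsD[OF \<zeta>] ptsD[OF dl_pts[OF v(1)]])
      then have F: "Fin L s (evp 0 N * ?x)" using Fin_evp[OF N(1)] by (rule Fin_mult[rotated])
      show "evp 0 N * ?x = 0"
      proof (rule obs_points[OF obs \<U> F])
        show "dg ic * (evp 0 N * ?x) = 0" using res(1)[OF v V(2) zero_pts] by (simp add: mult.assoc)
        fix U W' k and Z :: "'a rfmat rfmat"
        assume U: "U \<in> ?\<U>" "reg U W'" and k: "k < d" and Z: "Fin s s Z"
        obtain u where u: "U \<in> pts" "ev eta U S u" using U(1) by blast
        show "dg ic * W' * (rmap (ia k) Z * (evp 0 N * ?x)) = 0"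
          using res(2)[OF u U(2) single_pts[OF Z], of k] by (simp add: AS_single' k mult.assoc)
      qed
    qed
    then obtain N' where N': "Fin L L N'" "N = eta [:0, 1:] * N'" using evp_0_divisible[OF N(1)] by blast
    obtain h' where h': "h = [:0, 1:] * h'" using True by (auto simp: poly_eq_0_iff_dvd dvd_def)
    have h0: "h' \<noteq> 0" using N(4) h' by auto
    have "p.Lam Q * N' = eta h'"
    proof (rule eta_cancel)
      show "[:0, 1:] \<noteq> (0 :: 'a poly)" by simp
      have "p.Lam Q * N' * eta [:0, 1:] = p.Lam Q * N"
        unfolding N'(2) mult.assoc by (rule arg_cong[OF dg2_central[symmetric]])
      then show "p.Lam Q * N' * eta [:0, 1:] = eta h' * eta [:0, 1:]"
        unfolding N(2) h' by (simp add: mult.commute flip: dg_mult)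
    qed
    moreover have "N' * p.Lam Q = eta h'"
    proof (rule eta_cancel)
      show "[:0, 1:] \<noteq> (0 :: 'a poly)" by simp
      have "N' * p.Lam Q * eta [:0, 1:] = N * p.Lam Q"
        unfolding N'(2) mult.assoc[of "eta [:0, 1:]"] by (rule dg2_central[symmetric])
      then show "N' * p.Lam Q * eta [:0, 1:] = eta h' * eta [:0, 1:]"
        unfolding N(3) h' by (simp add: mult.commute flip: dg_mult)
    qed
    ultimately have "good (N', h')" using N'(1) h0 by (simp add: good_def)
    then have "degree h \<le> degree h'" using Nh(2)[of "(N', h')"] by simp
    moreover have "degree h = Suc (degree h')" unfolding h' using h0 by (subst degree_mult_eq) auto
    ultimately show ?thesis by simp
  next
    case False
    then obtain i where i: "evp 0 (eta h) * i = 1" "i * evp 0 (eta h) = 1"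
      using unit_eta[OF False] unfolding unit_def by auto
    then show ?thesis using special_reg[OF special_evp Q N(2,3) i] unfolding e by blast
  qed
qed


section \<open>Return to matrices and construction of the function\<close>

lemma reg_unique: "reg P W \<Longrightarrow> reg P W' \<Longrightarrow> W = W'"
  unfolding reg_def inverses_def by (metis mult.assoc mult_1_left mult_1_right)

lemma nc_eval_imp_ev_blocks:
  assumes m: "0 < m" and X: "X \<in> mat_tuples d (s * m)" and v: "nc_vars S \<subseteq> {..<d}" and V: "nc_eval (s * m) X S = Some V"
  shows "ev eta (ptm m X) S (amp2 s s m V)"
proof -
  interpret e: mat_emb "s * m" "amp2 s s m" "\<lambda>c::'a. eta c" by (rule mat_emb_amp2[OF s m])
  have "ev eta (\<lambda>k. amp2 s s m (X ! k)) S (amp2 s s m V)" using e.nc_eval_imp_ev[OF X v V] by blast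
  then show ?thesis by (subst ev_cong[of _ _ "\<lambda>k. amp2 s s m (X ! k)"]) (use v in \<open>auto simp: ptm_def\<close>)
qed

lemma ev_imp_nc_eval_blocks:
  assumes m: "0 < m" and X: "X \<in> mat_tuples d (s * m)" and v: "nc_vars S \<subseteq> {..<d}" and V: "ev eta (ptm m X) S V"
  obtains M where "nc_eval (s * m) X S = Some M" "V = amp2 s s m M"
proof -
  interpret e: mat_emb "s * m" "amp2 s s m" "\<lambda>c::'a. eta c" by (rule mat_emb_amp2[OF s m])
  have "ev eta (\<lambda>k. amp2 s s m (X ! k)) S V"
    using V by (subst ev_cong[of _ _ "ptm m X"]) (use v in \<open>auto simp: ptm_def\<close>)
  then obtain M where M: "nc_eval (s * m) X S = Some M" using e.ev_imp_nc_eval[OF X v] by blast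
  show ?thesis by (rule that[OF M ev_unique[OF V nc_eval_imp_ev_blocks[OF m X v M]]])
qed

lemma nc_eval_imp_ev_kron:
  assumes n: "0 < n" and X: "X \<in> mat_tuples d n" and v: "nc_vars S \<subseteq> {..<d}" and V: "nc_eval n X S = Some V"
  shows "V \<in> carrier_mat n n" and "ev eta (ptm n (map (kron (1\<^sub>m s)) X)) S (amp2 s s n (kron (1\<^sub>m s) V))"
proof -
  interpret e: mat_emb n "\<lambda>X. amp2 s s n (kron (1\<^sub>m s) X)" "\<lambda>c::'a. eta c" by (rule mat_emb_kron[OF s n])
  note * = e.nc_eval_imp_ev[OF X v V]
  show "V \<in> carrier_mat n n" using * by blast
  have "ev eta (\<lambda>k. amp2 s s n (kron (1\<^sub>m s) (X ! k))) S (amp2 s s n (kron (1\<^sub>m s) V))" using * by blast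
  then show "ev eta (ptm n (map (kron (1\<^sub>m s)) X)) S (amp2 s s n (kron (1\<^sub>m s) V))"
    by (subst ev_cong[of _ _ "\<lambda>k. amp2 s s n (kron (1\<^sub>m s) (X ! k))"])
      (use v X in \<open>auto simp: ptm_def mat_tuples_def\<close>)
qed

lemma nc_equiv_imp_agree:
  assumes e: "(R, S) \<in> nc_equiv d" shows "agree R S"
  unfolding agree_def
proof (intro ballI allI impI)
  fix P V V' assume P: "P \<in> pts" and V: "ev eta P R V" and V': "ev eta P S V'"
  have v: "nc_vars R \<subseteq> {..<d}" "nc_vars S \<subseteq> {..<d}" using e by (auto simp: nc_equiv_def nc_rat_exprs_def)
  obtain m X where m: "0 < m" and X: "X \<in> mat_tuples d (s * m)" and PX: "\<And>k. k < d \<Longrightarrow> P k = ptm m X k"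
    using pts_imp_ptm[OF P] by blast
  have e1: "ev eta (ptm m X) R V" and e2: "ev eta (ptm m X) S V'"
    using V V' ev_cong[of R P "ptm m X", OF PX] ev_cong[of S P "ptm m X", OF PX] v by blast+
  obtain M where M: "nc_eval (s * m) X R = Some M" "V = amp2 s s m M"
    by (rule ev_imp_nc_eval_blocks[OF m X v(1) e1])
  obtain M' where M': "nc_eval (s * m) X S = Some M'" "V' = amp2 s s m M'"
    by (rule ev_imp_nc_eval_blocks[OF m X v(2) e2])
  have "1 \<le> s * m" using s m by (simp add: Suc_le_eq)
  moreover have "X \<in> nc_dom d (s * m) R \<inter> nc_dom d (s * m) S"
    using X M(1) M'(1) by (simp add: nc_dom_def)
  ultimately have "nc_eval (s * m) X R = nc_eval (s * m) X S"
    using e unfolding nc_equiv_def by blast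
  then show "V = V'" using M M' by simp
qed

lemma eR_nc_eval:
  assumes lla: "linearized_lost_abbey s d Y r" and n: "0 < n" and X: "X \<in> mat_tuples d n"
    and \<phi>: "nc_eval n X (eR K c) = Some \<phi>"
  obtains W where "\<phi> \<in> carrier_mat n n" "reg (spt n X) W" "fval (spt n X) W = rmap dg (amp n n \<phi>)"
proof -
  interpret e: mat_emb n "amp n n" "\<lambda>c::'a. dg c" by (rule mat_emb_amp[OF n])
  have V: "\<phi> \<in> carrier_mat n n" "ev dg (xt n X) (eR K c) (amp n n \<phi>)"
    using e.nc_eval_imp_ev[OF X vars_eR \<phi>] by blast+
  obtain W where W: "reg (spt n X) W" using eR_value(1)[OF n X V(2)] by blast
  obtain \<psi> where \<psi>: "fval (spt n X) W = rmap dg (amp n n \<psi>)" using scalar_value[OF lla n X W] by blast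
  have "unpsi (rmap dg y) 0 0 = y" for y :: "'a rfmat"
    by (rule rfmat_eqI) (simp add: ent_unpsi ent_rmap ent_dg)
  then have "amp n n \<psi> = amp n n \<phi>" using eR_value(2)[OF n X V(2) W] \<psi> by simp
  then show ?thesis using that[OF V(1) W] \<psi> by simp
qed

lemma eR_nc_eval_exists:
  assumes n: "0 < n" and X: "X \<in> mat_tuples d n" and W: "reg (spt n X) W"
  obtains K c where "X \<in> nc_dom d n (eR K c)"
proof -
  interpret e: mat_emb n "amp n n" "\<lambda>c::'a. dg c" by (rule mat_emb_amp[OF n])
  obtain K c V where "ev dg (xt n X) (eR K c) V" using eR_defined[OF n X W] by blast
  from e.ev_imp_nc_eval[OF X vars_eR this] show ?thesis using that X by (auto simp: nc_dom_def)
qed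

text \<open>Wherever such an expression is defined, its value \<open>\<phi>\<close> satisfies
  \<open>\<phi> \<otimes> I = \<R>(X \<otimes> I)\<close>, which does not involve \<open>K\<close>
  and \<open>c\<close>.\<close>

lemma eR_equiv:
  assumes lla: "linearized_lost_abbey s d Y r"
    and X: "1 \<le> n" "X \<in> nc_dom d n (eR K c)" and X': "1 \<le> n'" "X' \<in> nc_dom d n' (eR K' c')"
  shows "(eR K c, eR K' c') \<in> nc_equiv d"
proof -
  have "nc_eval n X (eR K c) = nc_eval n X (eR K' c')"
    if n: "1 \<le> n" and X: "X \<in> nc_dom d n (eR K c)" "X \<in> nc_dom d n (eR K' c')" for n X
  proof -
    have n0: "0 < n" using n by simp
    have Xt: "X \<in> mat_tuples d n" using X(1) by (simp add: nc_dom_def)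
    obtain \<phi> \<psi> where v: "nc_eval n X (eR K c) = Some \<phi>" "nc_eval n X (eR K' c') = Some \<psi>"
      using X by (auto simp: nc_dom_def)
    obtain W where W: "\<phi> \<in> carrier_mat n n" "reg (spt n X) W" "fval (spt n X) W = rmap dg (amp n n \<phi>)"
      by (rule eR_nc_eval[OF lla n0 Xt v(1)])
    obtain W' where W': "\<psi> \<in> carrier_mat n n" "reg (spt n X) W'" "fval (spt n X) W' = rmap dg (amp n n \<psi>)"
      by (rule eR_nc_eval[OF lla n0 Xt v(2)])
    have eq: "rmap dg (amp n n \<phi>) = rmap dg (amp n n \<psi>)"
      using W(3) W'(3) reg_unique[OF W(2) W'(2)] by simp
    have "amp n n \<phi> = amp n n \<psi>"
    proof (rule rfmat_eqI)
      fix i j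
      show "ent (amp n n \<phi>) i j = ent (amp n n \<psi>) i j"
        using arg_cong[OF eq, of "\<lambda>P. ent (ent P i j) 0 0"] by (simp add: ent_rmap ent_dg)
    qed
    then have "\<phi> = \<psi>" by (rule amp_inj[OF W(1) W'(1)])
    then show ?thesis using v by simp
  qed
  then show ?thesis using X X' vars_eR by (auto simp: nc_equiv_def nc_rat_exprs_def)
qed

text \<open>\<open>S\<close> is related to the one expression \<open>eR K c\<close>, which may be
  undefined at the regular point \<open>P\<close>. Another one, \<open>eR K' c'\<close>, is defined
  there with the right value; \<open>agree_trans\<close>, with \<open>Z\<close> as a point in the
  domain of \<open>eR K c\<close>, links it to \<open>S\<close>.\<close>

lemma equiv_eR_represents:
  assumes lla: "linearized_lost_abbey s d Y r" and Z: "Z \<in> nc_dom d s (eR K c)" and S: "(eR K c, S) \<in> nc_equiv d"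
  shows "represents S"
  unfolding represents_def
proof (intro ballI allI impI)
  fix P V W assume P: "P \<in> pts" and V: "ev eta P S V" and W: "reg P W"
  obtain m X where m: "0 < m" and X: "X \<in> mat_tuples d (s * m)" and PX: "\<And>k. k < d \<Longrightarrow> P k = ptm m X k"
    using pts_imp_ptm[OF P] by blast
  have R: "reg (ptm m X) W" using W Lam_cong[OF PX] ptm_pts[OF m] unfolding reg_def by simp
  have sm: "0 < s * m" using s m by simp
  note kt = kron_tuples[OF X] and pk = ptm_kron[OF m X]
  \<comment> \<open>The matrices \<open>X\<close> of the point are themselves a tuple of size
    \<open>n = s * m\<close>, and \<open>I \<otimes> X\<close> is the same point of the ring; so the
    value of an \<open>eR\<close> at \<open>X\<close> is the value of the realization at
    \<open>P\<close>.\<close>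
  have "map (kron (1\<^sub>m s)) X \<in> fm_Omega s d Y r (s * m)"
    unfolding fm_Omega_iff_reg[OF sm kt] pk using R by blast
  then obtain W0 where "reg (spt (s * m) X) W0" using kron_Omega_iff[OF lla sm X] by blast
  then obtain K' c' where X': "X \<in> nc_dom d (s * m) (eR K' c')" using eR_nc_eval_exists[OF sm X] by blast
  then obtain \<phi> where \<phi>: "nc_eval (s * m) X (eR K' c') = Some \<phi>" by (auto simp: nc_dom_def)
  obtain W' where W': "\<phi> \<in> carrier_mat (s * m) (s * m)" "reg (spt (s * m) X) W'"
    "fval (spt (s * m) X) W' = rmap dg (amp (s * m) (s * m) \<phi>)"
    by (rule eR_nc_eval[OF lla sm X \<phi>])
  have "amp2 s s m \<phi> = amp2 s s (s * m) (kron (1\<^sub>m s) \<phi>)" using amp2_kron_left[OF W'(1) m s] by simp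
  also have "\<dots> = amp2 s s (s * m) (fm_eval s d Y r (s * m) (map (kron (1\<^sub>m s)) X))"
    using kron_value[OF lla sm X W'(2,1,3)] by simp
  also have "\<dots> = fval (ptm m X) W" using fm_eval_fval(2)[OF sm kt, unfolded pk, OF R] .
  finally have val: "amp2 s s m \<phi> = fval (ptm m X) W" .
  have ev': "ev eta (ptm m X) (eR K' c') (fval (ptm m X) W)"
    using nc_eval_imp_ev_blocks[OF m X vars_eR \<phi>] val by simp
  \<comment> \<open>\<open>s\<close> is written as \<open>s * 1\<close>: \<open>Z\<close> is a point
    with a single block.\<close>
  obtain \<psi> where \<psi>: "nc_eval (s * 1) Z (eR K c) = Some \<psi>" and Zt: "Z \<in> mat_tuples d (s * 1)"
    using Z by (auto simp: nc_dom_def)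
  have "(S, eR K c) \<in> nc_equiv d" using S by (auto simp: nc_equiv_def)
  moreover have "(eR K' c', eR K c) \<in> nc_equiv d"
    by (rule eR_equiv[OF lla _ X' _ Z]) (use sm s in auto)
  ultimately have "agree S (eR K' c')"
    using agree_trans[OF nc_equiv_imp_agree nc_equiv_imp_agree ptm_pts[of 1] nc_eval_imp_ev_blocks[OF _ Zt vars_eR \<psi>]]
    by simp
  moreover have "ev eta (ptm m X) S V"
  proof -
    have "nc_vars S \<subseteq> {..<d}" using S by (auto simp: nc_equiv_def nc_rat_exprs_def)
    then show ?thesis using V ev_cong[of S P "ptm m X", OF PX] by blast
  qed
  ultimately have "V = fval (ptm m X) W" using ev' ptm_pts[OF m] unfolding agree_def by blast
  then show "V = fval P W" using fval_cong[of P "ptm m X" W] PX by simp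
qed

text \<open>\<open>I \<otimes> Y\<close> is the centre, where the pencil is \<open>1\<close>;
  exchanging the tensor factors carries regularity to \<open>Y \<otimes> I\<close>.\<close>

lemma center_regular: "\<exists>W. reg (spt s Y) W" if lla: "linearized_lost_abbey s d Y r"
proof -
  have Yt: "Y \<in> mat_tuples d s" using real by (simp add: fm_realization_def)
  have "ptm s (map (kron (1\<^sub>m s)) Y) = cen"
    using amp2_kron_diag[OF Y_carrier s] Yt by (auto simp: fun_eq_iff ptm_def iy_def mat_tuples_def)
  then show ?thesis
    using reg_cen fm_Omega_iff_reg[OF s kron_tuples[OF Yt]] kron_Omega_iff[OF lla s Yt] by auto
qed

text \<open>The function is the class of an expression made for \<open>Y\<close>. Its domain
  contains the regular set since the expressions made for other points belong to the same class; the
  reverse inclusion is \<open>represents_imp_reg\<close>.\<close>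

theorem lla_imp_rep_kron:
  assumes lla: "linearized_lost_abbey s d Y r" and obs: "observable s d r" and ctrl: "controllable s d r"
  shows "\<exists>F\<in>nc_rat_funs d. Y \<in> rat_dom d s F \<and> rep_kron F"
proof -
  have Yt: "Y \<in> mat_tuples d s" using real by (simp add: fm_realization_def)
  obtain K c where Yd: "Y \<in> nc_dom d s (eR K c)"
    using center_regular[OF lla] eR_nc_eval_exists[OF s Yt] by blast
  let ?R = "eR K c"
  define F where "F = nc_equiv d `` {?R}"
  have s1: "1 \<le> s" using s by simp
  have RR: "(?R, ?R) \<in> nc_equiv d" by (rule eR_equiv[OF lla s1 Yd s1 Yd])
  then have F: "F \<in> nc_rat_funs d" unfolding F_def nc_rat_funs_def by (intro quotientI) (auto simp: nc_equiv_def)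
  have rep: "represents S" if "S \<in> F" for S
    using equiv_eR_represents[OF lla Yd] that unfolding F_def by blast
  have regular: "\<exists>W. reg (ptm n (map (kron (1\<^sub>m s)) X)) W \<and> amp2 s s n (kron (1\<^sub>m s) V) = fval (ptm n (map (kron (1\<^sub>m s)) X)) W"
    if n: "0 < n" and X: "X \<in> mat_tuples d n" and S: "S \<in> F" "nc_eval n X S = Some V" for n X S V
  proof -
    note e = nc_eval_imp_ev_kron(2)[OF n X rat_fun_member[OF F S(1)] S(2)]
    obtain W where W: "reg (ptm n (map (kron (1\<^sub>m s)) X)) W"
      using represents_imp_reg[OF obs ctrl rep[OF S(1)] ptm_pts[OF n] e] by blast
    with rep[OF S(1)] e ptm_pts[OF n] show ?thesis unfolding represents_def by blast
  qed
  have "rep_kron F"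
    unfolding rep_kron_def
  proof (intro allI impI conjI ballI)
    fix n :: nat assume n1: "1 \<le> n"
    then have n: "0 < n" by simp
    show dom: "rat_dom d n F = {X \<in> mat_tuples d n. map (kron (1\<^sub>m s)) X \<in> fm_Omega s d Y r n}"
    proof (intro equalityI subsetI)
      fix X assume "X \<in> rat_dom d n F"
      then obtain S V where S: "S \<in> F" "X \<in> mat_tuples d n" "nc_eval n X S = Some V"
        by (auto simp: rat_dom_def nc_dom_def)
      then show "X \<in> {X \<in> mat_tuples d n. map (kron (1\<^sub>m s)) X \<in> fm_Omega s d Y r n}"
        using regular[OF n S(2,1,3)] fm_Omega_iff_reg[OF n kron_tuples[OF S(2)]] by blast
    next
      fix X assume "X \<in> {X \<in> mat_tuples d n. map (kron (1\<^sub>m s)) X \<in> fm_Omega s d Y r n}"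
      then obtain W where X: "X \<in> mat_tuples d n" and "reg (spt n X) W" using kron_Omega_iff[OF lla n] by blast
      then obtain K' c' where X': "X \<in> nc_dom d n (eR K' c')" using eR_nc_eval_exists[OF n] by blast
      then have "eR K' c' \<in> F" unfolding F_def using eR_equiv[OF lla s1 Yd n1 X'] by blast
      then show "X \<in> rat_dom d n F" using X' by (auto simp: rat_dom_def)
    qed
    fix X assume X: "X \<in> rat_dom d n F"
    then have Xt: "X \<in> mat_tuples d n" using dom by blast
    obtain S where S: "S \<in> F" "nc_eval n X S = Some (rat_eval d n F X)" using rat_eval_member[OF X] by blast
    obtain W where W: "reg (ptm n (map (kron (1\<^sub>m s)) X)) W"
      "amp2 s s n (kron (1\<^sub>m s) (rat_eval d n F X)) = fval (ptm n (map (kron (1\<^sub>m s)) X)) W"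
      using regular[OF n Xt S] by blast
    note f = fm_eval_fval[OF n kron_tuples[OF Xt] W(1)]
    have c: "rat_eval d n F X \<in> carrier_mat n n" by (rule nc_eval_imp_ev_kron(1)[OF n Xt rat_fun_member[OF F S(1)] S(2)])
    show "kron (1\<^sub>m s) (rat_eval d n F X) = fm_eval s d Y r n (map (kron (1\<^sub>m s)) X)"
      by (rule amp2_inj[OF n kron_carrier[OF one_carrier_mat c] f(1)]) (simp add: f(2) W(2))
  qed
  moreover have "Y \<in> rat_dom d s F" using Yd RR by (auto simp: F_def rat_dom_def)
  ultimately show ?thesis using F by blast
qed

end

theorem theorem4p9:
  fixes s d :: nat and Y :: "'a::field mat list" and r :: "'a fm_data"
  assumes "s \<ge> 1" and "d \<ge> 1"
    and "fm_realization s d Y r"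
    and "controllable s d r" and "observable s d r"
  shows
    "((\<exists>F \<in> nc_rat_funs d. Y \<in> rat_dom d s F \<and>
         (\<forall>m\<ge>1. rat_dom d (s * m) F = fm_Omega s d Y r m \<and>
            (\<forall>X \<in> rat_dom d (s * m) F. rat_eval d (s * m) F X = fm_eval s d Y r m X)))
      \<longleftrightarrow> linearized_lost_abbey s d Y r)
     \<and>
     (linearized_lost_abbey s d Y r
      \<longleftrightarrow> (\<exists>F \<in> nc_rat_funs d. Y \<in> rat_dom d s F \<and>
         (\<forall>n\<ge>1. rat_dom d n F =
              {X \<in> mat_tuples d n. map (kron (1\<^sub>m s)) X \<in> fm_Omega s d Y r n} \<and>
            (\<forall>X \<in> rat_dom d n F.
               kron (1\<^sub>m s) (rat_eval d n F X) = fm_eval s d Y r n (map (kron (1\<^sub>m s)) X)))))"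
proof -
  interpret fm s d Y r by unfold_locales (use assms in simp_all)
  have 1: "linearized_lost_abbey s d Y r" if "\<exists>F \<in> nc_rat_funs d. Y \<in> rat_dom d s F \<and> rep_blocks F"
    using that rep_blocks_imp_lla assms(4,5) by blast
  have 2: "\<exists>F \<in> nc_rat_funs d. Y \<in> rat_dom d s F \<and> rep_kron F" if "linearized_lost_abbey s d Y r"
    using lla_imp_rep_kron[OF that assms(5,4)] .
  have 3: "\<exists>F \<in> nc_rat_funs d. Y \<in> rat_dom d s F \<and> rep_blocks F" if "\<exists>F \<in> nc_rat_funs d. Y \<in> rat_dom d s F \<and> rep_kron F"
    using that rep_kron_imp_rep_blocks by blast
  show ?thesis
    unfolding rep_blocks_def[symmetric] rep_kron_def[symmetric] using 1 2 3 by blast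
qed

end
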